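(* Let $1\le p<q$ be fixed integers. If $w\in\{t,T,a,A\}^*$ is a hill, then the peak normal form $\mathrm{pnf}(w)$ in $\mathbf{BS}(p,q)$ can be computed in linear time.
   Context: $\mathbf{BS}(p,q)=\langle a,t\mid ta^pt^{-1}=a^q\rangle$. Words over $\{t,T,a,A\}$ are read in $\mathbf{BS}(p,q)$ with $T=t^{-1}$, $A=a^{-1}$; $u\sim v$ means equality in the group. An integer $\alpha$ is identified with the word $a^\alpha$ ($A^{|\alpha|}$ if $\alpha<0$), $0$ is the empty word. A hill is a word $w$ such that $w\sim\beta_\ell t\cdots\beta_1t\,\alpha_0\,T\alpha_1\cdots T\alpha_m$ for some $\ell,m\ge 0$ and integers $\alpha_i,\beta_j$. After cancelling factors $aA$, $Aa$ every word is uniquely $u=\alpha_0\theta_1\alpha_1\cdots\theta_k\alpha_k$ with $\alpha_i\in\mathbb{Z}$, $\theta_i\in\{t,T\}$. $|g(w)|$ denotes the geodesic length of $w$ (length of a shortest word $\sim w$); $\Vert\alpha\Vert=|g(a^\alpha)|$ for integers, and $\Vert u\Vert=k+\sum_i\Vert\alpha_i\Vert$. A word is Britton-reduced if it has no factor $t\,\mu p\,T$ and no factor $T\,\mu q\,t$ with $\mu\in\mathbb{Z}$. Length-lexicographical normal form: order words over $\{t,T,a,A\}$ by length first, then lexicographically with $t<T<a<A$; $\mathrm{llnf}(w)$ is the smallest $v$ with $v\sim w$. Peak normal form: order the infinite alphabet $\Delta=\mathbb{Z}\cup\{t,T\}$ linearly by $t<T<\alpha$ for every integer $\alpha$; $\alpha<\beta$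 if $|\alpha|<|\beta|$; and $\alpha\le\beta$ if $0\le\alpha=|\beta|$. Let $\le_\Delta$ be the induced length-lexicographical order on words written as alternating sequences of integers and letters from $\{t,T\}$. For $u=\alpha_0\theta_1\cdots\theta_k\alpha_k$ let $h(0)=0$, $h(i)=h(i-1)+1$ if $\theta_i=t$, $h(i)=h(i-1)-1$ if $\theta_i=T$; $h(u)=\max_i h(i)$. The peak of $u$ is the largest position $i$ with $h(i)=h(u)$; this gives the factorization $u=u_1\alpha_iu_2$ with $u_1=\alpha_0\theta_1\cdots\alpha_{i-1}\theta_i$. Let $\overline{\,\cdot\,}$ be the involution reversing a word and exchanging $a\leftrightarrow A$, $t\leftrightarrow T$. A Britton-reduced $u$ is the Britton peak normal form of $w$ if $w\sim u$, $|g(w)|=\Vert u\Vert$ and, among all Britton-reduced words with these properties, $u_1$ is first with respect to $\le_\Delta$ and after that $\overline{u_2}$ is first with respect to $\le_\Delta$. The peak normal form is $\mathrm{pnf}(w)=\mathrm{llnf}(\alpha_0)\theta_1\mathrm{llnf}(\alpha_1)\cdots\theta_k\mathrm{llnf}(\alpha_k)$, where $\alpha_0\theta_1\cdots\theta_k\alpha_k$ is the Britton peak normal form of $w$. Complexity convention: $p,q$ are constants, integers are kept in binary, and an arithmetic operation on integers with $\mathcal{O}(n)$ bits ($n$ the input length) takes constant time. *)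

theory Defs
  imports Complex_Main
begin

subsection \<open>The group BS(p,q)\<close>

datatype letter = Lt | LT | La | LA

text \<open>The numbering realises the order t < T < a < A. It starts at 1, so that in the machine
  model below an unwritten memory cell (value 0) does not encode a letter.\<close>

fun code :: "letter \<Rightarrow> nat" where
  "code Lt = 1"
| "code LT = 2"
| "code La = 3"
| "code LA = 4"

text \<open>Equality in the group: the monoid congruence generated by the inverse relations and
  the defining relation.\<close>

inductive bs_eq :: "nat \<Rightarrow> nat \<Rightarrow> letter list \<Rightarrow> letter list \<Rightarrow> bool" for p q :: nat where
  bs_rel: "bs_eq p q ([Lt] @ replicate p La @ [LT]) (replicate q La)"
| bs_aA: "bs_eq p q [La, LA] []"
| bs_Aa: "bs_eq p q [LA, La] []"
| bs_tT: "bs_eq p q [Lt, LT] []"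
| bs_Tt: "bs_eq p q [LT, Lt] []"
| bs_refl: "bs_eq p q u u"
| bs_sym: "bs_eq p q u v \<Longrightarrow> bs_eq p q v u"
| bs_trans: "bs_eq p q u v \<Longrightarrow> bs_eq p q v w \<Longrightarrow> bs_eq p q u w"
| bs_cong: "bs_eq p q u v \<Longrightarrow> bs_eq p q (x @ u @ y) (x @ v @ y)"

definition apow :: "int \<Rightarrow> letter list" where
  "apow \<alpha> = (if \<alpha> \<ge> 0 then replicate (nat \<alpha>) La else replicate (nat (- \<alpha>)) LA)"

definition hill :: "nat \<Rightarrow> nat \<Rightarrow> letter list \<Rightarrow> bool" where
  "hill p q w \<longleftrightarrow> (\<exists>\<beta>s \<alpha>0 \<alpha>s. bs_eq p q w
     (concat (map (\<lambda>\<beta>. apow \<beta> @ [Lt]) \<beta>s) @ apow \<alpha>0 @ concat (map (\<lambda>\<alpha>. LT # apow \<alpha>) \<alpha>s)))"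

definition geolen :: "nat \<Rightarrow> nat \<Rightarrow> letter list \<Rightarrow> nat" where
  "geolen p q w = (LEAST n. \<exists>v. bs_eq p q v w \<and> length v = n)"

definition letter_less :: "(letter \<times> letter) set" where
  "letter_less = {(x, y). code x < code y}"

definition llnf :: "nat \<Rightarrow> nat \<Rightarrow> letter list \<Rightarrow> letter list" where
  "llnf p q w = (THE v. bs_eq p q v w \<and>
     (\<forall>v'. bs_eq p q v' w \<longrightarrow> v = v' \<or> (v, v') \<in> lenlex letter_less))"

subsection \<open>Alternating words and the peak normal form\<close>

datatype stab = Up | Down

fun stab_letter :: "stab \<Rightarrow> letter" where
  "stab_letter Up = Lt"
| "stab_letter Down = LT"

text \<open>\<open>(\<alpha>\<^sub>0, [(\<theta>\<^sub>1, \<alpha>\<^sub>1), \<dots>, (\<theta>\<^sub>k, \<alpha>\<^sub>k)])\<close> stands for \<open>\<alpha>\<^sub>0 \<theta>\<^sub>1 \<alpha>\<^sub>1 \<cdots> \<theta>\<^sub>k \<alpha>\<^sub>k\<close>.\<close>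

type_synonym alt = "int \<times> (stab \<times> int) list"

definition alt_word :: "alt \<Rightarrow> letter list" where
  "alt_word u = apow (fst u) @ concat (map (\<lambda>(\<theta>, \<alpha>). stab_letter \<theta> # apow \<alpha>) (snd u))"

definition inorm :: "nat \<Rightarrow> nat \<Rightarrow> int \<Rightarrow> nat" where
  "inorm p q \<alpha> = geolen p q (apow \<alpha>)"

definition alt_norm :: "nat \<Rightarrow> nat \<Rightarrow> alt \<Rightarrow> nat" where
  "alt_norm p q u =
     length (snd u) + (inorm p q (fst u) + (\<Sum>(\<theta>, \<alpha>)\<leftarrow>snd u. inorm p q \<alpha>))"

definition britton_reduced :: "nat \<Rightarrow> nat \<Rightarrow> letter list \<Rightarrow> bool" where
  "britton_reduced p q w \<longleftrightarrow>
     (\<nexists>x y \<mu>. w = x @ [Lt] @ apow (\<mu> * int p) @ [LT] @ y) \<and>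
     (\<nexists>x y \<mu>. w = x @ [LT] @ apow (\<mu> * int q) @ [Lt] @ y)"

datatype delta = St stab | Num int

fun delta_lt :: "delta \<Rightarrow> delta \<Rightarrow> bool" where
  "delta_lt (St \<theta>) (St \<theta>') \<longleftrightarrow> \<theta> = Up \<and> \<theta>' = Down"
| "delta_lt (St _) (Num _) \<longleftrightarrow> True"
| "delta_lt (Num _) (St _) \<longleftrightarrow> False"
| "delta_lt (Num \<alpha>) (Num \<beta>) \<longleftrightarrow> \<bar>\<alpha>\<bar> < \<bar>\<beta>\<bar> \<or> (0 \<le> \<alpha> \<and> \<alpha> = \<bar>\<beta>\<bar> \<and> \<alpha> \<noteq> \<beta>)"

definition delta_le :: "delta list \<Rightarrow> delta list \<Rightarrow> bool" where
  "delta_le u v \<longleftrightarrow> u = v \<or> (u, v) \<in> lenlex {(x, y). delta_lt x y}"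

definition dword :: "alt \<Rightarrow> delta list" where
  "dword u = Num (fst u) # concat (map (\<lambda>(\<theta>, \<alpha>). [St \<theta>, Num \<alpha>]) (snd u))"

fun dbar :: "delta \<Rightarrow> delta" where
  "dbar (St Up) = St Down"
| "dbar (St Down) = St Up"
| "dbar (Num \<alpha>) = Num (- \<alpha>)"

definition bar :: "delta list \<Rightarrow> delta list" where
  "bar u = rev (map dbar u)"

definition height :: "alt \<Rightarrow> nat \<Rightarrow> int" where
  "height u i = (\<Sum>(\<theta>, \<alpha>)\<leftarrow>take i (snd u). case \<theta> of Up \<Rightarrow> 1 | Down \<Rightarrow> - 1)"

definition peak :: "alt \<Rightarrow> nat" where
  "peak u = (GREATEST i. i \<le> length (snd u) \<and> height u i = Max (height u ` {..length (snd u)}))"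

text \<open>The integer at the peak is entry number \<open>2 * peak u\<close> of \<open>dword u\<close>.\<close>

definition left_part :: "alt \<Rightarrow> delta list" where
  "left_part u = take (2 * peak u) (dword u)"

definition right_part :: "alt \<Rightarrow> delta list" where
  "right_part u = drop (2 * peak u + 1) (dword u)"

definition geo_reduced :: "nat \<Rightarrow> nat \<Rightarrow> letter list \<Rightarrow> alt \<Rightarrow> bool" where
  "geo_reduced p q w u \<longleftrightarrow> britton_reduced p q (alt_word u) \<and> bs_eq p q w (alt_word u) \<and>
     geolen p q w = alt_norm p q u"

definition britton_pnf :: "nat \<Rightarrow> nat \<Rightarrow> letter list \<Rightarrow> alt" where
  "britton_pnf p q w = (THE u. geo_reduced p q w u \<and>
     (\<forall>v. geo_reduced p q w v \<longrightarrow> delta_le (left_part u) (left_part v) \<and>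
       (left_part u = left_part v \<longrightarrow> delta_le (bar (right_part u)) (bar (right_part v)))))"

definition pnf :: "nat \<Rightarrow> nat \<Rightarrow> letter list \<Rightarrow> letter list" where
  "pnf p q w = (let u = britton_pnf p q w in
     llnf p q (apow (fst u)) @
     concat (map (\<lambda>(\<theta>, \<alpha>). stab_letter \<theta> # llnf p q (apow \<alpha>)) (snd u)))"

subsection \<open>Machine model\<close>

text \<open>A random access machine over the integers in structured form: finitely many (because
  programs are finite) integer registers and integer arrays, and unit-cost arithmetic.
  The parameter \<open>B\<close> of the semantics is the word size: an execution exists only if every
  integer that is computed has at most \<open>B\<close> bits (plus sign) and every array access is to one
  of the first \<open>B\<close> cells. Arithmetic on integers of linear bit length being free of
  further charge thus corresponds to \<open>B\<close> being linear in the input length.\<close>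

datatype bop = Add | Sub | Mul | Div | Mod | Less | Equal

datatype expr = Const int | Reg nat | Read nat expr | Bin bop expr expr

datatype prog =
    Skip
  | Assign nat expr
  | Write nat expr expr
  | Seq prog prog
  | Cond expr prog prog
  | While expr prog

record state =
  reg :: "nat \<Rightarrow> int"
  arr :: "nat \<Rightarrow> int \<Rightarrow> int"

fun bop_val :: "bop \<Rightarrow> int \<Rightarrow> int \<Rightarrow> int" where
  "bop_val Add x y = x + y"
| "bop_val Sub x y = x - y"
| "bop_val Mul x y = x * y"
| "bop_val Div x y = x div y"
| "bop_val Mod x y = x mod y"
| "bop_val Less x y = (if x < y then 1 else 0)"
| "bop_val Equal x y = (if x = y then 1 else 0)"

fun val :: "expr \<Rightarrow> state \<Rightarrow> int" where
  "val (Const c) s = c"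
| "val (Reg x) s = reg s x"
| "val (Read a e) s = arr s a (val e s)"
| "val (Bin f e1 e2) s = bop_val f (val e1 s) (val e2 s)"

definition fits :: "nat \<Rightarrow> int \<Rightarrow> bool" where
  "fits B x \<longleftrightarrow> \<bar>x\<bar> < 2 ^ B"

definition addr :: "nat \<Rightarrow> int \<Rightarrow> bool" where
  "addr B i \<longleftrightarrow> 0 \<le> i \<and> i < int B"

fun safe :: "nat \<Rightarrow> expr \<Rightarrow> state \<Rightarrow> bool" where
  "safe B (Const c) s \<longleftrightarrow> fits B c"
| "safe B (Reg x) s \<longleftrightarrow> fits B (reg s x)"
| "safe B (Read a e) s \<longleftrightarrow> safe B e s \<and> addr B (val e s) \<and> fits B (val (Read a e) s)"
| "safe B (Bin f e1 e2) s \<longleftrightarrow> safe B e1 s \<and> safe B e2 s \<and>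
     (f \<in> {Div, Mod} \<longrightarrow> val e2 s \<noteq> 0) \<and> fits B (val (Bin f e1 e2) s)"

fun ecost :: "expr \<Rightarrow> nat" where
  "ecost (Const c) = 1"
| "ecost (Reg x) = 1"
| "ecost (Read a e) = 1 + ecost e"
| "ecost (Bin f e1 e2) = 1 + ecost e1 + ecost e2"

text \<open>\<open>exec B c s k s'\<close>: with word size \<open>B\<close>, program \<open>c\<close> started in \<open>s\<close> halts in \<open>s'\<close> after
  \<open>k\<close> elementary operations. A guard is true iff its value is nonzero.\<close>

inductive exec :: "nat \<Rightarrow> prog \<Rightarrow> state \<Rightarrow> nat \<Rightarrow> state \<Rightarrow> bool" for B :: nat where
  ex_Skip: "exec B Skip s 1 s"
| ex_Assign: "safe B e s \<Longrightarrow>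
    exec B (Assign x e) s (1 + ecost e) (s\<lparr>reg := (reg s)(x := val e s)\<rparr>)"
| ex_Write: "safe B e1 s \<Longrightarrow> addr B (val e1 s) \<Longrightarrow> safe B e2 s \<Longrightarrow>
    exec B (Write a e1 e2) s (1 + ecost e1 + ecost e2)
      (s\<lparr>arr := (arr s)(a := (arr s a)(val e1 s := val e2 s))\<rparr>)"
| ex_Seq: "exec B c1 s k1 s1 \<Longrightarrow> exec B c2 s1 k2 s2 \<Longrightarrow>
    exec B (Seq c1 c2) s (k1 + k2) s2"
| ex_IfTrue: "safe B e s \<Longrightarrow> val e s \<noteq> 0 \<Longrightarrow> exec B c1 s k s' \<Longrightarrow>
    exec B (Cond e c1 c2) s (1 + ecost e + k) s'"
| ex_IfFalse: "safe B e s \<Longrightarrow> val e s = 0 \<Longrightarrow> exec B c2 s k s' \<Longrightarrow>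
    exec B (Cond e c1 c2) s (1 + ecost e + k) s'"
| ex_WhileFalse: "safe B e s \<Longrightarrow> val e s = 0 \<Longrightarrow>
    exec B (While e c) s (1 + ecost e) s"
| ex_WhileTrue: "safe B e s \<Longrightarrow> val e s \<noteq> 0 \<Longrightarrow> exec B c s k1 s1 \<Longrightarrow>
    exec B (While e c) s1 k2 s2 \<Longrightarrow>
    exec B (While e c) s (1 + ecost e + k1 + k2) s2"

text \<open>Input: the length in register 0 and the coded letters in array 0; all else is 0.
  Output: the length in register 1 and the coded letters in array 1.\<close>

definition init_state :: "letter list \<Rightarrow> state" where
  "init_state w = \<lparr>
     reg = (\<lambda>x. if x = 0 then int (length w) else 0),
     arr = (\<lambda>a i. if a = 0 \<and> 0 \<le> i \<and> i < int (length w) then int (code (w ! nat i)) else 0)\<rparr>"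

definition outputs :: "state \<Rightarrow> letter list \<Rightarrow> bool" where
  "outputs s v \<longleftrightarrow> reg s 1 = int (length v) \<and>
     (\<forall>i < length v. arr s 1 (int i) = int (code (v ! i)))"

text \<open>\<open>f\<close> restricted to the inputs in \<open>D\<close> is computed by one program whose number of steps,
  word size and memory are all linear in the input length.\<close>

definition linear_time_computable ::
    "letter list set \<Rightarrow> (letter list \<Rightarrow> letter list) \<Rightarrow> bool" where
  "linear_time_computable D f \<longleftrightarrow> (\<exists>c C. \<forall>w \<in> D. \<exists>k s.
     exec (C * (length w + 1)) c (init_state w) k s \<and>
     k \<le> C * (length w + 1) \<and> outputs s (f w))"

end

theory Submission
  imports Defs
begin

text \<open>A hill is determined by its digits on both sides of the peak and the integer at the peak. In
  the group, a carry \<open>t\<close> can be moved past a stable letter: it changes the digit before the letter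
  by \<open>q t\<close> and the integer behind it by \<open>p t\<close>. On a geodesic hill all digits but the one at the
  peak are smaller than \<open>q\<close>, hence all carries relative to the HNN normal form lie in a fixed
  finite window, and finding the best digits is a shortest path problem through a strip of
  constant width, with ties broken lexicographically from the left and from the right. The integer
  at the peak has linearly many bits. Its own geodesics are hills as well: the HNN normal form
  climbs by replacing \<open>x\<close> by \<open>p (x div q)\<close> until the integer is bounded, after linearly many steps,
  and the digits left behind form another strip. In each strip the costs of the paths from the
  possible carries form a Lipschitz function on a finite window, and only its finitely many values
  up to an additive constant matter. Therefore all passes are runs of finite automata, and only
  reading the input and climbing need arithmetic with large integers.\<close>

text \<open>The hypothesis \<open>p < q\<close> enters in three ways. A valley
  \<open>T a^(qk) t\<close> is never shorter than \<open>a^(pk)\<close>, so geodesics of powers of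
  \<open>a\<close> only climb. A unit of carry taken out of a large digit trades \<open>q\<close>
  letters for at most \<open>p\<close>, which bounds the digits and thereby the carries. And
  climbing shrinks the integer at the peak geometrically.

  The obstacle is that the strips are coupled by their carries at the peak. Ties are to be broken on
  the left side first, but its cost contains the best right side and the length of the peak integer
  for every total carry. So these are computed beforehand, as functions of the carry. Moreover, a
  strip can only be traced against the direction in which its costs were accumulated. The right side
  is accumulated from the foot for its cost and from the peak for its digits. The strip of the peak
  integer is accumulated from its top for the length as a function of the carry, and later from its
  bottom, the carry being known, because its word shows the top first.\<close>

locale BS =
  fixes p q :: nat
  assumes p_pos: "1 \<le> p" and p_less_q: "p < q"
begin

abbreviation equ :: "letter list \<Rightarrow> letter list \<Rightarrow> bool" (infix "\<sim>" 50) where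
  "u \<sim> v \<equiv> bs_eq p q u v"

lemma q_pos: "0 < q" "q \<noteq> 0" "p \<noteq> 0" "2 \<le> q"
  using p_pos p_less_q by auto

declare bs_refl [simp, intro]

lemma equ_trans [trans]: "u \<sim> v \<Longrightarrow> v \<sim> w \<Longrightarrow> u \<sim> w"
  by (rule bs_trans)

lemma equ_append: "u \<sim> u' \<Longrightarrow> v \<sim> v' \<Longrightarrow> u @ v \<sim> u' @ v'"
  using bs_cong[of p q u u' "[]" v] bs_cong[of p q v v' u' "[]"] bs_trans by force

lemma equ_append_left: "v \<sim> v' \<Longrightarrow> u @ v \<sim> u @ v'"
  by (rule equ_append) auto

lemma equ_append_right: "u \<sim> u' \<Longrightarrow> u @ v \<sim> u' @ v"
  by (rule equ_append) auto

lemma equ_Cons: "v \<sim> v' \<Longrightarrow> l # v \<sim> l # v'"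
  using equ_append_left[of v v' "[l]"] by simp

lemma equ_cancel_mid: "m \<sim> [] \<Longrightarrow> x @ m @ y \<sim> x @ y"
  using bs_cong[of p q m "[]" x y] by simp

end

subsection \<open>Powers of the generator a\<close>

lemma apow_0 [simp]: "apow 0 = []"
  by (simp add: apow_def)

lemma length_apow [simp]: "length (apow x) = nat \<bar>x\<bar>"
  by (simp add: apow_def)

lemma apow_Suc: "0 \<le> x \<Longrightarrow> apow (x + 1) = La # apow x"
  by (simp add: apow_def nat_add_distrib)

lemma apow_Suc': "0 \<le> x \<Longrightarrow> apow (x + 1) = apow x @ [La]"
  by (simp add: apow_def nat_add_distrib replicate_append_same)

lemma apow_pred: "x \<le> 0 \<Longrightarrow> apow (x - 1) = LA # apow x"
proof -
  assume "x \<le> 0"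
  then have "nat (1 - x) = Suc (nat (- x))" by simp
  with \<open>x \<le> 0\<close> show ?thesis by (auto simp: apow_def)
qed

lemma apow_pred': "x \<le> 0 \<Longrightarrow> apow (x - 1) = apow x @ [LA]"
  using apow_pred[of x] by (auto simp: apow_def replicate_append_same split: if_splits)

lemma apow_add_same_sign: "0 \<le> x * y \<Longrightarrow> apow (x + y) = apow x @ apow y"
  by (auto simp: apow_def zero_le_mult_iff replicate_add[symmetric] nat_add_distrib[symmetric])

lemma apow_1 [simp]: "apow 1 = [La]" "apow (-1) = [LA]"
  by (simp_all add: apow_def)

lemma set_apow: "set (apow x) \<subseteq> {La, LA}"
  by (auto simp: apow_def)

context BS
begin

lemma apow_snoc: "apow x @ [La] \<sim> apow (x + 1)" "apow x @ [LA] \<sim> apow (x - 1)"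
proof -
  show "apow x @ [La] \<sim> apow (x + 1)"
  proof (cases "0 \<le> x")
    case False
    then have "apow x = apow (x + 1) @ [LA]" using apow_pred'[of "x + 1"] by simp
    then have "apow x @ [La] = apow (x + 1) @ [LA, La] @ []" by simp
    also have "\<dots> \<sim> apow (x + 1) @ []" by (rule equ_cancel_mid) (rule bs_Aa)
    finally show ?thesis by simp
  qed (simp add: apow_Suc')
  show "apow x @ [LA] \<sim> apow (x - 1)"
  proof (cases "x \<le> 0")
    case False
    then have "apow x = apow (x - 1) @ [La]" using apow_Suc'[of "x - 1"] by simp
    then have "apow x @ [LA] = apow (x - 1) @ [La, LA] @ []" by simp
    also have "\<dots> \<sim> apow (x - 1) @ []" by (rule equ_cancel_mid) (rule bs_aA)
    finally show ?thesis by simp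
  qed (simp add: apow_pred')
qed

lemma apow_add: "apow x @ apow y \<sim> apow (x + y)"
proof (induction y rule: int_induct[where k = 0])
  case (step1 i)
  have "apow x @ apow (i + 1) = (apow x @ apow i) @ [La]" using step1 by (simp add: apow_Suc')
  also have "\<dots> \<sim> apow (x + i) @ [La]" using step1 by (intro equ_append_right)
  also have "\<dots> \<sim> apow (x + i + 1)" by (rule apow_snoc)
  finally show ?case by (simp add: add.assoc)
next
  case (step2 i)
  have "apow x @ apow (i - 1) = (apow x @ apow i) @ [LA]" using step2 by (simp add: apow_pred')
  also have "\<dots> \<sim> apow (x + i) @ [LA]" using step2 by (intro equ_append_right)
  also have "\<dots> \<sim> apow (x + i - 1)" by (rule apow_snoc)
  finally show ?case by (simp add: diff_add_eq add_diff_eq)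
qed simp

lemma apow_add': "apow (x + y) \<sim> apow x @ apow y"
  by (rule bs_sym) (rule apow_add)

lemma conj_pos: "[Lt] @ apow (int p * int k) @ [LT] \<sim> apow (int q * int k)"
proof (induction k)
  case 0
  show ?case by (simp add: bs_tT)
next
  case (Suc k)
  have pk: "apow (int p * int (Suc k)) = apow (int p) @ apow (int p * int k)"
    using apow_add_same_sign[of "int p" "int p * int k"] by (simp add: distrib_left)
  have "[Lt] @ apow (int p * int (Suc k)) @ [LT] \<sim> [Lt] @ apow (int p) @ [LT, Lt] @ apow (int p * int k) @ [LT]"
    using equ_cancel_mid[OF bs_Tt, of "[Lt] @ apow (int p)" "apow (int p * int k) @ [LT]"] bs_sym
    unfolding pk by (simp add: bs_sym)
  also have "\<dots> = ([Lt] @ apow (int p) @ [LT]) @ ([Lt] @ apow (int p * int k) @ [LT])" by simp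
  also have "\<dots> \<sim> apow (int q) @ apow (int q * int k)"
    using Suc bs_rel[of p q] by (intro equ_append) (auto simp: apow_def)
  also have "\<dots> \<sim> apow (int q + int q * int k)" by (rule apow_add)
  finally show ?case by (simp add: distrib_left)
qed

lemma inverse_unique: "u @ v \<sim> [] \<Longrightarrow> v @ u' \<sim> [] \<Longrightarrow> u \<sim> u'"
  using equ_append_left[of "v @ u'" "[]" u] equ_append_right[of "u @ v" "[]" u'] bs_sym bs_trans
  by (metis append_Nil append_Nil2 append_assoc)

lemma conj_t: "[Lt] @ apow (int p * k) @ [LT] \<sim> apow (int q * k)"
proof (cases "0 \<le> k")
  case True
  then show ?thesis using conj_pos[of "nat k"] by simp
next
  case False
  define m where "m = nat (- k)"
  with False have k: "k = - int m" by simp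
  let ?P = "int p * int m" and ?Q = "int q * int m"
  have z: "apow (- x) @ apow x \<sim> []" "apow x @ apow (-x) \<sim> []" for x
    using apow_add[of "-x" x] apow_add[of x "-x"] by simp_all
  \<comment> \<open>Rewriting \<open>apow ?Q\<close> by the positive case makes everything cancel,
    so the conjugate is an inverse of \<open>apow ?Q\<close>.\<close>
  have "([Lt] @ apow (- ?P) @ [LT]) @ apow ?Q \<sim> ([Lt] @ apow (- ?P) @ [LT]) @ [Lt] @ apow ?P @ [LT]"
    by (intro equ_append_left bs_sym[OF conj_pos])
  also have "\<dots> = ([Lt] @ apow (- ?P)) @ [LT, Lt] @ apow ?P @ [LT]" by simp
  also have "\<dots> \<sim> ([Lt] @ apow (- ?P)) @ apow ?P @ [LT]"
    by (rule equ_cancel_mid) (rule bs_Tt)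
  also have "\<dots> = [Lt] @ (apow (- ?P) @ apow ?P) @ [LT]" by simp
  also have "\<dots> \<sim> [Lt] @ [LT]" by (rule equ_cancel_mid) (rule z)
  also have "\<dots> \<sim> []" using bs_tT by simp
  finally show ?thesis
    using inverse_unique[OF _ z(2), of "[Lt] @ apow (- ?P) @ [LT]" ?Q] by (simp add: k)
qed

lemma conj_T: "[LT] @ apow (int q * k) @ [Lt] \<sim> apow (int p * k)"
proof -
  have "[LT] @ apow (int q * k) @ [Lt] \<sim> [LT] @ ([Lt] @ apow (int p * k) @ [LT]) @ [Lt]"
    by (intro bs_cong) (rule bs_sym, rule conj_t)
  also have "\<dots> = ([] @ [LT, Lt] @ (apow (int p * k) @ [LT, Lt] @ []))" by simp
  also have "\<dots> \<sim> [] @ (apow (int p * k) @ [LT, Lt] @ [])" by (rule equ_cancel_mid) (rule bs_Tt)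
  also have "\<dots> \<sim> apow (int p * k) @ []" by simp (rule equ_cancel_mid[where y = "[]", simplified], rule bs_Tt)
  finally show ?thesis by simp
qed

text \<open>Treats both stable letters at once: multiples of \<open>modulus \<theta>\<close> in
  front of the letter \<open>\<theta>\<close> can be moved past it and become multiples of
  \<open>modulus (flip \<theta>)\<close>.\<close>

definition modulus :: "stab \<Rightarrow> int" where
  "modulus \<theta> = (case \<theta> of Up \<Rightarrow> int q | Down \<Rightarrow> int p)"

fun flip :: "stab \<Rightarrow> stab" where
  "flip Up = Down"
| "flip Down = Up"

lemma modulus_simps [simp]: "modulus Up = int q" "modulus Down = int p"
  by (simp_all add: modulus_def)

lemma modulus_pos [simp]: "0 < modulus \<theta>" "modulus \<theta> \<noteq> 0"
  using p_pos p_less_q by (cases \<theta>; simp)+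

lemma flip_flip [simp]: "flip (flip \<theta>) = \<theta>" "flip \<theta> \<noteq> \<theta>" "\<theta> \<noteq> flip \<theta>"
  by (cases \<theta>; simp)+

abbreviation sl :: "stab \<Rightarrow> letter" where "sl \<equiv> stab_letter"

lemma stab_cancel: "[sl \<theta>, sl (flip \<theta>)] \<sim> []"
  by (cases \<theta>) (simp_all add: bs_tT bs_Tt)

lemma conj_stab: "[sl \<theta>] @ apow (modulus (flip \<theta>) * k) @ [sl (flip \<theta>)] \<sim> apow (modulus \<theta> * k)"
  using conj_t conj_T by (cases \<theta>) auto

lemma apow_stab: "apow (modulus \<theta> * k) @ [sl \<theta>] \<sim> [sl \<theta>] @ apow (modulus (flip \<theta>) * k)"
proof -
  have "apow (modulus \<theta> * k) @ [sl \<theta>] \<sim> [] @ [sl \<theta>, sl (flip \<theta>)] @ apow (modulus \<theta> * k) @ [sl \<theta>]"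
    using bs_sym[OF equ_cancel_mid[OF stab_cancel, of "[]"]] by simp
  also have "\<dots> = [sl \<theta>] @ ([sl (flip \<theta>)] @ apow (modulus \<theta> * k) @ [sl \<theta>])" by simp
  also have "\<dots> \<sim> [sl \<theta>] @ apow (modulus (flip \<theta>) * k)"
    using conj_stab[of "flip \<theta>"] by (intro equ_append_left) simp
  finally show ?thesis .
qed

lemma apow_push: "apow x @ [sl \<theta>] \<sim> apow (x - modulus \<theta> * k) @ [sl \<theta>] @ apow (modulus (flip \<theta>) * k)"
proof -
  have "apow x @ [sl \<theta>] \<sim> (apow (x - modulus \<theta> * k) @ apow (modulus \<theta> * k)) @ [sl \<theta>]"
    using apow_add'[of "x - modulus \<theta> * k" "modulus \<theta> * k"] by (intro equ_append_right) simp
  also have "\<dots> = apow (x - modulus \<theta> * k) @ apow (modulus \<theta> * k) @ [sl \<theta>]" by simp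
  also have "\<dots> \<sim> apow (x - modulus \<theta> * k) @ [sl \<theta>] @ apow (modulus (flip \<theta>) * k)"
    by (intro equ_append_left apow_stab)
  finally show ?thesis .
qed

lemma apow_pop: "apow r @ [sl (flip \<theta>)] @ apow (modulus \<theta> * k) @ [sl \<theta>] \<sim> apow (r + modulus (flip \<theta>) * k)"
proof -
  have "apow r @ [sl (flip \<theta>)] @ apow (modulus \<theta> * k) @ [sl \<theta>] \<sim> apow r @ apow (modulus (flip \<theta>) * k)"
    using conj_stab[of "flip \<theta>"] by (intro equ_append_left) simp
  also have "\<dots> \<sim> apow (r + modulus (flip \<theta>) * k)" by (rule apow_add)
  finally show ?thesis .
qed

subsection \<open>Normal forms and Britton's lemma\<close>

text \<open>A configuration \<open>(st, x)\<close> is the prefix of a word read so far: \<open>x\<close> is the integer after the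
  last stable letter, and the stack, topmost entry first, holds the stable letters together with
  the integers in front of them. In the HNN normal form, computed by \<open>step\<close>, these integers are
  reduced modulo \<open>q\<close> in front of \<open>t\<close> and modulo \<open>p\<close> in front of \<open>T\<close>. In contrast, \<open>bstep\<close>
  cancels only what Britton's lemma allows and leaves the integers alone.\<close>

type_synonym conf = "(int \<times> stab) list \<times> int"

fun pops :: "stab \<Rightarrow> conf \<Rightarrow> bool" where
  "pops \<theta> ([], x) \<longleftrightarrow> False"
| "pops \<theta> ((r, \<theta>') # st, x) \<longleftrightarrow> \<theta>' = flip \<theta> \<and> modulus \<theta> dvd x"

fun pop :: "stab \<Rightarrow> conf \<Rightarrow> conf" where
  "pop \<theta> (st, x) = (tl st, fst (hd st) + modulus (flip \<theta>) * (x div modulus \<theta>))"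

fun push :: "stab \<Rightarrow> conf \<Rightarrow> conf" where
  "push \<theta> (st, x) = ((x mod modulus \<theta>, \<theta>) # st, modulus (flip \<theta>) * (x div modulus \<theta>))"

fun bpush :: "stab \<Rightarrow> conf \<Rightarrow> conf" where
  "bpush \<theta> (st, x) = ((x, \<theta>) # st, 0)"

definition stab_step :: "stab \<Rightarrow> conf \<Rightarrow> conf" where
  "stab_step \<theta> c = (if pops \<theta> c then pop \<theta> c else push \<theta> c)"

definition britton_stab_step :: "stab \<Rightarrow> conf \<Rightarrow> conf" where
  "britton_stab_step \<theta> c = (if pops \<theta> c then pop \<theta> c else bpush \<theta> c)"

fun step :: "letter \<Rightarrow> conf \<Rightarrow> conf" where
  "step La c = (fst c, snd c + 1)"
| "step LA c = (fst c, snd c - 1)"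
| "step Lt c = stab_step Up c"
| "step LT c = stab_step Down c"

fun bstep :: "letter \<Rightarrow> conf \<Rightarrow> conf" where
  "bstep La c = (fst c, snd c + 1)"
| "bstep LA c = (fst c, snd c - 1)"
| "bstep Lt c = britton_stab_step Up c"
| "bstep LT c = britton_stab_step Down c"

lemma step_sl [simp]: "step (sl \<theta>) = stab_step \<theta>" "bstep (sl \<theta>) = britton_stab_step \<theta>"
  by (cases \<theta>; simp add: fun_eq_iff)+

abbreviation run :: "letter list \<Rightarrow> conf \<Rightarrow> conf" where
  "run w c \<equiv> fold step w c"

definition nf :: "letter list \<Rightarrow> conf" where
  "nf w = run w ([], 0)"

text \<open>The condition on \<open>pops\<close> records that the letter did not cancel when it was
  pushed. Testing the remainder \<open>r\<close> instead of the original integer is the same, by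
  \<open>pops_mod\<close>.\<close>

fun valid_stack :: "(int \<times> stab) list \<Rightarrow> bool" where
  "valid_stack [] \<longleftrightarrow> True"
| "valid_stack ((r, \<theta>) # st) \<longleftrightarrow> valid_stack st \<and> 0 \<le> r \<and> r < modulus \<theta> \<and> \<not> pops \<theta> (st, r)"

lemma pops_mod: "pops \<theta> (st, x) \<Longrightarrow> pops \<theta> (st, x mod modulus \<theta>)" "pops \<theta> (st, x mod modulus \<theta>) \<Longrightarrow> pops \<theta> (st, x)"
  by (cases st; auto simp: dvd_eq_mod_eq_0)+

lemma valid_stab_step: "valid_stack (fst c) \<Longrightarrow> valid_stack (fst (stab_step \<theta> c))"
  by (cases c; cases "fst c") (auto simp: stab_step_def dest: pops_mod)

lemma valid_step: "valid_stack (fst c) \<Longrightarrow> valid_stack (fst (step l c))"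
  using valid_stab_step by (cases l) auto

lemma valid_run: "valid_stack (fst c) \<Longrightarrow> valid_stack (fst (run w c))"
  by (induction w arbitrary: c) (simp_all add: valid_step del: split_paired_All)

lemma mod_eq_self: "0 \<le> r \<Longrightarrow> r < m \<Longrightarrow> (r + m * k) mod m = r" for r m k :: int
  by simp

lemma div_eq_self: "0 \<le> r \<Longrightarrow> r < m \<Longrightarrow> (r + m * k) div m = k" for r m k :: int
  by simp

lemma pops_add: "pops \<theta> (st, x + modulus \<theta> * k) \<longleftrightarrow> pops \<theta> (st, x)"
  by (cases st) (auto simp: dvd_add_left_iff)

lemma stab_step_restore:
  "valid_stack ((r, \<theta>) # st) \<Longrightarrow> stab_step \<theta> (st, r + modulus \<theta> * k) = ((r, \<theta>) # st, modulus (flip \<theta>) * k)"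
  by (simp add: stab_step_def pops_add mod_eq_self div_eq_self)

lemma stab_step_pushed:
  "stab_step (flip \<theta>) ((r, \<theta>) # st, modulus (flip \<theta>) * k) = (st, r + modulus \<theta> * k)"
  by (simp add: stab_step_def)

lemma pops_cases:
  assumes "pops \<theta> (st, x)"
  obtains r st' k where "st = (r, flip \<theta>) # st'" "x = modulus \<theta> * k" 
  using assms by (cases st) (auto elim!: dvdE)

text \<open>The argument of van der Waerden: letters act on valid configurations, and the relations
  act trivially. For \<open>\<theta> = Up\<close> and \<open>j = 1\<close> this is the defining
  relation, for \<open>j = 0\<close> it gives both inverse relations of the stable letters.
  Whichever of the two letters pushes, the other one undoes it.\<close>

lemma stab_step_shift:
  assumes "valid_stack st"
  shows "run ([sl \<theta>] @ apow (modulus (flip \<theta>) * j) @ [sl (flip \<theta>)]) (st, x) = (st, x + modulus \<theta> * j)"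
proof -
  have [simp]: "run (apow y) (st', z) = (st', z + y)" for y st' z
  proof -
    have "(step La ^^ n) (st', z) = (st', z + int n)" "(step LA ^^ n) (st', z) = (st', z - int n)" for n
      by (induction n) auto
    then show ?thesis by (simp add: apow_def)
  qed
  show ?thesis
  proof (cases "pops \<theta> (st, x)")
    case True
    then obtain r st' k where st: "st = (r, flip \<theta>) # st'" and x: "x = modulus \<theta> * k"
      by (rule pops_cases)
    have "stab_step \<theta> (st, x) = (st', r + modulus (flip \<theta>) * k)" using True by (simp add: stab_step_def st x)
    moreover have "stab_step (flip \<theta>) (st', r + modulus (flip \<theta>) * (k + j)) = (st, modulus \<theta> * (k + j))"
      using stab_step_restore[of r "flip \<theta>" st' "k + j"] assms by (simp add: st)
    ultimately show ?thesis by (simp add: x distrib_left add.assoc)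
  next
    case False
    then have "stab_step \<theta> (st, x) = ((x mod modulus \<theta>, \<theta>) # st, modulus (flip \<theta>) * (x div modulus \<theta>))"
      by (simp add: stab_step_def)
    then show ?thesis
      using stab_step_pushed[of \<theta> "x mod modulus \<theta>" st "x div modulus \<theta> + j"] by (simp add: distrib_left add.assoc[symmetric])
  qed
qed

lemma run_apow [simp]: "run (apow y) c = (fst c, snd c + y)"
proof -
  have "(step La ^^ n) c = (fst c, snd c + int n)" "(step LA ^^ n) c = (fst c, snd c - int n)" for n
    by (induction n) auto
  then show ?thesis by (simp add: apow_def)
qed

text \<open>Validity matters because popping an entry and pushing it again restores it only if it
  was reduced.\<close>

lemma equ_run: "u \<sim> v \<Longrightarrow> valid_stack (fst c) \<Longrightarrow> run u c = run v c"
proof (induction arbitrary: c rule: bs_eq.induct)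
  case bs_rel
  have "replicate p La = apow (int p)" "replicate q La = apow (int q)" by (simp_all add: apow_def)
  then show ?case using stab_step_shift[OF bs_rel, of Up 1 "snd c"] by simp
next
  case bs_tT
  then show ?case using stab_step_shift[OF bs_tT, of Up 0 "snd c"] by simp
next
  case bs_Tt
  then show ?case using stab_step_shift[OF bs_Tt, of Down 0 "snd c"] by simp
next
  case (bs_cong u v x y)
  then show ?case using valid_run by (simp only: fold_append o_apply)
qed simp_all

lemma equ_nf: "u \<sim> v \<Longrightarrow> nf u = nf v"
  by (simp add: nf_def equ_run)

fun conf_word :: "conf \<Rightarrow> letter list" where
  "conf_word ([], x) = apow x"
| "conf_word ((r, \<theta>) # st, x) = conf_word (st, r) @ [sl \<theta>] @ apow x"

lemma conf_word_cong: "apow x @ u \<sim> apow y @ v \<Longrightarrow> conf_word (st, x) @ u \<sim> conf_word (st, y) @ v"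
  by (cases st) (auto intro!: equ_append_left equ_Cons)

lemma conf_word_append: "conf_word (st, x) @ apow y \<sim> conf_word (st, x + y)"
  using conf_word_cong[of x "apow y" "x + y" "[]" st] by (simp add: apow_add)

lemma conf_word_pop: "pops \<theta> c \<Longrightarrow> conf_word c @ [sl \<theta>] \<sim> conf_word (pop \<theta> c)"
proof -
  assume pops: "pops \<theta> c"
  obtain st x where c: "c = (st, x)" by (cases c)
  with pops obtain r st' k where st: "st = (r, flip \<theta>) # st'" and x: "x = modulus \<theta> * k"
    using pops_cases by metis
  show ?thesis
    using conf_word_cong[of r "[sl (flip \<theta>)] @ apow (modulus \<theta> * k) @ [sl \<theta>]" "r + modulus (flip \<theta>) * k" "[]" st']
      apow_pop[of r \<theta> k] by (simp add: c st x)
qed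

lemma step_sound: "conf_word c @ [l] \<sim> conf_word (step l c)"
proof -
  obtain st x where c: "c = (st, x)" by (cases c)
  have "conf_word c @ [sl \<theta>] \<sim> conf_word (stab_step \<theta> c)" for \<theta>
    using conf_word_pop[of \<theta> c] conf_word_cong[OF apow_push[of x \<theta> "x div modulus \<theta>"], of st]
    by (simp add: stab_step_def c minus_mult_div_eq_mod)
  from this[of Up] this[of Down] show ?thesis
    using conf_word_append[of st x 1] conf_word_append[of st x "-1"] by (cases l) (simp_all add: c)
qed

lemma bstep_sound: "conf_word c @ [l] \<sim> conf_word (bstep l c)"
proof -
  obtain st x where c: "c = (st, x)" by (cases c)
  have "conf_word c @ [sl \<theta>] \<sim> conf_word (britton_stab_step \<theta> c)" for \<theta>
    using conf_word_pop[of \<theta> c] by (simp add: britton_stab_step_def c)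
  from this[of Up] this[of Down] show ?thesis
    using conf_word_append[of st x 1] conf_word_append[of st x "-1"] by (cases l) (simp_all add: c)
qed

lemma fold_sound:
  assumes "\<And>c l. conf_word c @ [l] \<sim> conf_word (f l c)"
  shows "conf_word c @ w \<sim> conf_word (fold f w c)"
proof (induction w arbitrary: c)
  case (Cons l w)
  have "conf_word c @ l # w = (conf_word c @ [l]) @ w" by simp
  also have "\<dots> \<sim> conf_word (f l c) @ w" by (intro equ_append_right assms)
  also have "\<dots> \<sim> conf_word (fold f w (f l c))" by (rule Cons)
  finally show ?case by simp
qed simp

lemma nf_sound: "w \<sim> conf_word (nf w)"
  using fold_sound[of step "([], 0)" w, OF step_sound] by (simp add: nf_def)

lemma nf_eq_iff: "nf u = nf v \<longleftrightarrow> u \<sim> v"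
  using equ_nf nf_sound[of u] nf_sound[of v] bs_sym bs_trans by metis

section \<open>Britton reduction and its relation to the HNN normal form\<close>

definition britton_conf :: "letter list \<Rightarrow> conf" where
  "britton_conf w = fold bstep w ([], 0)"

lemma britton_conf_sound: "w \<sim> conf_word (britton_conf w)"
  using fold_sound[of bstep "([], 0)" w, OF bstep_sound] by (simp add: britton_conf_def)

text \<open>Applies the move of \<open>apow_push\<close> from the bottom of the stack to its top,
  leaving the stable letters in place.\<close>

fun normalise :: "conf \<Rightarrow> conf" where
  "normalise ([], x) = ([], x)"
| "normalise ((a, \<theta>) # st, x) =
     (let (st', y) = normalise (st, a) in ((y mod modulus \<theta>, \<theta>) # st', x + modulus (flip \<theta>) * (y div modulus \<theta>)))"

lemma normalise_stabs: "map snd (fst (normalise c)) = map snd (fst c)"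
  by (induction c rule: normalise.induct) (auto simp: Let_def split: prod.splits)

lemma normalise_add: "normalise (st, x + y) = (fst (normalise (st, x)), snd (normalise (st, x)) + y)"
  by (cases st) (auto simp: Let_def split: prod.splits)

text \<open>Moving carries upwards never changes whether the next letter cancels: the integer behind
  \<open>\<theta>'\<close> changes by a multiple of \<open>modulus (flip \<theta>')\<close>, which
  is the modulus tested by the only letter that can cancel \<open>\<theta>'\<close>.\<close>

lemma normalise_stab_step: "normalise (britton_stab_step \<theta> c) = stab_step \<theta> (normalise c)"
proof -
  obtain st x where c: "c = (st, x)" by (cases c)
  show ?thesis
  proof (cases st)
    case Nil
    then show ?thesis by (simp add: c britton_stab_step_def stab_step_def)
  next
    case (Cons b st')
    obtain a \<theta>' where b: "b = (a, \<theta>')" by (cases b)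
    obtain st2 y where N: "normalise (st', a) = (st2, y)" by (cases "normalise (st', a)")
    then have Na: "normalise (st', a + z) = (st2, y + z)" for z by (simp add: normalise_add)
    have "y + modulus \<theta>' * (x div modulus \<theta>) = y mod modulus \<theta>' + modulus \<theta>' * ((x + modulus (flip \<theta>') * (y div modulus \<theta>')) div modulus \<theta>)"
      if "\<theta>' = flip \<theta>" using that by (simp add: distrib_left)
    then show ?thesis
      by (auto simp: c Cons b britton_stab_step_def stab_step_def N Na dvd_add_left_iff)
  qed
qed

lemma normalise_step: "normalise (bstep l c) = step l (normalise c)"
  using normalise_stab_step[of Up] normalise_stab_step[of Down] normalise_add[of "fst c" "snd c"]
    normalise_add[of "fst c" "snd c" "-1"] by (cases l) auto

lemma normalise_britton_conf: "normalise (britton_conf w) = nf w"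
proof -
  have "normalise (fold bstep w c) = run w (normalise c)" for c
    by (induction w arbitrary: c) (auto simp: normalise_step)
  then show ?thesis by (simp add: britton_conf_def nf_def)
qed

definition stabs :: "letter list \<Rightarrow> nat" where
  "stabs w = length (filter (\<lambda>l. l \<in> {Lt, LT}) w)"

lemma stabs_simps [simp]: "stabs [] = 0" "stabs (u @ v) = stabs u + stabs v" "stabs (apow x) = 0"
  "stabs (Lt # u) = Suc (stabs u)" "stabs (LT # u) = Suc (stabs u)"
  "stabs (La # u) = stabs u" "stabs (LA # u) = stabs u" "stabs (sl \<theta> # u) = Suc (stabs u)"
  by (auto simp: stabs_def apow_def) (cases \<theta>; simp)

text \<open>Each stable letter adds at most one stack entry. As equal elements have equal normal
  forms, the normal form has the least number of stable letters among all words for its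
  element.\<close>

lemma length_nf_le: "length (fst (nf w)) \<le> stabs w"
proof -
  have sst: "length (fst (stab_step \<theta> c)) \<le> Suc (length (fst c))" for \<theta> c
    by (cases c) (auto simp: stab_step_def)
  have "length (fst (run w c)) \<le> length (fst c) + stabs w" for c
  proof (induction w arbitrary: c)
    case (Cons l w)
    show ?case using Cons[of "step l c"] sst[of Up c] sst[of Down c]
      by (cases l) (auto simp del: split_paired_All)
  qed simp
  from this[of "([], 0)"] show ?thesis by (simp add: nf_def)
qed

lemma britton_reducedI:
  assumes "length (fst (nf w)) = stabs w"
  shows "britton_reduced p q w"
proof -
  have "False" if w: "w = x @ ([sl \<theta>] @ apow (\<mu> * modulus (flip \<theta>)) @ [sl (flip \<theta>)]) @ y" for x y \<mu> \<theta>
  proof -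
    have "w \<sim> x @ apow (modulus \<theta> * \<mu>) @ y" unfolding w
      using conj_stab[of \<theta> \<mu>] by (intro bs_cong) (simp add: mult.commute)
    then have "nf w = nf (x @ apow (modulus \<theta> * \<mu>) @ y)" by (rule equ_nf)
    \<comment> \<open>Resolving the forbidden factor removes two stable letters but keeps the normal
      form.\<close>
    moreover have "stabs (x @ apow (modulus \<theta> * \<mu>) @ y) < stabs w" by (simp add: w)
    ultimately show False using length_nf_le assms by (metis not_le)
  qed
  from this[of _ Up] this[of _ Down] show ?thesis
    unfolding britton_reduced_def by (metis append.assoc flip.simps modulus_simps stab_letter.simps)
qed

lemma alt_word_Nil: "alt_word (a, []) = apow a"
  by (simp add: alt_word_def)

lemma alt_word_snoc: "alt_word (a, us @ [(\<theta>, b)]) = alt_word (a, us) @ [sl \<theta>] @ apow b"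
  by (simp add: alt_word_def)

text \<open>The conclusion on divisibility makes the induction go through: the last integer of the
  normal form agrees with that of the word modulo what a further stable letter tests.\<close>

lemma britton_stabs:
  assumes "britton_reduced p q (alt_word (a, us))"
  shows "map snd (fst (nf (alt_word (a, us)))) = rev (map fst us)"
    and "us \<noteq> [] \<Longrightarrow> modulus (flip (fst (last us))) dvd snd (nf (alt_word (a, us))) - snd (last us)"
proof -
  have "map snd (fst (nf (alt_word (a, us)))) = rev (map fst us) \<and>
    (us \<noteq> [] \<longrightarrow> modulus (flip (fst (last us))) dvd snd (nf (alt_word (a, us))) - snd (last us))"
    using assms
  proof (induction us rule: rev_induct)
    case Nil
    then show ?case by (simp add: alt_word_Nil nf_def)
  next
    case (snoc u us)
    obtain \<theta> b where u: "u = (\<theta>, b)" by (cases u)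
    let ?w = "alt_word (a, us)"
    have "britton_reduced p q ?w"
      using snoc.prems unfolding britton_reduced_def u alt_word_snoc
      by (metis append.assoc append_Cons)
    note IH = snoc.IH[OF this]
    have np: "\<not> pops \<theta> (nf ?w)"
    proof
      assume "pops \<theta> (nf ?w)"
      then obtain r st k where nf: "nf ?w = ((r, flip \<theta>) # st, modulus \<theta> * k)"
        by (cases "nf ?w") (metis pops_cases)
      with IH have "us \<noteq> []" by auto
      then obtain us' \<theta>' b' where us: "us = us' @ [(\<theta>', b')]" by (metis prod.exhaust rev_exhaust)
      with IH nf have th: "\<theta>' = flip \<theta>" and "modulus \<theta> dvd modulus \<theta> * k - b'" by auto
      \<comment> \<open>By the divisibility invariant the integer written in the word is divisible
        too, so the two letters around it form a forbidden factor.\<close>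
      then have "modulus \<theta> dvd b'" by (metis dvd_diff_right_iff dvd_triv_left)
      then obtain j where "b' = j * modulus \<theta>" by (auto elim!: dvdE simp: mult.commute)
      then have "alt_word (a, us @ [u]) = alt_word (a, us') @ [sl (flip \<theta>)] @ apow (j * modulus \<theta>) @ [sl \<theta>] @ apow b"
        by (simp add: u us alt_word_snoc th flip: append_assoc)
      with snoc.prems show False unfolding britton_reduced_def by (cases \<theta>) (simp_all, blast+)
    qed
    have "nf (alt_word (a, us @ [u])) = (fst (stab_step \<theta> (nf ?w)), snd (stab_step \<theta> (nf ?w)) + b)"
      by (simp add: u alt_word_snoc nf_def)
    also have "stab_step \<theta> (nf ?w) = push \<theta> (nf ?w)" using np by (simp add: stab_step_def)
    finally show ?case using IH by (cases "nf ?w") (simp add: u)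
  qed
  then show "map snd (fst (nf (alt_word (a, us)))) = rev (map fst us)"
    and "us \<noteq> [] \<Longrightarrow> modulus (flip (fst (last us))) dvd snd (nf (alt_word (a, us))) - snd (last us)"
    by auto
qed

end

context BS
begin

subsection \<open>Geodesic lengths of integers\<close>

abbreviation P :: int where "P \<equiv> int p"
abbreviation Q :: int where "Q \<equiv> int q"

text \<open>\<open>gword x n\<close>: some word for \<open>a\<^sup>x\<close> of the form \<open>a\<^sup>e t v T\<close>, nested, has length \<open>n\<close>.\<close>

inductive gword :: "int \<Rightarrow> nat \<Rightarrow> bool" where
  straight: "gword x (nat \<bar>x\<bar>)"
| lift: "gword (P * k) n \<Longrightarrow> gword (e + Q * k) (nat \<bar>e\<bar> + 2 + n)"

text \<open>The minimum over nested words only. That this is the geodesic length follows in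
  \<open>inorm_g\<close>, the lower bound being obtained from Britton reduction.\<close>

definition g :: "int \<Rightarrow> nat" where
  "g x = (LEAST n. gword x n)"

lemma gword_g: "gword x (g x)"
  unfolding g_def by (rule LeastI) (rule straight)

lemma g_le: "gword x n \<Longrightarrow> g x \<le> n"
  unfolding g_def by (rule Least_le)

lemma g_abs: "g x \<le> nat \<bar>x\<bar>"
  by (rule g_le) (rule straight)

lemma g_lift: "g (e + Q * k) \<le> nat \<bar>e\<bar> + 2 + g (P * k)"
  by (intro g_le lift gword_g)

lemma g_cases: "g x = nat \<bar>x\<bar> \<or> (\<exists>e k. x = e + Q * k \<and> g x = nat \<bar>e\<bar> + 2 + g (P * k))"
  using gword_g[of x]
proof (cases rule: gword.cases)
  case (lift k n e)
  then have "g x \<le> nat \<bar>e\<bar> + 2 + g (P * k)" "g (P * k) \<le> n" using g_lift g_le by blast+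
  with lift show ?thesis by (intro disjI2 exI[of _ e] exI[of _ k]) linarith
qed simp

lemma gword_neg: "gword x n \<Longrightarrow> gword (- x) n"
proof (induction rule: gword.induct)
  case (straight x)
  show ?case using gword.straight[of "- x"] by simp
next
  case (lift k n e)
  then show ?case using gword.lift[of "- k" n "- e"] by simp
qed

lemma g_neg [simp]: "g (- x) = g x"
  using g_le[OF gword_neg[OF gword_g[of x]]] g_le[OF gword_neg[OF gword_g[of "- x"]]] by simp

text \<open>Nested words are added level by level. Where both have a loop, the two loops are fused
  into one, which even saves two letters.\<close>

lemma gword_add: "gword x n \<Longrightarrow> gword y m \<Longrightarrow> \<exists>l\<le>n + m. gword (x + y) l"
proof (induction arbitrary: y m rule: gword.induct)
  case (straight x)
  from straight(1) show ?case
  proof (cases rule: gword.cases)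
    case straight
    then show ?thesis using gword.straight[of "x + y"] by (intro exI[of _ "nat \<bar>x + y\<bar>"]) auto
  next
    case (lift k n e)
    then show ?thesis using gword.lift[of k n "x + e"]
      by (intro exI[of _ "nat \<bar>x + e\<bar> + 2 + n"]) (auto simp: add.assoc)
  qed
next
  case (lift k n e)
  from lift.prems show ?case
  proof (cases rule: gword.cases)
    case straight
    then show ?thesis using lift gword.lift[of k n "e + y"]
      by (intro exI[of _ "nat \<bar>e + y\<bar> + 2 + n"]) (auto simp: algebra_simps)
  next
    case l: (lift k' n' e')
    from lift.IH[OF l(3)] obtain j where "j \<le> n + n'" "gword (P * (k + k')) j"
      by (auto simp: distrib_left)
    then show ?thesis using gword.lift[of "k + k'" j "e + e'"] l
      by (intro exI[of _ "nat \<bar>e + e'\<bar> + 2 + j"]) (auto simp: algebra_simps)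
  qed
qed

lemma g_add: "g (x + y) \<le> g x + g y"
  using gword_add[OF gword_g[of x] gword_g[of y]] g_le le_trans by blast

lemma g_diff: "g x \<le> g y + g (x - y)"
  using g_add[of y "x - y"] by simp

lemma g_P_le: "int (g (P * k)) \<le> P * \<bar>k\<bar>"
proof -
  have "int (g (P * k)) \<le> \<bar>P * k\<bar>" using g_abs[of "P * k"] by linarith
  then show ?thesis by (simp add: abs_mult)
qed

text \<open>This excludes valleys, since cancelling \<open>T a^(qk) t\<close> to
  \<open>a^(pk)\<close> never lengthens anything. If a geodesic for \<open>q k\<close> lifts
  \<open>k'\<close>, its remainder is \<open>q (k - k')\<close>, so it has at least the
  \<open>p |k - k'|\<close> letters that lead from \<open>p k'\<close> to
  \<open>p k\<close>.\<close>

lemma g_PQ: "g (P * k) \<le> g (Q * k)"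
proof -
  from g_cases[of "Q * k"] show ?thesis
  proof (elim disjE exE conjE)
    assume "g (Q * k) = nat \<bar>Q * k\<bar>"
    moreover have "P * \<bar>k\<bar> \<le> Q * \<bar>k\<bar>" using p_less_q by (intro mult_right_mono) auto
    ultimately show ?thesis using g_P_le[of k] by (simp add: abs_mult)
  next
    fix e k' assume e: "Q * k = e + Q * k'" and gq: "g (Q * k) = nat \<bar>e\<bar> + 2 + g (P * k')"
    have "g (P * k) \<le> g (P * k') + g (P * (k - k'))"
      using g_diff[of "P * k" "P * k'"] by (simp add: right_diff_distrib)
    moreover have "int (g (P * (k - k'))) \<le> P * \<bar>k - k'\<bar>" by (rule g_P_le)
    moreover have "P * \<bar>k - k'\<bar> \<le> Q * \<bar>k - k'\<bar>" using p_less_q by (intro mult_right_mono) auto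
    moreover have "\<bar>e\<bar> = Q * \<bar>k - k'\<bar>"
    proof -
      have "e = Q * (k - k')" using e by (simp add: right_diff_distrib)
      then show ?thesis by (simp add: abs_mult)
    qed
    ultimately show ?thesis using gq by linarith
  qed
qed

lemma g_QP: "g (Q * k) \<le> 2 + g (P * k)"
  using g_lift[of 0 k] by simp

section \<open>Norms of configurations as lower bounds for the length of words\<close>

fun conf_norm :: "conf \<Rightarrow> nat" where
  "conf_norm ([], x) = g x"
| "conf_norm ((a, \<theta>) # st, x) = conf_norm (st, a) + 1 + g x"

lemma conf_norm_add: "conf_norm (st, x + y) \<le> conf_norm (st, x) + g y"
  by (cases st) (use g_add in auto)

lemma g_0 [simp]: "g 0 = 0" and g_1: "g 1 \<le> 1" "g (-1) \<le> 1"
  using g_abs[of 0] g_abs[of 1] g_abs[of "-1"] by auto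

lemma g_pop: "g (modulus (flip \<theta>) * k) \<le> 2 + g (modulus \<theta> * k)"
  using g_PQ[of k] g_QP[of k] by (cases \<theta>) auto

text \<open>In the case of a cancellation the popped letter and the letter being read disappear, and
  these two pay for the increase of at most two allowed by \<open>g_pop\<close>.\<close>

lemma conf_norm_britton_stab_step: "conf_norm (britton_stab_step \<theta> c) \<le> conf_norm c + 1"
proof -
  obtain st x where c: "c = (st, x)" by (cases c)
  show ?thesis
  proof (cases "pops \<theta> c")
    case True
    then obtain r st' k where st: "st = (r, flip \<theta>) # st'" and x: "x = modulus \<theta> * k"
      unfolding c by (rule pops_cases)
    show ?thesis using True conf_norm_add[of st' r "modulus (flip \<theta>) * k"] g_pop[of \<theta> k]
      by (simp add: britton_stab_step_def c st x)
  qed (simp add: britton_stab_step_def c)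
qed

text \<open>Applied to a geodesic word, this shows that its Britton-reduced form has no larger norm.
  It yields the lower bound both for powers of \<open>a\<close> and for hills.\<close>

lemma conf_norm_britton_conf: "conf_norm (britton_conf w) \<le> length w"
proof -
  have st: "conf_norm (bstep l c) \<le> conf_norm c + 1" for l c
    using conf_norm_britton_stab_step[of _ c] conf_norm_add[of "fst c" "snd c" 1] conf_norm_add[of "fst c" "snd c" "-1"] g_1
    by (cases l) auto
  have "conf_norm (fold bstep w c) \<le> conf_norm c + length w" for c
  proof (induction w arbitrary: c)
    case (Cons l w)
    show ?case using Cons[of "bstep l c"] st[of l c] by simp
  qed simp
  from this[of "([], 0)"] show ?thesis by (simp add: britton_conf_def)
qed

lemma nf_apow [simp]: "nf (apow x) = ([], x)"
  by (simp add: nf_def)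

lemma equ_apow_iff: "v \<sim> apow x \<longleftrightarrow> nf v = ([], x)"
  by (subst nf_eq_iff[symmetric]) simp

lemma apow_equ_iff: "apow x \<sim> apow y \<longleftrightarrow> x = y"
  using nf_eq_iff[of "apow x" "apow y"] by auto

lemma g_lower:
  assumes "v \<sim> apow x"
  shows "g x \<le> length v"
proof -
  have "normalise (britton_conf v) = ([], x)" using equ_nf[OF assms] by (simp add: normalise_britton_conf)
  moreover from this have "fst (britton_conf v) = []" using normalise_stabs[of "britton_conf v"] by simp
  ultimately have "britton_conf v = ([], x)" by (cases "britton_conf v") auto
  then show ?thesis using conf_norm_britton_conf[of v] by simp
qed

lemma g_word: "\<exists>v. v \<sim> apow x \<and> length v = g x"
proof -
  have "gword x n \<Longrightarrow> \<exists>v. v \<sim> apow x \<and> length v = n" for n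
  proof (induction rule: gword.induct)
    case (lift k n e)
    then obtain u where u: "u \<sim> apow (P * k)" "length u = n" by auto
    have "apow e @ ([Lt] @ u @ [LT]) \<sim> apow e @ [Lt] @ apow (P * k) @ [LT]"
      by (intro equ_append_left bs_cong u)
    also have "\<dots> \<sim> apow e @ apow (Q * k)" by (intro equ_append_left conj_t)
    also have "\<dots> \<sim> apow (e + Q * k)" by (rule apow_add)
    finally show ?case using u by (intro exI[of _ "apow e @ ([Lt] @ u @ [LT])"]) simp
  qed auto
  then show ?thesis using gword_g by blast
qed

lemma inorm_g: "inorm p q x = g x"
  unfolding inorm_def geolen_def
  by (rule Least_equality) (use g_word g_lower in auto)

section \<open>The shape of geodesics of powers of \<open>a\<close>\<close>

text \<open>The suffix \<open>v'\<close> starts where the bottom entry is removed for the first time.\<close>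

lemma first_return:
  "run v (st @ [(0, \<theta>)], x) = ([], z) \<Longrightarrow>
   \<exists>u v' k. v = u @ [sl (flip \<theta>)] @ v' \<and> run u (st, x) = ([], modulus (flip \<theta>) * k) \<and>
     run v' ([], modulus \<theta> * k) = ([], z)"
proof (induction v arbitrary: st x)
  case (Cons l v)
  have lift: ?case if "step l (st @ [(0, \<theta>)], x) = (st' @ [(0, \<theta>)], x')" "step l (st, x) = (st', x')" for st' x'
  proof -
    from Cons.prems that have "run v (st' @ [(0, \<theta>)], x') = ([], z)" by simp
    from Cons.IH[OF this] obtain u v' k where
      "v = u @ [sl (flip \<theta>)] @ v'" "run u (st', x') = ([], modulus (flip \<theta>) * k)" "run v' ([], modulus \<theta> * k) = ([], z)"
      by auto
    with that show ?thesis by (intro exI[of _ "l # u"] exI[of _ v'] exI[of _ k]) simp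
  qed
  have main: ?case if l: "l = sl \<eta>" for \<eta>
  proof (cases "st = [] \<and> \<theta> = flip \<eta> \<and> modulus \<eta> dvd x")
    case True
    then obtain k where x: "x = modulus \<eta> * k" by (auto elim: dvdE)
    from True have "step l (st @ [(0, \<theta>)], x) = ([], modulus \<theta> * k)" by (simp add: l stab_step_def x)
    with Cons.prems True x show ?thesis
      by (intro exI[of _ "[]"] exI[of _ v] exI[of _ k]) (simp add: l)
  next
    case False
    show ?thesis
    proof (cases st)
      case Nil
      with False show ?thesis
        using lift[of "[(x mod modulus \<eta>, \<eta>)]" "modulus (flip \<eta>) * (x div modulus \<eta>)"] by (simp add: l stab_step_def)
    next
      case (Cons b st')
      then show ?thesis
        using lift[of st' "fst b + modulus (flip \<eta>) * (x div modulus \<eta>)"]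
          lift[of "(x mod modulus \<eta>, \<eta>) # st" "modulus (flip \<eta>) * (x div modulus \<eta>)"]
        by (cases b; cases "pops \<eta> (st, x)") (auto simp: l stab_step_def)
    qed
  qed
  show ?case
    using main[of Up] main[of Down] lift[of st "x + 1"] lift[of st "x - 1"] by (cases l) auto
qed simp

text \<open>The first stable letter has to be cancelled eventually, because a power of
  \<open>a\<close> has an empty stack; the word is split where this happens.\<close>

lemma loop_cases:
  assumes "sl \<theta> # v \<sim> apow z"
  shows "\<exists>u v' k. v = u @ [sl (flip \<theta>)] @ v' \<and> u \<sim> apow (modulus (flip \<theta>) * k) \<and> v' \<sim> apow (z - modulus \<theta> * k)"
proof -
  have "run v ([] @ [(0, \<theta>)], 0) = ([], z)"
    using equ_nf[OF assms] by (simp add: nf_def stab_step_def)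
  then obtain u v' k where v: "v = u @ [sl (flip \<theta>)] @ v'" and u: "run u ([], 0) = ([], modulus (flip \<theta>) * k)"
    and v': "run v' ([], modulus \<theta> * k) = ([], z)"
    using first_return by blast
  have 1: "apow (modulus \<theta> * k) @ v' \<sim> apow z" using v' by (simp add: equ_apow_iff nf_def)
  have "v' \<sim> apow (- (modulus \<theta> * k)) @ apow (modulus \<theta> * k) @ v'"
    using equ_append_right[OF apow_add, of "- (modulus \<theta> * k)" "modulus \<theta> * k" v'] by (simp add: bs_sym)
  also have "\<dots> \<sim> apow (- (modulus \<theta> * k)) @ apow z" by (intro equ_append_left 1)
  also have "\<dots> \<sim> apow (- (modulus \<theta> * k) + z)" by (rule apow_add)
  finally have "v' \<sim> apow (z - modulus \<theta> * k)" by simp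
  moreover have "u \<sim> apow (modulus (flip \<theta>) * k)" using u by (simp add: equ_apow_iff nf_def)
  ultimately show ?thesis using v by blast
qed

text \<open>All geodesics have to be known, not just those counted by \<open>gword\<close>, because
  the length-lexicographical normal form is chosen among all of them. Peeling off a letter or a loop
  leaves a shorter geodesic; opposite signs of \<open>e1\<close> and \<open>e2\<close>, a second
  loop on the same level and a valley would each waste letters.\<close>

lemma geodesic_cases:
  "v \<sim> apow x \<Longrightarrow> length v = g x \<Longrightarrow> v = apow x \<or>
    (\<exists>e1 e2 u k. v = apow e1 @ [Lt] @ u @ [LT] @ apow e2 \<and> 0 \<le> e1 * e2 \<and> x = e1 + e2 + Q * k \<and>
      u \<sim> apow (P * k) \<and> length u = g (P * k))"
proof (induction "length v" arbitrary: v x rule: less_induct)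
  case less
  have main: ?case if v: "v = apow s @ v'" and s: "s = 1 \<or> s = -1" for s v'
  proof -
    have "v' \<sim> apow (- s) @ apow s @ v'"
      using equ_append_right[OF apow_add, of "- s" s v'] by (simp add: bs_sym)
    also have "\<dots> \<sim> apow (- s) @ apow x" using less.prems by (intro equ_append_left) (simp add: v)
    also have "\<dots> \<sim> apow (- s + x)" by (rule apow_add)
    finally have v'x: "v' \<sim> apow (x - s)" by simp
    have len: "length v = Suc (length v')" using s by (auto simp: v)
    have "g x \<le> g (x - s) + 1" using g_diff[of x "x - s"] s g_1 by auto
    with g_lower[OF v'x] len less.prems have lv': "length v' = g (x - s)" by simp
    have "length v' < length v" using len by simp
    from less.hyps[OF this v'x lv'] show ?thesis
    proof (elim disjE exE conjE)
      assume v': "v' = apow (x - s)"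
      with less.prems len have "1 + \<bar>x - s\<bar> \<le> \<bar>x\<bar>" using g_abs[of x] by simp
      with s have "0 \<le> s * (x - s)" by auto
      then show ?thesis using apow_add_same_sign[of s "x - s"] v v' by simp
    next
      fix e1 e2 u k
      assume v': "v' = apow e1 @ [Lt] @ u @ [LT] @ apow e2" and x: "x - s = e1 + e2 + Q * k"
        and u: "u \<sim> apow (P * k)" "length u = g (P * k)"
      have "g x \<le> nat \<bar>s + e1 + e2\<bar> + 2 + g (P * k)" using g_lift[of "s + e1 + e2" k] x
        by (simp add: algebra_simps)
      with less.prems len v' u have le: "1 + \<bar>e1\<bar> + \<bar>e2\<bar> \<le> \<bar>s + e1 + e2\<bar>" by simp
      with s have "0 \<le> s * e1" "0 \<le> (s + e1) * e2" by (auto simp: zero_le_mult_iff)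
      then show ?thesis using apow_add_same_sign[of s e1] v v' u x
        by (intro disjI2 exI[of _ "s + e1"] exI[of _ e2] exI[of _ u] exI[of _ k]) simp
    qed
  qed
  show ?case
  proof (cases v)
    case Nil
    with less.prems show ?thesis by (simp add: equ_apow_iff nf_def)
  next
    case (Cons l w)
    show ?thesis
    proof (cases l)
      case La
      then show ?thesis using main[of 1 w] Cons by simp
    next
      case LA
      then show ?thesis using main[of "-1" w] Cons by simp
    next
      case Lt
      with Cons less.prems obtain u v' k where w: "w = u @ [LT] @ v'" and u: "u \<sim> apow (P * k)"
        and v': "v' \<sim> apow (x - Q * k)"
        using loop_cases[of Up w x] by auto
      have "g x \<le> g (x - Q * k) + g (Q * k)" using g_add[of "x - Q * k" "Q * k"] by simp
      with g_QP[of k] g_lower[OF u] g_lower[OF v'] less.prems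
      have lu: "length u = g (P * k)" and lv: "length v' = g (x - Q * k)"
        by (auto simp: Cons w)
      have lt: "length v' < length v" by (simp add: Cons w)
      from less.hyps[OF lt v' lv] show ?thesis
      proof (elim disjE exE conjE)
        assume "v' = apow (x - Q * k)"
        then show ?thesis using u lu Cons w Lt
          by (intro disjI2 exI[of _ 0] exI[of _ "x - Q * k"] exI[of _ u] exI[of _ k]) simp
      next
        fix e1 e2 u' k'
        assume v'': "v' = apow e1 @ [Lt] @ u' @ [LT] @ apow e2" and x: "x - Q * k = e1 + e2 + Q * k'"
          and u': "u' \<sim> apow (P * k')" "length u' = g (P * k')"
        \<comment> \<open>Two loops on one level can be merged into one, saving two letters.\<close>
        have "g x \<le> nat \<bar>e1 + e2\<bar> + 2 + g (P * (k + k'))"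
          using g_lift[of "e1 + e2" "k + k'"] x by (simp add: algebra_simps)
        moreover have "g (P * (k + k')) \<le> g (P * k) + g (P * k')" by (simp add: distrib_left g_add)
        moreover have "length v = 4 + g (P * k) + g (P * k') + nat \<bar>e1\<bar> + nat \<bar>e2\<bar>"
          by (simp add: Cons w v'' lu u')
        moreover have "nat \<bar>e1 + e2\<bar> \<le> nat \<bar>e1\<bar> + nat \<bar>e2\<bar>" by simp
        ultimately show ?thesis using less.prems by linarith
      qed
    next
      case LT
      with Cons less.prems obtain u v' k where w: "w = u @ [Lt] @ v'" and u: "u \<sim> apow (Q * k)"
        and v': "v' \<sim> apow (x - P * k)"
        using loop_cases[of Down w x] by auto
      \<comment> \<open>The valley uses two stable letters and at least \<open>g (Q * k)\<close>
        others, while \<open>g (P * k)\<close> letters suffice.\<close>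
      have "g x \<le> g (x - P * k) + g (P * k)" using g_add[of "x - P * k" "P * k"] by simp
      with g_PQ[of k] g_lower[OF u] g_lower[OF v'] less.prems show ?thesis by (simp add: Cons w)
    qed
  qed
qed

end

subsection \<open>Length-lexicographical normal forms\<close>

text \<open>Two words that differ at some letter, with no condition on their lengths. Unlike
  \<open>lex\<close> this survives arbitrary, different continuations, and neither word can be a
  prefix of the other.\<close>

definition lex_diff :: "('a \<times> 'a) set \<Rightarrow> 'a list \<Rightarrow> 'a list \<Rightarrow> bool" where
  "lex_diff r u v \<longleftrightarrow> (\<exists>c a b x y. u = c @ a # x \<and> v = c @ b # y \<and> (a, b) \<in> r)"

lemma lex_diff_append: "lex_diff r u v \<Longrightarrow> lex_diff r (c @ u @ x) (c @ v @ y)"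
  unfolding lex_diff_def by (metis append.assoc append_Cons)

lemma lex_diff_Cons: "(a, b) \<in> r \<Longrightarrow> lex_diff r (a # x) (b # y)"
  unfolding lex_diff_def by (metis append_Nil)

lemma lex_iff_lex_diff: "length u = length v \<Longrightarrow> (u, v) \<in> lex r \<longleftrightarrow> lex_diff r u v"
  unfolding lex_diff_def lex_conv by auto

lemma lenlex_iff_lex_diff: "length u = length v \<Longrightarrow> (u, v) \<in> lenlex r \<longleftrightarrow> lex_diff r u v"
  by (simp add: lenlex_conv lex_iff_lex_diff)

lemma wf_letter_less: "wf letter_less" and trans_letter_less: "trans letter_less"
  and total_letter_less: "total letter_less"
proof -
  show "wf letter_less" by (rule wf_subset[OF wf_measure[of code]]) (auto simp: letter_less_def)
  show "trans letter_less" by (auto simp: letter_less_def trans_def)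
  have "code x = code y \<Longrightarrow> x = y" for x y by (cases x; cases y) auto
  then show "total letter_less" unfolding letter_less_def total_on_def using nat_neq_iff by blast
qed

context BS
begin

abbreviation wless :: "letter list \<Rightarrow> letter list \<Rightarrow> bool" where
  "wless \<equiv> lex_diff letter_less"

lemma llnf_ex1: "\<exists>!v. v \<sim> w \<and> (\<forall>v'. v' \<sim> w \<longrightarrow> v = v' \<or> (v, v') \<in> lenlex letter_less)"
proof -
  have "wf (lenlex letter_less)" by (rule wf_lenlex) (rule wf_letter_less)
  then obtain z where z: "z \<sim> w" "\<And>y. (y, z) \<in> lenlex letter_less \<Longrightarrow> \<not> y \<sim> w"
    using wfE_min[of "lenlex letter_less" w "{v. v \<sim> w}"] by auto
  have tot: "total (lenlex letter_less)" by (rule total_lenlex) (rule total_letter_less)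
  show ?thesis
  proof (intro ex1I[of _ z] conjI allI impI)
    fix v' assume "v' \<sim> w"
    then show "z = v' \<or> (z, v') \<in> lenlex letter_less" using tot z by (auto simp: total_on_def)
  next
    fix v assume "v \<sim> w \<and> (\<forall>v'. v' \<sim> w \<longrightarrow> v = v' \<or> (v, v') \<in> lenlex letter_less)"
    with z show "v = z" by blast
  qed (rule z)
qed

lemma llnf_equ: "llnf p q w \<sim> w"
  and llnf_least: "v \<sim> w \<Longrightarrow> llnf p q w = v \<or> (llnf p q w, v) \<in> lenlex letter_less"
proof -
  from theI'[OF llnf_ex1[of w]] have "llnf p q w \<sim> w \<and>
    (\<forall>v'. v' \<sim> w \<longrightarrow> llnf p q w = v' \<or> (llnf p q w, v') \<in> lenlex letter_less)"
    unfolding llnf_def .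
  then show "llnf p q w \<sim> w"
    and "v \<sim> w \<Longrightarrow> llnf p q w = v \<or> (llnf p q w, v) \<in> lenlex letter_less"
    by simp_all
qed

definition L :: "int \<Rightarrow> letter list" where
  "L x = llnf p q (apow x)"

lemma L_equ: "L x \<sim> apow x"
  by (simp add: L_def llnf_equ)

lemma length_L: "length (L x) = g x"
proof -
  obtain v where "v \<sim> apow x" "length v = g x" using g_word by blast
  with llnf_least[of v "apow x"] g_lower[OF L_equ[of x]] show ?thesis
    by (auto simp: L_def lenlex_conv)
qed

lemma L_least: "v \<sim> apow x \<Longrightarrow> length v = g x \<Longrightarrow> L x = v \<or> wless (L x) v"
  using llnf_least[of v "apow x"] lenlex_iff_lex_diff[of "L x" v] length_L[of x] by (auto simp: L_def)

lemma wless_asym: "wless u v \<Longrightarrow> \<not> wless v u"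
proof -
  assume "wless u v"
  then obtain c a b x y where 1: "u = c @ a # x" "v = c @ b # y" "(a, b) \<in> letter_less"
    unfolding lex_diff_def by auto
  show ?thesis
  proof
    assume "wless v u"
    then obtain c' a' b' x' y' where 2: "v = c' @ a' # x'" "u = c' @ b' # y'" "(a', b') \<in> letter_less"
      unfolding lex_diff_def by auto
    from 1 2 show False
      by (auto simp: append_eq_append_conv2 Cons_eq_append_conv append_eq_Cons_conv letter_less_def)
  qed
qed

lemma L_not_wless: "v \<sim> apow x \<Longrightarrow> length v = g x \<Longrightarrow> \<not> wless v (L x)"
  using L_least wless_asym by metis

lemma lift_equ:
  assumes "u \<sim> apow (P * k)"
  shows "[Lt] @ u @ [LT] @ apow e \<sim> apow (e + Q * k)"
proof -
  have "([Lt] @ u @ [LT]) @ apow e \<sim> ([Lt] @ apow (P * k) @ [LT]) @ apow e"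
    by (intro equ_append_right bs_cong assms)
  also have "\<dots> \<sim> apow (Q * k) @ apow e" by (intro equ_append_right conj_t)
  also have "\<dots> \<sim> apow (Q * k + e)" by (rule apow_add)
  finally show ?thesis by (simp add: add.commute)
qed

lemma apow_nonempty: "e \<noteq> 0 \<Longrightarrow> \<exists>l w. apow e = l # w \<and> l \<in> {La, LA}"
  using set_apow[of e] length_apow[of e] by (cases "apow e") auto

text \<open>As \<open>t\<close> is the smallest letter, the least geodesic starts with
  \<open>t\<close> as soon as some geodesic has a loop. Hence all of \<open>e\<close> stands behind
  the loop, and then the word inside the loop has to be least itself.\<close>

lemma L_lift:
  assumes "x = e0 + Q * k0" "g x = nat \<bar>e0\<bar> + 2 + g (P * k0)"
  shows "\<exists>e k. x = e + Q * k \<and> g x = nat \<bar>e\<bar> + 2 + g (P * k) \<and> L x = [Lt] @ L (P * k) @ [LT] @ apow e"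
proof -
  have cand: "\<not> wless ([Lt] @ u @ [LT] @ apow e) (L x)"
    if "u \<sim> apow (P * k)" "x = e + Q * k" "g x = nat \<bar>e\<bar> + 2 + g (P * k)" "length u = g (P * k)" for u e k
    using lift_equ[OF that(1), of e] that by (intro L_not_wless) auto
  have t_less: "wless (Lt # y) (apow e @ z)" if "e \<noteq> 0" for y e z
    using apow_nonempty[OF that] by (auto intro!: lex_diff_Cons simp: letter_less_def)
  from geodesic_cases[OF L_equ length_L, of x] show ?thesis
  proof (elim disjE exE conjE)
    assume "L x = apow x"
    moreover have "x \<noteq> 0" using assms by auto
    ultimately show ?thesis
      using cand[OF L_equ assms length_L] t_less[of x _ "[]"] by simp
  next
    fix e1 e2 u k
    assume Lx: "L x = apow e1 @ [Lt] @ u @ [LT] @ apow e2" and s: "0 \<le> e1 * e2"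
      and x: "x = e1 + e2 + Q * k" and u: "u \<sim> apow (P * k)" "length u = g (P * k)"
    have "nat \<bar>e1 + e2\<bar> = nat \<bar>e1\<bar> + nat \<bar>e2\<bar>" using s by (auto simp: zero_le_mult_iff)
    with Lx u have gx: "g x = nat \<bar>e1 + e2\<bar> + 2 + g (P * k)" using length_L[of x] by simp
    have "e1 = 0"
      using cand[OF u(1) x gx u(2)] t_less[of e1] Lx by auto
    with x gx Lx have x': "x = e2 + Q * k" and gx': "g x = nat \<bar>e2\<bar> + 2 + g (P * k)"
      and Lx': "L x = [Lt] @ u @ [LT] @ apow e2" by auto
    have "\<not> wless (L (P * k)) u"
      using cand[OF L_equ x' gx' length_L] lex_diff_append[of letter_less "L (P * k)" u "[Lt]"] by (auto simp: Lx')
    then have "L (P * k) = u" using L_least[OF u] by simp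
    with x' gx' Lx' show ?thesis by blast
  qed
qed

lemma L_straight:
  assumes "\<And>e k. x = e + Q * k \<Longrightarrow> g x \<noteq> nat \<bar>e\<bar> + 2 + g (P * k)"
  shows "L x = apow x"
  using geodesic_cases[OF L_equ length_L, of x]
proof (elim disjE exE conjE)
  fix e1 e2 u k
  assume Lx: "L x = apow e1 @ [Lt] @ u @ [LT] @ apow e2" and s: "0 \<le> e1 * e2"
    and x: "x = e1 + e2 + Q * k" and u: "length u = g (P * k)"
  have "nat \<bar>e1 + e2\<bar> = nat \<bar>e1\<bar> + nat \<bar>e2\<bar>" using s by (auto simp: zero_le_mult_iff)
  then show ?thesis using assms[OF x] length_L[of x] Lx u by simp
qed

text \<open>A suffix of a geodesic is a geodesic, and no geodesic of a power of \<open>a\<close> starts with \<open>T\<close>.\<close>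

lemma L_T_prefix_free:
  assumes "L x @ [LT] @ v = L y"
  shows "False"
proof -
  have "apow x @ [LT] @ v \<sim> L x @ [LT] @ v" by (intro equ_append_right bs_sym[OF L_equ])
  also have "\<dots> \<sim> apow y" using L_equ[of y] assms by simp
  finally have 1: "apow x @ [LT] @ v \<sim> apow y" .
  have "[LT] @ v \<sim> apow (- x) @ apow x @ [LT] @ v"
    using equ_append_right[OF apow_add, of "- x" x "[LT] @ v"] by (simp add: bs_sym)
  also have "\<dots> \<sim> apow (- x) @ apow y" by (intro equ_append_left 1)
  also have "\<dots> \<sim> apow (- x + y)" by (rule apow_add)
  finally have v: "[LT] @ v \<sim> apow (y - x)" by simp
  have "g y \<le> g x + g (y - x)" by (rule g_diff)
  moreover have "length ([LT] @ v) + g x = g y" using length_L[of x] length_L[of y] assms[symmetric] by simp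
  ultimately have "length ([LT] @ v) = g (y - x)" using g_lower[OF v] by simp
  moreover have "[LT] @ v \<noteq> apow z" "[LT] @ v \<noteq> apow z @ [Lt] @ w" for z w
    using apow_nonempty[of z] by (cases "z = 0"; auto)+
  ultimately show False using geodesic_cases[OF v] by blast
qed

text \<open>With \<open>T\<close> appended no such word is a prefix of another, so two different
  integers at the top of the climb are compared independently of what follows.\<close>

lemma L_T_total:
  assumes "x \<noteq> y"
  shows "wless (L x @ [LT]) (L y @ [LT]) \<or> wless (L y @ [LT]) (L x @ [LT])"
proof -
  have "L x @ [LT] \<noteq> L y @ [LT]"
    using L_equ[of x] L_equ[of y] assms apow_equ_iff bs_sym bs_trans by (metis butlast_snoc)
  moreover have "L x @ [LT] \<noteq> (L y @ [LT]) @ a # v" for x y a v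
  proof
    assume *: "L x @ [LT] = (L y @ [LT]) @ a # v"
    then have "L x = L y @ [LT] @ butlast (a # v)"
      by (metis append.assoc butlast_append butlast_snoc list.distinct(1) snoc_eq_iff_butlast)
    then show False using L_T_prefix_free by metis
  qed
  moreover have "\<forall>a b. (a, b) \<in> letter_less \<or> a = b \<or> (b, a) \<in> letter_less"
    using total_letter_less by (auto simp: total_on_def)
  moreover have "(u, v) \<in> lexord letter_less \<longleftrightarrow> (\<exists>a w. v = u @ a # w) \<or> wless u v" for u v
    unfolding lexord_def lex_diff_def by blast
  ultimately show ?thesis
    using lexord_linear[of letter_less "L x @ [LT]" "L y @ [LT]"] by simp
qed

end

subsection \<open>Hills\<close>

text \<open>A hill is given by the digits \<open>bl\<close> on its left side and the digits \<open>br\<close> on its right side,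
  both listed from the foot to the peak, and the integer \<open>c\<close> at the peak. The digits on the right
  are negated, so that the two sides are mirror images under the involution of the peak normal form.\<close>

definition left_word :: "(int \<Rightarrow> letter list) \<Rightarrow> int list \<Rightarrow> letter list" where
  "left_word f bl = concat (map (\<lambda>b. f b @ [Lt]) bl)"

definition right_word :: "(int \<Rightarrow> letter list) \<Rightarrow> int list \<Rightarrow> letter list" where
  "right_word f br = concat (map (\<lambda>b. LT # f (- b)) (rev br))"

definition hill_word :: "(int \<Rightarrow> letter list) \<Rightarrow> int list \<Rightarrow> int \<Rightarrow> int list \<Rightarrow> letter list" where
  "hill_word f bl c br = left_word f bl @ f c @ right_word f br"

abbreviation hw :: "int list \<Rightarrow> int \<Rightarrow> int list \<Rightarrow> letter list" where
  "hw \<equiv> hill_word apow"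

definition mkalt :: "int list \<Rightarrow> int \<Rightarrow> int list \<Rightarrow> alt" where
  "mkalt bl c br = (hd (bl @ [c]), map (Pair Up) (tl (bl @ [c])) @ map (Pair Down) (rev (map uminus br)))"

lemma left_word_simps [simp]: "left_word f [] = []" "left_word f (b # bl) = f b @ Lt # left_word f bl"
  "left_word f (bl @ bl') = left_word f bl @ left_word f bl'"
  by (simp_all add: left_word_def)

lemma right_word_simps [simp]: "right_word f [] = []"
  "right_word f (b # br) = right_word f br @ LT # f (- b)"
  "right_word f (br @ br') = right_word f br' @ right_word f br"
  by (simp_all add: right_word_def)

lemma hill_iff_hw: "hill p q w \<longleftrightarrow> (\<exists>bl c br. bs_eq p q w (hw bl c br))"
proof -
  have "concat (map (\<lambda>\<alpha>. LT # apow \<alpha>) \<alpha>s) = right_word apow (map uminus (rev \<alpha>s))" for \<alpha>s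
    by (simp add: right_word_def rev_map[symmetric] comp_def)
  moreover have "right_word apow br = concat (map (\<lambda>\<alpha>. LT # apow \<alpha>) (map uminus (rev br)))" for br
    by (simp add: right_word_def comp_def)
  ultimately show ?thesis unfolding hill_def hill_word_def left_word_def by metis
qed

lemma alt_word_mkalt: "alt_word (mkalt bl c br) = hw bl c br"
proof -
  have r: "concat (map (\<lambda>(\<theta>, \<alpha>). stab_letter \<theta> # apow \<alpha>) (map (Pair Down) (rev (map uminus br)))) = right_word apow br"
    by (simp add: right_word_def rev_map[symmetric] comp_def)
  have "apow (hd (bl @ [c])) @ concat (map (\<lambda>(\<theta>, \<alpha>). stab_letter \<theta> # apow \<alpha>) (map (Pair Up) (tl (bl @ [c])))) =
    left_word apow bl @ apow c"
  proof (induction bl)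
    case (Cons b bl)
    then show ?case by (cases bl) auto
  qed simp
  then show ?thesis unfolding alt_word_def mkalt_def hill_word_def r[symmetric] by simp
qed

lemma mkalt_cover:
  assumes "map fst us = replicate l Up @ replicate m Down"
  shows "\<exists>bl c br. (a, us) = mkalt bl c br \<and> length bl = l \<and> length br = m"
proof -
  let ?xs = "a # map snd (take l us)" and ?br = "map uminus (rev (map snd (drop l us)))"
  have len: "length us = l + m" using arg_cong[OF assms, of length] by simp
  have f: "map fst (take l us) = replicate l Up" "map fst (drop l us) = replicate m Down"
    using arg_cong[OF assms, of "take l"] arg_cong[OF assms, of "drop l"] by (simp_all add: take_map drop_map)
  have eq: "map (Pair \<theta>) (map snd vs) = vs" if "map fst vs = replicate n \<theta>" for vs :: "(stab \<times> int) list" and \<theta> n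
    using that by (induction vs arbitrary: n) (auto simp: Cons_replicate_eq)
  let ?bl = "butlast ?xs" and ?c = "last ?xs"
  have xs: "?bl @ [?c] = ?xs" by (rule append_butlast_last_id) simp
  have "map uminus ?br = rev (map snd (drop l us))" by (simp add: comp_def)
  then have "(a, us) = mkalt ?bl ?c ?br"
    unfolding mkalt_def xs list.sel using eq[OF f(1)] eq[OF f(2)] by (simp del: map_map)
  moreover have "length ?bl = l" "length ?br = m" using len by auto
  ultimately show ?thesis by blast
qed

text \<open>A transducer running through the states \<open>s # ts\<close>: the digit
  \<open>x\<close> between the states \<open>s\<close> and \<open>t\<close> becomes
  \<open>dd x s t\<close>. The states will be carries, read upwards with \<open>shift_digit\<close>
  and downwards with \<open>lift_digit\<close>.\<close>

fun new_digits :: "(int \<Rightarrow> int \<Rightarrow> int \<Rightarrow> int) \<Rightarrow> int \<Rightarrow> int list \<Rightarrow> int list \<Rightarrow> int list" where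
  "new_digits dd s (x # xs) (t # ts) = dd x s t # new_digits dd t xs ts"
| "new_digits dd s _ _ = []"

abbreviation endst :: "int \<Rightarrow> int list \<Rightarrow> int" where
  "endst s ts \<equiv> last (s # ts)"

lemma length_new_digits [simp]: "length xs = length ts \<Longrightarrow> length (new_digits dd s xs ts) = length ts"
  by (induction xs ts arbitrary: s rule: list_induct2) auto

lemma neq_Nil_conv_snoc: "xs \<noteq> [] \<longleftrightarrow> (\<exists>ys y. xs = ys @ [y])"
  by (cases xs rule: rev_cases) auto

context BS
begin

section \<open>Carries along the two sides of a hill\<close>

text \<open>Moving \<open>t\<close> carries past the next stable letter turns a digit \<open>r\<close> into \<open>r + p s - q t\<close>, where
  \<open>s\<close> is the carry that arrives from the previous digit.\<close>

definition shift_digit :: "int \<Rightarrow> int \<Rightarrow> int \<Rightarrow> int" where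
  "shift_digit r s t = r + P * s - Q * t"

abbreviation shifted :: "int \<Rightarrow> int list \<Rightarrow> int list \<Rightarrow> int list" where
  "shifted \<equiv> new_digits shift_digit"

abbreviation digits :: "int list \<Rightarrow> bool" where
  "digits rs \<equiv> set rs \<subseteq> {0..<Q}"

lemma shifted_exists: "\<exists>rs ss. length rs = length bl \<and> length ss = length bl \<and> digits rs \<and> shifted s rs ss = bl"
proof (induction bl arbitrary: s)
  case (Cons b bl)
  let ?y = "b - P * s"
  from Cons obtain rs ss where *: "length rs = length bl" "length ss = length bl" "digits rs"
    "shifted (- (?y div Q)) rs ss = bl" by blast
  have "shift_digit (?y mod Q) s (- (?y div Q)) = b" by (simp add: shift_digit_def)
  with * show ?case using q_pos
    by (intro exI[of _ "?y mod Q # rs"] exI[of _ "- (?y div Q) # ss"]) auto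
qed simp

lemma left_shift:
  "length rs = length ss \<Longrightarrow>
   apow (- (P * s)) @ left_word apow (shifted s rs ss) \<sim> left_word apow rs @ apow (- (P * endst s ss))"
proof (induction rs ss arbitrary: s rule: list_induct2)
  case (Cons r rs t ss)
  let ?w = "left_word apow (shifted t rs ss)"
  have "apow (- (P * s)) @ left_word apow (shifted s (r # rs) (t # ss)) = (apow (- (P * s)) @ apow (shift_digit r s t)) @ [Lt] @ ?w"
    by simp
  also have "\<dots> \<sim> apow (- (P * s) + shift_digit r s t) @ [Lt] @ ?w" by (intro equ_append_right apow_add)
  also have "\<dots> = (apow (r - Q * t) @ [Lt]) @ ?w" by (simp add: shift_digit_def)
  also have "\<dots> \<sim> (apow (r - Q * t - Q * (- t)) @ [Lt] @ apow (P * (- t))) @ ?w"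
    using apow_push[of "r - Q * t" Up "- t"] by (intro equ_append_right) simp
  also have "\<dots> = (apow r @ [Lt]) @ apow (- (P * t)) @ ?w" by simp
  also have "\<dots> \<sim> (apow r @ [Lt]) @ left_word apow rs @ apow (- (P * endst t ss))"
    by (intro equ_append_left Cons)
  finally show ?case by simp
qed simp

lemma right_shift:
  "length rs = length ss \<Longrightarrow>
   right_word apow (shifted s rs ss) @ apow (P * s) \<sim> apow (P * endst s ss) @ right_word apow rs"
proof (induction rs ss arbitrary: s rule: list_induct2)
  case (Cons r rs t ss)
  let ?w = "right_word apow (shifted t rs ss)"
  have "right_word apow (shifted s (r # rs) (t # ss)) @ apow (P * s) = (?w @ [LT]) @ (apow (- shift_digit r s t) @ apow (P * s))"
    by simp
  also have "\<dots> \<sim> (?w @ [LT]) @ apow (- shift_digit r s t + P * s)" by (intro equ_append_left apow_add)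
  also have "\<dots> = (?w @ [LT]) @ apow (Q * t + - r)" by (simp add: shift_digit_def)
  also have "\<dots> \<sim> (?w @ [LT]) @ apow (Q * t) @ apow (- r)" by (intro equ_append_left apow_add')
  also have "\<dots> = ?w @ ([LT] @ apow (Q * t)) @ apow (- r)" by simp
  also have "\<dots> \<sim> ?w @ (apow (P * t) @ [LT]) @ apow (- r)" 
    using bs_sym[OF apow_stab[of Down t]] by (intro bs_cong) simp
  also have "\<dots> = (?w @ apow (P * t)) @ [LT] @ apow (- r)" by simp
  also have "\<dots> \<sim> (apow (P * endst t ss) @ right_word apow rs) @ [LT] @ apow (- r)"
    by (intro equ_append_right Cons)
  finally show ?case by simp
qed simp

text \<open>The two final carries enter the peak with opposite signs because the digits on the right
  are stored negated.\<close>

lemma hw_shift: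
  assumes "length rsL = length ss" "length rsR = length cs"
  shows "hw (shifted 0 rsL ss) (x + P * (endst 0 ss - endst 0 cs)) (shifted 0 rsR cs) \<sim> hw rsL x rsR"
proof -
  let ?a = "endst 0 ss" and ?b = "endst 0 cs" and ?l = "left_word apow rsL" and ?r = "right_word apow rsR"
  have A: "left_word apow (shifted 0 rsL ss) \<sim> ?l @ apow (- (P * ?a))"
    using left_shift[OF assms(1), of 0] by (simp only: mult_zero_right minus_zero apow_0 append_Nil)
  have B: "right_word apow (shifted 0 rsR cs) \<sim> apow (P * ?b) @ ?r"
    using right_shift[OF assms(2), of 0] by (simp only: mult_zero_right apow_0 append_Nil2)
  have "hw (shifted 0 rsL ss) (x + P * (?a - ?b)) (shifted 0 rsR cs) \<sim>
      (?l @ apow (- (P * ?a))) @ apow (x + P * (?a - ?b)) @ (apow (P * ?b) @ ?r)"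
    unfolding hill_word_def by (rule equ_append[OF A equ_append_left[OF B]])
  also have "\<dots> = ?l @ (apow (- (P * ?a)) @ apow (x + P * (?a - ?b)) @ apow (P * ?b)) @ ?r" by simp
  also have "\<dots> \<sim> ?l @ (apow (- (P * ?a)) @ apow (x + P * (?a - ?b) + P * ?b)) @ ?r"
    by (rule bs_cong, rule equ_append_left, rule apow_add)
  also have "\<dots> \<sim> ?l @ apow (- (P * ?a) + (x + P * (?a - ?b) + P * ?b)) @ ?r"
    by (intro bs_cong apow_add)
  finally show ?thesis by (simp add: hill_word_def algebra_simps)
qed

text \<open>The last condition forbids the factor \<open>t a^x T\<close> with \<open>p\<close>
  dividing \<open>x\<close> at the peak, the only place where a hill can fail to be
  Britton-reduced.\<close>

definition canonical :: "int list \<Rightarrow> int \<Rightarrow> int list \<Rightarrow> bool" where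
  "canonical rsL x rsR \<longleftrightarrow> digits rsL \<and> digits rsR \<and> (rsL = [] \<or> rsR = [] \<or> \<not> P dvd x)"

lemma hw_reduce: "hw (bl @ [b]) (P * k) (br @ [b']) \<sim> hw bl (b + Q * k - b') br"
proof -
  have "hw (bl @ [b]) (P * k) (br @ [b']) = left_word apow bl @ (apow b @ ([Lt] @ apow (P * k) @ [LT]) @ apow (- b')) @ right_word apow br"
    by (simp add: hill_word_def)
  also have "\<dots> \<sim> left_word apow bl @ (apow b @ apow (Q * k) @ apow (- b')) @ right_word apow br"
    by (intro bs_cong conj_t)
  also have "\<dots> \<sim> left_word apow bl @ (apow b @ apow (Q * k + - b')) @ right_word apow br"
    by (intro bs_cong equ_append_left apow_add)
  also have "\<dots> \<sim> left_word apow bl @ apow (b + (Q * k + - b')) @ right_word apow br"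
    by (intro bs_cong apow_add)
  also have "b + (Q * k + - b') = b + Q * k - b'" by simp
  finally show ?thesis by (simp add: hill_word_def)
qed

lemma digits_normalise:
  "\<exists>rsL x rsR ss cs. length rsL = length bl \<and> length ss = length bl \<and> length rsR = length br \<and>
    length cs = length br \<and> digits rsL \<and> digits rsR \<and> shifted 0 rsL ss = bl \<and> shifted 0 rsR cs = br \<and>
    c = x + P * (endst 0 ss - endst 0 cs)"
proof -
  obtain rsL ss rsR cs where "length rsL = length bl" "length ss = length bl" "digits rsL" "shifted 0 rsL ss = bl"
    "length rsR = length br" "length cs = length br" "digits rsR" "shifted 0 rsR cs = br"
    using shifted_exists[of bl 0] shifted_exists[of br 0] by blast
  then show ?thesis
    by (intro exI[of _ rsL] exI[of _ "c - P * (endst 0 ss - endst 0 cs)"] exI[of _ rsR] exI[of _ ss] exI[of _ cs] conjI)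
      simp_all
qed

text \<open>A peak divisible by \<open>p\<close> is cancelled together with the letters around it,
  which shortens both sides; hence the induction on the length of the left side.\<close>

lemma hill_canonical:
  assumes "hill p q w"
  obtains rsL x rsR where "canonical rsL x rsR" "w \<sim> hw rsL x rsR"
proof -
  have "\<exists>rsL x rsR. canonical rsL x rsR \<and> hw bl c br \<sim> hw rsL x rsR" for bl c br
  proof (induction "length bl" arbitrary: bl c br)
    case 0
    obtain rsL x rsR ss cs where *: "length rsL = length bl" "length ss = length bl" "length rsR = length br"
      "length cs = length br" "digits rsL" "digits rsR" "shifted 0 rsL ss = bl" "shifted 0 rsR cs = br"
      "c = x + P * (endst 0 ss - endst 0 cs)" using digits_normalise[of bl br c] by blast
    have "canonical rsL x rsR" using 0 *(1,5,6) by (simp add: canonical_def)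
    moreover have "hw bl c br \<sim> hw rsL x rsR"
      using hw_shift[of rsL ss rsR cs x] *(1-4) unfolding *(7,8) *(9)[symmetric] by simp
    ultimately show ?case by blast
  next
    case (Suc n)
    obtain rsL x rsR ss cs where *: "length rsL = length bl" "length ss = length bl" "length rsR = length br"
      "length cs = length br" "digits rsL" "digits rsR" "shifted 0 rsL ss = bl" "shifted 0 rsR cs = br"
      "c = x + P * (endst 0 ss - endst 0 cs)" using digits_normalise[of bl br c] by blast
    have eq: "hw bl c br \<sim> hw rsL x rsR"
      using hw_shift[of rsL ss rsR cs x] *(1-4) unfolding *(7,8) *(9)[symmetric] by simp
    show ?case
    proof (cases "canonical rsL x rsR")
      case False
      with *(5,6) have "rsL \<noteq> []" "rsR \<noteq> []" "P dvd x" by (auto simp: canonical_def)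
      then obtain l b r b' k where d: "rsL = l @ [b]" "rsR = r @ [b']" "x = P * k"
        by (metis dvdE neq_Nil_conv_snoc)
      then have "n = length l" using Suc(2) *(1) by simp
      from Suc(1)[OF this] obtain rsL' x' rsR' where
        "canonical rsL' x' rsR'" "hw l (b + Q * k - b') r \<sim> hw rsL' x' rsR'" by blast
      with eq[unfolded d] hw_reduce[of l b k r b'] show ?thesis by (meson bs_trans)
    qed (use eq in blast)
  qed
  moreover obtain bl c br where "w \<sim> hw bl c br" using assms hill_iff_hw by blast
  ultimately show ?thesis using that by (meson bs_trans)
qed

section \<open>Recovering the digits of a hill from its HNN normal form\<close>

text \<open>The normal form of a hill consists of digits modulo \<open>q\<close> on the left, but digits modulo \<open>p\<close> on
  the right, with the carries pushed away from the peak. \<open>unroll\<close> sends them back to the peak.\<close>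

fun unroll :: "conf \<Rightarrow> int list \<times> conf" where
  "unroll ((s, Down) # st, x) =
     (let (rs, c) = unroll (st, s - P * ((- x) div Q)) in ((- x) mod Q # rs, c))"
| "unroll (st, x) = ([], (st, x))"

definition ups :: "int list \<Rightarrow> (int \<times> stab) list" where
  "ups us = rev (map (\<lambda>r. (r, Up)) us)"

lemma unroll_ups [simp]: "unroll (ups us, x) = ([], (ups us, x))"
  by (cases us rule: rev_cases) (auto simp: ups_def)

lemma run_left: "digits rs \<Longrightarrow> run (left_word apow rs) (ups us, 0) = (ups (us @ rs), 0)"
proof (induction rs arbitrary: us)
  case (Cons r rs)
  have "\<not> pops Up (ups us, r)" by (cases us rule: rev_cases) (auto simp: ups_def)
  then have "run (apow r @ [Lt]) (ups us, 0) = (ups (us @ [r]), 0)"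
    using Cons.prems by (simp add: stab_step_def ups_def)
  then show ?case using Cons by simp
qed simp

text \<open>Behind a \<open>T\<close> the normal form holds the integer
  \<open>q (y div p) - b\<close>. Since \<open>0 <= b < q\<close>, it determines both the digit
  \<open>b\<close> and the quotient, and together with the stored residue \<open>y mod p\<close>
  also \<open>y\<close>. So \<open>unroll\<close> inverts the descent.\<close>

lemma run_right:
  "digits rs \<Longrightarrow> us = [] \<or> rs = [] \<or> \<not> P dvd x \<Longrightarrow>
   \<exists>ds y. run (right_word apow rs) (ups us, x) = (map (\<lambda>d. (d, Down)) ds @ ups us, y) \<and> length ds = length rs \<and>
     unroll (map (\<lambda>d. (d, Down)) ds @ ups us, y) = (rs, (ups us, x))"
proof (induction rs)
  case (Cons b rs)
  then obtain ds y where r: "run (right_word apow rs) (ups us, x) = (map (\<lambda>d. (d, Down)) ds @ ups us, y)"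
    and len: "length ds = length rs"
    and u: "unroll (map (\<lambda>d. (d, Down)) ds @ ups us, y) = (rs, (ups us, x))" by auto
  let ?c = "(map (\<lambda>d. (d, Down)) ds @ ups us, y)"
  have np: "\<not> pops Down ?c"
  proof (cases ds)
    case Nil
    with len r have "y = x" by simp
    then show ?thesis using Nil len Cons.prems by (cases us rule: rev_cases) (auto simp: ups_def)
  qed simp
  let ?st = "(y mod P, Down) # map (\<lambda>d. (d, Down)) ds @ ups us"
  have "run (right_word apow (b # rs)) (ups us, x) = (?st, Q * (y div P) - b)"
    using np by (simp add: r stab_step_def)
  moreover have "b - Q * (y div P) = b + Q * (- (y div P))" by simp
  then have "(b - Q * (y div P)) mod Q = b" "(b - Q * (y div P)) div Q = - (y div P)"
    using mod_eq_self[of b Q "- (y div P)"] div_eq_self[of b Q "- (y div P)"] Cons.prems by auto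
  ultimately show ?case using len u
    by (intro exI[of _ "y mod P # ds"] exI[of _ "Q * (y div P) - b"]) simp
qed auto

lemma nf_canonical:
  assumes "canonical rsL x rsR"
  shows "unroll (nf (hw rsL x rsR)) = (rsR, (ups rsL, x))"
    and "map snd (fst (nf (hw rsL x rsR))) = replicate (length rsR) Down @ replicate (length rsL) Up"
    and "\<exists>ds. length ds = length rsR \<and> fst (nf (hw rsL x rsR)) = map (\<lambda>d. (d, Down)) ds @ ups rsL"
proof -
  have "nf (hw rsL x rsR) = run (right_word apow rsR) (ups rsL, x)"
    using run_left[of rsL "[]"] assms by (simp add: nf_def hill_word_def canonical_def ups_def)
  with assms run_right[of rsR rsL x] obtain ds y where
    nf: "nf (hw rsL x rsR) = (map (\<lambda>d. (d, Down)) ds @ ups rsL, y)" and len: "length ds = length rsR"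
    and un: "unroll (nf (hw rsL x rsR)) = (rsR, (ups rsL, x))" by (auto simp: canonical_def)
  show "unroll (nf (hw rsL x rsR)) = (rsR, (ups rsL, x))" by (rule un)
  show "\<exists>ds. length ds = length rsR \<and> fst (nf (hw rsL x rsR)) = map (\<lambda>d. (d, Down)) ds @ ups rsL"
    using nf len by auto
  have "map (\<lambda>x. Down) ds = replicate (length ds) Down" by (induction ds) auto
  moreover have "map (\<lambda>x. Up) (rev rsL) = replicate (length rsL) Up" by (induction rsL) (auto simp: replicate_append_same)
  ultimately show "map snd (fst (nf (hw rsL x rsR))) = replicate (length rsR) Down @ replicate (length rsL) Up"
    using nf len by (simp add: ups_def rev_map[symmetric] comp_def)
qed

lemma ups_inject: "ups us = ups vs \<longleftrightarrow> us = vs"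
  by (auto simp: ups_def inj_on_def dest!: map_inj_on)

lemma stabs_hw [simp]: "stabs (hw bl c br) = length bl + length br"
proof -
  have "stabs (left_word apow bl) = length bl" by (induction bl) auto
  moreover have "stabs (right_word apow br) = length br" by (induction br) auto
  ultimately show ?thesis by (simp add: hill_word_def)
qed

text \<open>Division with remainder turns the given hill into one with digits below
  \<open>q\<close>; this is canonical and has the same normal form, so \<open>unroll\<close>
  identifies it with the given canonical hill. The carries of the division are the
  witnesses.\<close>

lemma hw_unique:
  assumes can: "canonical rsL x rsR" and eq: "hw bl c br \<sim> hw rsL x rsR"
    and len: "length bl = length rsL" "length br = length rsR"
  shows "\<exists>ss cs. length ss = length rsL \<and> length cs = length rsR \<and> bl = shifted 0 rsL ss \<and> br = shifted 0 rsR cs \<and>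
    c = x + P * (endst 0 ss - endst 0 cs)"
proof -
  obtain rs1 y rs2 ss cs where *: "length rs1 = length bl" "length ss = length bl" "length rs2 = length br"
      "length cs = length br" "digits rs1" "digits rs2" "shifted 0 rs1 ss = bl" "shifted 0 rs2 cs = br"
      "c = y + P * (endst 0 ss - endst 0 cs)" using digits_normalise[of bl br c] by blast
  have eq1: "hw bl c br \<sim> hw rs1 y rs2"
    using hw_shift[of rs1 ss rs2 cs y] *(1-4) unfolding *(7,8) *(9)[symmetric] by simp
  with eq have nf: "nf (hw rs1 y rs2) = nf (hw rsL x rsR)" by (metis nf_eq_iff)
  \<comment> \<open>Otherwise cancelling at the peak would give a word with fewer stable letters
    than its normal form has.\<close>
  have "canonical rs1 y rs2"
  proof (rule ccontr)
    assume "\<not> canonical rs1 y rs2"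
    with *(5,6) have "rs1 \<noteq> []" "rs2 \<noteq> []" "P dvd y" by (auto simp: canonical_def)
    then obtain l b r b' k where d: "rs1 = l @ [b]" "rs2 = r @ [b']" "y = P * k"
      by (metis dvdE neq_Nil_conv_snoc)
    then have "nf (hw l (b + Q * k - b') r) = nf (hw rsL x rsR)"
      using nf equ_nf[OF hw_reduce[of l b k r b']] by simp
    moreover have "length (fst (nf (hw rsL x rsR))) = length rsL + length rsR"
      using arg_cong[OF nf_canonical(2)[OF can], of length] by simp
    moreover have "length l + length r < length rsL + length rsR" using d *(1,3) len by simp
    ultimately show False using length_nf_le[of "hw l (b + Q * k - b') r"] by simp
  qed
  from nf_canonical(1)[OF this] nf_canonical(1)[OF can] have "(rs2, ups rs1, y) = (rsR, ups rsL, x)"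
    unfolding nf by (rule trans[OF sym])
  then have rs: "rs1 = rsL" "rs2 = rsR" "y = x"
    by (simp_all add: ups_inject)
  note eqs = *(7,8)[symmetric, unfolded rs] *(9)[unfolded rs]
  have "length ss = length rsL" "length cs = length rsR" using *(2,4) len by (auto intro: trans)
  with eqs show ?thesis by (intro exI conjI)
qed

section \<open>Geodesic hills as minimal sequences of carries\<close>

definition hnorm :: "int list \<Rightarrow> int \<Rightarrow> int list \<Rightarrow> nat" where
  "hnorm bl c br = length bl + length br + (sum_list (map g bl) + g c + sum_list (map g br))"

lemma alt_norm_mkalt: "alt_norm p q (mkalt bl c br) = hnorm bl c br"
proof -
  have 1: "g (hd (bl @ [c])) + sum_list (map g (tl (bl @ [c]))) = sum_list (map g bl) + g c"
    by (cases bl) auto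
  have 2: "sum_list (map g (rev (map uminus br))) = sum_list (map g br)"
    by (simp add: rev_map[symmetric] comp_def sum_list_rev)
  have 3: "(\<Sum>(\<theta>, \<alpha>)\<leftarrow>map (Pair \<theta>') xs. g \<alpha>) = sum_list (map g xs)" for xs and \<theta>' :: stab
    by (simp add: comp_def)
  show ?thesis
    unfolding alt_norm_def mkalt_def hnorm_def inorm_g fst_conv snd_conv map_append sum_list_append
    using 1 by (simp only: 2 3) simp
qed

lemma hill_word_L: "hill_word L bl c br \<sim> hw bl c br" "length (hill_word L bl c br) = hnorm bl c br"
proof -
  have "left_word L bl \<sim> left_word apow bl"
    using L_equ by (induction bl) (auto intro!: equ_append equ_Cons)
  moreover have "right_word L br \<sim> right_word apow br"
    using L_equ by (induction br) (auto intro!: equ_append equ_Cons)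
  ultimately show "hill_word L bl c br \<sim> hw bl c br"
    unfolding hill_word_def by (intro equ_append L_equ)
  have "length (left_word L bl) = length bl + sum_list (map g bl)" by (induction bl) (auto simp: length_L)
  moreover have "length (right_word L br) = length br + sum_list (map g br)" by (induction br) (auto simp: length_L)
  ultimately show "length (hill_word L bl c br) = hnorm bl c br"
    by (simp add: hill_word_def hnorm_def length_L)
qed

lemma conf_hill:
  "map snd st = replicate m Down @ replicate l Up \<Longrightarrow>
   \<exists>bl c br. length bl = l \<and> length br = m \<and> conf_word (st, x) = hw bl c br \<and> conf_norm (st, x) = hnorm bl c br"
proof (induction m arbitrary: st x)
  case 0
  then have "map snd st = replicate l Up" by simp
  then show ?case
  proof (induction l arbitrary: st x)
    case 0
    then show ?case by (intro exI[of _ "[]"] exI[of _ x]) (simp add: hill_word_def hnorm_def)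
  next
    case (Suc l)
    then obtain a st' where st: "st = (a, Up) # st'" "map snd st' = replicate l Up" by (cases st) auto
    from Suc(1)[OF st(2), of a] obtain bl c br where "length bl = l" "br = []"
      "conf_word (st', a) = hw bl c br" "conf_norm (st', a) = hnorm bl c br" by auto
    then show ?case
      by (intro exI[of _ "bl @ [c]"] exI[of _ x] exI[of _ "[]"]) (simp add: st hill_word_def hnorm_def)
  qed
next
  case (Suc m)
  then obtain a st' where st: "st = (a, Down) # st'" "map snd st' = replicate m Down @ replicate l Up"
    by (cases st) auto
  from Suc(1)[OF st(2), of a] obtain bl c br where *: "length bl = l" "length br = m"
    "conf_word (st', a) = hw bl c br" "conf_norm (st', a) = hnorm bl c br" by auto
  then show ?case
    by (intro exI[of _ bl] exI[of _ c] exI[of _ "- x # br"]) (simp add: st hill_word_def hnorm_def)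
qed

text \<open>The parameter \<open>f\<close> is \<open>g\<close> for the true norm and
  \<open>ac\<close> for the simpler cost that the shortest path computation uses. The integer at the
  peak is measured by \<open>g\<close> in both cases.\<close>

definition hcost :: "(int \<Rightarrow> nat) \<Rightarrow> int list \<Rightarrow> int \<Rightarrow> int list \<Rightarrow> int list \<Rightarrow> int list \<Rightarrow> nat" where
  "hcost f rsL x rsR ss cs = sum_list (map f (shifted 0 rsL ss)) + g (x + P * (endst 0 ss - endst 0 cs)) +
     sum_list (map f (shifted 0 rsR cs))"

abbreviation hill_alt :: "int list \<Rightarrow> int \<Rightarrow> int list \<Rightarrow> int list \<Rightarrow> int list \<Rightarrow> alt" where
  "hill_alt rsL x rsR ss cs \<equiv> mkalt (shifted 0 rsL ss) (x + P * (endst 0 ss - endst 0 cs)) (shifted 0 rsR cs)"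

lemma geolen_le: "v \<sim> w \<Longrightarrow> geolen p q w \<le> length v"
  unfolding geolen_def by (rule Least_le) auto

lemma geolen_word: "\<exists>v. v \<sim> w \<and> length v = geolen p q w"
  unfolding geolen_def by (rule LeastI_ex) (use bs_refl in blast)

text \<open>Turns the group-theoretic condition into a minimisation over carries. Every choice of
  carries is realised by a word of the corresponding length, and the Britton reduction of a geodesic
  is a hill with the same numbers of letters on both sides, so \<open>hw_unique\<close> describes it
  by carries.\<close>

lemma geo_reduced_iff:
  assumes can: "canonical rsL x rsR" and w: "w \<sim> hw rsL x rsR"
  shows "geo_reduced p q w u \<longleftrightarrow> (\<exists>ss cs. length ss = length rsL \<and> length cs = length rsR \<and>
    u = hill_alt rsL x rsR ss cs \<and> (\<forall>ss' cs'. length ss' = length rsL \<longrightarrow> length cs' = length rsR \<longrightarrow>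
      hcost g rsL x rsR ss cs \<le> hcost g rsL x rsR ss' cs'))" (is "_ \<longleftrightarrow> ?R")
proof -
  let ?h = "hcost g rsL x rsR" and ?n = "length rsL + length rsR"
  have nfw: "nf w = nf (hw rsL x rsR)" using w by (rule equ_nf)
  have wn: "hnorm (shifted 0 rsL ss) (x + P * (endst 0 ss - endst 0 cs)) (shifted 0 rsR cs) = ?n + ?h ss cs"
    if "length ss = length rsL" "length cs = length rsR" for ss cs
    using that by (simp add: hnorm_def hcost_def)
  have upper: "geolen p q w \<le> ?n + ?h ss cs"
    if "length ss = length rsL" "length cs = length rsR" for ss cs
  proof -
    let ?a = "shifted 0 rsL ss" and ?c = "x + P * (endst 0 ss - endst 0 cs)" and ?b = "shifted 0 rsR cs"
    have "hill_word L ?a ?c ?b \<sim> w"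
      by (rule bs_trans[OF hill_word_L(1) bs_trans[OF hw_shift[OF that[symmetric]] bs_sym[OF w]]])
    from geolen_le[OF this] show ?thesis using wn[OF that] hill_word_L(2) by metis
  qed
  \<comment> \<open>The Britton reduction of a geodesic \<open>v\<close> has norm at most
    \<open>length v\<close>, and its stable letters are those of the canonical hill.\<close>
  have lower: "\<exists>ss cs. length ss = length rsL \<and> length cs = length rsR \<and> ?n + ?h ss cs \<le> geolen p q w"
  proof -
    obtain v where v: "v \<sim> w" "length v = geolen p q w" using geolen_word by blast
    have "map snd (fst (britton_conf v)) = replicate (length rsR) Down @ replicate (length rsL) Up"
      using normalise_stabs[of "britton_conf v"] equ_nf[OF v(1)] nf_canonical(2)[OF can] by (simp add: normalise_britton_conf nfw)
    with conf_hill[of "fst (britton_conf v)" _ _ "snd (britton_conf v)"] obtain bl c br where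
      len: "length bl = length rsL" "length br = length rsR" and conf_word: "conf_word (britton_conf v) = hw bl c br"
      and nrm: "conf_norm (britton_conf v) = hnorm bl c br" by (metis prod.collapse)
    have "hw bl c br \<sim> hw rsL x rsR" unfolding conf_word[symmetric]
      by (rule bs_trans[OF bs_sym[OF britton_conf_sound] bs_trans[OF v(1) w]])
    from hw_unique[OF can this len] obtain ss cs where "length ss = length rsL" "length cs = length rsR"
      "bl = shifted 0 rsL ss" "br = shifted 0 rsR cs" "c = x + P * (endst 0 ss - endst 0 cs)" by blast
    with wn nrm conf_norm_britton_conf[of v] v show ?thesis by metis
  qed
  show ?thesis
  proof
    assume opt_path: "geo_reduced p q w u"
    obtain a us where u: "u = (a, us)" by (cases u)
    from opt_path have red: "britton_reduced p q (alt_word u)" and eq: "w \<sim> alt_word u"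
      and gl: "geolen p q w = alt_norm p q u" by (auto simp: geo_reduced_def)
    have "rev (map fst us) = replicate (length rsR) Down @ replicate (length rsL) Up"
      using britton_stabs(1)[OF red[unfolded u]] nf_canonical(2)[OF can] equ_nf[OF eq] by (simp add: nfw u)
    then have "map fst us = replicate (length rsL) Up @ replicate (length rsR) Down"
      by (metis rev_append rev_replicate rev_rev_ident)
    from mkalt_cover[OF this, of a] obtain bl c br where mk: "u = mkalt bl c br"
      and len: "length bl = length rsL" "length br = length rsR" by (auto simp: u)
    have "hw bl c br \<sim> hw rsL x rsR"
      using bs_trans[OF bs_sym[OF eq] w] unfolding mk alt_word_mkalt .
    from hw_unique[OF can this len] obtain ss cs where *: "length ss = length rsL" "length cs = length rsR"
      "bl = shifted 0 rsL ss" "br = shifted 0 rsR cs" "c = x + P * (endst 0 ss - endst 0 cs)" by blast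
    have "?n + ?h ss cs = geolen p q w"
      using wn[OF *(1,2)] gl unfolding mk alt_norm_mkalt *(3-5) by simp
    with upper have "\<forall>ss' cs'. length ss' = length rsL \<longrightarrow> length cs' = length rsR \<longrightarrow> ?h ss cs \<le> ?h ss' cs'"
      by (metis add_le_cancel_left)
    moreover have "u = hill_alt rsL x rsR ss cs" using mk unfolding *(3-5) .
    ultimately show ?R using *(1,2) by (intro exI[of _ ss] exI[of _ cs] conjI)
  next
    assume ?R
    then obtain ss cs where len: "length ss = length rsL" "length cs = length rsR"
      and u: "u = hill_alt rsL x rsR ss cs"
      and min: "\<forall>ss' cs'. length ss' = length rsL \<longrightarrow> length cs' = length rsR \<longrightarrow> ?h ss cs \<le> ?h ss' cs'"
      by (elim exE conjE) (rule that)
    have eq: "w \<sim> alt_word u" unfolding u alt_word_mkalt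
      by (rule bs_trans[OF w bs_sym[OF hw_shift[OF len[symmetric]]]])
    have "stabs (alt_word u) = ?n" unfolding u alt_word_mkalt using len by simp
    moreover have "length (fst (nf (hw rsL x rsR))) = ?n"
      using arg_cong[OF nf_canonical(2)[OF can], of length] by simp
    ultimately have "length (fst (nf (alt_word u))) = stabs (alt_word u)"
      unfolding equ_nf[OF eq, symmetric] nfw by simp
    then have "britton_reduced p q (alt_word u)" by (rule britton_reducedI)
    moreover have "geolen p q w = alt_norm p q u"
    proof -
      from lower obtain ss' cs' where "length ss' = length rsL" "length cs' = length rsR"
        and le: "?n + ?h ss' cs' \<le> geolen p q w" by blast
      with min have "?h ss cs \<le> ?h ss' cs'" by blast
      with le upper[OF len] show ?thesis unfolding u alt_norm_mkalt wn[OF len] by linarith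
    qed
    ultimately show "geo_reduced p q w u" using eq by (simp add: geo_reduced_def)
  qed
qed

end

abbreviation ac :: "int \<Rightarrow> nat" where "ac b \<equiv> nat \<bar>b\<bar>"

abbreviation window :: "int \<Rightarrow> int list \<Rightarrow> bool" where
  "window k ss \<equiv> set ss \<subseteq> {-k..k}"

context BS
begin

subsection \<open>Digits of geodesic hills\<close>

text \<open>A digit whose geodesics are all straight. For such digits the cost is the absolute
  value, and the length-lexicographical normal form is a power of \<open>a\<close>.\<close>

definition plain :: "int \<Rightarrow> bool" where
  "plain b \<longleftrightarrow> \<bar>b\<bar> < Q \<and> g b = nat \<bar>b\<bar> \<and> (\<forall>e k. b = e + Q * k \<longrightarrow> g b \<noteq> nat \<bar>e\<bar> + 2 + g (P * k))"

text \<open>If some geodesic of \<open>b\<close> has a loop, its content can cross the stable letter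
  that the hill has there anyway, which saves the two letters of the loop. Otherwise
  \<open>|b|\<close> is at least \<open>q\<close>, and one unit of carry saves \<open>q\<close>
  letters while it costs at most \<open>p\<close>.\<close>

lemma not_plain_improve:
  assumes "\<not> plain b"
  shows "\<exists>d. g (b + Q * d) + g (P * d) < g b"
proof (cases "\<exists>e k. b = e + Q * k \<and> g b = nat \<bar>e\<bar> + 2 + g (P * k)")
  case True
  then obtain e k where b: "b = e + Q * k" "g b = nat \<bar>e\<bar> + 2 + g (P * k)" by blast
  then show ?thesis using g_abs[of e] g_neg[of "P * k"] by (intro exI[of _ "- k"]) simp
next
  case False
  then have gb: "g b = nat \<bar>b\<bar>" using g_cases by blast
  have b: "Q \<le> \<bar>b\<bar>"
  proof (rule ccontr)
    assume "\<not> Q \<le> \<bar>b\<bar>"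
    with gb False have "plain b" unfolding plain_def not_le by blast
    with assms show False by simp
  qed
  have "g (P * s) < q" if "s = 1 \<or> s = -1" for s
    using that g_abs[of P] g_neg[of P] p_less_q by auto
  moreover have "g (b - Q) + q \<le> g b" if "0 \<le> b" using g_abs[of "b - Q"] b that gb by auto
  moreover have "g (b + Q) + q \<le> g b" if "b < 0" using g_abs[of "b + Q"] b that gb by auto
  ultimately have "\<exists>s. g (b + Q * s) + g (P * s) < g b"
    by (cases "0 \<le> b") (intro exI[of _ "-1"], force, intro exI[of _ 1], force)
  then show ?thesis .
qed

lemma tail_lipschitz:
  assumes "\<And>t d. W (t + d) \<le> W t + g (P * d)" and "length rs = length ts"
  shows "sum_list (map g (shifted (t + d) rs ts)) + W (endst (t + d) ts) \<le>
    sum_list (map g (shifted t rs ts)) + W (endst t ts) + g (P * d)"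
proof (cases ts)
  case (Cons t2 ts')
  with assms obtain r rs' where rs: "rs = r # rs'" by (cases rs) auto
  have "g (shift_digit r (t + d) t2) \<le> g (shift_digit r t t2) + g (P * d)"
    using g_add[of "shift_digit r t t2" "P * d"] by (simp add: shift_digit_def algebra_simps)
  then show ?thesis by (simp add: Cons rs)
qed (use assms in auto)

text \<open>An exchange argument: changing a single carry by \<open>- d\<close> affects only the
  digits on both sides of it, or the last digit and the weight \<open>W\<close> of all that lies
  beyond. So the gain of \<open>not_plain_improve\<close> would contradict minimality.\<close>

lemma chain_plain:
  assumes W: "\<And>t d. W (t + d) \<le> W t + g (P * d)"
  shows "length rs = length ss \<Longrightarrow>
    (\<And>ss'. length ss' = length rs \<Longrightarrow> sum_list (map g (shifted s rs ss)) + W (endst s ss) \<le>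
      sum_list (map g (shifted s rs ss')) + W (endst s ss')) \<Longrightarrow> b \<in> set (shifted s rs ss) \<Longrightarrow> plain b"
proof (induction rs ss arbitrary: s rule: list_induct2)
  case (Cons r rs t ts)
  have tail: "sum_list (map g (shifted t rs ts)) + W (endst t ts) \<le> sum_list (map g (shifted t rs ts')) + W (endst t ts')"
    if "length ts' = length rs" for ts'
    using Cons.prems(1)[of "t # ts'"] that by simp
  have "plain (shift_digit r s t)"
  proof (rule ccontr)
    assume "\<not> plain (shift_digit r s t)"
    then obtain d where d: "g (shift_digit r s t + Q * d) + g (P * d) < g (shift_digit r s t)"
      using not_plain_improve by blast
    have "shift_digit r s (t + - d) = shift_digit r s t + Q * d" by (simp add: shift_digit_def algebra_simps)
    moreover have "sum_list (map g (shifted (t + - d) rs ts)) + W (endst (t + - d) ts) \<le>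
      sum_list (map g (shifted t rs ts)) + W (endst t ts) + g (P * - d)"
      by (rule tail_lipschitz[OF W Cons.hyps])
    ultimately show False using d Cons.prems(1)[of "(t + - d) # ts"] Cons.hyps g_neg[of "P * d"]
      by (simp split: if_splits)
  qed
  then show ?case using Cons.prems(2) Cons.IH[OF tail] by auto
qed simp

text \<open>Old and new digit together contribute less than \<open>2 q\<close>. With
  \<open>p <= q - 1\<close>, a carry \<open>s\<close> in a window of radius \<open>k >= K\<close>
  leads to \<open>q |t| < 2 q + (q - 1) k <= q k\<close>, so the window is never left.\<close>

definition K :: int where "K = 2 * Q"

lemma window_step:
  assumes "0 \<le> r" "r < Q" "\<bar>s\<bar> \<le> k" "\<bar>shift_digit r s t\<bar> < Q" "K \<le> k"
  shows "\<bar>t\<bar> \<le> k"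
proof -
  have "P * \<bar>s\<bar> \<le> (Q - 1) * k" using assms p_less_q q_pos by (intro mult_mono) (auto simp: K_def)
  moreover have "Q * \<bar>t\<bar> \<le> \<bar>shift_digit r s t\<bar> + \<bar>r\<bar> + P * \<bar>s\<bar>"
    unfolding shift_digit_def using abs_triangle_ineq4[of "r + P * s" "r + P * s - Q * t"] abs_triangle_ineq[of r "P * s"]
    by (simp add: abs_mult)
  ultimately have "Q * \<bar>t\<bar> < Q * (k + 1)" using assms by (simp add: K_def algebra_simps)
  then show ?thesis using q_pos by simp
qed

lemma window_digits:
  "length rs = length ss \<Longrightarrow> digits rs \<Longrightarrow> \<forall>b\<in>set (shifted s rs ss). \<bar>b\<bar> < Q \<Longrightarrow> \<bar>s\<bar> \<le> k \<Longrightarrow> K \<le> k \<Longrightarrow> window k ss"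
proof (induction rs ss arbitrary: s rule: list_induct2)
  case (Cons r rs t ts)
  then have "\<bar>t\<bar> \<le> k" using window_step[of r s k t] by auto
  with Cons show ?case by auto
qed simp

lemma hcost_le: "hcost g rsL x rsR ss cs \<le> hcost ac rsL x rsR ss cs"
  unfolding hcost_def using g_abs by (intro add_mono sum_list_mono order_refl)

lemma hcost_min_plain:
  assumes len: "length ss = length rsL" "length cs = length rsR"
    and min: "\<And>ss' cs'. length ss' = length rsL \<Longrightarrow> length cs' = length rsR \<Longrightarrow>
      hcost g rsL x rsR ss cs \<le> hcost g rsL x rsR ss' cs'"
  shows "\<forall>b\<in>set (shifted 0 rsL ss) \<union> set (shifted 0 rsR cs). plain b"
proof -
  have "plain b" if "b \<in> set (shifted 0 rsL ss)" for b
  proof (rule chain_plain[OF _ len(1)[symmetric] _ that])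
    show "g (x + P * (t + d - endst 0 cs)) \<le> g (x + P * (t - endst 0 cs)) + g (P * d)" for t d
      using g_add[of "x + P * (t - endst 0 cs)" "P * d"] by (simp add: algebra_simps)
    show "sum_list (map g (shifted 0 rsL ss)) + g (x + P * (endst 0 ss - endst 0 cs)) \<le>
      sum_list (map g (shifted 0 rsL ss')) + g (x + P * (endst 0 ss' - endst 0 cs))" if "length ss' = length rsL" for ss'
      using min[OF that len(2)] unfolding hcost_def by linarith
  qed
  moreover have "plain b" if "b \<in> set (shifted 0 rsR cs)" for b
  proof (rule chain_plain[OF _ len(2)[symmetric] _ that])
    show "g (x + P * (endst 0 ss - (t + d))) \<le> g (x + P * (endst 0 ss - t)) + g (P * d)" for t d
      using g_add[of "x + P * (endst 0 ss - t)" "- (P * d)"] by (simp add: algebra_simps)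
    show "sum_list (map g (shifted 0 rsR cs)) + g (x + P * (endst 0 ss - endst 0 cs)) \<le>
      sum_list (map g (shifted 0 rsR cs')) + g (x + P * (endst 0 ss - endst 0 cs'))" if "length cs' = length rsR" for cs'
      using min[OF len(1) that] unfolding hcost_def by linarith
  qed
  ultimately show ?thesis by blast
qed

definition hill_min :: "int list \<Rightarrow> int \<Rightarrow> int list \<Rightarrow> int list \<Rightarrow> int list \<Rightarrow> bool" where
  "hill_min rsL x rsR ss cs \<longleftrightarrow> length ss = length rsL \<and> length cs = length rsR \<and> window K ss \<and> window K cs \<and>
     (\<forall>ss' cs'. length ss' = length rsL \<longrightarrow> length cs' = length rsR \<longrightarrow> window K ss' \<longrightarrow> window K cs' \<longrightarrow>
        hcost ac rsL x rsR ss cs \<le> hcost ac rsL x rsR ss' cs')"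

text \<open>Replacing \<open>g\<close> by the absolute value can only increase the cost and is exact
  on plain digits. As true minimisers have only plain digits and carries in the window, both
  problems have the same minimisers.\<close>

lemma hill_min_iff:
  assumes shifted: "digits rsL" "digits rsR"
  shows "hill_min rsL x rsR ss cs \<longleftrightarrow> length ss = length rsL \<and> length cs = length rsR \<and>
     (\<forall>ss' cs'. length ss' = length rsL \<longrightarrow> length cs' = length rsR \<longrightarrow>
        hcost g rsL x rsR ss cs \<le> hcost g rsL x rsR ss' cs')"
    (is "_ \<longleftrightarrow> ?M ss cs")
proof -
  have main: "window K ss' \<and> window K cs' \<and> hcost ac rsL x rsR ss' cs' = hcost g rsL x rsR ss' cs'"
    if M: "?M ss' cs'" for ss' cs'
  proof -
    have pl: "\<forall>b\<in>set (shifted 0 rsL ss') \<union> set (shifted 0 rsR cs'). plain b"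
      using hcost_min_plain[of ss' rsL cs' rsR x] M by blast
    have "window K ss'" using window_digits[of rsL ss' 0 K] M pl shifted by (auto simp: plain_def K_def)
    moreover have "window K cs'" using window_digits[of rsR cs' 0 K] M pl shifted by (auto simp: plain_def K_def)
    moreover have "map ac (shifted 0 rsL ss') = map g (shifted 0 rsL ss')" "map ac (shifted 0 rsR cs') = map g (shifted 0 rsR cs')"
      using pl unfolding plain_def by (auto simp del: imp_conjL)
    ultimately show ?thesis unfolding hcost_def by metis
  qed
  show ?thesis
  proof
    assume M: "?M ss cs"
    show "hill_min rsL x rsR ss cs"
      unfolding hill_min_def
    proof (intro conjI allI impI)
      fix ss' cs' :: "int list" assume "length ss' = length rsL" "length cs' = length rsR"
      with M have "hcost g rsL x rsR ss cs \<le> hcost g rsL x rsR ss' cs'" by blast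
      with main[OF M] show "hcost ac rsL x rsR ss cs \<le> hcost ac rsL x rsR ss' cs'"
        using hcost_le[of rsL x rsR ss' cs'] by linarith
    qed (use M main[OF M] in blast)+
  next
    assume hm: "hill_min rsL x rsR ss cs"
    have "\<exists>z. fst z \<in> {ss. length ss = length rsL} \<and> snd z \<in> {cs. length cs = length rsR} \<and>
      (\<forall>z'. fst z' \<in> {ss. length ss = length rsL} \<and> snd z' \<in> {cs. length cs = length rsR} \<longrightarrow>
        hcost g rsL x rsR (fst z) (snd z) \<le> hcost g rsL x rsR (fst z') (snd z'))"
      using ex_has_least_nat[of "\<lambda>z. fst z \<in> {ss. length ss = length rsL} \<and> snd z \<in> {cs. length cs = length rsR}"
        "(rsL, rsR)" "\<lambda>z. hcost g rsL x rsR (fst z) (snd z)"] by auto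
    then obtain ss0 cs0 where M: "?M ss0 cs0" by auto
    from hm M main[OF M] have "hcost ac rsL x rsR ss cs \<le> hcost ac rsL x rsR ss0 cs0"
      unfolding hill_min_def by blast
    with main[OF M] have "hcost ac rsL x rsR ss cs \<le> hcost g rsL x rsR ss0 cs0" by simp
    with hcost_le[of rsL x rsR ss cs] have *: "hcost g rsL x rsR ss cs \<le> hcost g rsL x rsR ss0 cs0" by simp
    show "?M ss cs"
    proof (intro conjI allI impI)
      fix ss' cs' :: "int list" assume "length ss' = length rsL" "length cs' = length rsR"
      with M have "hcost g rsL x rsR ss0 cs0 \<le> hcost g rsL x rsR ss' cs'" by blast
      with * show "hcost g rsL x rsR ss cs \<le> hcost g rsL x rsR ss' cs'" by linarith
    qed (use hm in \<open>auto simp: hill_min_def\<close>)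
  qed
qed

lemma hill_min_L:
  assumes "digits rsL" "digits rsR" "hill_min rsL x rsR ss cs" "b \<in> set (shifted 0 rsL ss) \<union> set (shifted 0 rsR cs)"
  shows "L b = apow b" "L (- b) = apow (- b)"
proof -
  have "plain b" using assms hcost_min_plain[of ss rsL cs rsR x] unfolding hill_min_iff[OF assms(1,2)] by blast
  then have *: "\<And>e k. b = e + Q * k \<Longrightarrow> g b \<noteq> nat \<bar>e\<bar> + 2 + g (P * k)" unfolding plain_def by blast
  then show "L b = apow b" by (rule L_straight)
  have "g (- b) \<noteq> nat \<bar>e\<bar> + 2 + g (P * k)" if "- b = e + Q * k" for e k
  proof -
    have "b = - e + Q * - k" using that by simp
    from *[OF this] show ?thesis using g_neg[of "P * k"] g_neg[of b] by (simp del: g_neg)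
  qed
  then show "L (- b) = apow (- b)" by (rule L_straight)
qed

end

subsection \<open>The peak normal form of a hill\<close>

text \<open>Numbers the integers in the order 0, 1, -1, 2, -2 and so on, so that one lemma on
  tie-breaking serves both this order and that of the exponents in a length-lexicographical normal
  form.\<close>

definition delta_rank :: "int \<Rightarrow> nat" where
  "delta_rank d = 2 * nat \<bar>d\<bar> + (if d < 0 then 1 else 0)"

abbreviation rank_less :: "(int \<Rightarrow> nat) \<Rightarrow> (int \<times> int) set" where
  "rank_less rk \<equiv> {(a, b). rk a < rk b}"

lemma delta_lt_Num: "delta_lt (Num a) (Num b) \<longleftrightarrow> delta_rank a < delta_rank b"
  by (auto simp: delta_rank_def)

definition dside :: "int list \<Rightarrow> delta list" where
  "dside bs = concat (map (\<lambda>b. [Num b, St Up]) bs)"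

lemma dside_simps [simp]: "dside [] = []" "dside (b # bs) = Num b # St Up # dside bs"
  "dside (bs @ cs) = dside bs @ dside cs"
  by (simp_all add: dside_def)

lemma length_dside [simp]: "length (dside bs) = 2 * length bs"
  by (induction bs) auto

lemma dside_inject: "dside bs = dside cs \<longleftrightarrow> bs = cs"
proof (induction bs arbitrary: cs)
  case Nil
  then show ?case by (cases cs) auto
next
  case (Cons b bs)
  then show ?case by (cases cs) auto
qed

lemma delta_le_dside: "lex_diff (rank_less delta_rank) bs cs \<Longrightarrow> length bs = length cs \<Longrightarrow> delta_le (dside bs) (dside cs)"
proof -
  assume "lex_diff (rank_less delta_rank) bs cs" and len: "length bs = length cs"
  then obtain c a b x y where *: "bs = c @ a # x" "cs = c @ b # y" "delta_rank a < delta_rank b" by (auto simp: lex_diff_def)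
  then have "lex_diff {(x, y). delta_lt x y} (dside bs) (dside cs)"
    using lex_diff_append[OF lex_diff_Cons[of "Num a" "Num b" "{(x, y). delta_lt x y}" "St Up # dside x" "St Up # dside y"],
      of "dside c" "[]" "[]"] unfolding mem_Collect_eq case_prod_conv delta_lt_Num by simp
  then show ?thesis using len by (simp add: delta_le_def lenlex_iff_lex_diff)
qed

lemma delta_le_antisym:
  assumes "delta_le u v" "delta_le v u"
  shows "u = v"
proof -
  have "asym {(x, y). delta_lt x y}"
  proof (rule asymI)
    fix a b assume "(a, b) \<in> {(x, y). delta_lt x y}"
    then show "(b, a) \<notin> {(x, y). delta_lt x y}" by (cases a; cases b) auto
  qed
  then have "asym (lenlex {(x, y). delta_lt x y})" by (rule asym_lenlex)
  with assms show ?thesis by (auto simp: delta_le_def dest: asymD)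
qed

lemma dword_mkalt: "dword (mkalt bl c br) = dside bl @ [Num c] @ concat (map (\<lambda>b. [St Down, Num (- b)]) (rev br))"
proof -
  have "Num (hd (bl @ [c])) # concat (map (\<lambda>(\<theta>, \<alpha>). [St \<theta>, Num \<alpha>]) (map (Pair Up) (tl (bl @ [c])))) = dside bl @ [Num c]"
  proof (induction bl)
    case (Cons b bl)
    then show ?case by (cases bl) auto
  qed simp
  then show ?thesis by (simp add: dword_def mkalt_def rev_map[symmetric] comp_def)
qed

lemma peak_mkalt: "peak (mkalt bl c br) = length bl"
proof -
  let ?u = "mkalt bl c br" and ?l = "length bl" and ?m = "length br"
  have len: "length (snd ?u) = ?l + ?m" by (simp add: mkalt_def)
  have sum: "(\<Sum>(\<theta>, \<alpha>)\<leftarrow>map (Pair \<theta>') xs. case \<theta> of Up \<Rightarrow> 1 | Down \<Rightarrow> - 1) =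
      (case \<theta>' of Up \<Rightarrow> 1 | Down \<Rightarrow> - 1) * int (length xs)" for xs :: "int list" and \<theta>'
    by (cases \<theta>'; induction xs) auto
  have h: "height ?u i = int (min i ?l) - int (i - ?l)" if "i \<le> ?l + ?m" for i
    using that by (simp add: height_def mkalt_def take_map sum del: map_map)
  have "Max (height ?u ` {..?l + ?m}) = int ?l"
  proof (rule Max_eqI)
    show "int ?l \<in> height ?u ` {..?l + ?m}" using h[of ?l] by (intro image_eqI[of _ _ ?l]) auto
  qed (use h in auto)
  then show ?thesis
    unfolding peak_def len by (intro Greatest_equality) (use h in auto)
qed

lemma left_part_mkalt: "left_part (mkalt bl c br) = dside bl"
  by (simp add: left_part_def peak_mkalt dword_mkalt)

lemma right_part_mkalt: "bar (right_part (mkalt bl c br)) = dside br"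
proof -
  have "right_part (mkalt bl c br) = concat (map (\<lambda>b. [St Down, Num (- b)]) (rev br))"
    by (simp add: right_part_def peak_mkalt dword_mkalt)
  moreover have "bar (concat (map (\<lambda>b. [St Down, Num (- b)]) (rev br))) = dside br"
    by (induction br) (auto simp: bar_def)
  ultimately show ?thesis by simp
qed

lemma (in BS) shifted_inject:
  "length rs = length ss \<Longrightarrow> length rs = length ss' \<Longrightarrow> shifted s rs ss = shifted s rs ss' \<Longrightarrow> ss = ss'"
proof (induction rs ss arbitrary: s ss' rule: list_induct2)
  case (Cons r rs t ts)
  then obtain t' ts' where ss': "ss' = t' # ts'" and len: "length rs = length ts'"
    by (cases ss') auto
  from Cons.prems(2) have "shift_digit r s t = shift_digit r s t'" and "shifted t rs ts = shifted t' rs ts'" by (auto simp: ss')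
  moreover from this have "t = t'" using q_pos by (simp add: shift_digit_def)
  ultimately show ?case using Cons.IH[OF len] by (simp add: ss')
qed simp

context BS
begin

definition hill_best :: "int list \<Rightarrow> int \<Rightarrow> int list \<Rightarrow> int list \<Rightarrow> int list \<Rightarrow> bool" where
  "hill_best rsL x rsR ss cs \<longleftrightarrow> hill_min rsL x rsR ss cs \<and> (\<forall>ss' cs'. hill_min rsL x rsR ss' cs' \<longrightarrow>
     (ss' = ss \<or> lex_diff (rank_less delta_rank) (shifted 0 rsL ss) (shifted 0 rsL ss')) \<and>
     (ss' = ss \<longrightarrow> cs' = cs \<or> lex_diff (rank_less delta_rank) (shifted 0 rsR cs) (shifted 0 rsR cs')))"

text \<open>Because all minimisers have sides of equal length, the length-lexicographical orders are
  decided by the first differing digit. Carries are determined by the digits, so the optimum is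
  unique, and its digits outside the peak are plain.\<close>

lemma pnf_hill:
  assumes can: "canonical rsL x rsR" and w: "w \<sim> hw rsL x rsR" and best: "hill_best rsL x rsR ss cs"
  shows "pnf p q w = left_word apow (shifted 0 rsL ss) @ L (x + P * (endst 0 ss - endst 0 cs)) @
    right_word apow (shifted 0 rsR cs)"
proof -
  let ?u = "hill_alt rsL x rsR ss cs" and ?c = "x + P * (endst 0 ss - endst 0 cs)"
  have shifted: "digits rsL" "digits rsR" using can by (auto simp: canonical_def)
  have geo: "geo_reduced p q w v \<longleftrightarrow> (\<exists>ss cs. hill_min rsL x rsR ss cs \<and> v = hill_alt rsL x rsR ss cs)" for v
    unfolding geo_reduced_iff[OF can w] hill_min_iff[OF shifted] by blast
  have min: "hill_min rsL x rsR ss cs" using best by (simp add: hill_best_def)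
  have le: "delta_le (left_part ?u) (left_part v) \<and>
       (left_part ?u = left_part v \<longrightarrow> delta_le (bar (right_part ?u)) (bar (right_part v)))"
    if "geo_reduced p q w v" for v
  proof -
    from that geo obtain ss' cs' where m': "hill_min rsL x rsR ss' cs'" and v: "v = hill_alt rsL x rsR ss' cs'" by blast
    have len: "length ss = length rsL" "length cs = length rsR" "length ss' = length rsL" "length cs' = length rsR"
      using min m' by (auto simp: hill_min_def)
    have inj: "ss = ss'" if "shifted 0 rsL ss = shifted 0 rsL ss'" 
      by (rule shifted_inject[OF _ _ that]) (use len in simp_all)
    note b = best[unfolded hill_best_def, THEN conjunct2, rule_format, OF m']
    note b1 = b[THEN conjunct1] and b2 = b[THEN conjunct2, rule_format]
    have "delta_le (dside (shifted 0 rsL ss)) (dside (shifted 0 rsL ss'))"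
      using b1
    proof
      assume "lex_diff (rank_less delta_rank) (shifted 0 rsL ss) (shifted 0 rsL ss')"
      then show ?thesis by (rule delta_le_dside) (simp add: len)
    qed (simp add: delta_le_def)
    moreover have "delta_le (dside (shifted 0 rsR cs)) (dside (shifted 0 rsR cs'))" if "ss = ss'"
      using b2[OF that[symmetric]]
    proof
      assume "lex_diff (rank_less delta_rank) (shifted 0 rsR cs) (shifted 0 rsR cs')"
      then show ?thesis by (rule delta_le_dside) (simp add: len)
    qed (simp add: delta_le_def)
    ultimately show ?thesis
      unfolding v left_part_mkalt right_part_mkalt dside_inject using inj by blast
  qed
  have u: "britton_pnf p q w = ?u" unfolding britton_pnf_def
  proof (rule the_equality)
    show "geo_reduced p q w ?u \<and> (\<forall>v. geo_reduced p q w v \<longrightarrow> delta_le (left_part ?u) (left_part v) \<and>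
       (left_part ?u = left_part v \<longrightarrow> delta_le (bar (right_part ?u)) (bar (right_part v))))"
      using geo min le by blast
  next
    fix v assume v: "geo_reduced p q w v \<and> (\<forall>v'. geo_reduced p q w v' \<longrightarrow> delta_le (left_part v) (left_part v') \<and>
       (left_part v = left_part v' \<longrightarrow> delta_le (bar (right_part v)) (bar (right_part v'))))"
    have "geo_reduced p q w ?u" using geo min by blast
    with v le have l: "left_part v = left_part ?u" by (blast intro: delta_le_antisym)
    have "delta_le (bar (right_part v)) (bar (right_part ?u))"
      using v \<open>geo_reduced p q w ?u\<close> l by blast
    moreover have "delta_le (bar (right_part ?u)) (bar (right_part v))" using v le l[symmetric] by blast
    ultimately have r: "bar (right_part v) = bar (right_part ?u)" by (rule delta_le_antisym)
    from v geo obtain ss' cs' where m': "hill_min rsL x rsR ss' cs'" and v': "v = hill_alt rsL x rsR ss' cs'" by blast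
    from l r have d: "shifted 0 rsL ss' = shifted 0 rsL ss" "shifted 0 rsR cs' = shifted 0 rsR cs"
      unfolding v' left_part_mkalt right_part_mkalt dside_inject by simp_all
    have "ss' = ss" by (rule shifted_inject[OF _ _ d(1)]) (use min m' in \<open>simp_all add: hill_min_def\<close>)
    moreover have "cs' = cs" by (rule shifted_inject[OF _ _ d(2)]) (use min m' in \<open>simp_all add: hill_min_def\<close>)
    ultimately show "v = ?u" by (simp add: v')
  qed
  let ?bl = "shifted 0 rsL ss" and ?br = "shifted 0 rsR cs"
  have eqL: "\<forall>b\<in>set ?bl. L b = apow b" and eqR: "\<forall>b\<in>set ?br. L (- b) = apow (- b)"
    using hill_min_L[OF shifted min] by auto
  have "pnf p q w = hill_word L ?bl ?c ?br"
  proof -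
    have 1: "L (hd (bl @ [c])) @ concat (map (\<lambda>(\<theta>, \<alpha>). stab_letter \<theta> # L \<alpha>) (map (Pair Up) (tl (bl @ [c])))) =
      left_word L bl @ L c" for bl c
    proof (induction bl)
      case (Cons b bl)
      then show ?case by (cases bl) auto
    qed simp
    have 2: "concat (map (\<lambda>(\<theta>, \<alpha>). stab_letter \<theta> # L \<alpha>) (map (Pair Down) (rev (map uminus br)))) = right_word L br" for br
      by (simp add: right_word_def rev_map[symmetric] comp_def)
    show ?thesis unfolding pnf_def u Let_def L_def[symmetric] hill_word_def using 1[of ?bl ?c] 2[of ?br]
      by (simp add: mkalt_def)
  qed
  also have "\<dots> = left_word apow ?bl @ L ?c @ right_word apow ?br"
  proof -
    have "left_word L ?bl = left_word apow ?bl"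
      unfolding left_word_def using eqL by (intro arg_cong[of _ _ concat] map_cong) auto
    moreover have "right_word L ?br = right_word apow ?br"
      unfolding right_word_def using eqR by (intro arg_cong[of _ _ concat] map_cong) auto
    ultimately show ?thesis by (simp only: hill_word_def)
  qed
  finally show ?thesis .
qed

end

subsection \<open>Shortest paths with lexicographic tie-breaking\<close>

definition cost_step :: "(int \<Rightarrow> int \<Rightarrow> int \<Rightarrow> int) \<Rightarrow> int \<Rightarrow> (int \<Rightarrow> int) \<Rightarrow> int \<Rightarrow> int \<Rightarrow> int" where
  "cost_step dd k F x s = Min ((\<lambda>t. F t + \<bar>dd x s t\<bar>) ` {-k..k})"

text \<open>The list is consumed from its end, where \<open>F\<close> weighs the final state. The
  profile of each suffix is what a tracing from the start has to know.\<close>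

fun opt_cost :: "(int \<Rightarrow> int \<Rightarrow> int \<Rightarrow> int) \<Rightarrow> int \<Rightarrow> (int \<Rightarrow> int) \<Rightarrow> int list \<Rightarrow> int \<Rightarrow> int" where
  "opt_cost dd k F [] = F"
| "opt_cost dd k F (x # xs) = cost_step dd k (opt_cost dd k F xs) x"

definition opt_step :: "(int \<Rightarrow> int \<Rightarrow> int \<Rightarrow> int) \<Rightarrow> int \<Rightarrow> (int \<Rightarrow> nat) \<Rightarrow> (int \<Rightarrow> int) \<Rightarrow> int \<Rightarrow> int \<Rightarrow> int" where
  "opt_step dd k rk F x s = arg_min_on (\<lambda>t. rk (dd x s t)) {t \<in> {-k..k}. F t + \<bar>dd x s t\<bar> = cost_step dd k F x s}"

fun opt_path :: "(int \<Rightarrow> int \<Rightarrow> int \<Rightarrow> int) \<Rightarrow> int \<Rightarrow> (int \<Rightarrow> nat) \<Rightarrow> (int \<Rightarrow> int) \<Rightarrow> int \<Rightarrow> int list \<Rightarrow> int list" where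
  "opt_path dd k rk F s [] = []"
| "opt_path dd k rk F s (x # xs) = (let t = opt_step dd k rk (opt_cost dd k F xs) x s in t # opt_path dd k rk F t xs)"

definition path_cost :: "(int \<Rightarrow> int \<Rightarrow> int \<Rightarrow> int) \<Rightarrow> int \<Rightarrow> int list \<Rightarrow> int list \<Rightarrow> nat" where
  "path_cost dd s xs ts = sum_list (map ac (new_digits dd s xs ts))"

lemma path_cost_simps [simp]: "path_cost dd s [] ts = 0" "path_cost dd s (x # xs) (t # ts) = ac (dd x s t) + path_cost dd t xs ts"
  by (simp_all add: path_cost_def)

lemma cost_step_le: "t \<in> {-k..k} \<Longrightarrow> cost_step dd k F x s \<le> F t + \<bar>dd x s t\<bar>"
  unfolding cost_step_def by (intro Min_le) auto

lemma cost_step_attained: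
  assumes "0 \<le> k"
  obtains t where "t \<in> {-k..k}" "cost_step dd k F x s = F t + \<bar>dd x s t\<bar>"
proof -
  have "cost_step dd k F x s \<in> (\<lambda>t. F t + \<bar>dd x s t\<bar>) ` {-k..k}"
    unfolding cost_step_def using assms by (intro Min_in) auto
  then show ?thesis using that by blast
qed

lemma opt_step_props:
  assumes "0 \<le> k"
  shows "opt_step dd k rk F x s \<in> {-k..k}"
    and "F (opt_step dd k rk F x s) + \<bar>dd x s (opt_step dd k rk F x s)\<bar> = cost_step dd k F x s"
    and "t \<in> {-k..k} \<Longrightarrow> F t + \<bar>dd x s t\<bar> = cost_step dd k F x s \<Longrightarrow> rk (dd x s (opt_step dd k rk F x s)) \<le> rk (dd x s t)"
proof -
  let ?A = "{t \<in> {-k..k}. F t + \<bar>dd x s t\<bar> = cost_step dd k F x s}"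
  have "?A \<noteq> {}" using cost_step_attained[OF assms, of dd F x s] by (metis (mono_tags, lifting) empty_iff mem_Collect_eq)
  moreover have fin: "finite ?A" by (rule finite_subset[of _ "{-k..k}"]) auto
  ultimately have "opt_step dd k rk F x s \<in> ?A" unfolding opt_step_def by (intro arg_min_if_finite(1))
  then show "opt_step dd k rk F x s \<in> {-k..k}"
    and "F (opt_step dd k rk F x s) + \<bar>dd x s (opt_step dd k rk F x s)\<bar> = cost_step dd k F x s" by auto
  assume "t \<in> {-k..k}" "F t + \<bar>dd x s t\<bar> = cost_step dd k F x s"
  then have "t \<in> ?A" by simp
  then show "rk (dd x s (opt_step dd k rk F x s)) \<le> rk (dd x s t)"
    unfolding opt_step_def by (intro arg_min_least[OF fin]) auto
qed

lemma opt_cost_le: "length xs = length ts \<Longrightarrow> window k ts \<Longrightarrow> opt_cost dd k F xs s \<le> F (endst s ts) + int (path_cost dd s xs ts)"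
proof (induction xs ts arbitrary: s rule: list_induct2)
  case (Cons x xs t ts)
  have "opt_cost dd k F (x # xs) s \<le> opt_cost dd k F xs t + \<bar>dd x s t\<bar>" using Cons.prems by (auto intro!: cost_step_le)
  moreover have "opt_cost dd k F xs t \<le> F (endst t ts) + int (path_cost dd t xs ts)" using Cons by auto
  ultimately show ?case by simp
qed simp

lemma opt_path_length [simp]: "length (opt_path dd k rk F s xs) = length xs"
  by (induction xs arbitrary: s) (auto simp: Let_def)

lemma opt_path_window: "0 \<le> k \<Longrightarrow> window k (opt_path dd k rk F s xs)"
  using opt_step_props(1)[of k] by (induction xs arbitrary: s) (auto simp: Let_def)

lemma opt_path_opt: "0 \<le> k \<Longrightarrow>
  F (endst s (opt_path dd k rk F s xs)) + int (path_cost dd s xs (opt_path dd k rk F s xs)) = opt_cost dd k F xs s"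
proof (induction xs arbitrary: s)
  case (Cons x xs)
  let ?t = "opt_step dd k rk (opt_cost dd k F xs) x s"
  have "opt_cost dd k F xs ?t + \<bar>dd x s ?t\<bar> = opt_cost dd k F (x # xs) s"
    using opt_step_props(2)[OF Cons.prems, of "opt_cost dd k F xs" dd rk x s] by simp
  with Cons.IH[OF Cons.prems, of ?t] show ?case by (simp add: Let_def)
qed simp

text \<open>Both paths are optimal on every suffix as long as they agree. At the first difference
  the greedy path has taken the least rank, and strictly so because the rank of the digit determines
  the step. The set \<open>X\<close> admits ranks that are injective only for certain
  digits.\<close>

lemma opt_path_lex:
  assumes k: "0 \<le> k"
    and inj: "\<And>x s t t'. x \<in> X \<Longrightarrow> s \<in> {-k..k} \<Longrightarrow> t \<in> {-k..k} \<Longrightarrow> t' \<in> {-k..k} \<Longrightarrow> rk (dd x s t) = rk (dd x s t') \<Longrightarrow> t = t'"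
  shows "length xs = length ts \<Longrightarrow> set xs \<subseteq> X \<Longrightarrow> s \<in> {-k..k} \<Longrightarrow> window k ts \<Longrightarrow>
    F (endst s ts) + int (path_cost dd s xs ts) = opt_cost dd k F xs s \<Longrightarrow>
    ts = opt_path dd k rk F s xs \<or> lex_diff (rank_less rk) (new_digits dd s xs (opt_path dd k rk F s xs)) (new_digits dd s xs ts)"
proof (induction xs ts arbitrary: s rule: list_induct2)
  case (Cons x xs t ts)
  let ?t = "opt_step dd k rk (opt_cost dd k F xs) x s"
  have t: "t \<in> {-k..k}" "window k ts" using Cons.prems by auto
  have 1: "opt_cost dd k F (x # xs) s \<le> opt_cost dd k F xs t + \<bar>dd x s t\<bar>" using t by (auto intro!: cost_step_le)
  have 2: "opt_cost dd k F xs t \<le> F (endst t ts) + int (path_cost dd t xs ts)" by (rule opt_cost_le[OF Cons.hyps t(2)])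
  have 3: "F (endst t ts) + int (path_cost dd t xs ts) + \<bar>dd x s t\<bar> = opt_cost dd k F (x # xs) s"
    using Cons.prems(4) by simp
  have opt: "F (endst t ts) + int (path_cost dd t xs ts) = opt_cost dd k F xs t" using 1 2 3 by linarith
  have t_opt: "opt_cost dd k F xs t + \<bar>dd x s t\<bar> = cost_step dd k (opt_cost dd k F xs) x s" using 1 2 3 by simp
  have rk: "rk (dd x s ?t) \<le> rk (dd x s t)" by (rule opt_step_props(3)[OF k t(1) t_opt])
  show ?case
  proof (cases "t = ?t")
    case True
    have "ts = opt_path dd k rk F t xs \<or> lex_diff (rank_less rk) (new_digits dd t xs (opt_path dd k rk F t xs)) (new_digits dd t xs ts)"
      using Cons.prems(1) by (intro Cons.IH t opt) auto
    moreover have "opt_path dd k rk F s (x # xs) = t # opt_path dd k rk F t xs" using True by (simp add: Let_def)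
    ultimately show ?thesis
      using lex_diff_append[of "rank_less rk" "new_digits dd t xs (opt_path dd k rk F t xs)" "new_digits dd t xs ts" "[dd x s t]" "[]" "[]"] by auto
  next
    case False
    then have "rk (dd x s ?t) \<noteq> rk (dd x s t)"
      using inj[OF _ _ opt_step_props(1)[OF k] t(1), of x s dd rk "opt_cost dd k F xs" x s] Cons.prems(1,2) by auto
    with rk show ?thesis by (auto simp: Let_def intro!: lex_diff_Cons)
  qed
qed simp

lemma cost_step_shift:
  assumes "0 \<le> k" "\<And>t. t \<in> {-k..k} \<Longrightarrow> F t = F' t + c"
  shows "cost_step dd k F x s = cost_step dd k F' x s + c"
proof (rule antisym)
  obtain t where t: "t \<in> {-k..k}" "cost_step dd k F' x s = F' t + \<bar>dd x s t\<bar>" using cost_step_attained[OF assms(1)] by metis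
  show "cost_step dd k F x s \<le> cost_step dd k F' x s + c" using cost_step_le[OF t(1), of dd F x s] assms(2) t by simp
next
  obtain t where t: "t \<in> {-k..k}" "cost_step dd k F x s = F t + \<bar>dd x s t\<bar>" using cost_step_attained[OF assms(1)] by metis
  show "cost_step dd k F' x s + c \<le> cost_step dd k F x s" using cost_step_le[OF t(1), of dd F' x s] assms(2) t by simp
qed

text \<open>An optimal step sees the profile only up to an additive constant. This allows profiles
  to be replaced by finitely many codes.\<close>

lemma opt_step_shift:
  assumes "0 \<le> k" "\<And>t. t \<in> {-k..k} \<Longrightarrow> F t = F' t + c"
  shows "opt_step dd k rk F x s = opt_step dd k rk F' x s"
proof -
  have "{t \<in> {-k..k}. F t + \<bar>dd x s t\<bar> = cost_step dd k F x s} = {t \<in> {-k..k}. F' t + \<bar>dd x s t\<bar> = cost_step dd k F' x s}"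
  proof (rule Collect_cong, rule conj_cong[OF refl])
    fix t assume "t \<in> {-k..k}"
    then show "(F t + \<bar>dd x s t\<bar> = cost_step dd k F x s) = (F' t + \<bar>dd x s t\<bar> = cost_step dd k F' x s)"
      using assms(2)[of t] cost_step_shift[where F = F, OF assms, of dd x s] by auto
  qed
  then show ?thesis by (simp add: opt_step_def)
qed

section \<open>Paths read backwards\<close>

lemma new_digits_snoc: "length xs = length ts \<Longrightarrow> new_digits dd s (xs @ [x]) (ts @ [t]) = new_digits dd s xs ts @ [dd x (endst s ts) t]"
  by (induction xs ts arbitrary: s rule: list_induct2) auto

lemma endst_rev: "endst (endst s ts) (rev (butlast (s # ts))) = s"
  by (cases ts rule: rev_cases) simp_all

text \<open>A path with \<open>n\<close> steps visits the \<open>n + 1\<close> states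
  \<open>s # ts\<close>. Reversed, it starts in the last of them, and the others follow in the order
  \<open>rev (butlast (s # ts))\<close>.\<close>

lemma new_digits_rev: "length xs = length ts \<Longrightarrow>
  new_digits (\<lambda>x s t. dd x t s) (endst s ts) (rev xs) (rev (butlast (s # ts))) = rev (new_digits dd s xs ts)"
proof (induction xs ts arbitrary: s rule: list_induct2)
  case (Cons x xs t ts)
  let ?us = "rev (butlast (t # ts))"
  have len: "length (rev xs) = length ?us" using Cons.hyps by (simp del: butlast.simps)
  have "endst s (t # ts) = endst t ts" "rev (butlast (s # t # ts)) = ?us @ [s]" by simp_all
  then show ?case using new_digits_snoc[OF len, of "\<lambda>x s t. dd x t s" "endst t ts" x s]
    by (simp only: Cons.IH endst_rev rev.simps new_digits.simps)
qed simp

lemma path_cost_rev: "length xs = length ts \<Longrightarrow>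
  path_cost (\<lambda>x s t. dd x t s) (endst s ts) (rev xs) (rev (butlast (s # ts))) = path_cost dd s xs ts"
  unfolding path_cost_def by (simp only: new_digits_rev rev_map[symmetric] sum_list_rev)

lemma length_rev_path: "length (rev (butlast (s # ts))) = length ts"
  by (simp del: butlast.simps)

lemma win_rev: "window k (s # ts) \<Longrightarrow> window k (rev (butlast (s # ts)))"
proof -
  have "set (rev (butlast (s # ts))) \<subseteq> set (s # ts)"
    unfolding set_rev by (rule subsetI) (rule in_set_butlastD)
  then show "window k (s # ts) \<Longrightarrow> window k (rev (butlast (s # ts)))" by (rule order_trans)
qed

context BS
begin

text \<open>The same strip traversed from the top: \<open>s\<close> is now the carry above the digit
  and \<open>t\<close> the carry below it.\<close>

definition lift_digit :: "int \<Rightarrow> int \<Rightarrow> int \<Rightarrow> int" where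
  "lift_digit r s t = shift_digit r t s"

lemma lift_digit_flip: "lift_digit = (\<lambda>x s t. shift_digit x t s)" "shift_digit = (\<lambda>x s t. lift_digit x t s)"
  by (simp_all add: lift_digit_def fun_eq_iff)

text \<open>The penalty makes an optimal path end in \<open>s\<close>: moving its end there changes only the last
  digit, by at most \<open>p\<close> per unit.\<close>

definition end_penalty :: "int \<Rightarrow> int \<Rightarrow> int" where
  "end_penalty s t = Q * \<bar>t - s\<bar>"

lemma end_penalty_self [simp]: "end_penalty s s = 0"
  by (simp add: end_penalty_def)

lemma end_penalty_P: "e \<noteq> s \<Longrightarrow> P * \<bar>e - s\<bar> < end_penalty s e"
  unfolding end_penalty_def using p_less_q by (intro mult_strict_right_mono) auto

lemma g_lipschitz: "int (g (x + P * s)) \<le> int (g (x + P * t)) + P * \<bar>t - s\<bar>"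
proof -
  have "g (x + P * s) \<le> g (x + P * t) + g (P * (s - t))"
    using g_diff[of "x + P * s" "x + P * t"] by (simp add: right_diff_distrib)
  with g_P_le[of "s - t"] show ?thesis by (simp add: abs_minus_commute)
qed

text \<open>If there are no digits, the end of the path is its start, so the weight \<open>W\<close>
  of the start has to be Lipschitz as well.\<close>

lemma penalised_path:
  assumes len: "length xs = length ts" and s0: "s0 \<in> {-k..k}" and window: "window k (u # ts)"
    and W: "\<And>s t. W s \<le> W t + P * \<bar>t - s\<bar>" and e: "endst u ts \<noteq> s0"
  shows "\<exists>u' ts'. length ts' = length xs \<and> window k (u' # ts') \<and> endst u' ts' = s0 \<and>
    W u' + int (path_cost lift_digit u' xs ts') < W u + int (path_cost lift_digit u xs ts) + end_penalty s0 (endst u ts)"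
proof (cases ts rule: rev_cases)
  case Nil
  with len have "xs = []" by simp
  with Nil W[of s0 u] end_penalty_P[of u s0] e s0 show ?thesis
    by (intro exI[of _ s0] exI[of _ "[]"]) simp
next
  case (snoc ts1 t)
  with len obtain xs1 x where xs: "xs = xs1 @ [x]" "length xs1 = length ts1" by (cases xs rule: rev_cases) auto
  have "\<bar>lift_digit x (endst u ts1) s0\<bar> \<le> \<bar>lift_digit x (endst u ts1) t\<bar> + P * \<bar>t - s0\<bar>"
  proof -
    have "lift_digit x (endst u ts1) s0 = lift_digit x (endst u ts1) t + P * (s0 - t)"
      by (simp add: lift_digit_def shift_digit_def algebra_simps)
    then show ?thesis using abs_triangle_ineq[of "lift_digit x (endst u ts1) t" "P * (s0 - t)"]
      by (simp add: abs_mult abs_minus_commute)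
  qed
  moreover have "P * \<bar>t - s0\<bar> < end_penalty s0 t" using e snoc by (intro end_penalty_P) simp
  ultimately show ?thesis using snoc xs window s0
    by (intro exI[of _ u] exI[of _ "ts1 @ [s0]"]) (auto simp: path_cost_def new_digits_snoc)
qed

subsection \<open>The digits of the peak normal form\<close>

text \<open>The least cost of a right side as a function of the carry with which it arrives at the
  peak. The carry at the foot must be 0; the penalty stands in for this condition and keeps all
  profiles finite.\<close>

definition right_cost :: "int list \<Rightarrow> int \<Rightarrow> int" where
  "right_cost rsR = opt_cost lift_digit K (end_penalty 0) (rev rsR)"

text \<open>An infimal convolution: the cost of everything behind the left side, as a function of
  the left carry \<open>s\<close>, with the best right carry \<open>u\<close>. The peak receives
  \<open>s - u\<close>.\<close>

definition left_weight :: "(int \<Rightarrow> int) \<Rightarrow> (int \<Rightarrow> int) \<Rightarrow> int \<Rightarrow> int" where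
  "left_weight C G s = Min ((\<lambda>u. C u + G (s - u)) ` {-K..K})"

lemma K_nonneg [simp]: "0 \<le> K"
  by (simp add: K_def)

lemma left_weight_le:
  assumes "length cs = length rsR" "window K cs"
  shows "left_weight (right_cost rsR) G s \<le> G (s - endst 0 cs) + int (path_cost shift_digit 0 rsR cs)"
proof -
  let ?u = "endst 0 cs"
  have w: "window K (0 # cs)" using assms by auto
  have "right_cost rsR ?u \<le> end_penalty 0 (endst ?u (rev (butlast (0 # cs)))) + int (path_cost lift_digit ?u (rev rsR) (rev (butlast (0 # cs))))"
    unfolding right_cost_def using assms win_rev[OF w] 
    by (intro opt_cost_le) (simp_all del: butlast.simps)
  then have "right_cost rsR ?u \<le> int (path_cost shift_digit 0 rsR cs)"
    using path_cost_rev[of rsR cs shift_digit 0] assms by (simp only: endst_rev lift_digit_flip(1)[symmetric]) simp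
  moreover have "?u \<in> {-K..K}" using w last_in_set[of "0 # cs"] by blast
  then have "left_weight (right_cost rsR) G s \<le> right_cost rsR ?u + G (s - ?u)"
    unfolding left_weight_def by (intro Min_le) auto
  ultimately show ?thesis by simp
qed

text \<open>The penalised minimum is not too small: an optimal path that does not end in 0 could be
  redirected there at lower cost.\<close>

lemma left_weight_attained:
  assumes G: "\<And>s t. G s \<le> G t + P * \<bar>t - s\<bar>"
  shows "\<exists>cs. length cs = length rsR \<and> window K cs \<and>
    G (s - endst 0 cs) + int (path_cost shift_digit 0 rsR cs) = left_weight (right_cost rsR) G s"
proof -
  have "left_weight (right_cost rsR) G s \<in> (\<lambda>u. right_cost rsR u + G (s - u)) ` {-K..K}"
    unfolding left_weight_def by (intro Min_in) auto
  then obtain u where u: "u \<in> {-K..K}" "left_weight (right_cost rsR) G s = right_cost rsR u + G (s - u)" by blast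
  let ?ts = "opt_path lift_digit K (\<lambda>_. 0) (end_penalty 0) u (rev rsR)"
  have len: "length (rev rsR) = length ?ts" by simp
  have window: "window K (u # ?ts)" using opt_path_window[of K lift_digit "\<lambda>_. 0" "end_penalty 0" u "rev rsR"] u by auto
  have opt: "end_penalty 0 (endst u ?ts) + int (path_cost lift_digit u (rev rsR) ?ts) = right_cost rsR u"
    unfolding right_cost_def by (rule opt_path_opt) simp
  have "\<exists>u' ts'. length ts' = length rsR \<and> window K (u' # ts') \<and> endst u' ts' = 0 \<and>
    G (s - u') + int (path_cost lift_digit u' (rev rsR) ts') \<le> left_weight (right_cost rsR) G s"
  proof (cases "endst u ?ts = 0")
    case True
    then show ?thesis using window opt u by (intro exI[of _ u] exI[of _ ?ts]) simp
  next
    case False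
    have "G (s - a) \<le> G (s - b) + P * \<bar>b - a\<bar>" for a b
      using G[of "s - a" "s - b"] by (simp add: abs_minus_commute)
    from penalised_path[OF len _ window this False] obtain u' ts' where
      "length ts' = length (rev rsR)" "window K (u' # ts')" "endst u' ts' = 0"
      "G (s - u') + int (path_cost lift_digit u' (rev rsR) ts') < G (s - u) + int (path_cost lift_digit u (rev rsR) ?ts) + end_penalty 0 (endst u ?ts)"
      by auto
    with opt u show ?thesis by (intro exI[of _ u'] exI[of _ ts']) simp
  qed
  then obtain u' ts' where *: "length ts' = length rsR" "window K (u' # ts')" "endst u' ts' = 0"
    "G (s - u') + int (path_cost lift_digit u' (rev rsR) ts') \<le> left_weight (right_cost rsR) G s" by blast
  let ?cs = "rev (butlast (u' # ts'))"
  have len': "length ?cs = length rsR" using *(1) by (simp only: length_rev_path)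
  have window': "window K ?cs" by (rule win_rev[OF *(2)])
  have e: "endst 0 ?cs = u'" using endst_rev[of u' ts'] unfolding *(3) .
  have "path_cost shift_digit 0 rsR ?cs = path_cost lift_digit u' (rev rsR) ts'"
    using path_cost_rev[of "rev rsR" ts' lift_digit u'] *(1) unfolding *(3) lift_digit_flip(2)[symmetric] by simp
  then have "G (s - endst 0 ?cs) + int (path_cost shift_digit 0 rsR ?cs) \<le> left_weight (right_cost rsR) G s"
    using *(4) unfolding e by simp
  then show ?thesis using left_weight_le[OF len' window', of G s] len' window' by (intro exI[of _ ?cs]) auto
qed

lemma delta_rank_inj: "delta_rank a = delta_rank b \<Longrightarrow> a = b"
proof -
  have "even (delta_rank d) \<longleftrightarrow> 0 \<le> d" "delta_rank d div 2 = nat \<bar>d\<bar>" for d by (auto simp: delta_rank_def)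
  from this[of a] this[of b] show "delta_rank a = delta_rank b \<Longrightarrow> a = b" by auto
qed

lemma shift_digit_inj: "shift_digit x s t = shift_digit x s t' \<Longrightarrow> t = t'" and lift_digit_inj: "lift_digit x s t = lift_digit x s t' \<Longrightarrow> t = t'"
  using q_pos by (auto simp: shift_digit_def lift_digit_def)

lemma delta_rank_shift_digit_inj: "delta_rank (shift_digit x s t) = delta_rank (shift_digit x s t') \<Longrightarrow> t = t'"
  by (rule shift_digit_inj) (rule delta_rank_inj)

text \<open>The left path is greedy for the weight that anticipates an optimal right side; the right
  path is then greedy for the left carry found.\<close>

lemma hill_best_opt_path:
  fixes x :: int
  assumes "digits rsL" "digits rsR"
  defines "G \<equiv> \<lambda>t. int (g (x + P * t))"
  defines "ss \<equiv> opt_path shift_digit K delta_rank (left_weight (right_cost rsR) G) 0 rsL"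
  defines "cs \<equiv> opt_path shift_digit K delta_rank (\<lambda>u. G (endst 0 ss - u)) 0 rsR"
  shows "hill_best rsL x rsR ss cs"
proof -
  let ?W = "left_weight (right_cost rsR) G"
  have cost: "int (hcost ac rsL x rsR ss' cs') = int (path_cost shift_digit 0 rsL ss') + G (endst 0 ss' - endst 0 cs') + int (path_cost shift_digit 0 rsR cs')"
    for ss' cs' by (simp add: hcost_def path_cost_def G_def)
  have lenS: "length ss = length rsL" and winS: "window K ss" unfolding ss_def by (simp, rule opt_path_window[OF K_nonneg])
  have lenC: "length cs = length rsR" and winC: "window K cs" unfolding cs_def by (simp, rule opt_path_window[OF K_nonneg])
  have G: "G s \<le> G t + P * \<bar>t - s\<bar>" for s t unfolding G_def by (rule g_lipschitz)
  have optS: "?W (endst 0 ss) + int (path_cost shift_digit 0 rsL ss) = opt_cost shift_digit K ?W rsL 0"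
    unfolding ss_def by (rule opt_path_opt) simp
  have optC: "G (endst 0 ss - endst 0 cs) + int (path_cost shift_digit 0 rsR cs) = opt_cost shift_digit K (\<lambda>u. G (endst 0 ss - u)) rsR 0"
    unfolding cs_def using opt_path_opt[of K "\<lambda>u. G (endst 0 ss - u)" 0 shift_digit delta_rank rsR] by simp
  have le: "?W (endst 0 ss') + int (path_cost shift_digit 0 rsL ss') \<le> int (hcost ac rsL x rsR ss' cs')"
    if "length cs' = length rsR" "window K cs'" for ss' cs'
    using left_weight_le[OF that, of G "endst 0 ss'"] unfolding cost by simp
  \<comment> \<open>For the left carry found, the right side can do as well as was anticipated when
    the left side was chosen.\<close>
  have bwC: "opt_cost shift_digit K (\<lambda>u. G (endst 0 ss - u)) rsR 0 \<le> ?W (endst 0 ss)"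
  proof -
    obtain cs' where "length cs' = length rsR" "window K cs'"
      "G (endst 0 ss - endst 0 cs') + int (path_cost shift_digit 0 rsR cs') = ?W (endst 0 ss)"
      using left_weight_attained[OF G] by blast
    then show ?thesis using opt_cost_le[of rsR cs' K shift_digit "\<lambda>u. G (endst 0 ss - u)" 0] by simp
  qed
  have val: "int (hcost ac rsL x rsR ss cs) \<le> opt_cost shift_digit K ?W rsL 0"
    using optS optC bwC unfolding cost by linarith
  have lower: "opt_cost shift_digit K ?W rsL 0 \<le> int (hcost ac rsL x rsR ss' cs')"
    if "length ss' = length rsL" "length cs' = length rsR" "window K ss'" "window K cs'" for ss' cs'
    using opt_cost_le[of rsL ss' K shift_digit ?W 0] le[of cs' ss'] that by simp
  have min: "hill_min rsL x rsR ss cs"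
    unfolding hill_min_def
  proof (intro conjI allI impI lenS winS lenC winC)
    fix ss' cs' :: "int list"
    assume "length ss' = length rsL" "length cs' = length rsR" "window K ss'" "window K cs'"
    from lower[OF this] val have "int (hcost ac rsL x rsR ss cs) \<le> int (hcost ac rsL x rsR ss' cs')"
      by linarith
    then show "hcost ac rsL x rsR ss cs \<le> hcost ac rsL x rsR ss' cs'" by simp
  qed
  show ?thesis unfolding hill_best_def
  proof (intro conjI allI impI min)
    fix ss' cs' assume "hill_min rsL x rsR ss' cs'"
    then have *: "length ss' = length rsL" "length cs' = length rsR" "window K ss'" "window K cs'"
      and "hcost ac rsL x rsR ss' cs' \<le> hcost ac rsL x rsR ss cs"
      using lenS winS lenC winC unfolding hill_min_def by blast+
    with val lower[OF *] have eq: "int (hcost ac rsL x rsR ss' cs') = opt_cost shift_digit K ?W rsL 0" by linarith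
    \<comment> \<open>A minimal pair leaves no slack in these inequalities, so its left path is
      optimal for \<open>?W\<close> and the tie-breaking lemma applies to it.\<close>
    have "?W (endst 0 ss') + int (path_cost shift_digit 0 rsL ss') = opt_cost shift_digit K ?W rsL 0"
      using eq le[OF *(2,4), of ss'] opt_cost_le[OF *(1)[symmetric] *(3), of shift_digit ?W 0] by linarith
    then have "ss' = ss \<or> lex_diff (rank_less delta_rank) (shifted 0 rsL ss) (shifted 0 rsL ss')"
      unfolding ss_def using *
        by (intro opt_path_lex[where X = UNIV, OF K_nonneg delta_rank_shift_digit_inj]) simp_all
    then show "ss' = ss \<or> lex_diff (rank_less delta_rank) (shifted 0 rsL ss) (shifted 0 rsL ss')" .
    assume [simp]: "ss' = ss"
    have "G (endst 0 ss - endst 0 cs') + int (path_cost shift_digit 0 rsR cs') = opt_cost shift_digit K (\<lambda>u. G (endst 0 ss - u)) rsR 0"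
    proof -
      have "G (endst 0 ss - endst 0 cs') + int (path_cost shift_digit 0 rsR cs') \<le> ?W (endst 0 ss)"
        using eq optS unfolding cost by simp
      moreover have "?W (endst 0 ss) \<le> opt_cost shift_digit K (\<lambda>u. G (endst 0 ss - u)) rsR 0"
        using left_weight_le[OF lenC winC, of G "endst 0 ss"] optC by simp
      ultimately show ?thesis using opt_cost_le[OF *(2)[symmetric] *(4), of shift_digit "\<lambda>u. G (endst 0 ss - u)" 0] by linarith
    qed
    then show "cs' = cs \<or> lex_diff (rank_less delta_rank) (shifted 0 rsR cs) (shifted 0 rsR cs')"
      unfolding cs_def using *
        by (intro opt_path_lex[where X = UNIV, OF K_nonneg delta_rank_shift_digit_inj]) simp_all
  qed
qed

end

lemma lex_diff_iff_nth: "lex_diff r u v \<longleftrightarrow> (\<exists>i. i < length u \<and> i < length v \<and> take i u = take i v \<and> (u ! i, v ! i) \<in> r)"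
proof
  assume "lex_diff r u v"
  then obtain c a b x y where "u = c @ a # x" "v = c @ b # y" "(a, b) \<in> r" by (auto simp: lex_diff_def)
  then show "\<exists>i. i < length u \<and> i < length v \<and> take i u = take i v \<and> (u ! i, v ! i) \<in> r"
    by (intro exI[of _ "length c"]) simp
next
  assume "\<exists>i. i < length u \<and> i < length v \<and> take i u = take i v \<and> (u ! i, v ! i) \<in> r"
  then obtain i where i: "i < length u" "i < length v" "take i u = take i v" "(u ! i, v ! i) \<in> r" by blast
  have "u = take i u @ u ! i # drop (Suc i) u" using i(1) by (rule id_take_nth_drop)
  moreover have "v = take i u @ v ! i # drop (Suc i) v" unfolding i(3) using i(2) by (rule id_take_nth_drop)
  ultimately show "lex_diff r u v" unfolding lex_diff_def using i(4) by blast
qed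

lemma lex_diff_trans:
  assumes r: "trans r" and uv: "lex_diff r u v" and vw: "lex_diff r v w"
  shows "lex_diff r u w"
proof -
  obtain i where i: "i < length u" "i < length v" "take i u = take i v" "(u ! i, v ! i) \<in> r"
    using uv unfolding lex_diff_iff_nth by blast
  obtain j where j: "j < length v" "j < length w" "take j v = take j w" "(v ! j, w ! j) \<in> r"
    using vw unfolding lex_diff_iff_nth by blast
  have tk: "take (min i j) u = take (min i j) w"
    using arg_cong[OF i(3), of "take (min i j)"] arg_cong[OF j(3), of "take (min i j)"] by (simp add: min.commute)
  have "(u ! min i j, w ! min i j) \<in> r"
  proof (cases i j rule: linorder_cases)
    case less
    then have "v ! i = w ! i" using j(3) by (metis nth_take)
    with less i show ?thesis by (simp add: min_def)
  next
    case equal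
    then show ?thesis using i(4) j(4) r by (auto dest: transD)
  next
    case greater
    then have "u ! j = v ! j" using i(3) by (metis nth_take)
    with greater j show ?thesis by (simp add: min_def)
  qed
  with tk i j show ?thesis unfolding lex_diff_iff_nth by (intro exI[of _ "min i j"]) auto
qed

lemma finite_strict_least:
  assumes "finite A" "A \<noteq> {}"
    and total: "\<And>a b. a \<noteq> b \<Longrightarrow> R a b \<or> R b a" and trans: "\<And>a b c. R a b \<Longrightarrow> R b c \<Longrightarrow> R a c"
  shows "\<exists>m\<in>A. \<forall>a\<in>A. a \<noteq> m \<longrightarrow> R m a"
  using assms(1,2)
proof (induction rule: finite_ne_induct)
  case (insert x A)
  then obtain m where m: "m \<in> A" "\<forall>a\<in>A. a \<noteq> m \<longrightarrow> R m a" by blast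
  show ?case
  proof (cases "R m x")
    case False
    have "m \<noteq> x" using m(1) insert.hyps by blast
    with False total have xm: "R x m" by blast
    have "R x a" if "a \<in> insert x A" "a \<noteq> x" for a
    proof (cases "a = m")
      case False
      with that m(2) have "R m a" by blast
      with xm show ?thesis by (rule trans)
    qed (use xm in simp)
    then show ?thesis by blast
  next
    case True
    then have "\<forall>a\<in>insert x A. a \<noteq> m \<longrightarrow> R m a" using m(2) by simp
    with m(1) show ?thesis by blast
  qed
qed simp

context BS
begin

subsection \<open>The integer at the peak\<close>

text \<open>The carry into the peak is a difference of two carries from the window of radius
  \<open>K\<close>.\<close>

definition K2 :: int where "K2 = 2 * K"

text \<open>For carries \<open>s\<close> in the window, \<open>|p s|\<close> is at most
  \<open>q K2 = 4 q^2\<close>. So if \<open>|x|\<close> exceeds \<open>M\<close>, then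
  \<open>|x + p s|\<close> is still larger than \<open>4 q^2\<close>, hence at least
  \<open>3 q\<close>. The size also absorbs the rounding error in
  \<open>climb_contract\<close>.\<close>

definition M :: int where "M = 8 * Q * Q"

lemma K2_nonneg [simp]: "0 \<le> K2"
  by (simp add: K2_def)

inductive climb :: "int \<Rightarrow> int list \<Rightarrow> int \<Rightarrow> bool" where
  climb_stop: "\<bar>x\<bar> \<le> M \<Longrightarrow> climb x [] x"
| climb_step: "M < \<bar>x\<bar> \<Longrightarrow> climb (P * (x div Q)) rs y \<Longrightarrow> climb x (x mod Q # rs) y"

lemma climb_split: "x + P * s = shift_digit (x mod Q) s t + Q * (x div Q + t)"
  by (simp add: shift_digit_def algebra_simps)

text \<open>Above the threshold every geodesic has a loop, whatever carry arrives, so the fixed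
  climb of \<open>x\<close> is as high as needed for all \<open>x + p s\<close> at once. The
  remainder of the loop is smaller than \<open>q\<close>, which keeps the next carry in the
  window.\<close>

lemma climb_lift:
  assumes x: "M < \<bar>x\<bar>" and s: "s \<in> {-K2..K2}"
  obtains t where "t \<in> {-K2..K2}"
    "g (x + P * s) = ac (shift_digit (x mod Q) s t) + 2 + g (P * (x div Q) + P * t)"
    "L (x + P * s) = [Lt] @ L (P * (x div Q) + P * t) @ [LT] @ apow (shift_digit (x mod Q) s t)"
proof -
  let ?y = "x + P * s"
  have "P * \<bar>s\<bar> \<le> Q * K2" using s p_less_q by (intro mult_mono) auto
  then have "\<bar>P * s\<bar> \<le> 4 * (Q * Q)" by (simp add: abs_mult K2_def K_def)
  moreover have "2 * Q \<le> Q * Q" using q_pos by (intro mult_right_mono) auto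
  moreover have "8 * (Q * Q) < \<bar>x\<bar>" using x by (simp add: M_def)
  ultimately have big: "3 * Q \<le> \<bar>?y\<bar>" 
    using abs_triangle_ineq2[of x "- (P * s)"] unfolding abs_minus_cancel diff_minus_eq_add by linarith
  have "g ?y < ac ?y"
  proof -
    \<comment> \<open>Lifting three units saves \<open>3 q\<close> letters and costs at most
      \<open>3 p + 2\<close>, which is less since \<open>q - p >= 1\<close>.\<close>
    define \<sigma> where "\<sigma> = (if 0 \<le> ?y then 1 else - 1 :: int)"
    have "g ?y \<le> ac (?y - 3 * \<sigma> * Q) + 2 + g (P * (3 * \<sigma>))"
      using g_lift[of "?y - 3 * \<sigma> * Q" "3 * \<sigma>"] by (simp add: algebra_simps)
    moreover have "int (g (P * (3 * \<sigma>))) \<le> P * 3" using g_P_le[of "3 * \<sigma>"] by (simp add: \<sigma>_def split: if_splits)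
    moreover have "\<bar>?y - 3 * \<sigma> * Q\<bar> = \<bar>?y\<bar> - 3 * Q" using big by (auto simp: \<sigma>_def)
    ultimately show ?thesis using big p_less_q by linarith
  qed
  with g_cases[of ?y] obtain e0 k0 where "?y = e0 + Q * k0" "g ?y = nat \<bar>e0\<bar> + 2 + g (P * k0)" by auto
  from L_lift[OF this] obtain e k where y: "?y = e + Q * k" and gy: "g ?y = nat \<bar>e\<bar> + 2 + g (P * k)"
    and Ly: "L ?y = [Lt] @ L (P * k) @ [LT] @ apow e" by blast
  have e: "\<bar>e\<bar> < Q"
  proof (rule ccontr)
    assume "\<not> \<bar>e\<bar> < Q"
    \<comment> \<open>Lifting one more unit would save \<open>q\<close> letters of \<open>e\<close>
      and cost at most \<open>p\<close> above.\<close>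
    define \<sigma> where "\<sigma> = (if 0 \<le> e then 1 else - 1 :: int)"
    have "g ?y \<le> ac (e - \<sigma> * Q) + 2 + g (P * (k + \<sigma>))"
      using g_lift[of "e - \<sigma> * Q" "k + \<sigma>"] unfolding y by (simp add: algebra_simps)
    moreover have "g (P * (k + \<sigma>)) \<le> g (P * k) + g (P * \<sigma>)" by (simp only: distrib_left g_add)
    moreover have "int (g (P * \<sigma>)) \<le> P" using g_P_le[of \<sigma>] by (simp add: \<sigma>_def split: if_splits)
    moreover have "\<bar>e - \<sigma> * Q\<bar> = \<bar>e\<bar> - Q" using \<open>\<not> \<bar>e\<bar> < Q\<close> by (auto simp: \<sigma>_def)
    ultimately show False using gy \<open>\<not> \<bar>e\<bar> < Q\<close> p_less_q by linarith
  qed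
  define t where "t = k - x div Q"
  have k: "k = x div Q + t" by (simp add: t_def)
  have ed: "e = shift_digit (x mod Q) s t" using climb_split[of x s t] y by (simp add: k)
  have "\<bar>t\<bar> \<le> K2"
    using window_step[of "x mod Q" s K2 t] s e q_pos by (auto simp: ed K2_def)
  with gy Ly show ?thesis by (intro that[of t]) (auto simp: k ed distrib_left)
qed

lemma climb_le: "g (x + P * s) \<le> ac (shift_digit (x mod Q) s t) + 2 + g (P * (x div Q) + P * t)"
  unfolding climb_split[of x s t] using g_lift[of "shift_digit (x mod Q) s t" "x div Q + t"] by (simp add: distrib_left)

text \<open>The two stable letters of each level do not occur in the path cost; they make up the
  constant, which is the same for all carries and so does not influence optimal steps.\<close>

lemma peak_weight:
  "climb x rs y \<Longrightarrow> s \<in> {-K2..K2} \<Longrightarrow>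
   opt_cost shift_digit K2 (\<lambda>t. int (g (y + P * t))) rs s = int (g (x + P * s)) - 2 * int (length rs)"
proof (induction arbitrary: s rule: climb.induct)
  case (climb_step x rs y)
  let ?F = "opt_cost shift_digit K2 (\<lambda>t. int (g (y + P * t))) rs" and ?n = "2 * int (length rs)"
  have F: "?F t = int (g (P * (x div Q) + P * t)) - ?n" if "t \<in> {-K2..K2}" for t
    using climb_step.IH[OF that] by simp
  have "cost_step shift_digit K2 ?F (x mod Q) s = int (g (x + P * s)) - 2 - ?n"
  proof (rule antisym)
    obtain t where t: "t \<in> {-K2..K2}" "g (x + P * s) = ac (shift_digit (x mod Q) s t) + 2 + g (P * (x div Q) + P * t)"
      using climb_lift[OF climb_step.hyps(1) climb_step.prems] by metis
    show "cost_step shift_digit K2 ?F (x mod Q) s \<le> int (g (x + P * s)) - 2 - ?n"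
      using cost_step_le[OF t(1), of shift_digit ?F "x mod Q" s] F[OF t(1)] t(2) by simp
  next
    obtain t where t: "t \<in> {-K2..K2}" "cost_step shift_digit K2 ?F (x mod Q) s = ?F t + \<bar>shift_digit (x mod Q) s t\<bar>"
      using cost_step_attained[OF K2_nonneg] by metis
    show "int (g (x + P * s)) - 2 - ?n \<le> cost_step shift_digit K2 ?F (x mod Q) s"
      using t(2) F[OF t(1)] climb_le[of x s t] by simp
  qed
  then show ?case by simp
qed simp

text \<open>The digits \<open>es\<close> are listed from the top down, in the order in which the
  word shows them.\<close>

definition peak_word :: "int \<Rightarrow> int \<Rightarrow> int list \<Rightarrow> letter list" where
  "peak_word y s es = replicate (length es) Lt @ L (y + P * s) @ concat (map (\<lambda>e. LT # apow e) es)"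

lemma peak_word_snoc: "peak_word y s (es @ [e]) = [Lt] @ peak_word y s es @ [LT] @ apow e"
  by (simp add: peak_word_def)

lemma length_peak_word: "length (peak_word y s es) = 2 * length es + g (y + P * s) + sum_list (map ac es)"
  by (induction es rule: rev_induct) (simp_all add: peak_word_snoc, simp add: peak_word_def length_L)

lemma peak_word_equ:
  "climb x rs y \<Longrightarrow> length ts = length rs \<Longrightarrow> peak_word y (endst s ts) (rev (new_digits shift_digit s rs ts)) \<sim> apow (x + P * s)"
proof (induction arbitrary: s ts rule: climb.induct)
  case (climb_stop x)
  then show ?case by (simp add: peak_word_def L_equ)
next
  case (climb_step x rs y)
  then obtain t ts' where ts: "ts = t # ts'" "length ts' = length rs" by (cases ts) auto
  have "peak_word y (endst t ts') (rev (new_digits shift_digit t rs ts')) \<sim> apow (P * (x div Q + t))"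
    using climb_step.IH[OF ts(2), of t] by (simp add: distrib_left)
  from lift_equ[OF this, of "shift_digit (x mod Q) s t"] show ?case
    unfolding climb_split[of x s t] by (simp add: ts(1) peak_word_snoc)
qed

lemma L_peak_word:
  "climb x rs y \<Longrightarrow> s \<in> {-K2..K2} \<Longrightarrow>
   \<exists>ts. length ts = length rs \<and> window K2 ts \<and> L (x + P * s) = peak_word y (endst s ts) (rev (new_digits shift_digit s rs ts))"
proof (induction arbitrary: s rule: climb.induct)
  case (climb_stop x)
  show ?case by (intro exI[of _ "[]"]) (simp add: peak_word_def)
next
  case (climb_step x rs y)
  obtain t where t: "t \<in> {-K2..K2}"
    "L (x + P * s) = [Lt] @ L (P * (x div Q) + P * t) @ [LT] @ apow (shift_digit (x mod Q) s t)"
    using climb_lift[OF climb_step.hyps(1) climb_step.prems] by metis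
  from climb_step.IH[OF t(1)] obtain ts where ts: "length ts = length rs" "window K2 ts"
    "L (P * (x div Q) + P * t) = peak_word y (endst t ts) (rev (new_digits shift_digit t rs ts))" by blast
  have "L (x + P * s) = peak_word y (endst s (t # ts)) (rev (new_digits shift_digit s (x mod Q # rs) (t # ts)))"
    unfolding t(2) ts(3) by (simp add: peak_word_snoc)
  with t(1) ts(1,2) show ?case by (intro exI[of _ "t # ts"]) simp
qed

text \<open>A bound for all digits with carries in the window of radius \<open>K2\<close>; in
  \<open>llnf_rank\<close> it also places the negative exponents behind the others.\<close>

definition Mx :: nat where "Mx = nat (2 * Q * (K2 + 1))"

section \<open>Lexicographic comparison of the words for the integer at the peak\<close>

text \<open>The order in which the words \<open>a\<^sup>e T\<close> are sorted.\<close>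

definition llnf_rank :: "int \<Rightarrow> nat" where
  "llnf_rank e = (if 0 \<le> e then nat e else Mx + nat (- e))"

lemma lift_digit_bound:
  assumes "0 \<le> r" "r < Q" "s \<in> {-K2..K2}" "t \<in> {-K2..K2}"
  shows "\<bar>lift_digit r s t\<bar> \<le> int Mx"
proof -
  have "P * \<bar>t\<bar> \<le> Q * K2" "Q * \<bar>s\<bar> \<le> Q * K2" using assms p_less_q by (auto intro!: mult_mono simp del: mult_le_cancel_left_pos)
  moreover have "int Mx = 2 * (Q * K2) + 2 * Q" by (simp add: Mx_def algebra_simps)
  moreover have "\<bar>lift_digit r s t\<bar> \<le> \<bar>r\<bar> + P * \<bar>t\<bar> + Q * \<bar>s\<bar>"
    unfolding lift_digit_def shift_digit_def using abs_triangle_ineq4[of "r + P * t" "Q * s"] abs_triangle_ineq[of r "P * t"]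
    by (simp add: abs_mult)
  moreover have "\<bar>r\<bar> < Q" using assms by simp
  ultimately show ?thesis by linarith
qed

lemma llnf_rank_inj: "\<bar>d\<bar> \<le> int Mx \<Longrightarrow> \<bar>e\<bar> \<le> int Mx \<Longrightarrow> llnf_rank d = llnf_rank e \<Longrightarrow> d = e"
  by (auto simp: llnf_rank_def split: if_splits)

lemma llnf_rank_less:
  assumes "llnf_rank d < llnf_rank e" "\<bar>d\<bar> \<le> int Mx" "\<bar>e\<bar> \<le> int Mx"
  shows "wless (apow d @ [LT]) (apow e @ [LT])"
proof -
  have pre: "wless (apow d @ [LT]) (apow (d + f) @ [LT])" if df: "0 \<le> d * f" and f: "f \<noteq> 0" for f
  proof -
    obtain l w where "apow f = l # w" "l \<in> {La, LA}" using apow_nonempty[OF f] by blast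
    then have "wless [LT] (apow f @ [LT])" by (auto intro!: lex_diff_Cons simp: letter_less_def)
    from lex_diff_append[OF this, of "apow d" "[]" "[]"] show ?thesis by (simp add: apow_add_same_sign[OF df])
  qed
  consider "0 \<le> d" "d < e" | "d < 0" "e < d" | "0 \<le> d" "e < 0"
    using assms by (auto simp: llnf_rank_def split: if_splits)
  then show ?thesis
  proof cases
    case 1
    then show ?thesis using pre[of "e - d"] by simp
  next
    case 2
    then show ?thesis using pre[of "e - d"] by (simp add: mult_nonpos_nonpos)
  next
    case 3
    have e: "apow e = LA # apow (e + 1)" using apow_pred[of "e + 1"] 3 by simp
    show ?thesis
    proof (cases "d = 0")
      case True
      then show ?thesis unfolding e by (auto intro!: lex_diff_Cons simp: letter_less_def)
    next
      case False
      then have "apow d = La # apow (d - 1)" using apow_Suc[of "d - 1"] 3 by simp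
      then show ?thesis unfolding e by (auto intro!: lex_diff_Cons simp: letter_less_def)
    qed
  qed
qed

text \<open>A further \<open>T\<close> at the end regroups the descent into blocks
  \<open>a^e T\<close>. These are compared independently of what follows; for words of equal length
  the added letter does not matter, by \<open>wless_butlast\<close>.\<close>

lemma T_word_shift: "concat (map (\<lambda>e. LT # apow e) es) @ [LT] = [LT] @ concat (map (\<lambda>e. apow e @ [LT]) es)"
  by (induction es) auto

lemma peak_word_T: "peak_word y s es @ [LT] =
    replicate (length es) Lt @ (L (y + P * s) @ [LT]) @ concat (map (\<lambda>e. apow e @ [LT]) es)"
  using T_word_shift[of es] by (simp add: peak_word_def)

lemma wless_butlast:
  assumes "wless (u @ [LT]) (v @ [LT])" "length u = length v"
  shows "wless u v"
proof -
  obtain i where i: "i < length (u @ [LT])" "take i (u @ [LT]) = take i (v @ [LT])"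
    "((u @ [LT]) ! i, (v @ [LT]) ! i) \<in> letter_less" using assms(1) unfolding lex_diff_iff_nth by blast
  have "i \<noteq> length u" using i(3) assms(2) by (auto simp: nth_append letter_less_def)
  with i have "i < length u" by simp
  with i assms(2) show ?thesis unfolding lex_diff_iff_nth by (intro exI[of _ i]) (simp add: nth_append)
qed

lemma peak_word_less_top:
  assumes "length es = length es'" "wless (L (y + P * s) @ [LT]) (L (y + P * s') @ [LT])"
    "length (peak_word y s es) = length (peak_word y s' es')"
  shows "wless (peak_word y s es) (peak_word y s' es')"
proof -
  have "wless (peak_word y s es @ [LT]) (peak_word y s' es' @ [LT])"
    unfolding peak_word_T assms(1) by (rule lex_diff_append) (rule assms(2))
  then show ?thesis using assms(3) by (rule wless_butlast)
qed

lemma peak_word_less_digits: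
  assumes "lex_diff (rank_less llnf_rank) es es'" "length es = length es'"
    and bound: "\<forall>e\<in>set es \<union> set es'. \<bar>e\<bar> \<le> int Mx"
    and len: "length (peak_word y s es) = length (peak_word y s es')"
  shows "wless (peak_word y s es) (peak_word y s es')"
proof -
  let ?f = "\<lambda>es. concat (map (\<lambda>e. apow e @ [LT]) es)"
  obtain c a b x z where *: "es = c @ a # x" "es' = c @ b # z" "llnf_rank a < llnf_rank b"
    using assms(1) by (auto simp: lex_diff_def)
  have "wless (apow a @ [LT]) (apow b @ [LT])" using * bound by (intro llnf_rank_less) auto
  from lex_diff_append[OF this, of "?f c" "?f x" "?f z"] have 1: "wless (?f es) (?f es')" by (simp add: *)
  have "wless (peak_word y s es @ [LT]) (peak_word y s es' @ [LT])"
    unfolding peak_word_T assms(2)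
    using lex_diff_append[OF 1, of "replicate (length es') Lt @ (L (y + P * s) @ [LT])" "[]" "[]"] by simp
  then show ?thesis using len by (rule wless_butlast)
qed

definition top_set :: "(int \<Rightarrow> int) \<Rightarrow> int \<Rightarrow> int set" where
  "top_set F y = {t \<in> {-K2..K2}. \<forall>t'\<in>{-K2..K2}. F t + int (g (y + P * t)) \<le> F t' + int (g (y + P * t'))}"

text \<open>Ties between tops of equal total cost are resolved before any digit is chosen: all
  candidates begin with the same number of \<open>t\<close>, and then the word of the top comes
  first.\<close>

definition best_top :: "(int \<Rightarrow> int) \<Rightarrow> int \<Rightarrow> int" where
  "best_top F y = (SOME t. t \<in> top_set F y \<and>
     (\<forall>t'\<in>top_set F y. t' \<noteq> t \<longrightarrow> wless (L (y + P * t) @ [LT]) (L (y + P * t') @ [LT])))"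

lemma best_top_props: "best_top F y \<in> top_set F y"
  "t' \<in> top_set F y \<Longrightarrow> t' \<noteq> best_top F y \<Longrightarrow> wless (L (y + P * best_top F y) @ [LT]) (L (y + P * t') @ [LT])"
proof -
  let ?R = "\<lambda>t t'. wless (L (y + P * t) @ [LT]) (L (y + P * t') @ [LT])"
  let ?c = "\<lambda>t. F t + int (g (y + P * t))"
  have "finite (top_set F y)" unfolding top_set_def by (rule finite_subset[of _ "{-K2..K2}"]) auto
  moreover have "top_set F y \<noteq> {}"
  proof -
    have "Min (?c ` {-K2..K2}) \<in> ?c ` {-K2..K2}" by (intro Min_in) auto
    then obtain t where t: "Min (?c ` {-K2..K2}) = ?c t" "t \<in> {-K2..K2}" by (rule imageE)
    have "?c t \<le> ?c t'" if "t' \<in> {-K2..K2}" for t'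
      unfolding t(1)[symmetric] using that by (intro Min_le) auto
    with t(2) have "t \<in> top_set F y" unfolding top_set_def by blast
    then show ?thesis by blast
  qed
  ultimately have "\<exists>m\<in>top_set F y. \<forall>a\<in>top_set F y. a \<noteq> m \<longrightarrow> ?R m a"
  proof (rule finite_strict_least)
    show "?R a b \<or> ?R b a" if "a \<noteq> b" for a b
      by (rule L_T_total) (use that q_pos in simp)
    show "?R a c" if "?R a b" "?R b c" for a b c
      by (rule lex_diff_trans[OF trans_letter_less that])
  qed
  then have "best_top F y \<in> top_set F y \<and> (\<forall>t'\<in>top_set F y. t' \<noteq> best_top F y \<longrightarrow> ?R (best_top F y) t')"
    unfolding best_top_def bex_simps(1) Bex_def by (rule someI_ex)
  then show "best_top F y \<in> top_set F y"
    "t' \<in> top_set F y \<Longrightarrow> t' \<noteq> best_top F y \<Longrightarrow> ?R (best_top F y) t'" by simp_all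
qed

lemma climb_digits: "climb x rs y \<Longrightarrow> digits rs \<and> \<bar>y\<bar> \<le> M"
  by (induction rule: climb.induct) (use q_pos in auto)

lemma new_digits_lift_digit_bound:
  "length xs = length ts \<Longrightarrow> digits xs \<Longrightarrow> s \<in> {-K2..K2} \<Longrightarrow> window K2 ts \<Longrightarrow> e \<in> set (new_digits lift_digit s xs ts) \<Longrightarrow> \<bar>e\<bar> \<le> int Mx"
proof (induction xs ts arbitrary: s rule: list_induct2)
  case (Cons x xs t ts)
  then have "\<bar>lift_digit x s t\<bar> \<le> int Mx" by (intro lift_digit_bound) auto
  moreover have "e = lift_digit x s t \<or> \<bar>e\<bar> \<le> int Mx" using Cons by auto
  ultimately show ?case by blast
qed simp

text \<open>The least geodesic is itself a path through the strip, and so is the word constructed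
  greedily from the top. Both have minimal length; the first difference between them would be in
  favour of the constructed word.\<close>

lemma L_peak:
  assumes climb: "climb x rs y" and s: "s \<in> {-K2..K2}"
  defines "F \<equiv> opt_cost lift_digit K2 (end_penalty s) (rev rs)"
  defines "h \<equiv> best_top F y"
  shows "L (x + P * s) = peak_word y h (new_digits lift_digit h (rev rs) (opt_path lift_digit K2 llnf_rank (end_penalty s) h (rev rs)))"
proof -
  define ts where "ts = opt_path lift_digit K2 llnf_rank (end_penalty s) h (rev rs)"
  let ?G = "\<lambda>t. int (g (y + P * t))" and ?n = "length rs"
  let ?E = "\<lambda>u vs. new_digits lift_digit u (rev rs) vs"
  have dig: "digits (rev rs)" using climb_digits[OF climb] by simp
  have hS: "h \<in> {-K2..K2}" and hmin: "\<And>t. t \<in> {-K2..K2} \<Longrightarrow> F h + ?G h \<le> F t + ?G t"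
    using best_top_props(1)[of F y] unfolding h_def top_set_def by blast+
  have lents: "length ts = ?n" by (simp add: ts_def)
  have wints: "window K2 (h # ts)" using opt_path_window[OF K2_nonneg, of lift_digit llnf_rank "end_penalty s" h "rev rs"] hS by (simp add: ts_def)
  have opt: "end_penalty s (endst h ts) + int (path_cost lift_digit h (rev rs) ts) = F h"
    unfolding F_def ts_def by (rule opt_path_opt) simp
  have path: "peak_word y u (?E u vs) \<sim> apow (x + P * s)"
    if "length vs = ?n" "endst u vs = s" for u vs
  proof -
    let ?ws = "rev (butlast (u # vs))"
    have "length ?ws = length rs" using that(1) by (simp del: butlast.simps)
    from peak_word_equ[OF climb this, of s] show ?thesis
      using endst_rev[of u vs] new_digits_rev[of "rev rs" vs lift_digit u] that(1)
      unfolding that(2) lift_digit_flip(2)[symmetric] by simp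
  qed
  have len: "length (peak_word y u (?E u vs)) = 2 * ?n + g (y + P * u) + path_cost lift_digit u (rev rs) vs"
    if "length vs = ?n" for u vs
    using that by (simp add: length_peak_word path_cost_def)
  have lower: "int (g (x + P * s)) \<le> 2 * int ?n + ?G u + int (path_cost lift_digit u (rev rs) vs)"
    if "length vs = ?n" "endst u vs = s" for u vs
    using g_lower[OF path[OF that]] len[OF that(1), of u] by linarith
  \<comment> \<open>The path of the true normal form, reversed so that it starts at the top.\<close>
  obtain u vs where uv: "length vs = ?n" "window K2 (u # vs)" "endst u vs = s"
    and Luv: "L (x + P * s) = peak_word y u (?E u vs)"
  proof -
    obtain ws where ws: "length ws = length rs" "window K2 ws"
      and Lws: "L (x + P * s) = peak_word y (endst s ws) (rev (new_digits shift_digit s rs ws))"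
      using L_peak_word[OF climb s] by blast
    let ?u = "endst s ws" and ?vs = "rev (butlast (s # ws))"
    have w: "window K2 (s # ws)" using ws(2) s by simp
    then have "?u \<in> {-K2..K2}" using last_in_set[of "s # ws"] by blast
    with win_rev[OF w] have "window K2 (?u # ?vs)" unfolding list.set(2) by blast
    moreover have "length ?vs = ?n" using ws(1) by (simp only: length_rev_path)
    moreover have "rev (new_digits shift_digit s rs ws) = ?E ?u ?vs"
      using new_digits_rev[of rs ws shift_digit s] ws(1) unfolding lift_digit_flip(1)[symmetric] by simp
    ultimately show ?thesis using that[of ?vs ?u] endst_rev[of s ws] Lws by simp
  qed
  have gx: "int (g (x + P * s)) = 2 * int ?n + ?G u + int (path_cost lift_digit u (rev rs) vs)"
    using len[OF uv(1), of u] length_L[of "x + P * s"] unfolding Luv by simp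
  have uS: "u \<in> {-K2..K2}" "window K2 vs" using uv(2) by auto
  have Fu: "F u \<le> int (path_cost lift_digit u (rev rs) vs)"
    using opt_cost_le[of "rev rs" vs K2 lift_digit "end_penalty s" u] uv uS unfolding F_def by simp
  have val: "2 * int ?n + F h + ?G h \<le> int (g (x + P * s))" using hmin[OF uS(1)] Fu gx by linarith
  \<comment> \<open>A path paying a penalty could be redirected to \<open>s\<close> at lower cost,
    giving a word for \<open>x + p s\<close> that is shorter than its geodesic length.\<close>
  have "endst h ts = s"
  proof (rule ccontr)
    assume "endst h ts \<noteq> s"
    with lents wints s g_lipschitz[of y] obtain u' ts' where "length ts' = ?n" "endst u' ts' = s"
      "?G u' + int (path_cost lift_digit u' (rev rs) ts') < ?G h + int (path_cost lift_digit h (rev rs) ts) + end_penalty s (endst h ts)"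
      using penalised_path[of "rev rs" ts s K2 h ?G] by auto
    with lower[of ts' u'] opt val show False by linarith
  qed
  with opt have optF: "int (path_cost lift_digit h (rev rs) ts) = F h" by simp
  have word: "peak_word y h (?E h ts) \<sim> apow (x + P * s)" by (rule path) fact+
  have lenword: "length (peak_word y h (?E h ts)) = g (x + P * s)"
    using len[OF lents, of h] val optF lower[OF lents \<open>endst h ts = s\<close>] by linarith
  have not_less: "\<not> wless (peak_word y h (?E h ts)) (peak_word y u (?E u vs))"
    using L_not_wless[OF word lenword] unfolding Luv .
  have leneq: "length (peak_word y h (?E h ts)) = length (peak_word y u (?E u vs))"
    using lenword length_L[of "x + P * s"] unfolding Luv by simp
  have Fu': "F u + ?G u = F h + ?G h" using Fu gx val hmin[OF uS(1)] lower[OF lents \<open>endst h ts = s\<close>] optF by linarith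
  \<comment> \<open>A different top would make the constructed word smaller than the least
    one.\<close>
  have "u = h"
  proof (rule ccontr)
    assume "u \<noteq> h"
    moreover have "u \<in> top_set F y" using uS(1) hmin Fu' by (simp add: top_set_def)
    ultimately have "wless (L (y + P * h) @ [LT]) (L (y + P * u) @ [LT])"
      unfolding h_def using best_top_props(2) by blast
    then have "wless (peak_word y h (?E h ts)) (peak_word y u (?E u vs))"
      using leneq lents uv(1) by (intro peak_word_less_top) simp_all
    with not_less show False by simp
  qed
  have inj: "t = t'" if "x \<in> {0..<Q}" "s \<in> {-K2..K2}" "t \<in> {-K2..K2}" "t' \<in> {-K2..K2}"
    "llnf_rank (lift_digit x s t) = llnf_rank (lift_digit x s t')" for x s t t'
    using that by (intro lift_digit_inj[of x s t t'] llnf_rank_inj lift_digit_bound) auto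
  have "end_penalty s (endst h vs) + int (path_cost lift_digit h (rev rs) vs) = opt_cost lift_digit K2 (end_penalty s) (rev rs) h"
    using Fu Fu' gx val uv(3) lower[OF lents \<open>endst h ts = s\<close>] optF unfolding \<open>u = h\<close> F_def by simp
  then have "vs = ts \<or> lex_diff (rank_less llnf_rank) (?E h ts) (?E h vs)"
    unfolding ts_def using uv(1) uS dig hS by (intro opt_path_lex[where X = "{0..<Q}", OF K2_nonneg inj]) simp_all
  moreover have "\<not> lex_diff (rank_less llnf_rank) (?E h ts) (?E h vs)"
  proof
    assume "lex_diff (rank_less llnf_rank) (?E h ts) (?E h vs)"
    then have "wless (peak_word y h (?E h ts)) (peak_word y h (?E h vs))"
    proof (rule peak_word_less_digits)
      show "\<forall>e\<in>set (?E h ts) \<union> set (?E h vs). \<bar>e\<bar> \<le> int Mx"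
        using new_digits_lift_digit_bound[OF _ dig hS, of ts] new_digits_lift_digit_bound[OF _ dig hS, of vs] lents uv(1) wints uS(2) by auto
    qed (use lents uv(1) leneq \<open>u = h\<close> in simp_all)
    with not_less \<open>u = h\<close> show False by simp
  qed
  ultimately have "vs = ts" by blast
  then show ?thesis using Luv \<open>u = h\<close> by (simp add: ts_def)
qed

theorem pnf_computed:
  assumes can: "canonical rsL x rsR" and w: "w \<sim> hw rsL x rsR" and climb: "climb x rs y"
  defines "G \<equiv> \<lambda>t. int (g (x + P * t))"
  defines "ss \<equiv> opt_path shift_digit K delta_rank (left_weight (right_cost rsR) G) 0 rsL"
  defines "cs \<equiv> opt_path shift_digit K delta_rank (\<lambda>u. G (endst 0 ss - u)) 0 rsR"
  defines "s \<equiv> endst 0 ss - endst 0 cs"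
  defines "h \<equiv> best_top (opt_cost lift_digit K2 (end_penalty s) (rev rs)) y"
  shows "s \<in> {-K2..K2}"
    and "pnf p q w = left_word apow (new_digits shift_digit 0 rsL ss) @
      peak_word y h (new_digits lift_digit h (rev rs) (opt_path lift_digit K2 llnf_rank (end_penalty s) h (rev rs))) @ right_word apow (new_digits shift_digit 0 rsR cs)"
proof -
  have dig: "digits rsL" "digits rsR" using can by (auto simp: canonical_def)
  have best: "hill_best rsL x rsR ss cs"
    using hill_best_opt_path[OF dig, of x] unfolding ss_def cs_def G_def .
  then have window: "window K ss" "window K cs" by (auto simp: hill_best_def hill_min_def)
  have "endst 0 vs \<in> {-K..K}" if "window K vs" for vs
    using last_in_set[of "0 # vs"] that by (cases vs) auto
  from this[OF window(1)] this[OF window(2)] show s: "s \<in> {-K2..K2}" by (auto simp: s_def K2_def)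
  show "pnf p q w = left_word apow (new_digits shift_digit 0 rsL ss) @
      peak_word y h (new_digits lift_digit h (rev rs) (opt_path lift_digit K2 llnf_rank (end_penalty s) h (rev rs))) @ right_word apow (new_digits shift_digit 0 rsR cs)"
    unfolding pnf_hill[OF can w best] h_def using L_peak[OF climb s] by (simp add: s_def)
qed

end

subsection \<open>Reasoning about the machine\<close>

definition hoare :: "nat \<Rightarrow> prog \<Rightarrow> nat \<Rightarrow> state \<Rightarrow> (state \<Rightarrow> bool) \<Rightarrow> bool" where
  "hoare B c n s R \<longleftrightarrow> (\<exists>k s'. exec B c s k s' \<and> k \<le> n \<and> R s')"

fun wp :: "nat \<Rightarrow> prog \<Rightarrow> (state \<Rightarrow> bool) \<Rightarrow> state \<Rightarrow> bool" where
  "wp B Skip R s \<longleftrightarrow> R s"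
| "wp B (Assign x e) R s \<longleftrightarrow> safe B e s \<and> R (s\<lparr>reg := (reg s)(x := val e s)\<rparr>)"
| "wp B (Write a e1 e2) R s \<longleftrightarrow> safe B e1 s \<and> addr B (val e1 s) \<and> safe B e2 s \<and>
     R (s\<lparr>arr := (arr s)(a := (arr s a)(val e1 s := val e2 s))\<rparr>)"
| "wp B (Seq c1 c2) R s \<longleftrightarrow> wp B c1 (wp B c2 R) s"
| "wp B (Cond e c1 c2) R s \<longleftrightarrow> safe B e s \<and> (if val e s \<noteq> 0 then wp B c1 R s else wp B c2 R s)"
| "wp B (While e c) R s \<longleftrightarrow> False"

text \<open>Only meant for loop-free programs: \<open>wp\<close> is false on loops.\<close>

fun pcost :: "prog \<Rightarrow> nat" where
  "pcost Skip = 1"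
| "pcost (Assign x e) = 1 + ecost e"
| "pcost (Write a e1 e2) = 1 + ecost e1 + ecost e2"
| "pcost (Seq c1 c2) = pcost c1 + pcost c2"
| "pcost (Cond e c1 c2) = 1 + ecost e + max (pcost c1) (pcost c2)"
| "pcost (While e c) = 0"

lemma hoare_mono: "hoare B c n s R \<Longrightarrow> n \<le> n' \<Longrightarrow> (\<And>s. R s \<Longrightarrow> R' s) \<Longrightarrow> hoare B c n' s R'"
  unfolding hoare_def by (meson order_trans)

lemma hoare_Seq: "hoare B c1 n1 s R \<Longrightarrow> (\<And>s'. R s' \<Longrightarrow> hoare B c2 n2 s' R') \<Longrightarrow> hoare B (Seq c1 c2) (n1 + n2) s R'"
  unfolding hoare_def by (meson add_mono ex_Seq)

lemma hoare_wp: "wp B c R s \<Longrightarrow> hoare B c (pcost c) s R"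
proof (induction c arbitrary: R s)
  case Skip
  then show ?case unfolding hoare_def by (intro exI[of _ 1] exI[of _ s] conjI ex_Skip) simp_all
next
  case (Assign x e)
  then show ?case unfolding hoare_def
    by (intro exI[of _ "1 + ecost e"] exI[of _ "s\<lparr>reg := (reg s)(x := val e s)\<rparr>"] conjI ex_Assign) simp_all
next
  case (Write a e1 e2)
  then show ?case unfolding hoare_def
    by (intro exI[of _ "1 + ecost e1 + ecost e2"]
      exI[of _ "s\<lparr>arr := (arr s)(a := (arr s a)(val e1 s := val e2 s))\<rparr>"] conjI ex_Write) simp_all
next
  case (Seq c1 c2)
  then show ?case unfolding wp.simps pcost.simps by (blast intro: hoare_Seq)
next
  case (Cond e c1 c2)
  show ?case
  proof (cases "val e s \<noteq> 0")
    case True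
    with Cond obtain k s' where "exec B c1 s k s'" "k \<le> pcost c1" "R s'" "safe B e s"
      unfolding hoare_def by fastforce
    with True show ?thesis unfolding hoare_def
      by (intro exI[of _ "1 + ecost e + k"] exI[of _ s'] conjI ex_IfTrue) auto
  next
    case False
    with Cond obtain k s' where "exec B c2 s k s'" "k \<le> pcost c2" "R s'" "safe B e s"
      unfolding hoare_def by fastforce
    with False show ?thesis unfolding hoare_def
      by (intro exI[of _ "1 + ecost e + k"] exI[of _ s'] conjI ex_IfFalse) auto
  qed
qed simp

text \<open>The invariant is indexed by the number of rounds that remain, which gives termination
  and the time bound together.\<close>

lemma hoare_While:
  assumes step: "\<And>m s. I (Suc m) s \<Longrightarrow> safe B e s \<and> val e s \<noteq> 0 \<and> hoare B c t s (I m)"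
    and stop: "\<And>s. I 0 s \<Longrightarrow> safe B e s \<and> val e s = 0"
  shows "I m s \<Longrightarrow> hoare B (While e c) ((m + 1) * (1 + ecost e + t)) s (I 0)"
proof (induction m arbitrary: s)
  case 0
  then show ?case unfolding hoare_def using stop[OF 0]
    by (intro exI[of _ "1 + ecost e"] exI[of _ s] conjI ex_WhileFalse) auto
next
  case (Suc m)
  from step[OF Suc.prems] obtain k1 s1 where e: "safe B e s" "val e s \<noteq> 0" and 1: "exec B c s k1 s1" "k1 \<le> t" "I m s1"
    unfolding hoare_def by blast
  from Suc.IH[OF 1(3)] obtain k2 s2 where 2: "exec B (While e c) s1 k2 s2"
    "k2 \<le> (m + 1) * (1 + ecost e + t)" "I 0 s2" unfolding hoare_def by blast
  have "exec B (While e c) s (1 + ecost e + k1 + k2) s2" by (rule ex_WhileTrue[OF e 1(1) 2(1)])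
  moreover have "1 + ecost e + k1 + k2 \<le> (Suc m + 1) * (1 + ecost e + t)" using 1(2) 2(2) by simp
  ultimately show ?case unfolding hoare_def using 2(3) by blast
qed

definition keeps :: "nat set \<Rightarrow> nat set \<Rightarrow> state \<Rightarrow> state \<Rightarrow> bool" where
  "keeps X A s s' \<longleftrightarrow> (\<forall>x. x \<notin> X \<longrightarrow> reg s' x = reg s x) \<and> (\<forall>a. a \<notin> A \<longrightarrow> arr s' a = arr s a)"

lemma fits_small: "\<bar>x\<bar> \<le> int B \<Longrightarrow> fits B x"
proof -
  have "int B < 2 ^ B" using of_nat_less_two_power[of B] by simp
  then show "\<bar>x\<bar> \<le> int B \<Longrightarrow> fits B x" unfolding fits_def by linarith
qed

subsection \<open>Finite tables\<close>

text \<open>A table unfolded into an arithmetic expression of constant size, since the memory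
  contains only the input initially. The entries become part of the program, so \<open>f\<close> can
  be any function, even one defined by choice.\<close>

fun tab :: "(int \<Rightarrow> int) \<Rightarrow> nat \<Rightarrow> expr \<Rightarrow> expr" where
  "tab f 0 e = Const 0"
| "tab f (Suc n) e = Bin Add (tab f n e) (Bin Mul (Bin Equal e (Const (int n))) (Const (f (int n))))"

lemma val_tab: "val (tab f n e) s = (if 0 \<le> val e s \<and> val e s < int n then f (val e s) else 0)"
  by (induction n) auto

lemma safe_tab:
  assumes "safe B e s" "\<And>i. i < n \<Longrightarrow> \<bar>f (int i)\<bar> \<le> int B"
  shows "n \<le> B \<Longrightarrow> safe B (tab f n e) s"
  using assms(2)
proof (induction n)
  case 0
  then show ?case by (simp add: fits_small)
next
  case (Suc n)
  have "\<bar>f (val e s)\<bar> \<le> int B" if "0 \<le> val e s" "val e s < int (Suc n)"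
    using Suc.prems(2)[of "nat (val e s)"] that by simp
  moreover have "\<bar>f (int n)\<bar> \<le> int B" using Suc.prems by simp
  moreover have "safe B (tab f n e) s" using Suc by simp
  ultimately show ?case using assms(1) Suc.prems(1) by (auto simp: val_tab intro!: fits_small)
qed

definition pair :: "int \<Rightarrow> expr \<Rightarrow> expr \<Rightarrow> expr" where
  "pair m e1 e2 = Bin Add (Bin Mul e1 (Const m)) e2"

lemma val_pair [simp]: "val (pair m e1 e2) s = val e1 s * m + val e2 s"
  by (simp add: pair_def)

lemma safe_pair:
  assumes "safe B e1 s" "safe B e2 s" "0 \<le> val e1 s" "val e1 s < n" "0 \<le> val e2 s" "val e2 s < m" "n * m \<le> int B"
  shows "safe B (pair m e1 e2) s" and "0 \<le> val e1 s * m + val e2 s" and "val e1 s * m + val e2 s < n * m"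
proof -
  have "(val e1 s + 1) * m \<le> n * m" using assms by (intro mult_right_mono) auto
  then have lt: "val e1 s * m + val e2 s < n * m" using assms by (simp add: distrib_right)
  have "0 \<le> val e1 s * m" using assms by simp
  moreover have "1 * m \<le> n * m" using assms by (intro mult_right_mono) auto
  then have "m \<le> int B" using assms(7) by linarith
  ultimately show "safe B (pair m e1 e2) s" "0 \<le> val e1 s * m + val e2 s" "val e1 s * m + val e2 s < n * m"
    using assms lt by (auto simp: pair_def intro!: fits_small)
qed

lemma pair_decode: "0 \<le> b \<Longrightarrow> b < m \<Longrightarrow> (a * m + b) div m = a \<and> (a * m + b) mod m = b" for a b m :: int
  by (simp add: mult.commute[of a m])

fun emit_word :: "letter list \<Rightarrow> prog" where
  "emit_word [] = Skip"
| "emit_word (l # w) = Seq (Seq (Write 1 (Reg 1) (Const (int (code l)))) (Assign 1 (Bin Add (Reg 1) (Const 1)))) (emit_word w)"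

text \<open>Words are not values of expressions, hence the case distinction instead of a
  table.\<close>

fun emit_tab :: "(int \<Rightarrow> letter list) \<Rightarrow> nat \<Rightarrow> expr \<Rightarrow> prog" where
  "emit_tab f 0 e = Skip"
| "emit_tab f (Suc n) e = Cond (Bin Equal e (Const (int n))) (emit_word (f (int n))) (emit_tab f n e)"

lemma wp_emit_word:
  "outputs s v \<Longrightarrow> length v + length w < B \<Longrightarrow> 4 \<le> B \<Longrightarrow>
   (\<And>s'. outputs s' (v @ w) \<Longrightarrow> keeps {1} {1} s s' \<Longrightarrow> R s') \<Longrightarrow> wp B (emit_word w) R s"
proof (induction w arbitrary: s v)
  case Nil
  then show ?case by (simp add: keeps_def)
next
  case (Cons l w)
  let ?s1 = "s\<lparr>arr := (arr s)(1 := (arr s 1)(reg s 1 := int (code l)))\<rparr>"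
  let ?s2 = "?s1\<lparr>reg := (reg ?s1)(1 := reg ?s1 1 + 1)\<rparr>"
  have r: "reg s 1 = int (length v)" using Cons.prems by (simp add: outputs_def)
  have cl: "code l \<le> 4" by (cases l) auto
  have "outputs ?s2 (v @ [l])" using Cons.prems(1) by (auto simp: outputs_def nth_append less_Suc_eq)
  then have "wp B (emit_word w) R ?s2"
    by (rule Cons.IH) (use Cons.prems in \<open>auto simp: keeps_def\<close>)
  then show ?case using Cons.prems(2,3) r cl by (auto simp: addr_def intro!: fits_small)
qed

lemma wp_emit_tab:
  assumes "outputs s v" "length v + length (f (val e s)) < B" "4 \<le> B" "safe B e s"
    "\<And>s'. outputs s' (v @ f (val e s)) \<Longrightarrow> keeps {1} {1} s s' \<Longrightarrow> R s'"
  shows "0 \<le> val e s \<Longrightarrow> val e s < int n \<Longrightarrow> n \<le> B \<Longrightarrow> wp B (emit_tab f n e) R s"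
proof (induction n)
  case (Suc n)
  have sf: "safe B (Bin Equal e (Const (int n))) s"
    using assms(3,4) Suc.prems by (auto intro!: fits_small)
  show ?case
  proof (cases "val e s = int n")
    case True
    have "wp B (emit_word (f (val e s))) R s" by (rule wp_emit_word[OF assms(1-3,5)])
    with sf True show ?thesis by simp
  next
    case False
    then have "wp B (emit_tab f n e) R s" using Suc by simp
    with sf False show ?thesis by simp
  qed
qed simp

subsection \<open>The three loops of dynamic programming\<close>

text \<open>Register 2 is the loop counter, \<open>nr\<close> the register holding the number of entries, and \<open>ix\<close> the
  index of the current entry.\<close>

definition is_index :: "nat \<Rightarrow> expr \<Rightarrow> nat \<Rightarrow> nat \<Rightarrow> (nat \<Rightarrow> nat) \<Rightarrow> bool" where
  "is_index B ix nr n pos \<longleftrightarrow> (\<forall>s i. i < n \<longrightarrow> reg s 2 = int i \<longrightarrow> reg s nr = int n \<longrightarrow>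
     safe B ix s \<and> val ix s = int (pos i) \<and> pos i < B)"

definition ix_up :: expr where "ix_up = Reg 2"
definition ix_Suc :: expr where "ix_Suc = Bin Add (Reg 2) (Const 1)"
definition ix_down :: "nat \<Rightarrow> expr" where "ix_down nr = Bin Sub (Bin Sub (Reg nr) (Const 1)) (Reg 2)"

lemma is_index_up: "n < B \<Longrightarrow> is_index B ix_up nr n (\<lambda>i. i)"
  and is_index_Suc: "n < B \<Longrightarrow> is_index B ix_Suc nr n Suc"
  and is_index_down: "n < B \<Longrightarrow> is_index B (ix_down nr) nr n (\<lambda>i. n - 1 - i)"
  by (auto simp: is_index_def ix_up_def ix_Suc_def ix_down_def intro!: fits_small)

definition holds :: "state \<Rightarrow> nat \<Rightarrow> (nat \<Rightarrow> nat) \<Rightarrow> int list \<Rightarrow> bool" where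
  "holds s a pos xs \<longleftrightarrow> (\<forall>i<length xs. arr s a (int (pos i)) = xs ! i)"

lemma holds_rev: "holds s a (\<lambda>i. i) xs \<longleftrightarrow> holds s a (\<lambda>i. length xs - 1 - i) (rev xs)"
proof
  assume "holds s a (\<lambda>i. i) xs"
  then have "arr s a (int (length xs - 1 - i)) = xs ! (length xs - 1 - i)" if "i < length xs" for i
    using that unfolding holds_def by (auto simp del: of_nat_diff)
  then show "holds s a (\<lambda>i. length xs - 1 - i) (rev xs)"
    unfolding holds_def length_rev by (simp add: rev_nth del: of_nat_diff)
next
  assume h: "holds s a (\<lambda>i. length xs - 1 - i) (rev xs)"
  show "holds s a (\<lambda>i. i) xs" unfolding holds_def
  proof (intro allI impI)
    fix i assume i: "i < length xs"
    then have eq: "length xs - 1 - (length xs - 1 - i) = i" and "length xs - 1 - i < length (rev xs)" by auto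
    with h[unfolded holds_def, rule_format, of "length xs - 1 - i"] show "arr s a (int i) = xs ! i"
      unfolding eq using i by (simp add: rev_nth)
  qed
qed

text \<open>Cell \<open>j\<close> of array 7 receives the state before the entry \<open>j\<close> is
  consumed. This is the code for the suffix behind the entry, on which the optimal step at
  \<open>j\<close> depends.\<close>

definition pass_body :: "(int \<Rightarrow> int \<Rightarrow> int) \<Rightarrow> nat \<Rightarrow> nat \<Rightarrow> nat \<Rightarrow> expr \<Rightarrow> prog" where
  "pass_body ft N m a ix = Seq (Assign 2 (Bin Sub (Reg 2) (Const 1))) (Seq (Write 7 (Reg 2) (Reg 5))
     (Assign 5 (tab (\<lambda>i. ft (i div int m) (i mod int m)) (N * m) (pair (int m) (Reg 5) (Read a ix)))))"

definition pass :: "(int \<Rightarrow> int \<Rightarrow> int) \<Rightarrow> nat \<Rightarrow> nat \<Rightarrow> nat \<Rightarrow> nat \<Rightarrow> expr \<Rightarrow> prog" where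
  "pass ft N m nr a ix = Seq (Assign 2 (Reg nr)) (While (Reg 2) (pass_body ft N m a ix))"

lemma foldr_range: "e \<in> {0..<int N} \<Longrightarrow> set xs \<subseteq> {0..<int m} \<Longrightarrow>
    (\<And>e x. e \<in> {0..<int N} \<Longrightarrow> x \<in> {0..<int m} \<Longrightarrow> ft e x \<in> {0..<int N}) \<Longrightarrow>
    foldr (\<lambda>x e. ft e x) xs e \<in> {0..<int N}"
  by (induction xs) auto

lemma tab2_safe:
  assumes "safe B e1 s" "safe B e2 s" "val e1 s \<in> {0..<int N}" "val e2 s \<in> {0..<int m}" "N * m \<le> B"
    and ft: "\<And>e x. e \<in> {0..<int N} \<Longrightarrow> x \<in> {0..<int m} \<Longrightarrow> \<bar>ft e x\<bar> \<le> int B"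
  defines "T \<equiv> tab (\<lambda>i. ft (i div int m) (i mod int m)) (N * m) (pair (int m) e1 e2)"
  shows "safe B T s" "val T s = ft (val e1 s) (val e2 s)"
proof -
  have Nm: "int N * int m \<le> int B" using assms(5) by (metis of_nat_le_iff of_nat_mult)
  note p = safe_pair[of B e1 s e2 "int N" "int m", OF assms(1,2) _ _ _ _ Nm]
  have "\<bar>ft (int i div int m) (int i mod int m)\<bar> \<le> int B" if "i < N * m" for i
  proof (rule ft)
    have "m \<noteq> 0" using that by (cases m) auto
    moreover have "i div m < N" using that by (simp add: less_mult_imp_div_less)
    ultimately show "int i div int m \<in> {0..<int N}" "int i mod int m \<in> {0..<int m}"
      by (simp_all add: zdiv_int[symmetric] zmod_int[symmetric])
  qed
  then show "safe B T s" unfolding T_def using p(1) assms(3-5) by (intro safe_tab) auto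
  show "val T s = ft (val e1 s) (val e2 s)"
    unfolding T_def val_tab val_pair using p(2,3) pair_decode[of "val e2 s" "int m" "val e1 s"] assms(3,4) by auto
qed

lemma hoare_pass:
  assumes n: "reg s nr = int (length xs)" "nr \<noteq> 2" "nr \<noteq> 5" and len: "length xs < B"
    and a: "holds s a pos xs" "a \<noteq> 7" and xs: "set xs \<subseteq> {0..<int m}"
    and e: "reg s 5 \<in> {0..<int N}" and ix: "is_index B ix nr (length xs) pos" and NB: "N * m \<le> B" "N \<le> B" "m \<le> B" "1 \<le> B"
    and ft: "\<And>e x. e \<in> {0..<int N} \<Longrightarrow> x \<in> {0..<int m} \<Longrightarrow> ft e x \<in> {0..<int N}"
  shows "hoare B (pass ft N m nr a ix) ((length xs + 1) * (4 + pcost (pass_body ft N m a ix))) s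
    (\<lambda>s'. reg s' 5 = foldr (\<lambda>x e. ft e x) xs (reg s 5) \<and>
      (\<forall>j<length xs. arr s' 7 (int j) = foldr (\<lambda>x e. ft e x) (drop (Suc j) xs) (reg s 5)) \<and>
      keeps {2, 5} {7} s s')"
proof -
  let ?n = "length xs" and ?b = "pass_body ft N m a ix"
  let ?v = "\<lambda>j. foldr (\<lambda>x e. ft e x) (drop j xs) (reg s 5)"
  define I where "I = (\<lambda>i s'. i \<le> ?n \<and> reg s' 2 = int i \<and> reg s' 5 = ?v i \<and>
    (\<forall>j. i \<le> j \<longrightarrow> j < ?n \<longrightarrow> arr s' 7 (int j) = ?v (Suc j)) \<and> keeps {2, 5} {7} s s')"
  have v: "?v j \<in> {0..<int N}" for j
    using xs by (intro foldr_range[OF e _ ft]) (auto dest: in_set_dropD)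
  have "hoare B (While (Reg 2) ?b) ((?n + 1) * (1 + ecost (Reg 2) + pcost ?b)) s1 (I 0)" if "I ?n s1" for s1
  proof (rule hoare_While[where I = I, OF _ _ that])
    fix i s' assume I: "I (Suc i) s'"
    let ?s1 = "s'\<lparr>reg := (reg s')(2 := int i)\<rparr>"
    let ?s2 = "?s1\<lparr>arr := (arr ?s1)(7 := (arr ?s1 7)(int i := ?v (Suc i)))\<rparr>"
    from I have i: "i < ?n" and r2: "reg s' 2 = int (Suc i)" and r5: "reg s' 5 = ?v (Suc i)"
      and A: "arr s' a = arr s a" and nr: "reg s' nr = int ?n"
      using n a by (auto simp: I_def keeps_def)
    have ix2: "safe B ix ?s2" "val ix ?s2 = int (pos i)" "pos i < B"
      using ix[unfolded is_index_def, rule_format, of i ?s2] i n nr by auto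
    have rd: "arr ?s2 a (int (pos i)) = xs ! i" using a i A by (auto simp: holds_def)
    have xi: "xs ! i \<in> {0..<int m}" using xs i by (meson nth_mem subsetD)
    have sR: "safe B (Reg 5) ?s2" "safe B (Read a ix) ?s2"
      using ix2 v[of "Suc i"] r5 rd xi NB by (auto simp: addr_def intro!: fits_small)
    have step: "?v i = ft (?v (Suc i)) (xs ! i)" using i by (simp add: Cons_nth_drop_Suc[symmetric])
    let ?T = "tab (\<lambda>i. ft (i div int m) (i mod int m)) (N * m) (pair (int m) (Reg 5) (Read a ix))"
    have fb: "\<bar>ft e x\<bar> \<le> int B" if "e \<in> {0..<int N}" "x \<in> {0..<int m}" for e x
      using ft[OF that] NB(2) by simp
    have v5: "val (Reg 5) ?s2 = ?v (Suc i)" using r5 by simp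
    have vR: "val (Read a ix) ?s2 = xs ! i" using ix2 rd by simp
    have T: "safe B ?T ?s2" "val ?T ?s2 = ?v i"
      using tab2_safe[OF sR _ _ NB(1) fb] v[of "Suc i"] xi unfolding v5 vR step by auto
    have "wp B ?b (I i) s'"
      unfolding pass_body_def using T r2 r5 i len v[of "Suc i"] NB I n(2,3) a(2)
      by (auto simp: addr_def I_def keeps_def intro!: fits_small)
    then show "safe B (Reg 2) s' \<and> val (Reg 2) s' \<noteq> 0 \<and> hoare B ?b (pcost ?b) s' (I i)"
      using r2 i len by (auto intro!: fits_small hoare_wp)
  next
    fix s' assume "I 0 s'"
    then show "safe B (Reg 2) s' \<and> val (Reg 2) s' = 0" by (simp add: I_def fits_small)
  qed
  moreover have "hoare B (Assign 2 (Reg nr)) (pcost (Assign 2 (Reg nr))) s (I ?n)"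
    by (rule hoare_wp) (use n len in \<open>auto simp: I_def keeps_def intro!: fits_small\<close>)
  ultimately have "hoare B (pass ft N m nr a ix) (pcost (Assign 2 (Reg nr)) + (?n + 1) * (1 + ecost (Reg 2) + pcost ?b)) s (I 0)"
    unfolding pass_def by (intro hoare_Seq)
  then show ?thesis by (rule hoare_mono) (auto simp: I_def algebra_simps)
qed

fun follow :: "(int \<Rightarrow> int \<Rightarrow> int \<Rightarrow> int) \<Rightarrow> int list \<Rightarrow> int list \<Rightarrow> int \<Rightarrow> int list" where
  "follow st (e # es) (x # xs) s = (let t = st e x s in t # follow st es xs t)"
| "follow st _ _ s = []"

lemma length_follow [simp]: "length es = length xs \<Longrightarrow> length (follow st es xs s) = length xs"
  by (induction es xs arbitrary: s rule: list_induct2) (auto simp: Let_def)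

lemma nth_follow: "length es = length xs \<Longrightarrow> i < length xs \<Longrightarrow>
    follow st es xs s ! i = st (es ! i) (xs ! i) ((s # follow st es xs s) ! i)"
proof (induction es xs arbitrary: s i rule: list_induct2)
  case (Cons e es x xs)
  then show ?case by (cases i) (simp_all add: Let_def)
qed simp

lemma nth_new_digits: "length xs = length ts \<Longrightarrow> i < length xs \<Longrightarrow> new_digits dd s xs ts ! i = dd (xs ! i) ((s # ts) ! i) (ts ! i)"
proof (induction xs ts arbitrary: s i rule: list_induct2)
  case (Cons x xs t ts)
  then show ?case by (cases i) simp_all
qed simp

text \<open>The common form of \<open>shift_digit\<close> and \<open>lift_digit\<close>: new digits
  are computed by arithmetic, and only the next carry is looked up.\<close>

definition affine :: "int \<Rightarrow> int \<Rightarrow> int \<Rightarrow> int \<Rightarrow> int \<Rightarrow> int" where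
  "affine c d x s t = x + c * s + d * t"

text \<open>A table with three arguments, by two nested pairings. Adding \<open>k\<close> makes the
  carry nonnegative.\<close>

definition trace_tab :: "(int \<Rightarrow> int \<Rightarrow> int \<Rightarrow> int) \<Rightarrow> nat \<Rightarrow> nat \<Rightarrow> nat \<Rightarrow> nat \<Rightarrow> expr \<Rightarrow> expr" where
  "trace_tab st N m k a ix = tab (\<lambda>i. (\<lambda>ex. \<lambda>s. st (ex div int m) (ex mod int m) (s - int k)) (i div int (2 * k + 1)) (i mod int (2 * k + 1)))
     (N * m * (2 * k + 1)) (pair (int (2 * k + 1)) (pair (int m) (Read 7 (Reg 2)) (Read a ix)) (Bin Add (Reg 10) (Const (int k))))"

definition trace_body :: "(int \<Rightarrow> int \<Rightarrow> int \<Rightarrow> int) \<Rightarrow> nat \<Rightarrow> nat \<Rightarrow> nat \<Rightarrow> int \<Rightarrow> int \<Rightarrow> nat \<Rightarrow> nat \<Rightarrow> expr \<Rightarrow> prog" where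
  "trace_body st N m k c d a b ix = Seq (Assign 12 (trace_tab st N m k a ix))
    (Seq (Write b (Reg 2) (Bin Add (Bin Add (Read a ix) (Bin Mul (Const c) (Reg 10))) (Bin Mul (Const d) (Reg 12))))
    (Seq (Assign 10 (Reg 12)) (Assign 2 (Bin Add (Reg 2) (Const 1)))))"

definition trace :: "(int \<Rightarrow> int \<Rightarrow> int \<Rightarrow> int) \<Rightarrow> nat \<Rightarrow> nat \<Rightarrow> nat \<Rightarrow> int \<Rightarrow> int \<Rightarrow> nat \<Rightarrow> nat \<Rightarrow> nat \<Rightarrow> expr \<Rightarrow> prog" where
  "trace st N m k c d nr a b ix = Seq (Assign 2 (Const 0)) (While (Bin Less (Reg 2) (Reg nr)) (trace_body st N m k c d a b ix))"

lemma trace_tab_val: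
  assumes R: "safe B (Read 7 (Reg 2)) s" "safe B (Read a ix) s" "safe B (Reg 10) s"
    and v: "val (Read 7 (Reg 2)) s \<in> {0..<int N}" "val (Read a ix) s \<in> {0..<int m}" "reg s 10 \<in> {- int k..int k}"
    and st: "\<And>e x s. e \<in> {0..<int N} \<Longrightarrow> x \<in> {0..<int m} \<Longrightarrow> s \<in> {- int k..int k} \<Longrightarrow> st e x s \<in> {- int k..int k}"
    and B: "N * m * (2 * k + 1) \<le> B"
  shows "safe B (trace_tab st N m k a ix) s"
    "val (trace_tab st N m k a ix) s = st (val (Read 7 (Reg 2)) s) (val (Read a ix) s) (reg s 10)"
proof -
  have pos: "0 < N" "0 < m" using v by auto
  have le: "N * m * 1 \<le> N * m * (2 * k + 1)" "1 * (2 * k + 1) \<le> N * m * (2 * k + 1)"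
    using pos by (auto intro!: mult_le_mono simp del: mult_Suc_right)
  then have NmB: "N * m \<le> B" and kB: "2 * k + 1 \<le> B"
    using order_trans[OF le(1) B] order_trans[OF le(2) B] by simp_all
  have "int N * int m \<le> int B" using NmB by (metis of_nat_le_iff of_nat_mult)
  note p = safe_pair[of B "Read 7 (Reg 2)" s "Read a ix" "int N" "int m", OF R(1,2) _ _ _ _ this]
  let ?e1 = "pair (int m) (Read 7 (Reg 2)) (Read a ix)" and ?e2 = "Bin Add (Reg 10) (Const (int k))"
  have e1: "safe B ?e1 s" "val ?e1 s \<in> {0..<int (N * m)}" using p v by auto
  have e2: "safe B ?e2 s" "val ?e2 s \<in> {0..<int (2 * k + 1)}" using R(3) v(3) kB by (auto intro!: fits_small)
  have fb: "\<bar>st (ex div int m) (ex mod int m) (z - int k)\<bar> \<le> int B"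
    if "ex \<in> {0..<int (N * m)}" "z \<in> {0..<int (2 * k + 1)}" for ex z
  proof -
    have "ex div int m < int N"
    proof -
      have "ex < int N * int m" using that by simp
      moreover have "int N * int m \<le> ex div int m * int m" if "int N \<le> ex div int m"
        using that by (intro mult_right_mono) auto
      moreover have "ex div int m * int m \<le> ex"
        using pos div_mult_mod_eq[of ex "int m"] pos_mod_sign[of "int m" ex] by linarith
      ultimately show ?thesis by linarith
    qed
    then have "st (ex div int m) (ex mod int m) (z - int k) \<in> {- int k..int k}"
      using that pos by (intro st) (auto simp: pos_imp_zdiv_nonneg_iff)
    then show ?thesis using kB by auto
  qed
  note T = tab2_safe[where ft = "\<lambda>ex z. st (ex div int m) (ex mod int m) (z - int k)", OF e1(1) e2(1) e1(2) e2(2) B fb]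
  show "safe B (trace_tab st N m k a ix) s"
    unfolding trace_tab_def by (rule T(1))
  have "val (trace_tab st N m k a ix) s = st (val ?e1 s div int m) (val ?e1 s mod int m) (val ?e2 s - int k)"
    unfolding trace_tab_def by (rule T(2))
  then show "val (trace_tab st N m k a ix) s = st (val (Read 7 (Reg 2)) s) (val (Read a ix) s) (reg s 10)"
    unfolding val_pair using pair_decode[of "val (Read a ix) s" "int m" "val (Read 7 (Reg 2)) s"] v(2) by simp
qed

lemma hoare_trace:
  assumes n: "reg s nr = int (length xs)" "nr \<notin> {2, 10, 12}" and len: "length xs < B" "length es = length xs"
    and a: "holds s a pos xs" "holds s 7 (\<lambda>i. i) es" "b \<noteq> 7" "b \<noteq> a"
    and xs: "set xs \<subseteq> {0..<int m}" and es: "set es \<subseteq> {0..<int N}" and s0: "reg s 10 \<in> {- int k..int k}"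
    and ix: "is_index B ix nr (length xs) pos"
    and st: "\<And>e x s. e \<in> {0..<int N} \<Longrightarrow> x \<in> {0..<int m} \<Longrightarrow> s \<in> {- int k..int k} \<Longrightarrow> st e x s \<in> {- int k..int k}"
    and B: "N * m * (2 * k + 1) \<le> B" "1 \<le> B" "N \<le> B" "m \<le> B" "m + nat \<bar>c\<bar> * k + nat \<bar>d\<bar> * k + nat \<bar>c\<bar> + nat \<bar>d\<bar> + k \<le> B"
  defines "ts \<equiv> follow st es xs (reg s 10)"
  shows "hoare B (trace st N m k c d nr a b ix) ((length xs + 1) * (6 + pcost (trace_body st N m k c d a b ix))) s
    (\<lambda>s'. reg s' 10 = endst (reg s 10) ts \<and> holds s' b (\<lambda>i. i) (new_digits (affine c d) (reg s 10) xs ts) \<and>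
      keeps {2, 10, 12} {b} s s')"
proof -
  let ?n = "length xs" and ?b = "trace_body st N m k c d a b ix" and ?z = "reg s 10 # ts"
    and ?g = "Bin Less (Reg 2) (Reg nr)"
  have lts: "length ts = ?n" using len by (simp add: ts_def)
  have zst: "?z ! Suc i = st (es ! i) (xs ! i) (?z ! i)" if "i < ?n" for i
    using nth_follow[OF len(2) that, of st "reg s 10"] by (simp add: ts_def)
  have xi: "xs ! i \<in> {0..<int m}" if "i < ?n" for i using xs that by (meson nth_mem subsetD)
  have ei: "es ! i \<in> {0..<int N}" if "i < ?n" for i using es that len(2) by (metis nth_mem subsetD)
  have z: "?z ! i \<in> {- int k..int k}" if "i \<le> ?n" for i
    using that
  proof (induction i)
    case (Suc i)
    then show ?case unfolding zst[OF Suc_le_lessD[OF Suc.prems]] using xi[of i] ei[of i] by (intro st) auto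
  qed (use s0 in simp)
  \<comment> \<open>Here \<open>r\<close> counts the remaining rounds, while register 2 counts
    upwards.\<close>
  define I where "I = (\<lambda>r s'. r \<le> ?n \<and> reg s' 2 = int (?n - r) \<and> reg s' 10 = ?z ! (?n - r) \<and>
    (\<forall>j < ?n - r. arr s' b (int j) = affine c d (xs ! j) (?z ! j) (ts ! j)) \<and> keeps {2, 10, 12} {b} s s')"
  have "hoare B (While ?g ?b) ((?n + 1) * (1 + ecost ?g + pcost ?b)) s1 (I 0)" if "I ?n s1" for s1
  proof (rule hoare_While[where I = I, OF _ _ that])
    fix r s' assume I: "I (Suc r) s'"
    define i where "i = ?n - Suc r"
    have i: "i < ?n" "?n - r = Suc i" using I by (auto simp: i_def I_def)
    have r2: "reg s' 2 = int i" and r10: "reg s' 10 = ?z ! i" and K: "keeps {2, 10, 12} {b} s s'"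
      and dn: "\<forall>j<i. arr s' b (int j) = affine c d (xs ! j) (?z ! j) (ts ! j)"
      using I by (simp_all add: I_def i_def[symmetric])
    have A: "arr s' a = arr s a" "arr s' 7 = arr s 7" "reg s' nr = int ?n" using K n a by (auto simp: keeps_def)
    let ?t = "?z ! Suc i"
    let ?s1 = "s'\<lparr>reg := (reg s')(12 := ?t)\<rparr>"
    have rd7: "arr s 7 (int i) = es ! i" using a(2) i len(2) by (simp add: holds_def)
    have rda: "arr s a (int (pos i)) = xs ! i" using a(1) i by (simp add: holds_def)
    have ixs: "safe B ix s'" "val ix s' = int (pos i)" "pos i < B"
      using ix[unfolded is_index_def, rule_format, of i s'] i r2 A by auto
    have ixs1: "safe B ix ?s1" "val ix ?s1 = int (pos i)"
      using ix[unfolded is_index_def, rule_format, of i ?s1] i r2 A n(2) by auto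
    have zi: "?z ! i \<in> {- int k..int k}" and ti: "?t \<in> {- int k..int k}" using z[of i] z[of "Suc i"] i by simp_all
    have kB: "int k \<le> int B" using B(5) by linarith
    have R10: "safe B (Reg 10) s'" unfolding safe.simps r10 using zi kB by (intro fits_small) auto
    have R: "safe B (Read 7 (Reg 2)) s'" "safe B (Read a ix) s'" "safe B (Read a ix) ?s1"
      "val (Read 7 (Reg 2)) s' = es ! i" "val (Read a ix) s' = xs ! i" "val (Read a ix) ?s1 = xs ! i"
      using ixs ixs1 r2 A rd7 rda ei[OF i(1)] xi[OF i(1)] i len(1) B zi r10 kB
      by (auto simp: addr_def intro!: fits_small)
    note T = trace_tab_val[OF R(1,2) R10, of N m k st]
    have T1: "safe B (trace_tab st N m k a ix) s'" and T2: "val (trace_tab st N m k a ix) s' = ?t"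
      using T[OF _ _ _ st B(1)] ei[OF i(1)] xi[OF i(1)] zi unfolding R(4,5) r10 zst[OF i(1)] by auto
    have cz: "\<bar>c * (?z ! i)\<bar> \<le> \<bar>c\<bar> * int k" and dt: "\<bar>d * ?t\<bar> \<le> \<bar>d\<bar> * int k"
      unfolding abs_mult using zi ti by (auto intro!: mult_left_mono)
    have Bi: "int m + \<bar>c\<bar> * int k + \<bar>d\<bar> * int k + \<bar>c\<bar> + \<bar>d\<bar> + int k \<le> int B"
      using B(5) by (simp add: nat_le_iff flip: of_nat_le_iff[where 'a = int])
    have nn: "0 \<le> \<bar>c\<bar> * int k" "0 \<le> \<bar>d\<bar> * int k" by simp_all
    have fits: "fits B c" "fits B d" "fits B (c * (?z ! i))" "fits B (d * ?t)" "fits B ?t" "fits B (?z ! i)"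
      "fits B (xs ! i + c * (?z ! i))" "fits B (xs ! i + c * (?z ! i) + d * ?t)"
      using cz dt Bi nn zi ti xi[OF i(1)] by (auto intro!: fits_small)
    have tsi: "ts ! i = ?t" by simp
    have small: "fits B (int i)" "fits B (int i + 1)" "fits B 1" using i len B by (auto intro!: fits_small)
    have "wp B ?b (I r) s'"
      unfolding trace_body_def wp.simps T2
      using T1 R(3,6) fits small r2 r10 i len(1) K dn n(2) a(3,4)
      by (auto simp: addr_def I_def keeps_def affine_def less_Suc_eq)
    then show "safe B ?g s' \<and> val ?g s' \<noteq> 0 \<and> hoare B ?b (pcost ?b) s' (I r)"
      using r2 A i len B by (auto intro!: fits_small hoare_wp)
  next
    fix s' assume "I 0 s'"
    then show "safe B ?g s' \<and> val ?g s' = 0" using n len B by (auto simp: I_def keeps_def intro!: fits_small)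
  qed
  moreover have "hoare B (Assign 2 (Const 0)) (pcost (Assign 2 (Const 0))) s (I ?n)"
    by (rule hoare_wp) (use n in \<open>auto simp: I_def keeps_def intro!: fits_small\<close>)
  ultimately have "hoare B (trace st N m k c d nr a b ix)
      (pcost (Assign 2 (Const 0)) + (?n + 1) * (1 + ecost ?g + pcost ?b)) s (I 0)"
    unfolding trace_def by (intro hoare_Seq)
  moreover have "endst (reg s 10) ts = ?z ! ?n" using lts by (simp add: last_conv_nth del: last.simps)
  ultimately show ?thesis
    by (elim hoare_mono) (auto simp: I_def holds_def nth_new_digits lts algebra_simps)
qed

definition emit_body :: "(int \<Rightarrow> letter list) \<Rightarrow> nat \<Rightarrow> int \<Rightarrow> nat \<Rightarrow> expr \<Rightarrow> prog" where
  "emit_body W N off a ix = Seq (emit_tab (\<lambda>i. W (i - off)) N (Bin Add (Read a ix) (Const off))) (Assign 2 (Bin Add (Reg 2) (Const 1)))"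

definition emit :: "(int \<Rightarrow> letter list) \<Rightarrow> nat \<Rightarrow> int \<Rightarrow> nat \<Rightarrow> nat \<Rightarrow> expr \<Rightarrow> prog" where
  "emit W N off nr a ix = Seq (Assign 2 (Const 0)) (While (Bin Less (Reg 2) (Reg nr)) (emit_body W N off a ix))"

lemma hoare_emit:
  assumes out: "outputs s v"
    and n: "reg s nr = int (length xs)" "nr \<notin> {1, 2}" and len: "length xs < B"
    and a: "holds s a pos xs" "a \<noteq> 1" and xs: "\<And>x. x \<in> set xs \<Longrightarrow> 0 \<le> x + off \<and> x + off < int N \<and> length (W x) \<le> wl"
    and ix: "is_index B ix nr (length xs) pos"
    and B: "int N + \<bar>off\<bar> \<le> int B" "length v + wl * length xs < B" "4 \<le> B"
  shows "hoare B (emit W N off nr a ix) ((length xs + 1) * (6 + pcost (emit_body W N off a ix))) s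
    (\<lambda>s'. outputs s' (v @ concat (map W xs)) \<and> keeps {1, 2} {1} s s')"
proof -
  let ?n = "length xs" and ?b = "emit_body W N off a ix" and ?g = "Bin Less (Reg 2) (Reg nr)"
  let ?w = "\<lambda>i. v @ concat (map W (take i xs))"
  have lw: "length (?w i) \<le> length v + wl * i" if "i \<le> ?n" for i
    using that
  proof (induction i)
    case (Suc i)
    have "length (W (xs ! i)) \<le> wl" using xs Suc.prems by simp
    with Suc show ?case by (simp add: take_Suc_conv_app_nth)
  qed simp
  define I where "I = (\<lambda>r s'. r \<le> ?n \<and> reg s' 2 = int (?n - r) \<and> outputs s' (?w (?n - r)) \<and> keeps {1, 2} {1} s s')"
  have "hoare B (While ?g ?b) ((?n + 1) * (1 + ecost ?g + pcost ?b)) s1 (I 0)" if "I ?n s1" for s1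
  proof (rule hoare_While[where I = I, OF _ _ that])
    fix r s' assume I: "I (Suc r) s'"
    define i where "i = ?n - Suc r"
    have i: "i < ?n" "?n - r = Suc i" using I by (auto simp: i_def I_def)
    have r2: "reg s' 2 = int i" and o: "outputs s' (?w i)" and K: "keeps {1, 2} {1} s s'"
      using I by (simp_all add: I_def i_def[symmetric])
    have A: "arr s' a = arr s a" "reg s' nr = int ?n" using K n a by (auto simp: keeps_def)
    have rda: "arr s a (int (pos i)) = xs ! i" using a(1) i by (simp add: holds_def)
    have ixs: "safe B ix s'" "val ix s' = int (pos i)" "pos i < B"
      using ix[unfolded is_index_def, rule_format, of i s'] i r2 A by auto
    have xi: "0 \<le> xs ! i + off" "xs ! i + off < int N" "length (W (xs ! i)) \<le> wl" using xs[of "xs ! i"] i by auto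
    let ?e = "Bin Add (Read a ix) (Const off)"
    have e: "safe B ?e s'" "val ?e s' = xs ! i + off"
      using ixs A rda xi B by (auto simp: addr_def intro!: fits_small)
    have ln: "length (?w i) + length (W (xs ! i)) < B"
    proof -
      have "wl * i + wl \<le> wl * ?n" using i by (metis Suc_leI mult_Suc_right add.commute mult_le_mono2)
      then show ?thesis using lw[of i] xi(3) i B(2) by linarith
    qed
    have w: "?w (Suc i) = ?w i @ W (xs ! i)" using i by (simp add: take_Suc_conv_app_nth)
    have "wp B (emit_tab (\<lambda>i. W (i - off)) N ?e) (wp B (Assign 2 (Bin Add (Reg 2) (Const 1))) (I r)) s'"
    proof (rule wp_emit_tab[OF o _ B(3) e(1)])
      fix s'' assume o2: "outputs s'' (?w i @ W (val ?e s' - off))" and k: "keeps {1} {1} s' s''"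
      have r: "reg s'' 2 = int i" using k r2 by (auto simp: keeps_def)
      have "keeps {1, 2} {1} s s''" using K k unfolding keeps_def by auto
      moreover have "outputs s'' (?w (Suc i))" using o2 unfolding w e(2) by simp
      ultimately have "I r (s''\<lparr>reg := (reg s'')(2 := int i + 1)\<rparr>)"
        using i by (auto simp: I_def keeps_def outputs_def)
      then show "wp B (Assign 2 (Bin Add (Reg 2) (Const 1))) (I r) s''"
        using r i len B(3) by (auto intro!: fits_small)
    qed (use ln xi B e in auto)
    then have "wp B ?b (I r) s'" by (simp add: emit_body_def)
    then show "safe B ?g s' \<and> val ?g s' \<noteq> 0 \<and> hoare B ?b (pcost ?b) s' (I r)"
      using r2 A i len B by (auto intro!: fits_small hoare_wp)
  next
    fix s' assume "I 0 s'"
    then show "safe B ?g s' \<and> val ?g s' = 0" using n len B by (auto simp: I_def keeps_def intro!: fits_small)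
  qed
  moreover have "hoare B (Assign 2 (Const 0)) (pcost (Assign 2 (Const 0))) s (I ?n)"
    by (rule hoare_wp) (use n out in \<open>auto simp: I_def keeps_def outputs_def intro!: fits_small\<close>)
  ultimately have "hoare B (emit W N off nr a ix)
      (pcost (Assign 2 (Const 0)) + (?n + 1) * (1 + ecost ?g + pcost ?b)) s (I 0)"
    unfolding emit_def by (intro hoare_Seq)
  then show ?thesis by (rule hoare_mono) (auto simp: I_def algebra_simps)
qed

subsection \<open>Reading the input\<close>

definition thc :: "stab \<Rightarrow> int" where
  "thc \<theta> = (case \<theta> of Up \<Rightarrow> 1 | Down \<Rightarrow> 2)"

lemma thc_simps [simp]: "thc Up = 1" "thc Down = 2" "thc \<theta> = thc \<eta> \<longleftrightarrow> \<theta> = \<eta>" "0 < thc \<theta>" "thc \<theta> \<le> 2" "thc \<theta> \<noteq> 0"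
  by (cases \<theta>; cases \<eta>; simp add: thc_def)+

text \<open>The stack occupies the cells from 1 on, so that a test of the top entry of the empty stack
  reads the cell 0, which contains the code of no stable letter.\<close>

definition conf_rep :: "state \<Rightarrow> (int \<times> stab) list \<times> int \<Rightarrow> bool" where
  "conf_rep s c \<longleftrightarrow> reg s 3 = int (length (fst c)) \<and> reg s 4 = snd c \<and> arr s 3 0 = 0 \<and>
     (\<forall>i<length (fst c). arr s 2 (int (Suc i)) = fst (rev (fst c) ! i) \<and> arr s 3 (int (Suc i)) = thc (snd (rev (fst c) ! i)))"

lemma conf_rep_Cons: "conf_rep s ((r, \<theta>) # st, x) \<longleftrightarrow> reg s 3 = int (Suc (length st)) \<and> reg s 4 = x \<and> arr s 3 0 = 0 \<and>
    arr s 2 (int (Suc (length st))) = r \<and> arr s 3 (int (Suc (length st))) = thc \<theta> \<and>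
    (\<forall>i<length st. arr s 2 (int (Suc i)) = fst (rev st ! i) \<and> arr s 3 (int (Suc i)) = thc (snd (rev st ! i)))"
  unfolding conf_rep_def by (auto simp: nth_append less_Suc_eq)

lemma abs_div_le: "0 < m \<Longrightarrow> \<bar>x div m\<bar> \<le> \<bar>x\<bar>" for x m :: int
proof -
  assume m: "0 < m"
  show ?thesis
  proof (cases "0 \<le> x")
    case True
    have "x div m \<le> x" using True m by (metis div_by_1 int_one_le_iff_zero_less zdiv_mono2 zero_less_one)
    moreover have "0 \<le> x div m" using True m by (simp add: pos_imp_zdiv_nonneg_iff)
    ultimately show ?thesis using True by simp
  next
    case False
    have "x * m \<le> x * 1" using False m by (intro mult_left_mono_neg) auto
    then have "x * m div m \<le> x div m" using m by (intro zdiv_mono1) auto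
    then have "x \<le> x div m" using m by simp
    moreover have "x div m < 0" using False m by (simp add: pos_imp_zdiv_neg_iff)
    ultimately show ?thesis using False by simp
  qed
qed

lemma conf_rep_tl:
  assumes "conf_rep s (b # st, x)" "reg s2 3 = int (length st)" "arr s2 2 = arr s 2" "arr s2 3 = arr s 3"
  shows "conf_rep s2 (st, reg s2 4)"
proof -
  obtain r \<theta> where b: "b = (r, \<theta>)" by (cases b)
  show ?thesis using assms(1)[unfolded b conf_rep_Cons] assms(2-4) by (simp add: conf_rep_def)
qed

lemma wp_mono: "wp B c R1 s \<Longrightarrow> (\<And>s'. R1 s' \<Longrightarrow> R2 s') \<Longrightarrow> wp B c R2 s"
proof (induction c arbitrary: s R1 R2)
  case (Seq c1 c2)
  from Seq.prems(1) have "wp B c1 (wp B c2 R1) s" by simp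
  then have "wp B c1 (wp B c2 R2) s" by (rule Seq.IH(1)) (erule Seq.IH(2), rule Seq.prems(2))
  then show ?case by simp
next
  case (Cond e c1 c2)
  have "wp B c1 R1 s \<Longrightarrow> wp B c1 R2 s" by (erule Cond.IH(1)) (rule Cond.prems(2))
  moreover have "wp B c2 R1 s \<Longrightarrow> wp B c2 R2 s" by (erule Cond.IH(2)) (rule Cond.prems(2))
  ultimately show ?case using Cond.prems(1) by (simp split: if_splits)
qed simp_all

context BS
begin

section \<open>Reading one stable letter on the machine\<close>

definition top_test :: "stab \<Rightarrow> expr" where
  "top_test \<theta> = Bin Mul (Bin Equal (Read 3 (Reg 3)) (Const (thc (flip \<theta>)))) (Bin Equal (Bin Mod (Reg 4) (Const (modulus \<theta>))) (Const 0))"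

definition pop_prog :: "stab \<Rightarrow> prog" where
  "pop_prog \<theta> = Seq (Assign 4 (Bin Add (Read 2 (Reg 3)) (Bin Mul (Const (modulus (flip \<theta>))) (Bin Div (Reg 4) (Const (modulus \<theta>))))))
     (Assign 3 (Bin Sub (Reg 3) (Const 1)))"

definition push_prog :: "stab \<Rightarrow> prog" where
  "push_prog \<theta> = Seq (Assign 3 (Bin Add (Reg 3) (Const 1))) (Seq (Write 2 (Reg 3) (Bin Mod (Reg 4) (Const (modulus \<theta>))))
     (Seq (Write 3 (Reg 3) (Const (thc \<theta>))) (Assign 4 (Bin Mul (Const (modulus (flip \<theta>))) (Bin Div (Reg 4) (Const (modulus \<theta>)))))))"

definition stab_prog :: "stab \<Rightarrow> prog" where
  "stab_prog \<theta> = Cond (top_test \<theta>) (pop_prog \<theta>) (push_prog \<theta>)"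

lemma modulus_abs [simp]: "\<bar>modulus \<theta>\<bar> = modulus \<theta>"
  by (cases \<theta>) auto

lemma modulus_le: "modulus \<theta> \<le> Q"
  using p_less_q by (cases \<theta>) auto

lemma modulus_div: "\<bar>modulus (flip \<theta>) * (x div modulus \<theta>)\<bar> \<le> Q * \<bar>x\<bar>"
  unfolding abs_mult using abs_div_le[of "modulus \<theta>" x] modulus_le[of "flip \<theta>"] modulus_pos(1)[of "flip \<theta>"]
  by (intro mult_mono) auto

text \<open>The bound \<open>2 * Q * (\<bar>snd c\<bar> + 1)\<close> covers all large intermediate
  values of one step; residues and addresses are small anyway.\<close>

lemma wp_stab:
  assumes rep: "conf_rep s c" and valid: "valid_stack (fst c)" and len: "Suc (length (fst c)) < B"
    and x: "\<And>v. \<bar>v\<bar> \<le> 2 * Q * (\<bar>snd c\<bar> + 1) \<Longrightarrow> fits B v" and B: "q \<le> B" "2 \<le> B"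
  shows "wp B (stab_prog \<theta>) (\<lambda>s'. conf_rep s' (stab_step \<theta> c) \<and> keeps {3, 4} {2, 3} s s') s"
proof -
  obtain st x where c: "c = (st, x)" by (cases c)
  have r3: "reg s 3 = int (length st)" and r4: "reg s 4 = x" and a30: "arr s 3 0 = 0" using rep by (auto simp: conf_rep_def c)
  have Qx: "Q * \<bar>x\<bar> + 2 * Q \<le> 2 * Q * (\<bar>x\<bar> + 1)" by (simp add: distrib_left)
  have "\<bar>x\<bar> \<le> Q * \<bar>x\<bar>" using q_pos mult_right_mono[of 1 Q "\<bar>x\<bar>"] by simp
  with Qx q_pos have fx: "fits B x" by (intro x) (auto simp: c)
  have fdiv: "fits B (x div modulus \<theta>)"
    using abs_div_le[of "modulus \<theta>" x] \<open>\<bar>x\<bar> \<le> Q * \<bar>x\<bar>\<close> Qx q_pos by (intro x) (auto simp: c)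
  have mdB: "modulus \<eta> \<le> int B" for \<eta> using modulus_le[of \<eta>] B by simp
  have fm: "fits B (modulus \<eta>)" for \<eta> using mdB[of \<eta>] modulus_pos(1)[of \<eta>] by (intro fits_small) simp
  have "0 \<le> x mod modulus \<theta>" "x mod modulus \<theta> < modulus \<theta>" by simp_all
  then have fmod: "fits B (x mod modulus \<theta>)" using mdB[of \<theta>] by (intro fits_small) linarith
  have fmul: "fits B (modulus (flip \<theta>) * (x div modulus \<theta>))" using modulus_div[of \<theta> x] Qx q_pos by (intro x) (auto simp: c)
  have ft: "fits B (thc \<eta>)" for \<eta> using B by (cases \<eta>) (auto intro!: fits_small)
  have top: "st \<noteq> [] \<Longrightarrow> arr s 3 (int (length st)) = thc (snd (hd st))" "st \<noteq> [] \<Longrightarrow> arr s 2 (int (length st)) = fst (hd st)"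
    using rep unfolding c by (cases st; simp add: conf_rep_Cons split: prod.splits; cases "hd st"; simp add: conf_rep_Cons)+
  have a3: "arr s 3 (int (length st)) = (if st = [] then 0 else thc (snd (hd st)))" using top(1) a30 by simp
  have test: "safe B (top_test \<theta>) s" "val (top_test \<theta>) s \<noteq> 0 \<longleftrightarrow> pops \<theta> c"
  proof -
    show "safe B (top_test \<theta>) s"
      unfolding top_test_def using r3 r4 a3 len fx fmod fm ft B by (auto simp: c addr_def intro!: fits_small)
    show "val (top_test \<theta>) s \<noteq> 0 \<longleftrightarrow> pops \<theta> c"
      unfolding top_test_def using r3 r4 a3 by (cases st) (auto simp: c dvd_eq_mod_eq_0)
  qed
  show ?thesis
  proof (cases "pops \<theta> c")
    case True
    then obtain r st' k where st: "st = (r, flip \<theta>) # st'" and xk: "x = modulus \<theta> * k" unfolding c by (rule pops_cases)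
    have r: "0 \<le> r" "r < Q" using valid modulus_le[of "flip \<theta>"] by (auto simp: c st)
    have sum: "fits B (r + modulus (flip \<theta>) * (x div modulus \<theta>))" using modulus_div[of \<theta> x] Qx r by (intro x) (auto simp: c)
    have rB: "fits B r" using r B by (intro fits_small) auto
    have s2: "stab_step \<theta> c = (st', r + modulus (flip \<theta>) * (x div modulus \<theta>))" using True by (simp add: stab_step_def c st)
    let ?z = "r + modulus (flip \<theta>) * (x div modulus \<theta>)"
    let ?s2 = "s\<lparr>reg := (reg s)(4 := ?z, 3 := int (length st'))\<rparr>"
    have "conf_rep ?s2 (st', ?z)"
      using conf_rep_tl[of s "(r, flip \<theta>)" st' x ?s2] rep by (simp add: c st)
    moreover have "arr s 2 (int (Suc (length st'))) = r" "reg s 3 = int (Suc (length st'))" using top(2) r3 by (simp_all add: st)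
    ultimately have "wp B (pop_prog \<theta>) (\<lambda>s'. conf_rep s' (st', ?z) \<and> keeps {3, 4} {2, 3} s s') s"
      using r4 len fx fm fdiv fmul sum rB unfolding pop_prog_def
      by (auto simp: c st addr_def keeps_def intro!: fits_small)
    then have "wp B (pop_prog \<theta>) (\<lambda>s'. conf_rep s' (stab_step \<theta> c) \<and> keeps {3, 4} {2, 3} s s') s" unfolding s2 .
    with test True show ?thesis by (simp add: stab_prog_def)
  next
    case False
    have s2: "stab_step \<theta> c = ((x mod modulus \<theta>, \<theta>) # st, modulus (flip \<theta>) * (x div modulus \<theta>))" using False by (simp add: stab_step_def c)
    have "wp B (push_prog \<theta>) (\<lambda>s'. conf_rep s' (stab_step \<theta> c) \<and> keeps {3, 4} {2, 3} s s') s"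
      using rep r3 r4 len fx fm fdiv fmul fmod ft unfolding s2 push_prog_def
      by (auto simp: c conf_rep_def nth_append less_Suc_eq addr_def keeps_def intro!: fits_small)
    with test False show ?thesis by (simp add: stab_prog_def)
  qed
qed

definition read_body :: prog where
  "read_body = Seq (Cond (Bin Equal (Read 0 (Reg 2)) (Const 1)) (stab_prog Up)
     (Cond (Bin Equal (Read 0 (Reg 2)) (Const 2)) (stab_prog Down)
     (Cond (Bin Equal (Read 0 (Reg 2)) (Const 3)) (Assign 4 (Bin Add (Reg 4) (Const 1))) (Assign 4 (Bin Sub (Reg 4) (Const 1))))))
     (Assign 2 (Bin Add (Reg 2) (Const 1)))"

definition read_prog :: prog where
  "read_prog = While (Bin Less (Reg 2) (Reg 0)) read_body"

text \<open>The integer grows by a factor of at most \<open>2 q\<close> per letter, so its bit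
  length stays linear in the input length.\<close>

lemma run_bound: "valid_stack (fst c) \<Longrightarrow> \<bar>snd (step l c)\<bar> + 1 \<le> 2 * Q * (\<bar>snd c\<bar> + 1)"
proof -
  assume valid: "valid_stack (fst c)"
  obtain st x where c: "c = (st, x)" by (cases c)
  have Q2: "2 \<le> Q" using q_pos by simp
  have "2 * \<bar>x\<bar> \<le> Q * \<bar>x\<bar>" using Q2 by (intro mult_right_mono) auto
  moreover have "\<bar>snd (stab_step \<theta> c)\<bar> \<le> Q * \<bar>x\<bar> + Q" for \<theta>
  proof (cases "pops \<theta> c")
    case True
    then obtain r st' k where st: "st = (r, flip \<theta>) # st'" unfolding c by (rule pops_cases)
    have "0 \<le> r" "r < Q" using valid modulus_le[of "flip \<theta>"] by (auto simp: c st)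
    moreover have "snd (stab_step \<theta> c) = r + modulus (flip \<theta>) * (x div modulus \<theta>)" using True by (simp add: stab_step_def c st)
    ultimately show ?thesis using modulus_div[of \<theta> x] by simp
  next
    case False
    then have "snd (stab_step \<theta> c) = modulus (flip \<theta>) * (x div modulus \<theta>)" by (simp add: stab_step_def c)
    then show ?thesis using modulus_div[of \<theta> x] by simp
  qed
  from this[of Up] this[of Down] have "\<bar>snd (stab_step Up c)\<bar> \<le> Q * \<bar>x\<bar> + Q" "\<bar>snd (stab_step Down c)\<bar> \<le> Q * \<bar>x\<bar> + Q" by auto
  moreover have "2 * Q * (\<bar>snd c\<bar> + 1) = Q * \<bar>x\<bar> + Q * \<bar>x\<bar> + 2 * Q" by (simp add: c distrib_left)
  moreover have "snd (step l c) = x + 1 \<or> snd (step l c) = x - 1 \<or> snd (step l c) = snd (stab_step Up c) \<or>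
    snd (step l c) = snd (stab_step Down c)" by (cases l) (simp_all add: c)
  ultimately show ?thesis using Q2 by (elim disjE) linarith+
qed

lemma run_bounds:
  "valid_stack (fst (run w ([], 0)))" "\<bar>snd (run w ([], 0))\<bar> + 1 \<le> (2 * Q) ^ length w"
  "length (fst (run w ([], 0))) \<le> length w"
proof -
  have "valid_stack (fst (run w ([], 0))) \<and> \<bar>snd (run w ([], 0))\<bar> + 1 \<le> (2 * Q) ^ length w"
  proof (induction w rule: rev_induct)
    case (snoc l w)
    let ?c = "run w ([], 0)"
    have "\<bar>snd (step l ?c)\<bar> + 1 \<le> 2 * Q * (\<bar>snd ?c\<bar> + 1)" using run_bound snoc by blast
    also have "\<dots> \<le> 2 * Q * (2 * Q) ^ length w" using snoc by (intro mult_left_mono) auto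
    finally show ?case using snoc valid_step by simp
  qed simp
  then show "valid_stack (fst (run w ([], 0)))" "\<bar>snd (run w ([], 0))\<bar> + 1 \<le> (2 * Q) ^ length w" by auto
  have "stabs w \<le> length w" by (simp add: stabs_def)
  then show "length (fst (run w ([], 0))) \<le> length w" using length_nf_le[of w] by (simp add: nf_def)
qed

lemma pow2Q_mono: "i \<le> j \<Longrightarrow> (2 * Q) ^ i \<le> (2 * Q) ^ j"
  using q_pos by (intro power_increasing) auto

lemma hoare_read:
  assumes s: "reg s 0 = int (length w)" "reg s 2 = 0" "conf_rep s ([], 0)"
    "\<And>i. i < length w \<Longrightarrow> arr s 0 (int i) = int (code (w ! i))"
    and B: "Suc (length w) < B" "q \<le> B" "4 \<le> B" and fit: "\<And>v. \<bar>v\<bar> \<le> (2 * Q) ^ Suc (length w) \<Longrightarrow> fits B v"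
  shows "hoare B read_prog ((length w + 1) * (4 + pcost read_body)) s
    (\<lambda>s'. conf_rep s' (nf w) \<and> keeps {2, 3, 4} {2, 3} s s')"
proof -
  let ?n = "length w" and ?g = "Bin Less (Reg 2) (Reg 0)"
  let ?c = "\<lambda>i. run (take i w) ([], 0)"
  define I where "I = (\<lambda>r s'. r \<le> ?n \<and> reg s' 2 = int (?n - r) \<and> conf_rep s' (?c (?n - r)) \<and> keeps {2, 3, 4} {2, 3} s s')"
  have "hoare B read_prog ((?n + 1) * (1 + ecost ?g + pcost read_body)) s (I 0)"
    unfolding read_prog_def
  proof (rule hoare_While[where I = I])
    show "I ?n s" using s by (simp add: I_def keeps_def)
  next
    fix r s' assume I: "I (Suc r) s'"
    define i where "i = ?n - Suc r"
    have i: "i < ?n" "?n - r = Suc i" using I by (auto simp: i_def I_def)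
    have r2: "reg s' 2 = int i" and rep: "conf_rep s' (?c i)" and K: "keeps {2, 3, 4} {2, 3} s s'"
      using I by (simp_all add: I_def i_def[symmetric])
    have r0: "reg s' 0 = int ?n" and a0: "arr s' 0 (int i) = int (code (w ! i))"
      using K s(1) s(4)[OF i(1)] by (auto simp: keeps_def)
    have b: "valid_stack (fst (?c i))" "\<bar>snd (?c i)\<bar> + 1 \<le> (2 * Q) ^ i" "length (fst (?c i)) \<le> i"
      using run_bounds[of "take i w"] i by simp_all
    have "2 * Q * (\<bar>snd (?c i)\<bar> + 1) \<le> 2 * Q * (2 * Q) ^ i" using b(2) by (intro mult_left_mono) auto
    also have "\<dots> \<le> (2 * Q) ^ Suc ?n" using pow2Q_mono[of "Suc i" "Suc ?n"] i by simp
    finally have fitx: "fits B v" if "\<bar>v\<bar> \<le> 2 * Q * (\<bar>snd (?c i)\<bar> + 1)" for v using that fit by simp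
    have Qx: "\<bar>snd (?c i)\<bar> + 2 \<le> 2 * Q * (\<bar>snd (?c i)\<bar> + 1)"
      using mult_right_mono[of 2 "2 * Q" "\<bar>snd (?c i)\<bar> + 1"] q_pos by simp
    have suc: "?c (Suc i) = step (w ! i) (?c i)" using i by (simp add: take_Suc_conv_app_nth)
    define R where "R = (\<lambda>s1. conf_rep s1 (?c (Suc i)) \<and> keeps {3, 4} {2, 3} s' s1)"
    have stab: "wp B (stab_prog \<theta>) R s'" if "w ! i = sl \<theta>" for \<theta>
      using wp_stab[OF rep b(1) _ fitx, of \<theta>] b(3) i B that unfolding R_def suc by simp
    have fx: "fits B (snd (?c i))" "fits B (snd (?c i) + 1)" "fits B (snd (?c i) - 1)"
      using Qx by (auto intro!: fitx)
    have r4: "reg s' 4 = snd (?c i)" using rep by (simp add: conf_rep_def)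
    have cl: "code (w ! i) \<le> 4" by (cases "w ! i") auto
    have rd: "safe B (Read 0 (Reg 2)) s'" "val (Read 0 (Reg 2)) s' = int (code (w ! i))"
      using r2 a0 i B cl by (auto simp: addr_def intro!: fits_small)
    have final: "wp B (Assign 2 (Bin Add (Reg 2) (Const 1))) (I r) s1" if "R s1" for s1
    proof -
      have "reg s1 2 = int i" using that r2 by (auto simp: R_def keeps_def)
      then show ?thesis using that K i B by (auto simp: R_def I_def keeps_def conf_rep_def intro!: fits_small)
    qed
    have mono: "wp B c R s1 \<Longrightarrow> wp B c (wp B (Assign 2 (Bin Add (Reg 2) (Const 1))) (I r)) s1" for c s1
      by (erule wp_mono) (rule final)
    have upd: "conf_rep (s'\<lparr>reg := (reg s')(4 := z)\<rparr>) (fst (?c i), z)" "keeps {3, 4} {2, 3} s' (s'\<lparr>reg := (reg s')(4 := z)\<rparr>)" for z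
      using rep by (auto simp: conf_rep_def keeps_def)
    have sm: "fits B 1" "fits B 2" "fits B 3" "fits B 0" using B by (auto intro!: fits_small)
    have "wp B read_body (I r) s'"
      unfolding read_body_def wp.simps(4)
    proof (rule mono)
      show "wp B (Cond (Bin Equal (Read 0 (Reg 2)) (Const 1)) (stab_prog Up)
         (Cond (Bin Equal (Read 0 (Reg 2)) (Const 2)) (stab_prog Down)
         (Cond (Bin Equal (Read 0 (Reg 2)) (Const 3)) (Assign 4 (Bin Add (Reg 4) (Const 1))) (Assign 4 (Bin Sub (Reg 4) (Const 1)))))) R s'"
        using rd stab[of Up] stab[of Down] fx sm r4 upd[of "snd (?c i) + 1"] upd[of "snd (?c i) - 1"] suc
        by (cases "w ! i") (simp_all add: R_def del: take_Suc_conv_app_nth)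
    qed
    then show "safe B ?g s' \<and> val ?g s' \<noteq> 0 \<and> hoare B read_body (pcost read_body) s' (I r)"
      using r2 r0 i B by (auto intro!: fits_small hoare_wp)
  next
    fix s' assume "I 0 s'"
    then show "safe B ?g s' \<and> val ?g s' = 0" using s B by (auto simp: I_def keeps_def intro!: fits_small)
  qed
  then show ?thesis by (rule hoare_mono) (auto simp: I_def nf_def algebra_simps)
qed

section \<open>Unrolling the descent on the machine\<close>

definition unroll_body :: prog where
  "unroll_body = Seq (Write 5 (Reg 6) (Bin Mod (Bin Sub (Const 0) (Reg 4)) (Const Q)))
     (Seq (Assign 4 (Bin Sub (Read 2 (Reg 3)) (Bin Mul (Const P) (Bin Div (Bin Sub (Const 0) (Reg 4)) (Const Q)))))
     (Seq (Assign 3 (Bin Sub (Reg 3) (Const 1))) (Assign 6 (Bin Add (Reg 6) (Const 1)))))"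

text \<open>The constant 2 is \<open>thc Down\<close>. The loop stops at the first entry for
  \<open>t\<close> or, on an empty stack, at the zero in cell 0.\<close>

definition unroll_prog :: prog where
  "unroll_prog = While (Bin Equal (Read 3 (Reg 3)) (Const 2)) unroll_body"

text \<open>Each unrolled entry may contribute another factor \<open>2 q\<close>. There are at most
  \<open>n\<close> of them, so the exponent at most doubles.\<close>

lemma hoare_unroll:
  assumes rep: "conf_rep s (map (\<lambda>d. (d, Down)) ds @ ups us, x)" and r6: "reg s 6 = 0"
    and un: "unroll (map (\<lambda>d. (d, Down)) ds @ ups us, x) = (rs, (ups us, x0))"
    and ds: "set ds \<subseteq> {0..<Q}" and x: "\<bar>x\<bar> + 1 \<le> (2 * Q) ^ n" and len: "length ds + length us \<le> n"
    and B: "Suc n < B" "q \<le> B" "4 \<le> B" and fit: "\<And>v. \<bar>v\<bar> \<le> (2 * Q) ^ Suc (2 * n) \<Longrightarrow> fits B v"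
  shows "hoare B unroll_prog ((length ds + 1) * (5 + pcost unroll_body)) s
    (\<lambda>s'. conf_rep s' (ups us, x0) \<and> reg s' 6 = int (length rs) \<and> holds s' 5 (\<lambda>i. i) rs \<and> length rs = length ds \<and>
      \<bar>x0\<bar> + 1 \<le> (2 * Q) ^ (2 * n) \<and> keeps {3, 4, 6} {5} s s')"
proof -
  let ?g = "Bin Equal (Read 3 (Reg 3)) (Const 2)"
  define I where "I = (\<lambda>r s'. \<exists>ds' x' rs1 rs2. conf_rep s' (map (\<lambda>d. (d, Down)) ds' @ ups us, x') \<and>
    unroll (map (\<lambda>d. (d, Down)) ds' @ ups us, x') = (rs2, (ups us, x0)) \<and> rs = rs1 @ rs2 \<and> reg s' 6 = int (length rs1) \<and>
    holds s' 5 (\<lambda>i. i) rs1 \<and> length ds' = r \<and> length rs1 + r = length ds \<and> set ds' \<subseteq> {0..<Q} \<and>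
    \<bar>x'\<bar> + 1 \<le> (2 * Q) ^ (n + length rs1) \<and> keeps {3, 4, 6} {5} s s')"
  have "hoare B unroll_prog ((length ds + 1) * (1 + ecost ?g + pcost unroll_body)) s (I 0)"
    unfolding unroll_prog_def
  proof (rule hoare_While[where I = I])
    have "conf_rep s (map (\<lambda>d. (d, Down)) ds @ ups us, x) \<and> unroll (map (\<lambda>d. (d, Down)) ds @ ups us, x) = (rs, (ups us, x0)) \<and>
      rs = [] @ rs \<and> reg s 6 = int (length ([] :: int list)) \<and> holds s 5 (\<lambda>i. i) [] \<and> length ds = length ds \<and>
      length ([] :: int list) + length ds = length ds \<and> set ds \<subseteq> {0..<Q} \<and> \<bar>x\<bar> + 1 \<le> (2 * Q) ^ (n + length ([] :: int list)) \<and>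
      keeps {3, 4, 6} {5} s s"
      using rep un ds x r6 by (simp add: holds_def keeps_def)
    then show "I (length ds) s" unfolding I_def by blast
  next
    fix r s' assume "I (Suc r) s'"
    then obtain ds0 x' rs1 rs2 where rep': "conf_rep s' (map (\<lambda>d. (d, Down)) ds0 @ ups us, x')"
      and un': "unroll (map (\<lambda>d. (d, Down)) ds0 @ ups us, x') = (rs2, (ups us, x0))" and rs: "rs = rs1 @ rs2"
      and r6': "reg s' 6 = int (length rs1)" and h: "holds s' 5 (\<lambda>i. i) rs1" and l0: "length ds0 = Suc r"
      and l1: "length rs1 + Suc r = length ds" and ds0: "set ds0 \<subseteq> {0..<Q}"
      and x': "\<bar>x'\<bar> + 1 \<le> (2 * Q) ^ (n + length rs1)" and K: "keeps {3, 4, 6} {5} s s'"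
      unfolding I_def by blast
    from l0 obtain d ds' where ds0': "ds0 = d # ds'" and l2: "length ds' = r" by (cases ds0) auto
    let ?st = "map (\<lambda>d. (d, Down)) ds' @ ups us"
    define y where "y = d - P * ((- x') div Q)"
    from un' obtain rs3 where un3: "unroll (?st, y) = (rs3, (ups us, x0))" and rs2: "rs2 = (- x') mod Q # rs3"
      by (auto simp: ds0' y_def Let_def split: prod.splits)
    have d: "0 \<le> d" "d < Q" using ds0 by (auto simp: ds0')
    from rep' have rr: "reg s' 3 = int (Suc (length ?st))" "reg s' 4 = x'" "arr s' 2 (int (Suc (length ?st))) = d"
      "arr s' 3 (int (Suc (length ?st))) = 2"
      unfolding ds0' list.map append_Cons conf_rep_Cons by simp_all
    have tl: "conf_rep s2 (?st, reg s2 4)"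
      if "reg s2 3 = int (length ?st)" "arr s2 2 = arr s' 2" "arr s2 3 = arr s' 3" for s2
      using rep' unfolding ds0' list.map append_Cons by (rule conf_rep_tl) (rule that)+
    have Pd: "\<bar>P * ((- x') div Q)\<bar> \<le> Q * \<bar>x'\<bar>"
      unfolding abs_mult using abs_div_le[of Q "- x'"] q_pos p_less_q by (intro mult_mono) auto
    have Q2: "2 \<le> Q" using q_pos by simp
    have y1: "\<bar>y\<bar> + 1 \<le> 2 * Q * (\<bar>x'\<bar> + 1)"
    proof -
      have "\<bar>y\<bar> \<le> Q + Q * \<bar>x'\<bar>" using Pd d by (simp add: y_def)
      moreover have "2 * Q * (\<bar>x'\<bar> + 1) = Q * \<bar>x'\<bar> + Q * \<bar>x'\<bar> + 2 * Q" by (simp add: distrib_left)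
      moreover have "0 \<le> Q * \<bar>x'\<bar>" by simp
      ultimately show ?thesis using Q2 by linarith
    qed
    have pw: "2 * Q * (\<bar>x'\<bar> + 1) \<le> (2 * Q) ^ Suc (n + length rs1)" using x' by (simp add: mult_left_mono)
    have pw2: "(2 * Q) ^ Suc (n + length rs1) \<le> (2 * Q) ^ Suc (2 * n)" using l1 len by (intro pow2Q_mono) simp
    have fitx: "fits B v" if "\<bar>v\<bar> \<le> 2 * Q * (\<bar>x'\<bar> + 1)" for v using that pw pw2 by (intro fit) linarith
    have Qx: "\<bar>x'\<bar> \<le> Q * \<bar>x'\<bar>" using mult_right_mono[of 1 Q "\<bar>x'\<bar>"] Q2 by simp
    have e2: "2 * Q * (\<bar>x'\<bar> + 1) = Q * \<bar>x'\<bar> + Q * \<bar>x'\<bar> + 2 * Q" by (simp add: distrib_left)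
    have nn: "0 \<le> Q * \<bar>x'\<bar>" by simp
    have "\<bar>(- x') div Q\<bar> \<le> \<bar>- x'\<bar>" using Q2 by (intro abs_div_le) simp
    then have "\<bar>x'\<bar> \<le> 2 * Q * (\<bar>x'\<bar> + 1)" "\<bar>- x'\<bar> \<le> 2 * Q * (\<bar>x'\<bar> + 1)"
      "\<bar>(- x') div Q\<bar> \<le> 2 * Q * (\<bar>x'\<bar> + 1)" "\<bar>P * ((- x') div Q)\<bar> \<le> 2 * Q * (\<bar>x'\<bar> + 1)"
      "\<bar>y\<bar> \<le> 2 * Q * (\<bar>x'\<bar> + 1)"
      using Qx e2 nn Q2 y1 Pd by linarith+
    note f = this[THEN fitx]
    have "0 \<le> (- x') mod Q" "(- x') mod Q < Q" using Q2 by simp_all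
    then have fm: "fits B ((- x') mod Q)" using B by (intro fits_small) linarith
    have fc: "fits B P" "fits B Q" "fits B 0" "fits B 1" "fits B 2" "fits B d"
      using B p_less_q d by (auto intro!: fits_small)
    have ln: "length ?st < n" using l1 len l2 by (simp add: ups_def)
    have lr: "length rs1 < n" using l1 len by simp
    have fn: "fits B (int (Suc (length ?st)))" "fits B (int (length ?st))" "fits B (int (length rs1))" "fits B (int (length rs1) + 1)"
      using ln lr B by (auto intro!: fits_small simp del: length_append length_map)
    have ad: "addr B (int (Suc (length ?st)))" "addr B (int (length rs1))" using ln lr B
      by (auto simp: addr_def simp del: length_append length_map)
    define s2 where "s2 = s'\<lparr>arr := (arr s')(5 := (arr s' 5)(int (length rs1) := (- x') mod Q)),
      reg := (reg s')(4 := y, 3 := int (length ?st), 6 := int (length rs1) + 1)\<rparr>"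
    have "I r s2"
    proof -
      have "conf_rep s2 (?st, y)" using tl[of s2] by (simp add: s2_def)
      moreover have "holds s2 5 (\<lambda>i. i) (rs1 @ [(- x') mod Q])" using h by (auto simp: s2_def holds_def nth_append less_Suc_eq)
      moreover have "keeps {3, 4, 6} {5} s s2" using K by (auto simp: keeps_def s2_def)
      moreover have "\<bar>y\<bar> + 1 \<le> (2 * Q) ^ (n + length (rs1 @ [(- x') mod Q]))" using y1 pw by simp
      moreover have "set ds' \<subseteq> {0..<Q}" using ds0 by (simp add: ds0')
      moreover have "rs = (rs1 @ [(- x') mod Q]) @ rs3" by (simp add: rs rs2)
      moreover have "reg s2 6 = int (length (rs1 @ [(- x') mod Q]))" by (simp add: s2_def)
      moreover have "length (rs1 @ [(- x') mod Q]) + r = length ds" using l1 by simp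
      ultimately show ?thesis unfolding I_def using un3 l2 by blast
    qed
    moreover have "wp B unroll_body (\<lambda>s. s = s2) s'"
      unfolding unroll_body_def using rr r6' f fm fc fn ad Q2
      by (simp add: s2_def y_def fun_upd_twist del: length_append length_map)
    moreover have "wp B unroll_body (\<lambda>s. s = s2) s' \<Longrightarrow> I r s2 \<Longrightarrow> wp B unroll_body (I r) s'"
      unfolding unroll_body_def by simp
    ultimately have "wp B unroll_body (I r) s'" by blast
    then show "safe B ?g s' \<and> val ?g s' \<noteq> 0 \<and> hoare B unroll_body (pcost unroll_body) s' (I r)"
      using rr fn(1) ad(1) fc B by (auto intro!: hoare_wp fits_small simp del: length_append length_map)
  next
    fix s' assume "I 0 s'"
    then have rep': "conf_rep s' (ups us, x0)" and K: "keeps {3, 4, 6} {5} s s'" by (auto simp: I_def)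
    have "arr s' 3 (int (length us)) \<noteq> 2" "\<bar>arr s' 3 (int (length us))\<bar> \<le> 2" "reg s' 3 = int (length us)"
    proof -
      have "arr s' 3 (int (length us)) = (if us = [] then 0 else 1)"
      proof (cases us rule: rev_cases)
        case (snoc vs v)
        then have "ups us = (v, Up) # ups vs" "length (ups vs) = length vs" by (simp_all add: ups_def)
        with rep' show ?thesis by (simp add: conf_rep_Cons snoc)
      qed (use rep' in \<open>simp add: conf_rep_def ups_def\<close>)
      then show "arr s' 3 (int (length us)) \<noteq> 2" "\<bar>arr s' 3 (int (length us))\<bar> \<le> 2" by auto
      show "reg s' 3 = int (length us)" using rep' by (simp add: conf_rep_def ups_def)
    qed
    then show "safe B ?g s' \<and> val ?g s' = 0" using len B by (auto simp: addr_def intro!: fits_small)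
  qed
  moreover have "length rs = length ds \<and> \<bar>x0\<bar> + 1 \<le> (2 * Q) ^ (2 * n)" if "I 0 s'" for s'
  proof -
    from that have "length rs = length ds" "\<bar>x0\<bar> + 1 \<le> (2 * Q) ^ (n + length rs)" by (auto simp: I_def)
    moreover have "(2 * Q) ^ (n + length ds) \<le> (2 * Q) ^ (2 * n)" using len by (intro pow2Q_mono) simp
    ultimately show ?thesis by auto
  qed
  ultimately show ?thesis by (elim hoare_mono) (auto simp: I_def algebra_simps)
qed

section \<open>The climb: contraction and number of steps\<close>

definition climb_body :: prog where
  "climb_body = Seq (Write 6 (Reg 7) (Bin Mod (Reg 4) (Const Q)))
     (Seq (Assign 4 (Bin Mul (Const P) (Bin Div (Reg 4) (Const Q)))) (Assign 7 (Bin Add (Reg 7) (Const 1))))"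

definition climb_prog :: prog where
  "climb_prog = While (Bin Add (Bin Less (Const M) (Reg 4)) (Bin Less (Reg 4) (Const (- M)))) climb_body"

text \<open>Up to rounding the factor is \<open>p / q\<close>, at most \<open>(q - 1) / q\<close>.
  The weaker factor \<open>(2 q - 1) / (2 q)\<close> absorbs the rounding as long as
  \<open>|x|\<close> exceeds \<open>M\<close>.\<close>

lemma climb_contract:
  assumes "M < \<bar>x\<bar>"
  shows "2 * Q * \<bar>P * (x div Q)\<bar> \<le> (2 * Q - 1) * \<bar>x\<bar>"
proof -
  have "\<bar>x div Q\<bar> * Q \<le> \<bar>x\<bar> + Q"
  proof -
    have "\<bar>x div Q\<bar> * Q = \<bar>x div Q * Q\<bar>" by (simp add: abs_mult)
    also have "x div Q * Q = x - x mod Q" by (simp add: minus_mod_eq_div_mult)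
    also have "\<bar>x - x mod Q\<bar> \<le> \<bar>x\<bar> + Q"
    proof -
      have "0 \<le> x mod Q" "x mod Q < Q" using q_pos by simp_all
      then show ?thesis by linarith
    qed
    finally show ?thesis .
  qed
  then have "P * (\<bar>x div Q\<bar> * Q) \<le> (Q - 1) * (\<bar>x\<bar> + Q)" using p_less_q q_pos by (intro mult_mono) auto
  moreover have "Q * Q \<le> \<bar>x\<bar>" "8 * (Q * Q) \<le> \<bar>x\<bar>" using assms by (auto simp: M_def)
  ultimately show ?thesis by (simp add: abs_mult algebra_simps)
qed

lemma climb_contract': "M < \<bar>x\<bar> \<Longrightarrow> \<bar>P * (x div Q)\<bar> \<le> \<bar>x\<bar>"
proof -
  assume "M < \<bar>x\<bar>"
  then have "2 * Q * \<bar>P * (x div Q)\<bar> \<le> 2 * Q * \<bar>x\<bar>" using climb_contract[of x] by (simp add: algebra_simps)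
  then show ?thesis using q_pos by simp
qed

lemma climb_exists_pow:
  "\<bar>x\<bar> * (2 * Q - 1) ^ j < (2 * Q) ^ j \<Longrightarrow> \<exists>rs y. climb x rs y \<and> length rs \<le> j"
proof (induction j arbitrary: x)
  case 0
  then have "climb x [] x" by (intro climb_stop) (simp add: M_def)
  then show ?case by auto
next
  case (Suc j)
  show ?case
  proof (cases "\<bar>x\<bar> \<le> M")
    case True
    then show ?thesis by (intro exI[of _ "[]"] exI[of _ x]) (simp add: climb_stop)
  next
    case False
    let ?x = "P * (x div Q)"
    have "(2 * Q * \<bar>?x\<bar>) * (2 * Q - 1) ^ j \<le> ((2 * Q - 1) * \<bar>x\<bar>) * (2 * Q - 1) ^ j"
      using climb_contract[of x] False q_pos by (intro mult_right_mono zero_le_power) auto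
    also have "\<dots> < 2 * Q * (2 * Q) ^ j" using Suc.prems by (simp add: mult_ac)
    finally have "2 * Q * (\<bar>?x\<bar> * (2 * Q - 1) ^ j) < 2 * Q * (2 * Q) ^ j" by (simp only: mult.assoc)
    then have "\<bar>?x\<bar> * (2 * Q - 1) ^ j < (2 * Q) ^ j" using q_pos by simp
    from Suc.IH[OF this] obtain rs y where "climb ?x rs y" "length rs \<le> j" by blast
    then show ?thesis using climb_step[of x rs y] False by (intro exI[of _ "x mod Q # rs"] exI[of _ y]) auto
  qed
qed

text \<open>By Bernoulli's inequality \<open>2 q\<close> steps at least halve the integer, so
  \<open>2 q\<close> steps per bit suffice.\<close>

lemma climb_exists:
  assumes "\<bar>x\<bar> < 2 ^ b"
  shows "\<exists>rs y. climb x rs y \<and> length rs \<le> 2 * q * b"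
proof (rule climb_exists_pow)
  have Q2: "2 \<le> Q" using q_pos by simp
  have bern: "2 * (2 * Q - 1) ^ (2 * q) \<le> (2 * Q) ^ (2 * q)"
  proof -
    let ?r = "real_of_int (2 * Q - 1)"
    have pos: "0 < ?r" using Q2 by simp
    have "1 + real (2 * q) * (1 / ?r) \<le> (1 + 1 / ?r) ^ (2 * q)"
    proof (rule Bernoulli_inequality)
      have "0 \<le> 1 / ?r" using pos by simp
      then show "- 1 \<le> 1 / ?r" by linarith
    qed
    moreover have "1 \<le> real (2 * q) * (1 / ?r)" using pos by (simp add: field_simps)
    ultimately have "2 \<le> (1 + 1 / ?r) ^ (2 * q)" by linarith
    then have "2 * ?r ^ (2 * q) \<le> (1 + 1 / ?r) ^ (2 * q) * ?r ^ (2 * q)" using pos by (intro mult_right_mono) auto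
    also have "\<dots> = ((1 + 1 / ?r) * ?r) ^ (2 * q)" by (simp add: power_mult_distrib)
    also have "(1 + 1 / ?r) * ?r = real_of_int (2 * Q)" using pos by (simp add: distrib_right)
    finally have "real_of_int (2 * (2 * Q - 1) ^ (2 * q)) \<le> real_of_int ((2 * Q) ^ (2 * q))" by simp
    then show ?thesis by (simp only: of_int_le_iff)
  qed
  have "\<bar>x\<bar> * (2 * Q - 1) ^ (2 * q * b) < 2 ^ b * (2 * Q - 1) ^ (2 * q * b)"
    using assms Q2 by (intro mult_strict_right_mono) auto
  also have "\<dots> = (2 * (2 * Q - 1) ^ (2 * q)) ^ b" by (simp add: power_mult_distrib power_mult)
  also have "\<dots> \<le> ((2 * Q) ^ (2 * q)) ^ b" using bern Q2 by (intro power_mono) auto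
  finally show "\<bar>x\<bar> * (2 * Q - 1) ^ (2 * q * b) < (2 * Q) ^ (2 * q * b)" by (simp add: power_mult)
qed

lemma hoare_climb:
  assumes r: "reg s 4 = x" "reg s 7 = 0" and climb: "climb x rs y"
    and B: "Suc (length rs) < B" "nat M \<le> B" "q \<le> B" and fit: "\<And>v. \<bar>v\<bar> \<le> \<bar>x\<bar> \<Longrightarrow> fits B v"
  shows "hoare B climb_prog ((length rs + 1) * (8 + pcost climb_body)) s
    (\<lambda>s'. reg s' 4 = y \<and> reg s' 7 = int (length rs) \<and> holds s' 6 (\<lambda>i. i) rs \<and> keeps {4, 7} {6} s s')"
proof -
  let ?g = "Bin Add (Bin Less (Const M) (Reg 4)) (Bin Less (Reg 4) (Const (- M)))"
  define I where "I = (\<lambda>r s'. \<exists>rs1 rs2 x'. rs = rs1 @ rs2 \<and> climb x' rs2 y \<and> reg s' 4 = x' \<and> \<bar>x'\<bar> \<le> \<bar>x\<bar> \<and>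
    reg s' 7 = int (length rs1) \<and> holds s' 6 (\<lambda>i. i) rs1 \<and> length rs2 = r \<and> keeps {4, 7} {6} s s')"
  have MB: "\<bar>M\<bar> + 1 \<le> int B + 1" using B(2) by (simp add: M_def nat_le_iff)
  have B1: "1 \<le> B" using B(1) by simp
  have g: "safe B ?g s'" "val ?g s' \<noteq> 0 \<longleftrightarrow> M < \<bar>reg s' 4\<bar>" if "\<bar>reg s' 4\<bar> \<le> \<bar>x\<bar>" for s'
    using that MB B(1) fit by (auto intro!: fits_small)
  have "hoare B climb_prog ((length rs + 1) * (1 + ecost ?g + pcost climb_body)) s (I 0)"
    unfolding climb_prog_def
  proof (rule hoare_While[where I = I])
    show "I (length rs) s" unfolding I_def using r climb
      by (intro exI[of _ "[]"] exI[of _ rs] exI[of _ x]) (simp add: holds_def keeps_def)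
  next
    fix r s' assume "I (Suc r) s'"
    then obtain rs1 rs2 x' where rs: "rs = rs1 @ rs2" and cl: "climb x' rs2 y" and r4: "reg s' 4 = x'" and x': "\<bar>x'\<bar> \<le> \<bar>x\<bar>"
      and r7: "reg s' 7 = int (length rs1)" and h: "holds s' 6 (\<lambda>i. i) rs1" and l: "length rs2 = Suc r"
      and K: "keeps {4, 7} {6} s s'" unfolding I_def by blast
    from cl l obtain rs3 where rs2: "rs2 = x' mod Q # rs3" and big: "M < \<bar>x'\<bar>" and cl3: "climb (P * (x' div Q)) rs3 y"
      by (cases rule: climb.cases) auto
    have f: "fits B x'" "fits B (x' div Q)" "fits B (P * (x' div Q))"
      using x' abs_div_le[of Q x'] climb_contract'[OF big] q_pos by (auto intro!: fit)
    have "0 \<le> x' mod Q" "x' mod Q < Q" using q_pos by simp_all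
    then have "fits B (x' mod Q)" using B by (intro fits_small) linarith
    moreover have "fits B P" "fits B Q" "fits B 1" "fits B (int (length rs1))" "fits B (int (length rs1) + 1)"
      using B p_less_q by (auto simp: rs intro!: fits_small)
    ultimately have fc: "fits B P" "fits B Q" "fits B 1" "fits B (x' mod Q)" "fits B (int (length rs1))"
      "fits B (int (length rs1) + 1)" by auto
    have ad: "addr B (int (length rs1))" using B by (simp add: addr_def rs)
    let ?s2 = "s'\<lparr>arr := (arr s')(6 := (arr s' 6)(int (length rs1) := x' mod Q)),
      reg := (reg s')(4 := P * (x' div Q), 7 := int (length rs1) + 1)\<rparr>"
    have "I r ?s2" unfolding I_def
      using rs rs2 cl3 climb_contract'[OF big] x' h l K
      by (intro exI[of _ "rs1 @ [x' mod Q]"] exI[of _ rs3] exI[of _ "P * (x' div Q)"])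
        (auto simp: holds_def nth_append less_Suc_eq keeps_def)
    then have "wp B climb_body (I r) s'"
      unfolding climb_body_def using r4 r7 f fc ad q_pos by simp
    then show "safe B ?g s' \<and> val ?g s' \<noteq> 0 \<and> hoare B climb_body (pcost climb_body) s' (I r)"
      using g[of s'] r4 x' big hoare_wp by simp
  next
    fix s' assume "I 0 s'"
    then obtain x' where cl: "climb x' [] y" and r4: "reg s' 4 = x'" and x': "\<bar>x'\<bar> \<le> \<bar>x\<bar>" by (auto simp: I_def)
    from cl have "\<bar>x'\<bar> \<le> M" by (cases rule: climb.cases) auto
    then show "safe B ?g s' \<and> val ?g s' = 0" using g[of s'] r4 x' by auto
  qed
  moreover have "reg s' 4 = y" if "I 0 s'" for s'
  proof -
    from that obtain x' where cl: "climb x' [] y" and r4: "reg s' 4 = x'" by (auto simp: I_def)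
    from cl r4 show ?thesis by (cases rule: climb.cases) auto
  qed
  ultimately show ?thesis by (elim hoare_mono) (auto simp: I_def algebra_simps)
qed

end

subsection \<open>Codes for cost profiles\<close>

context BS
begin

text \<open>The Lipschitz constant \<open>q\<close> times the diameter of the window.\<close>

abbreviation spread :: int where "spread \<equiv> 2 * Q * K2"

text \<open>Optimal steps depend on a cost profile on \<open>{-k..k}\<close> only up to an additive constant, and the
  Lipschitz property bounds its variation: finitely many codes suffice, so that a pass over the
  digits is the run of a finite automaton.\<close>

lemma profile_codes:
  "\<exists>N dec. 0 < N \<and> (\<forall>k F. 0 \<le> k \<longrightarrow> k \<le> K2 \<longrightarrow> (\<forall>t\<in>{-k..k}. \<forall>t'\<in>{-k..k}. F t \<le> F t' + spread) \<longrightarrow>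
     (\<exists>e\<in>{0..<int N}. \<exists>c. \<forall>t\<in>{-k..k}. F t = dec e t + (c::int)))"
proof -
  \<comment> \<open>Profiles normalised to minimum 0 and set to 0 outside the window; there are
    finitely many.\<close>
  define PF where "PF = {f :: int \<Rightarrow> int. \<forall>t. (t \<in> {-K2..K2} \<longrightarrow> f t \<in> {0..spread}) \<and> (t \<notin> {-K2..K2} \<longrightarrow> f t = 0)}"
  have fin: "finite PF" unfolding PF_def by (rule finite_set_of_finite_funs) auto
  then obtain h where h: "bij_betw h {0..<card PF} PF" using ex_bij_betw_nat_finite by blast
  have "(\<lambda>_. 0) \<in> PF" using K2_nonneg by (simp add: PF_def)
  then have pos: "0 < card PF" using fin by (auto simp: card_gt_0_iff)
  have "\<exists>e\<in>{0..<int (card PF)}. \<exists>c. \<forall>t\<in>{-k..k}. F t = h (nat e) t + c"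
    if k: "0 \<le> k" "k \<le> K2" and F: "\<forall>t\<in>{-k..k}. \<forall>t'\<in>{-k..k}. F t \<le> F t' + spread" for k and F :: "int \<Rightarrow> int"
  proof -
    define m where "m = Min (F ` {-k..k})"
    have "m \<in> F ` {-k..k}" unfolding m_def using k by (intro Min_in) auto
    then obtain t0 where t0: "m = F t0" "t0 \<in> {-k..k}" by (rule imageE)
    have m: "m \<le> F t" "F t \<le> m + spread" if "t \<in> {-k..k}" for t
    proof -
      show "m \<le> F t" unfolding m_def using that by (intro Min_le) auto
      show "F t \<le> m + spread" unfolding t0(1) using F that t0(2) by blast
    qed
    \<comment> \<open>A profile on a smaller window is extended by its boundary values, so that the
      same codes serve the windows of radius \<open>K\<close> and \<open>K2\<close>.\<close>
    define f where "f = (\<lambda>t. if t \<in> {-K2..K2} then F (max (- k) (min k t)) - m else 0)"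
    have "max (- k) (min k t) \<in> {-k..k}" for t using k by auto
    then have "f \<in> PF" using m unfolding PF_def f_def by (simp add: algebra_simps)
    then have "f \<in> h ` {0..<card PF}" using h by (simp add: bij_betw_def)
    then obtain i where i: "i < card PF" "h i = f" by auto
    have "F t = h (nat (int i)) t + m" if "t \<in> {-k..k}" for t
    proof -
      have "max (- k) (min k t) = t" using that by auto
      then show ?thesis using that k by (simp add: i f_def)
    qed
    then show ?thesis using i(1) by (intro bexI[of _ "int i"] exI[of _ m]) auto
  qed
  then show ?thesis using pos by (intro exI[of _ "card PF"] exI[of _ "\<lambda>e. h (nat e)"]) blast
qed

end

locale coded = BS p q for p q +
  fixes N :: nat and dec :: "int \<Rightarrow> int \<Rightarrow> int"
  assumes N_pos: "0 < N"
    and codes: "\<And>k F. 0 \<le> k \<Longrightarrow> k \<le> K2 \<Longrightarrow> \<forall>t\<in>{-k..k}. \<forall>t'\<in>{-k..k}. F t \<le> F t' + spread \<Longrightarrow>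
      \<exists>e\<in>{0..<int N}. \<exists>c. \<forall>t\<in>{-k..k}. F t = dec e t + c"
begin

section \<open>Cost profiles as states of finite automata\<close>

definition rep :: "int \<Rightarrow> int \<Rightarrow> (int \<Rightarrow> int) \<Rightarrow> bool" where
  "rep k e F \<longleftrightarrow> e \<in> {0..<int N} \<and> (\<exists>c. \<forall>t\<in>{-k..k}. F t = dec e t + c)"

text \<open>The default keeps the value in the range of codes even for functions without a code, so
  tables can be filled in everywhere.\<close>

definition enc :: "int \<Rightarrow> (int \<Rightarrow> int) \<Rightarrow> int" where
  "enc k F = (if \<exists>e. rep k e F then SOME e. rep k e F else 0)"

lemma enc_range: "enc k F \<in> {0..<int N}"
proof (cases "\<exists>e. rep k e F")
  case True
  then have "rep k (SOME e. rep k e F) F" by (rule someI_ex)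
  with True show ?thesis by (simp add: enc_def rep_def)
qed (use N_pos in \<open>auto simp: enc_def\<close>)

lemma enc_small: "N \<le> B \<Longrightarrow> \<bar>enc k F\<bar> \<le> int B"
  using enc_range[of k F] by auto

lemma rep_enc:
  assumes "0 \<le> k" "k \<le> K2" "\<And>t t'. t \<in> {-k..k} \<Longrightarrow> t' \<in> {-k..k} \<Longrightarrow> F t \<le> F t' + spread"
  shows "rep k (enc k F) F"
proof -
  have ex: "\<exists>e. rep k e F" using codes[of k F] assms unfolding rep_def by blast
  then have "rep k (SOME e. rep k e F) F" by (rule someI_ex)
  with ex show ?thesis by (simp add: enc_def)
qed

lemma rep_shift:
  assumes "rep k e F" "\<And>t. t \<in> {-k..k} \<Longrightarrow> F' t = F t + c"
  shows "rep k e F'"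
proof -
  obtain c' where "\<forall>t\<in>{-k..k}. F t = dec e t + c'" using assms(1) by (auto simp: rep_def)
  then have "\<forall>t\<in>{-k..k}. F' t = dec e t + (c' + c)" using assms(2) by auto
  then show ?thesis using assms(1) unfolding rep_def by blast
qed

lemma lipschitz_spread:
  assumes "\<And>s t. (F s::int) \<le> F t + Q * \<bar>t - s\<bar>" "t \<in> {-k..k}" "t' \<in> {-k..k}" "k \<le> K2"
  shows "F t \<le> F t' + spread"
proof -
  have "Q * \<bar>t' - t\<bar> \<le> Q * (2 * K2)" using assms by (intro mult_left_mono) auto
  with assms(1)[of t t'] show ?thesis by (simp add: mult_ac)
qed

lemma rep_enc_lipschitz:
  assumes "0 \<le> k" "k \<le> K2" "\<And>s t. F s \<le> F t + Q * \<bar>t - s\<bar>"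
  shows "rep k (enc k F) F"
  using assms lipschitz_spread[OF assms(3) _ _ assms(2)] by (intro rep_enc) auto

lemma P_Q_lipschitz: "(F s::int) \<le> F t + P * \<bar>t - s\<bar> \<Longrightarrow> F s \<le> F t + Q * \<bar>t - s\<bar>"
  using p_less_q mult_right_mono[of P Q "\<bar>t - s\<bar>"] by simp

lemma dd_lipschitz: "dd = shift_digit \<or> dd = lift_digit \<Longrightarrow> \<bar>dd x s t\<bar> \<le> \<bar>dd x s' t\<bar> + Q * \<bar>s' - s\<bar>"
proof (elim disjE)
  assume "dd = shift_digit"
  moreover have "shift_digit x s t = shift_digit x s' t + P * (s - s')" by (simp add: shift_digit_def algebra_simps)
  moreover have "P * \<bar>s' - s\<bar> \<le> Q * \<bar>s' - s\<bar>" using p_less_q by (intro mult_right_mono) auto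
  ultimately show ?thesis using abs_triangle_ineq[of "shift_digit x s' t" "P * (s - s')"]
    by (simp add: abs_mult abs_minus_commute)
next
  assume "dd = lift_digit"
  moreover have "lift_digit x s t = lift_digit x s' t + Q * (s' - s)" by (simp add: lift_digit_def shift_digit_def algebra_simps)
  ultimately show ?thesis using abs_triangle_ineq[of "lift_digit x s' t" "Q * (s' - s)"] by (simp add: abs_mult)
qed

text \<open>This holds for every \<open>F\<close>, as a minimum of Lipschitz functions of
  \<open>s\<close> is Lipschitz. So whatever profile a code stands for, the profile after one step
  has a code again.\<close>

lemma cost_step_lipschitz:
  assumes "0 \<le> k" "dd = shift_digit \<or> dd = lift_digit"
  shows "cost_step dd k F x s \<le> cost_step dd k F x s' + Q * \<bar>s' - s\<bar>"
proof -
  obtain t where t: "t \<in> {-k..k}" "cost_step dd k F x s' = F t + \<bar>dd x s' t\<bar>" using cost_step_attained[OF assms(1)] by metis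
  show ?thesis using cost_step_le[OF t(1), of dd F x s] dd_lipschitz[OF assms(2), of x s t s'] t(2) by simp
qed

text \<open>The transition function of the automaton. It works with the decoded profile, which
  differs from the true one by a constant only.\<close>

definition ft :: "(int \<Rightarrow> int \<Rightarrow> int \<Rightarrow> int) \<Rightarrow> int \<Rightarrow> int \<Rightarrow> int \<Rightarrow> int" where
  "ft dd k e x = enc k (cost_step dd k (dec e) x)"

definition st :: "(int \<Rightarrow> int \<Rightarrow> int \<Rightarrow> int) \<Rightarrow> int \<Rightarrow> (int \<Rightarrow> nat) \<Rightarrow> int \<Rightarrow> int \<Rightarrow> int \<Rightarrow> int" where
  "st dd k rk e x s = opt_step dd k rk (dec e) x s"

lemma rep_ft:
  assumes "0 \<le> k" "k \<le> K2" "dd = shift_digit \<or> dd = lift_digit" "rep k e F"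
  shows "rep k (ft dd k e x) (cost_step dd k F x)"
proof -
  obtain c where c: "\<And>t. t \<in> {-k..k} \<Longrightarrow> F t = dec e t + c" using assms(4) by (auto simp: rep_def)
  have "rep k (ft dd k e x) (cost_step dd k (dec e) x)"
    unfolding ft_def by (intro rep_enc_lipschitz assms(1,2) cost_step_lipschitz[OF assms(1,3)])
  then show ?thesis by (rule rep_shift) (rule cost_step_shift[OF assms(1) c])
qed

lemma rep_foldr:
  assumes "0 \<le> k" "k \<le> K2" "dd = shift_digit \<or> dd = lift_digit" "rep k e F"
  shows "rep k (foldr (\<lambda>x e. ft dd k e x) xs e) (opt_cost dd k F xs)"
proof (induction xs)
  case (Cons x xs)
  have "opt_cost dd k F (x # xs) = cost_step dd k (opt_cost dd k F xs) x" by (simp add: fun_eq_iff)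
  then show ?case using rep_ft[OF assms(1-3) Cons, of x] by simp
qed (use assms in \<open>simp add: fun_eq_iff\<close>)

lemma follow_opt_path:
  assumes "0 \<le> k"
  shows "length es = length xs \<Longrightarrow> (\<And>j. j < length xs \<Longrightarrow> rep k (es ! j) (opt_cost dd k F (drop (Suc j) xs))) \<Longrightarrow>
    follow (st dd k rk) es xs s = opt_path dd k rk F s xs"
proof (induction es xs arbitrary: s rule: list_induct2)
  case (Cons e es x xs)
  obtain c where "\<And>t. t \<in> {-k..k} \<Longrightarrow> opt_cost dd k F xs t = dec e t + c"
    using Cons.prems[of 0] by (auto simp: rep_def)
  from opt_step_shift[OF assms this, where dd = dd and rk = rk and x = x and s = s]
  have "st dd k rk e x s = opt_step dd k rk (opt_cost dd k F xs) x s" by (simp add: st_def)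
  moreover have "follow (st dd k rk) es xs t = opt_path dd k rk F t xs" for t
    using Cons.prems[of "Suc _"] by (intro Cons.IH) auto
  ultimately show ?case by (simp add: Let_def)
qed simp

end

subsection \<open>Running times\<close>

text \<open>If no loops are nested and each loop is passed less than \<open>Z\<close> times, then \<open>Z * loop_cost c\<close>
  bounds the running time; the 8 covers the guard.\<close>

fun loop_cost :: "prog \<Rightarrow> nat" where
  "loop_cost (Seq c1 c2) = loop_cost c1 + loop_cost c2"
| "loop_cost (While e c) = 8 + pcost c"
| "loop_cost c = pcost c"

definition runs :: "nat \<Rightarrow> nat \<Rightarrow> prog \<Rightarrow> state \<Rightarrow> state \<Rightarrow> bool" where
  "runs B Z c s s' \<longleftrightarrow> (\<exists>k. k \<le> Z * loop_cost c \<and> exec B c s k s')"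

lemma runs_Seq: "runs B Z c1 s s1 \<Longrightarrow> runs B Z c2 s1 s2 \<Longrightarrow> runs B Z (Seq c1 c2) s s2"
proof -
  assume "runs B Z c1 s s1" "runs B Z c2 s1 s2"
  then obtain k1 k2 where "k1 \<le> Z * loop_cost c1" "exec B c1 s k1 s1" "k2 \<le> Z * loop_cost c2" "exec B c2 s1 k2 s2"
    unfolding runs_def by blast
  then show ?thesis unfolding runs_def
    by (intro exI[of _ "k1 + k2"] conjI ex_Seq[of B c1 s k1 s1]) (simp_all add: distrib_left)
qed

lemma runs_hoare:
  assumes "hoare B c ((m + 1) * a) s R" "m + 1 \<le> Z" "a \<le> loop_cost c"
  shows "\<exists>s'. runs B Z c s s' \<and> R s'"
proof -
  obtain k s' where k: "exec B c s k s'" "k \<le> (m + 1) * a" "R s'" using assms(1) unfolding hoare_def by blast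
  have "(m + 1) * a \<le> Z * loop_cost c" using assms(2,3) by (rule mult_le_mono)
  with k show ?thesis unfolding runs_def using le_trans by blast
qed

lemma runs_Assign: "safe B e s \<Longrightarrow> 1 \<le> Z \<Longrightarrow> runs B Z (Assign x e) s (s\<lparr>reg := (reg s)(x := val e s)\<rparr>)"
  unfolding runs_def by (intro exI[of _ "1 + ecost e"] conjI ex_Assign)
    (use mult_le_mono1[of 1 Z "1 + ecost e"] in simp_all)

definition tab2 :: "(int \<Rightarrow> int \<Rightarrow> int) \<Rightarrow> nat \<Rightarrow> nat \<Rightarrow> expr \<Rightarrow> expr \<Rightarrow> expr" where
  "tab2 ft N m e1 e2 = tab (\<lambda>i. ft (i div int m) (i mod int m)) (N * m) (pair (int m) e1 e2)"

lemma runs_tab2: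
  assumes "safe B e1 s" "safe B e2 s" "val e1 s \<in> {0..<int N}" "val e2 s \<in> {0..<int m}" "N * m \<le> B"
    "\<And>e x. e \<in> {0..<int N} \<Longrightarrow> x \<in> {0..<int m} \<Longrightarrow> \<bar>ft e x\<bar> \<le> int B" "1 \<le> Z"
  shows "\<exists>s'. runs B Z (Assign r (tab2 ft N m e1 e2)) s s' \<and> reg s' r = ft (val e1 s) (val e2 s) \<and> keeps {r} {} s s'"
  using runs_Assign[of B "tab2 ft N m e1 e2" s Z r] tab2_safe[where ft = ft, OF assms(1-6)] assms(7)
  by (intro exI[of _ "s\<lparr>reg := (reg s)(r := val (tab2 ft N m e1 e2) s)\<rparr>"]) (simp add: keeps_def tab2_def)

lemma runs_tab:
  assumes "safe B e s" "0 \<le> val e s" "val e s < int n" "n \<le> B" "\<And>i. i < n \<Longrightarrow> \<bar>f (int i)\<bar> \<le> int B" "1 \<le> Z"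
  shows "\<exists>s'. runs B Z (Assign r (tab f n e)) s s' \<and> reg s' r = f (val e s) \<and> keeps {r} {} s s'"
  using runs_Assign[OF safe_tab[where f = f and n = n, OF assms(1) _ assms(4)] assms(6), of r] assms(2,3,5)
  by (intro exI[of _ "s\<lparr>reg := (reg s)(r := val (tab f n e) s)\<rparr>"]) (simp add: keeps_def val_tab)

lemma runs_Assign_ex:
  assumes "safe B e s" "1 \<le> Z"
  shows "\<exists>s'. runs B Z (Assign r e) s s' \<and> reg s' r = val e s \<and> keeps {r} {} s s'"
  using runs_Assign[OF assms, of r] by (intro exI[of _ "s\<lparr>reg := (reg s)(r := val e s)\<rparr>"]) (simp add: keeps_def)

lemma holds_keeps: "holds s a pos xs \<Longrightarrow> keeps X A s s' \<Longrightarrow> a \<notin> A \<Longrightarrow> holds s' a pos xs"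
  by (simp add: holds_def keeps_def)

lemma outputs_keeps: "outputs s v \<Longrightarrow> keeps X A s s' \<Longrightarrow> 1 \<notin> X \<Longrightarrow> 1 \<notin> A \<Longrightarrow> outputs s' v"
  by (simp add: outputs_def keeps_def)

lemma reg_keeps: "keeps X A s s' \<Longrightarrow> x \<notin> X \<Longrightarrow> reg s' x = reg s x"
  by (simp add: keeps_def)

context coded
begin

abbreviation kk :: nat where "kk \<equiv> nat K"
abbreviation kk2 :: nat where "kk2 \<equiv> nat K2"
abbreviation mm :: nat where "mm \<equiv> nat M"

lemma int_kk [simp]: "int kk = K" "int kk2 = K2" "int mm = M"
  by (simp_all add: M_def)

lemma runs_pass:
  assumes "reg s nr = int (length xs)" "nr \<noteq> 2" "nr \<noteq> 5" "length xs < B" "holds s a pos xs" "a \<noteq> 7" "digits xs"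
    "is_index B ix nr (length xs) pos" "N * q \<le> B" "N \<le> B" "q \<le> B" "length xs + 1 \<le> Z"
    and k: "0 \<le> k" "k \<le> K2" and dd: "dd = shift_digit \<or> dd = lift_digit" and rep: "rep k (reg s 5) F"
  shows "\<exists>s'. runs B Z (pass (ft dd k) N q nr a ix) s s' \<and> rep k (reg s' 5) (opt_cost dd k F xs) \<and>
    (\<forall>j<length xs. rep k (arr s' 7 (int j)) (opt_cost dd k F (drop (Suc j) xs))) \<and> keeps {2, 5} {7} s s'"
proof -
  have "reg s 5 \<in> {0..<int N}" using rep by (simp add: rep_def)
  moreover have "1 \<le> B" using assms(10) N_pos by simp
  ultimately have "hoare B (pass (ft dd k) N q nr a ix) ((length xs + 1) * (4 + pcost (pass_body (ft dd k) N q a ix))) s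
    (\<lambda>s'. reg s' 5 = foldr (\<lambda>x e. ft dd k e x) xs (reg s 5) \<and>
      (\<forall>j<length xs. arr s' 7 (int j) = foldr (\<lambda>x e. ft dd k e x) (drop (Suc j) xs) (reg s 5)) \<and>
      keeps {2, 5} {7} s s')"
    using assms enc_range by (intro hoare_pass) (unfold ft_def, assumption?, simp_all del: atLeastLessThan_iff)
  from runs_hoare[OF this assms(12)] obtain s' where "runs B Z (pass (ft dd k) N q nr a ix) s s'"
    "reg s' 5 = foldr (\<lambda>x e. ft dd k e x) xs (reg s 5)"
    "\<forall>j<length xs. arr s' 7 (int j) = foldr (\<lambda>x e. ft dd k e x) (drop (Suc j) xs) (reg s 5)" "keeps {2, 5} {7} s s'"
    by (auto simp: pass_def)
  then show ?thesis using rep_foldr[OF k dd rep] by (intro exI[of _ s']) simp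
qed

lemma runs_trace:
  assumes "reg s nr = int (length xs)" "nr \<notin> {2, 10, 12}" "length xs < B" "holds s a pos xs" "b \<noteq> 7" "b \<noteq> a" "digits xs"
    "is_index B ix nr (length xs) pos" "N * q * (2 * k + 1) \<le> B" "N \<le> B" "3 * q + 2 * q * k + k \<le> B" "length xs + 1 \<le> Z"
    and codes: "\<forall>j<length xs. rep (int k) (arr s 7 (int j)) (opt_cost dd (int k) F (drop (Suc j) xs))"
    and dd: "dd = affine c d" "\<bar>c\<bar> \<le> Q" "\<bar>d\<bar> \<le> Q" and s10: "reg s 10 \<in> {- int k..int k}"
  shows "\<exists>s'. runs B Z (trace (st dd (int k) rk) N q k c d nr a b ix) s s' \<and>
    reg s' 10 = endst (reg s 10) (opt_path dd (int k) rk F (reg s 10) xs) \<and>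
    holds s' b (\<lambda>i. i) (new_digits dd (reg s 10) xs (opt_path dd (int k) rk F (reg s 10) xs)) \<and> keeps {2, 10, 12} {b} s s'"
proof -
  define es where "es = map (\<lambda>j. arr s 7 (int j)) [0..<length xs]"
  have es: "length es = length xs" "holds s 7 (\<lambda>i. i) es" by (simp_all add: es_def holds_def)
  have esr: "rep (int k) (es ! j) (opt_cost dd (int k) F (drop (Suc j) xs))" if "j < length xs" for j
    using codes that by (simp add: es_def)
  have tr: "follow (st dd (int k) rk) es xs (reg s 10) = opt_path dd (int k) rk F (reg s 10) xs"
    using esr by (rule follow_opt_path[OF of_nat_0_le_iff es(1)])
  have "set es \<subseteq> {0..<int N}"
  proof
    fix e assume "e \<in> set es"
    then obtain j where "j < length xs" "e = es ! j" using es(1) by (metis in_set_conv_nth)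
    then show "e \<in> {0..<int N}" using esr[of j] by (simp add: rep_def)
  qed
  moreover have "nat \<bar>c\<bar> * k \<le> q * k" "nat \<bar>d\<bar> * k \<le> q * k" using dd by (auto intro!: mult_le_mono1)
  then have "q + nat \<bar>c\<bar> * k + nat \<bar>d\<bar> * k + nat \<bar>c\<bar> + nat \<bar>d\<bar> + k \<le> B" using assms(11) dd by linarith
  moreover have "1 \<le> B" "q \<le> B" using assms(10,11) N_pos by simp_all
  moreover have "st dd (int k) rk e x s \<in> {- int k..int k}" for e x s
    unfolding st_def by (rule opt_step_props(1)) simp
  ultimately have "hoare B (trace (st dd (int k) rk) N q k c d nr a b ix)
    ((length xs + 1) * (6 + pcost (trace_body (st dd (int k) rk) N q k c d a b ix))) s
    (\<lambda>s'. reg s' 10 = endst (reg s 10) (follow (st dd (int k) rk) es xs (reg s 10)) \<and>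
      holds s' b (\<lambda>i. i) (new_digits (affine c d) (reg s 10) xs (follow (st dd (int k) rk) es xs (reg s 10))) \<and>
      keeps {2, 10, 12} {b} s s')"
    using assms es by (intro hoare_trace) auto
  moreover have "6 + pcost (trace_body (st dd (int k) rk) N q k c d a b ix) \<le> loop_cost (trace (st dd (int k) rk) N q k c d nr a b ix)"
    by (simp add: trace_def)
  ultimately show ?thesis
    unfolding tr unfolding dd(1) by (rule runs_hoare[OF _ assms(12)])
qed

lemma runs_emit:
  assumes "outputs s v" "reg s nr = int (length xs)" "nr \<notin> {1, 2}" "length xs < B" "holds s a pos xs" "a \<noteq> 1"
    "\<And>x. x \<in> set xs \<Longrightarrow> 0 \<le> x + off \<and> x + off < int n \<and> length (W x) \<le> wl"
    "is_index B ix nr (length xs) pos" "int n + \<bar>off\<bar> \<le> int B" "length v + wl * length xs < B" "4 \<le> B" "length xs + 1 \<le> Z"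
  shows "\<exists>s'. runs B Z (emit W n off nr a ix) s s' \<and> outputs s' (v @ concat (map W xs)) \<and> keeps {1, 2} {1} s s'"
proof (rule runs_hoare[OF _ assms(12)])
  show "hoare B (emit W n off nr a ix) ((length xs + 1) * (6 + pcost (emit_body W n off a ix))) s
    (\<lambda>s'. outputs s' (v @ concat (map W xs)) \<and> keeps {1, 2} {1} s s')"
    using assms(7) by (rule hoare_emit[OF assms(1-6) _ assms(8-11)])
  show "6 + pcost (emit_body W n off a ix) \<le> loop_cost (emit W n off nr a ix)"
    by (simp add: emit_def)
qed

end

lemma keeps_trans: "keeps X A s s1 \<Longrightarrow> keeps X' A' s1 s2 \<Longrightarrow> keeps (X \<union> X') (A \<union> A') s s2"
  by (simp add: keeps_def)

lemma length_concat_le: "(\<And>x. x \<in> set xs \<Longrightarrow> length (W x) \<le> c) \<Longrightarrow> length (concat (map W xs)) \<le> c * length xs"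
proof (induction xs)
  case (Cons x xs)
  have "length (W x) \<le> c" "length (concat (map W xs)) \<le> c * length xs" using Cons by auto
  then show ?case by simp
qed simp

lemma loop_cost_emit_tab: "loop_cost (emit_tab f n e) = pcost (emit_tab f n e)"
  by (cases n) simp_all

lemma endst_window: "0 \<le> k \<Longrightarrow> window k ts \<Longrightarrow> endst 0 ts \<in> {-k..k}"
  using last_in_set[of "0 # ts"] by (cases ts) auto

lemma concat_replicate_Lt: "concat (map (\<lambda>_. [Lt]) xs) = replicate (length xs) Lt"
  by (induction xs) simp_all

context BS
begin

lemma new_digits_shift_digit_bound:
  "length xs = length ts \<Longrightarrow> digits xs \<Longrightarrow> s \<in> {-K2..K2} \<Longrightarrow> window K2 ts \<Longrightarrow> e \<in> set (new_digits shift_digit s xs ts) \<Longrightarrow> \<bar>e\<bar> \<le> int Mx"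
proof (induction xs ts arbitrary: s rule: list_induct2)
  case (Cons x xs t ts)
  then have "\<bar>lift_digit x t s\<bar> \<le> int Mx" by (intro lift_digit_bound) auto
  then have "\<bar>shift_digit x s t\<bar> \<le> int Mx" by (simp add: lift_digit_def)
  moreover have "e = shift_digit x s t \<or> \<bar>e\<bar> \<le> int Mx" using Cons by auto
  ultimately show ?case by blast
qed simp

lemma best_top_shift:
  assumes "\<And>t. t \<in> {-K2..K2} \<Longrightarrow> F t = F' t + c"
  shows "best_top F y = best_top F' y"
proof -
  have "top_set F y = top_set F' y"
    unfolding top_set_def using assms by (intro Collect_cong conj_cong ball_cong refl) simp
  then show ?thesis by (simp add: best_top_def)
qed

lemma shift_digit_affine: "shift_digit = affine P (- Q)" and lift_digit_affine: "lift_digit = affine (- Q) P"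
  by (simp_all add: fun_eq_iff affine_def shift_digit_def lift_digit_def)

lemma K_le_K2 [simp]: "K \<le> K2"
  by (simp add: K2_def)

definition input_held :: "int list \<Rightarrow> int list \<Rightarrow> int list \<Rightarrow> int \<Rightarrow> state \<Rightarrow> bool" where
  "input_held rsL rsR rs y s \<longleftrightarrow> reg s 3 = int (length rsL) \<and> reg s 6 = int (length rsR) \<and> reg s 7 = int (length rs) \<and>
     reg s 4 = y \<and> holds s 2 Suc rsL \<and> holds s 5 (\<lambda>i. i) rsR \<and> holds s 6 (\<lambda>i. i) rs"

lemma input_held_keeps: "input_held rsL rsR rs y s \<Longrightarrow> keeps X A s s' \<Longrightarrow> {3, 4, 6, 7} \<inter> X = {} \<Longrightarrow> {2, 5, 6} \<inter> A = {} \<Longrightarrow> input_held rsL rsR rs y s'"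
  by (auto simp: input_held_def keeps_def holds_def)

text \<open>Bounds \<open>|y + p h|\<close> for the integer \<open>y\<close> left by the climb and
  all carries \<open>h\<close> in the window.\<close>

definition off :: nat where "off = nat (M + P * K2)"

definition maxw :: nat where "maxw = Mx + off + 2"

end

context coded
begin

lemma left_weight_lipschitz:
  assumes "\<And>s t. G s \<le> G t + Q * \<bar>t - s\<bar>"
  shows "left_weight C G s \<le> left_weight C G t + Q * \<bar>t - s\<bar>"
proof -
  have "left_weight C G t \<in> (\<lambda>u. C u + G (t - u)) ` {-K..K}" unfolding left_weight_def by (intro Min_in) auto
  then obtain u where u: "left_weight C G t = C u + G (t - u)" "u \<in> {-K..K}" by (rule imageE)
  have "left_weight C G s \<le> C u + G (s - u)" unfolding left_weight_def using u(2) by (intro Min_le) auto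
  with u(1) assms[of "s - u" "t - u"] show ?thesis by simp
qed

lemma left_weight_shift:
  assumes "\<And>u. u \<in> {-K..K} \<Longrightarrow> C u = C' u + c" "\<And>u. u \<in> {-K2..K2} \<Longrightarrow> G u = G' u + d" "s \<in> {-K..K}"
  shows "left_weight C G s = left_weight C' G' s + (c + d)"
proof -
  have "s - u \<in> {-K2..K2}" if "u \<in> {-K..K}" for u using that assms(3) by (auto simp: K2_def)
  then have "(\<lambda>u. C u + G (s - u)) ` {-K..K} = (\<lambda>z. z + (c + d)) ` (\<lambda>u. C' u + G' (s - u)) ` {-K..K}"
    unfolding image_image using assms(1,2) by (intro image_cong) auto
  then have "left_weight C G s = Min ((\<lambda>z. z + (c + d)) ` (\<lambda>u. C' u + G' (s - u)) ` {-K..K})"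
    by (simp add: left_weight_def)
  also have "\<dots> = left_weight C' G' s + (c + d)"
    unfolding left_weight_def by (rule mono_Min_commute[symmetric]) (auto intro: monoI)
  finally show ?thesis .
qed

lemma rep_left_weight:
  assumes "rep K a C" "rep K2 b G" and G: "\<And>s t. G s \<le> G t + Q * \<bar>t - s\<bar>"
  shows "rep K (enc K (left_weight (dec a) (dec b))) (left_weight C G)"
proof -
  obtain c where c: "\<And>u. u \<in> {-K..K} \<Longrightarrow> C u = dec a u + c" using assms(1) unfolding rep_def by blast
  obtain d where d: "\<And>u. u \<in> {-K2..K2} \<Longrightarrow> G u = dec b u + d" using assms(2) unfolding rep_def by blast
  have eq: "left_weight C G s = left_weight (dec a) (dec b) s + (c + d)" if "s \<in> {-K..K}" for s
    by (rule left_weight_shift[OF c d that])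
  have "rep K (enc K (left_weight (dec a) (dec b))) (left_weight (dec a) (dec b))"
  proof (rule rep_enc)
    \<comment> \<open>The bound is taken over from the true convolution, from which the decoded one
      differs by a constant on the window.\<close>
    show "left_weight (dec a) (dec b) t \<le> left_weight (dec a) (dec b) t' + spread"
      if "t \<in> {-K..K}" "t' \<in> {-K..K}" for t t'
      using lipschitz_spread[OF left_weight_lipschitz[OF G] that K_le_K2, of C] eq[OF that(1)] eq[OF that(2)] by simp
  qed simp_all
  then show ?thesis by (rule rep_shift) (rule eq)
qed

lemma rep_right_weight:
  assumes "rep K2 b G" and G: "\<And>s t. G s \<le> G t + Q * \<bar>t - s\<bar>" and a: "a \<in> {-K..K}"
  shows "rep K (enc K (\<lambda>u. dec b (a - u))) (\<lambda>u. G (a - u))"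
proof -
  obtain d where d: "\<And>u. u \<in> {-K2..K2} \<Longrightarrow> G u = dec b u + d" using assms(1) unfolding rep_def by blast
  have eq: "G (a - u) = dec b (a - u) + d" if "u \<in> {-K..K}" for u
    using that a by (intro d) (auto simp: K2_def)
  have lip: "G (a - s) \<le> G (a - t) + Q * \<bar>t - s\<bar>" for s t using G[of "a - s" "a - t"] by (simp add: abs_minus_commute)
  have "rep K (enc K (\<lambda>u. dec b (a - u))) (\<lambda>u. dec b (a - u))"
  proof (rule rep_enc)
    show "dec b (a - t) \<le> dec b (a - t') + spread" if "t \<in> {-K..K}" "t' \<in> {-K..K}" for t t'
      using lipschitz_spread[of "\<lambda>u. G (a - u)", OF lip that K_le_K2] eq[OF that(1)] eq[OF that(2)] by simp
  qed simp_all
  then show ?thesis by (rule rep_shift) (rule eq)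
qed

lemma rep_end_penalty: "0 \<le> k \<Longrightarrow> k \<le> K2 \<Longrightarrow> rep k (enc k (end_penalty s)) (end_penalty s)"
proof (rule rep_enc_lipschitz)
  show "end_penalty s a \<le> end_penalty s b + Q * \<bar>b - a\<bar>" for a b
    using mult_left_mono[of "\<bar>a - s\<bar>" "\<bar>b - s\<bar> + \<bar>b - a\<bar>" Q] by (simp add: end_penalty_def distrib_left)
qed

text \<open>The sum of all demands that tables, digits and words make on the word size; multiplied
  by \<open>Z\<close> it also covers addresses and the length of the output.\<close>

definition min_word_size :: nat where
  "min_word_size = 10 + 8 * q + N + N * q + N * N + N * (2 * kk + 1) + N * (2 * mm + 1) + N * q * (2 * kk + 1) +
     N * q * (2 * kk2 + 1) + (3 * q + 2 * q * kk + kk) + (3 * q + 2 * q * kk2 + kk2) + 10 * Mx + 8 * mm + 8 * kk2 + 8 * off + 8 * maxw"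

text \<open>Registers 3, 6 and 7 hold the numbers of digits on the left, on the right and above the peak
  integer, arrays 2, 5 and 6 the digits, and register 4 the integer that remains after climbing.
  Register 9 holds the code of the cost of the peak as a function of the carry into it,
  registers 11 and 13 hold the carry from the left and the total carry. Array 7 holds the codes of
  the profiles met in the last pass, arrays 8, 9 and 10 the digits of the result.\<close>

definition weight_prog :: prog where
  "weight_prog = Seq (Assign 5 (tab (\<lambda>i. enc K2 (\<lambda>t. int (g (i - M + P * t)))) (2 * mm + 1) (Bin Add (Reg 4) (Const M))))
     (Seq (pass (ft shift_digit K2) N q 7 6 ix_up) (Assign 9 (Reg 5)))"

definition cost_prog :: prog where
  "cost_prog = Seq (Assign 5 (Const (enc K (end_penalty 0)))) (pass (ft lift_digit K) N q 6 5 (ix_down 6))"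

definition left_prog :: prog where
  "left_prog = Seq (Assign 5 (tab2 (\<lambda>a b. enc K (left_weight (dec a) (dec b))) N N (Reg 5) (Reg 9)))
     (Seq (pass (ft shift_digit K) N q 3 2 ix_Suc) (Seq (Assign 10 (Const 0))
     (Seq (trace (st shift_digit K delta_rank) N q kk P (- Q) 3 2 8 ix_Suc) (Assign 11 (Reg 10)))))"

definition right_prog :: prog where
  "right_prog = Seq (Assign 5 (tab2 (\<lambda>b i. enc K (\<lambda>u. dec b (i - K - u))) N (2 * kk + 1) (Reg 9) (Bin Add (Reg 11) (Const K))))
     (Seq (pass (ft shift_digit K) N q 6 5 ix_up) (Seq (Assign 10 (Const 0))
     (Seq (trace (st shift_digit K delta_rank) N q kk P (- Q) 6 5 9 ix_up) (Assign 13 (Bin Sub (Reg 11) (Reg 10))))))"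

definition top_prog :: prog where
  "top_prog = Seq (Assign 5 (tab (\<lambda>i. enc K2 (end_penalty (i - K2))) (2 * kk2 + 1) (Bin Add (Reg 13) (Const K2))))
     (Seq (pass (ft lift_digit K2) N q 7 6 (ix_down 7))
     (Assign 10 (tab2 (\<lambda>e i. best_top (dec e) (i - M)) N (2 * mm + 1) (Reg 5) (Bin Add (Reg 4) (Const M)))))"

definition peak_prog :: prog where
  "peak_prog = Seq (emit (\<lambda>_. [Lt]) q 0 7 6 ix_up)
     (Seq (emit_tab (\<lambda>i. L (i - int off)) (2 * off + 1) (Bin Add (Bin Add (Reg 4) (Bin Mul (Const P) (Reg 10))) (Const (int off))))
     (Seq (trace (st lift_digit K2 llnf_rank) N q kk2 (- Q) P 7 6 10 (ix_down 7))
     (emit (\<lambda>e. LT # apow e) (2 * Mx + 1) (int Mx) 7 10 ix_up)))"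

text \<open>The right side is traced before the word of the peak is written, because the carry into
  the peak depends on it. Its digits wait in array 9 until they are written from the peak to the
  foot.\<close>

definition hill_prog :: prog where
  "hill_prog = Seq weight_prog (Seq cost_prog (Seq left_prog
     (Seq (emit (\<lambda>b. apow b @ [Lt]) (2 * Mx + 1) (int Mx) 3 8 ix_up)
     (Seq right_prog (Seq top_prog (Seq peak_prog
     (emit (\<lambda>b. LT # apow (- b)) (2 * Mx + 1) (int Mx) 6 9 (ix_down 6))))))))"

section \<open>Correctness of the phases on a fixed canonical hill\<close>

context
  fixes B Z :: nat and rsL rsR rs :: "int list" and x y :: int
  assumes BZ: "min_word_size * Z \<le> B" and Z: "length rsL + 1 \<le> Z" "length rsR + 1 \<le> Z" "length rs + 1 \<le> Z"
    and dig: "digits rsL" "digits rsR" and climb: "climb x rs y"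
begin

lemma bcB: "a \<le> min_word_size \<Longrightarrow> a \<le> B"
proof -
  have "min_word_size * 1 \<le> min_word_size * Z" using Z by (intro mult_le_mono2) simp
  then show "a \<le> min_word_size \<Longrightarrow> a \<le> B" using BZ by linarith
qed

lemma ZB: "a \<le> min_word_size \<Longrightarrow> a * Z \<le> B"
  by (rule le_trans[OF mult_le_mono1 BZ])

lemma sizes: "N * q \<le> B" "N \<le> B" "q \<le> B" "N * N \<le> B" "N * (2 * kk + 1) \<le> B" "N * (2 * mm + 1) \<le> B"
  "N * q * (2 * kk + 1) \<le> B" "N * q * (2 * kk2 + 1) \<le> B" "3 * q + 2 * q * kk + kk \<le> B" "3 * q + 2 * q * kk2 + kk2 \<le> B"
  "10 * Mx \<le> B" "8 * mm + 1 \<le> B" "8 * kk2 + 1 \<le> B" "8 * off + 1 \<le> B" "4 \<le> B" "1 \<le> B" "10 * Mx + 1 \<le> B" "8 * maxw \<le> B"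
  by (rule bcB; simp add: min_word_size_def)+

lemma lens: "length rsL + 1 < B" "length rsR < B" "length rs < B"
proof -
  have "10 * Z \<le> B" by (rule ZB) (simp add: min_word_size_def)
  then show "length rsL + 1 < B" "length rsR < B" "length rs < B" using Z by simp_all
qed

lemma Z1: "1 \<le> Z"
  using Z by simp

lemma digrs: "digits rs" "\<bar>y\<bar> \<le> M"
  using climb_digits[OF climb] by auto

abbreviation G :: "int \<Rightarrow> int" where "G \<equiv> \<lambda>t. int (g (x + P * t))"

lemma G_lipschitz: "G s \<le> G t + Q * \<bar>t - s\<bar>"
  by (rule P_Q_lipschitz[of G]) (rule g_lipschitz)

lemma fitM: "fits B M" "fits B y" "fits B (y + M)"
  using digrs(2) sizes(12) by (auto simp: M_def nat_le_iff intro!: fits_small)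

lemma runs_weight:
  assumes "input_held rsL rsR rs y s"
  shows "\<exists>s'. runs B Z weight_prog s s' \<and> rep K2 (reg s' 9) G \<and> keeps {2, 5, 9} {7} s s'"
proof -
  let ?e = "Bin Add (Reg 4) (Const M)" and ?f = "\<lambda>i. enc K2 (\<lambda>t. int (g (i - M + P * t)))"
  have e: "safe B ?e s" "val ?e s = y + M" using assms fitM by (auto simp: input_held_def)
  have "\<exists>s1. runs B Z (Assign 5 (tab ?f (2 * mm + 1) ?e)) s s1 \<and> reg s1 5 = ?f (val ?e s) \<and> keeps {5} {} s s1"
  proof (rule runs_tab[OF e(1) _ _ _ _ Z1])
    show "0 \<le> val ?e s" "val ?e s < int (2 * mm + 1)" unfolding e(2) using digrs(2) int_kk(3) by linarith+
    show "2 * mm + 1 \<le> B" using sizes(12) by simp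
    show "\<bar>?f (int i)\<bar> \<le> int B" for i by (rule enc_small) (rule sizes)
  qed
  then obtain s1 where 1: "runs B Z (Assign 5 (tab ?f (2 * mm + 1) ?e)) s s1" "keeps {5} {} s s1"
    and r5: "reg s1 5 = enc K2 (\<lambda>t. int (g (y + P * t)))" by (auto simp: e(2) simp del: tab.simps val.simps)
  have rep1: "rep K2 (reg s1 5) (\<lambda>t. int (g (y + P * t)))"
    unfolding r5 by (rule rep_enc_lipschitz) (simp_all add: P_Q_lipschitz[of "\<lambda>t. int (g (y + P * t))"] g_lipschitz)
  have c1: "input_held rsL rsR rs y s1" by (rule input_held_keeps[OF assms 1(2)]) auto
  have "\<exists>s2. runs B Z (pass (ft shift_digit K2) N q 7 6 ix_up) s1 s2 \<and>
    rep K2 (reg s2 5) (opt_cost shift_digit K2 (\<lambda>t. int (g (y + P * t))) rs) \<and>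
    (\<forall>j<length rs. rep K2 (arr s2 7 (int j)) (opt_cost shift_digit K2 (\<lambda>t. int (g (y + P * t))) (drop (Suc j) rs))) \<and> keeps {2, 5} {7} s1 s2"
    using c1 lens Z digrs(1) rep1 by (intro runs_pass[where pos = "\<lambda>i. i"] is_index_up sizes) (simp_all add: input_held_def)
  then obtain s2 where 2: "runs B Z (pass (ft shift_digit K2) N q 7 6 ix_up) s1 s2" "keeps {2, 5} {7} s1 s2"
    and rep2: "rep K2 (reg s2 5) (opt_cost shift_digit K2 (\<lambda>t. int (g (y + P * t))) rs)" by blast
  \<comment> \<open>The computed profile differs from \<open>G\<close> by the stable letters of the
    climb, a constant that the code does not see.\<close>
  have repG: "rep K2 (reg s2 5) G"
    by (rule rep_shift[OF rep2, where c = "2 * int (length rs)"]) (simp add: peak_weight[OF climb])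
  have "reg s2 5 \<in> {0..<int N}" using repG by (simp add: rep_def)
  then have "safe B (Reg 5) s2" using sizes(2) by (auto intro!: fits_small)
  from runs_Assign_ex[OF this Z1, of 9] obtain s3 where 3: "runs B Z (Assign 9 (Reg 5)) s2 s3" "keeps {9} {} s2 s3"
    and "reg s3 9 = reg s2 5" by auto
  with repG have "rep K2 (reg s3 9) G" by simp
  moreover have "runs B Z weight_prog s s3" unfolding weight_prog_def by (intro runs_Seq[OF 1(1)] runs_Seq[OF 2(1)] 3(1))
  moreover have "keeps {2, 5, 9} {7} s s3" using keeps_trans[OF keeps_trans[OF 1(2) 2(2)] 3(2)] by (simp add: insert_commute)
  ultimately show ?thesis by blast
qed

lemma runs_cost:
  assumes "input_held rsL rsR rs y s"
  shows "\<exists>s'. runs B Z cost_prog s s' \<and> rep K (reg s' 5) (right_cost rsR) \<and> keeps {2, 5} {7} s s'"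
proof -
  have "safe B (Const (enc K (end_penalty 0))) s" using enc_small[OF sizes(2)] by (simp add: fits_small)
  from runs_Assign_ex[OF this Z1, of 5] obtain s1 where 1: "runs B Z (Assign 5 (Const (enc K (end_penalty 0)))) s s1" "keeps {5} {} s s1"
    and r5: "reg s1 5 = enc K (end_penalty 0)" by auto
  have rep1: "rep K (reg s1 5) (end_penalty 0)" unfolding r5 by (rule rep_end_penalty) simp_all
  have c1: "input_held rsL rsR rs y s1" by (rule input_held_keeps[OF assms 1(2)]) auto
  have "holds s1 5 (\<lambda>i. length (rev rsR) - 1 - i) (rev rsR)" using c1 unfolding input_held_def holds_rev[of s1 5 rsR] by (elim conjE) (simp only: length_rev)
  then have "\<exists>s2. runs B Z (pass (ft lift_digit K) N q 6 5 (ix_down 6)) s1 s2 \<and>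
    rep K (reg s2 5) (opt_cost lift_digit K (end_penalty 0) (rev rsR)) \<and>
    (\<forall>j<length (rev rsR). rep K (arr s2 7 (int j)) (opt_cost lift_digit K (end_penalty 0) (drop (Suc j) (rev rsR)))) \<and> keeps {2, 5} {7} s1 s2"
    using c1 lens Z dig rep1
    by (intro runs_pass[where pos = "\<lambda>i. length (rev rsR) - 1 - i"] is_index_down sizes) (simp_all add: input_held_def)
  then obtain s2 where 2: "runs B Z (pass (ft lift_digit K) N q 6 5 (ix_down 6)) s1 s2" "keeps {2, 5} {7} s1 s2"
    and rep2: "rep K (reg s2 5) (right_cost rsR)" unfolding right_cost_def by blast
  have "runs B Z cost_prog s s2" unfolding cost_prog_def by (rule runs_Seq[OF 1(1) 2(1)])
  moreover have "keeps {2, 5} {7} s s2" using keeps_trans[OF 1(2) 2(2)] by (simp add: insert_commute)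
  ultimately show ?thesis using rep2 by blast
qed

text \<open>The part common to \<open>left_prog\<close> and \<open>right_prog\<close>: accumulate,
  trace, and store a value \<open>fe\<close> of the final carry in register
  \<open>r\<close>.\<close>

lemma runs_chain:
  assumes input_held: "input_held rsL rsR rs y s" and rep: "rep K (reg s 5) F" and nr: "nr \<in> {3, 6}"
    and xs: "reg s nr = int (length xs)" "holds s a pos xs" "length xs < B" "length xs + 1 \<le> Z" "digits xs"
    and ix: "is_index B ix nr (length xs) pos" and ab: "a \<in> {2, 5}" "b \<in> {8, 9}" and r: "r \<in> {11, 13}"
    and fin: "\<And>s. reg s 10 \<in> {-K..K} \<Longrightarrow> \<bar>reg s 11\<bar> \<le> K \<or> r = 11 \<Longrightarrow> safe B fe s"
    and r11: "\<bar>reg s 11\<bar> \<le> K \<or> r = 11"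
  defines "ss \<equiv> opt_path shift_digit K delta_rank F 0 xs"
  shows "\<exists>s'. runs B Z (Seq (pass (ft shift_digit K) N q nr a ix) (Seq (Assign 10 (Const 0))
     (Seq (trace (st shift_digit K delta_rank) N q kk P (- Q) nr a b ix) (Assign r fe)))) s s' \<and>
    reg s' 10 = endst 0 ss \<and> holds s' b (\<lambda>i. i) (new_digits shift_digit 0 xs ss) \<and>
    (\<exists>s3. reg s3 10 = endst 0 ss \<and> reg s3 11 = reg s 11 \<and> reg s' r = val fe s3) \<and> keeps {2, 5, 10, 12, r} {7, b} s s'"
proof -
  have "\<exists>s1. runs B Z (pass (ft shift_digit K) N q nr a ix) s s1 \<and> rep K (reg s1 5) (opt_cost shift_digit K F xs) \<and>
    (\<forall>j<length xs. rep K (arr s1 7 (int j)) (opt_cost shift_digit K F (drop (Suc j) xs))) \<and> keeps {2, 5} {7} s s1"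
    using xs nr ab ix rep by (intro runs_pass[where pos = pos] sizes) auto
  then obtain s1 where 1: "runs B Z (pass (ft shift_digit K) N q nr a ix) s s1" "keeps {2, 5} {7} s s1"
    and codes: "\<forall>j<length xs. rep K (arr s1 7 (int j)) (opt_cost shift_digit K F (drop (Suc j) xs))" by blast
  have "safe B (Const 0) s1" by (simp add: fits_small)
  from runs_Assign_ex[OF this Z1, of 10] obtain s2 where 2: "runs B Z (Assign 10 (Const 0)) s1 s2" "keeps {10} {} s1 s2"
    and r10: "reg s2 10 = 0" by auto
  have k2: "keeps {2, 5, 10} {7} s s2" using keeps_trans[OF 1(2) 2(2)] by (simp add: insert_commute)
  have "\<exists>s3. runs B Z (trace (st shift_digit (int kk) delta_rank) N q kk P (- Q) nr a b ix) s2 s3 \<and>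
    reg s3 10 = endst (reg s2 10) (opt_path shift_digit (int kk) delta_rank F (reg s2 10) xs) \<and>
    holds s3 b (\<lambda>i. i) (new_digits shift_digit (reg s2 10) xs (opt_path shift_digit (int kk) delta_rank F (reg s2 10) xs)) \<and> keeps {2, 10, 12} {b} s2 s3"
  proof (rule runs_trace[OF _ _ xs(3) _ _ _ xs(5) ix sizes(7,2,9) xs(4) _ shift_digit_affine])
    show "reg s2 nr = int (length xs)" using xs(1) nr reg_keeps[OF k2, of nr] by auto
    show "holds s2 a pos xs" using holds_keeps[OF xs(2) k2] ab by auto
    show "\<forall>j<length xs. rep (int kk) (arr s2 7 (int j)) (opt_cost shift_digit (int kk) F (drop (Suc j) xs))"
      using codes 2(2) by (simp add: keeps_def)
  qed (use nr ab r10 p_less_q in auto)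
  then obtain s3 where 3: "runs B Z (trace (st shift_digit K delta_rank) N q kk P (- Q) nr a b ix) s2 s3" "keeps {2, 10, 12} {b} s2 s3"
    and r10': "reg s3 10 = endst 0 ss" and h: "holds s3 b (\<lambda>i. i) (new_digits shift_digit 0 xs ss)"
    unfolding r10 int_kk ss_def by blast
  have k3: "keeps {2, 5, 10, 12} {7, b} s s3" using keeps_trans[OF k2 3(2)] by (simp add: insert_commute)
  have window: "window K ss" unfolding ss_def by (rule opt_path_window) simp
  have "endst 0 ss \<in> {-K..K}" by (rule endst_window[OF _ window]) simp
  then have "safe B fe s3" using r11 reg_keeps[OF k3, of 11] by (intro fin) (auto simp: r10')
  from runs_Assign_ex[OF this Z1, of r] obtain s4 where 4: "runs B Z (Assign r fe) s3 s4" "keeps {r} {} s3 s4"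
    and rr: "reg s4 r = val fe s3" by auto
  have "reg s4 10 = endst 0 ss" using reg_keeps[OF 4(2), of 10] r r10' by auto
  moreover have "holds s4 b (\<lambda>i. i) (new_digits shift_digit 0 xs ss)" by (rule holds_keeps[OF h 4(2)]) simp
  moreover have "reg s3 11 = reg s 11" using reg_keeps[OF k3, of 11] by simp
  moreover have "keeps {2, 5, 10, 12, r} {7, b} s s4" using keeps_trans[OF k3 4(2)] by (simp add: insert_commute)
  moreover note runs_Seq[OF 1(1) runs_Seq[OF 2(1) runs_Seq[OF 3(1) 4(1)]]]
  ultimately show ?thesis using rr r10' by blast
qed

lemma KB: "8 * K + 1 \<le> int B" "8 * K2 + 1 \<le> int B"
  using sizes(13) K_nonneg K_le_K2 int_kk(2) by linarith+

lemma runs_left: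
  assumes input_held: "input_held rsL rsR rs y s" and r9: "rep K2 (reg s 9) G" and r5: "rep K (reg s 5) (right_cost rsR)"
  defines "ss \<equiv> opt_path shift_digit K delta_rank (left_weight (right_cost rsR) G) 0 rsL"
  shows "\<exists>s'. runs B Z left_prog s s' \<and> reg s' 11 = endst 0 ss \<and> holds s' 8 (\<lambda>i. i) (new_digits shift_digit 0 rsL ss) \<and>
    keeps {2, 5, 10, 11, 12} {7, 8} s s'"
proof -
  have rg: "reg s 5 \<in> {0..<int N}" "reg s 9 \<in> {0..<int N}" using r9 r5 by (simp_all add: rep_def)
  have "\<exists>s1. runs B Z (Assign 5 (tab2 (\<lambda>a b. enc K (left_weight (dec a) (dec b))) N N (Reg 5) (Reg 9))) s s1 \<and>
    reg s1 5 = enc K (left_weight (dec (val (Reg 5) s)) (dec (val (Reg 9) s))) \<and> keeps {5} {} s s1"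
    using rg sizes Z1 by (intro runs_tab2 enc_small) (auto intro!: fits_small)
  then obtain s1 where 1: "runs B Z (Assign 5 (tab2 (\<lambda>a b. enc K (left_weight (dec a) (dec b))) N N (Reg 5) (Reg 9))) s s1"
    "keeps {5} {} s s1" and e: "reg s1 5 = enc K (left_weight (dec (reg s 5)) (dec (reg s 9)))" by auto
  have rep1: "rep K (reg s1 5) (left_weight (right_cost rsR) G)"
    unfolding e by (rule rep_left_weight[OF r5 r9 G_lipschitz])
  have c1: "input_held rsL rsR rs y s1" by (rule input_held_keeps[OF input_held 1(2)]) auto
  have "\<exists>s2. runs B Z (Seq (pass (ft shift_digit K) N q 3 2 ix_Suc) (Seq (Assign 10 (Const 0))
     (Seq (trace (st shift_digit K delta_rank) N q kk P (- Q) 3 2 8 ix_Suc) (Assign 11 (Reg 10))))) s1 s2 \<and>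
    reg s2 10 = endst 0 ss \<and> holds s2 8 (\<lambda>i. i) (new_digits shift_digit 0 rsL ss) \<and>
    (\<exists>s3. reg s3 10 = endst 0 ss \<and> reg s3 11 = reg s1 11 \<and> reg s2 11 = val (Reg 10) s3) \<and> keeps {2, 5, 10, 12, 11} {7, 8} s1 s2"
    unfolding ss_def using c1 lens Z dig KB
    by (intro runs_chain[OF c1 rep1, where pos = Suc] is_index_Suc) (auto simp: input_held_def intro!: fits_small)
  then obtain s2 where 2: "runs B Z (Seq (pass (ft shift_digit K) N q 3 2 ix_Suc) (Seq (Assign 10 (Const 0))
     (Seq (trace (st shift_digit K delta_rank) N q kk P (- Q) 3 2 8 ix_Suc) (Assign 11 (Reg 10))))) s1 s2"
    "holds s2 8 (\<lambda>i. i) (new_digits shift_digit 0 rsL ss)" "reg s2 11 = endst 0 ss" "keeps {2, 5, 10, 12, 11} {7, 8} s1 s2" by auto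
  have "keeps {2, 5, 10, 11, 12} {7, 8} s s2" using keeps_trans[OF 1(2) 2(4)] by (simp add: insert_commute)
  moreover have "runs B Z left_prog s s2" unfolding left_prog_def by (rule runs_Seq[OF 1(1) 2(1)])
  ultimately show ?thesis using 2 by blast
qed

lemma runs_right:
  assumes input_held: "input_held rsL rsR rs y s" and r9: "rep K2 (reg s 9) G" and r11: "reg s 11 = a" "a \<in> {-K..K}"
  defines "cs \<equiv> opt_path shift_digit K delta_rank (\<lambda>u. G (a - u)) 0 rsR"
  shows "\<exists>s'. runs B Z right_prog s s' \<and> reg s' 13 = a - endst 0 cs \<and> holds s' 9 (\<lambda>i. i) (new_digits shift_digit 0 rsR cs) \<and>
    keeps {2, 5, 10, 12, 13} {7, 9} s s'"
proof -
  let ?t = "tab2 (\<lambda>b i. enc K (\<lambda>u. dec b (i - K - u))) N (2 * kk + 1) (Reg 9) (Bin Add (Reg 11) (Const K))"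
  have rg: "reg s 9 \<in> {0..<int N}" using r9 by (simp add: rep_def)
  have fit: "fits B (reg s 11)" "fits B K" "fits B (reg s 11 + K)" using r11 KB(1) by (auto intro!: fits_small)
  have "\<exists>s1. runs B Z (Assign 5 ?t) s s1 \<and>
    reg s1 5 = (\<lambda>b i. enc K (\<lambda>u. dec b (i - K - u))) (val (Reg 9) s) (val (Bin Add (Reg 11) (Const K)) s) \<and> keeps {5} {} s s1"
    using rg sizes Z1 r11 fit by (intro runs_tab2 enc_small) (auto intro!: fits_small)
  then obtain s1 where 1: "runs B Z (Assign 5 ?t) s s1" "keeps {5} {} s s1"
    and e: "reg s1 5 = enc K (\<lambda>u. dec (reg s 9) (a - u))" by (auto simp: r11)
  have rep1: "rep K (reg s1 5) (\<lambda>u. G (a - u))"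
    unfolding e by (rule rep_right_weight[OF r9 G_lipschitz r11(2)])
  have c1: "input_held rsL rsR rs y s1" by (rule input_held_keeps[OF input_held 1(2)]) auto
  have r11': "reg s1 11 = a" using reg_keeps[OF 1(2), of 11] r11 by simp
  have "\<exists>s2. runs B Z (Seq (pass (ft shift_digit K) N q 6 5 ix_up) (Seq (Assign 10 (Const 0))
     (Seq (trace (st shift_digit K delta_rank) N q kk P (- Q) 6 5 9 ix_up) (Assign 13 (Bin Sub (Reg 11) (Reg 10)))))) s1 s2 \<and>
    reg s2 10 = endst 0 cs \<and> holds s2 9 (\<lambda>i. i) (new_digits shift_digit 0 rsR cs) \<and>
    (\<exists>s3. reg s3 10 = endst 0 cs \<and> reg s3 11 = reg s1 11 \<and> reg s2 13 = val (Bin Sub (Reg 11) (Reg 10)) s3) \<and>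
    keeps {2, 5, 10, 12, 13} {7, 9} s1 s2"
    unfolding cs_def using c1 lens Z dig KB r11' r11
    by (intro runs_chain[OF c1 rep1, where pos = "\<lambda>i. i"] is_index_up) (auto simp: input_held_def intro!: fits_small)
  then obtain s2 where 2: "runs B Z (Seq (pass (ft shift_digit K) N q 6 5 ix_up) (Seq (Assign 10 (Const 0))
     (Seq (trace (st shift_digit K delta_rank) N q kk P (- Q) 6 5 9 ix_up) (Assign 13 (Bin Sub (Reg 11) (Reg 10)))))) s1 s2"
    "holds s2 9 (\<lambda>i. i) (new_digits shift_digit 0 rsR cs)" "reg s2 13 = a - endst 0 cs" "keeps {2, 5, 10, 12, 13} {7, 9} s1 s2"
    by (auto simp: r11')
  have "keeps {2, 5, 10, 12, 13} {7, 9} s s2" using keeps_trans[OF 1(2) 2(4)] by (simp add: insert_commute)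
  moreover have "runs B Z right_prog s s2" unfolding right_prog_def by (rule runs_Seq[OF 1(1) 2(1)])
  ultimately show ?thesis using 2 by blast
qed

lemma runs_top:
  assumes input_held: "input_held rsL rsR rs y s" and r13: "reg s 13 = z" "z \<in> {-K2..K2}"
  defines "F \<equiv> opt_cost lift_digit K2 (end_penalty z) (rev rs)"
  shows "\<exists>s'. runs B Z top_prog s s' \<and> reg s' 10 = best_top F y \<and>
    (\<forall>j<length (rev rs). rep K2 (arr s' 7 (int j)) (opt_cost lift_digit K2 (end_penalty z) (drop (Suc j) (rev rs)))) \<and> keeps {2, 5, 10} {7} s s'"
proof -
  let ?e = "Bin Add (Reg 13) (Const K2)" and ?f = "\<lambda>i. enc K2 (end_penalty (i - K2))"
  have e: "safe B ?e s" "val ?e s = z + K2" using r13 KB by (auto intro!: fits_small)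
  have "\<exists>s1. runs B Z (Assign 5 (tab ?f (2 * kk2 + 1) ?e)) s s1 \<and> reg s1 5 = ?f (val ?e s) \<and> keeps {5} {} s s1"
  proof (rule runs_tab[OF e(1) _ _ _ _ Z1])
    show "0 \<le> val ?e s" "val ?e s < int (2 * kk2 + 1)" unfolding e(2) using r13(2) by simp_all
    show "2 * kk2 + 1 \<le> B" using sizes(13) by simp
    show "\<bar>?f (int i)\<bar> \<le> int B" for i by (rule enc_small) (rule sizes)
  qed
  then obtain s1 where 1: "runs B Z (Assign 5 (tab ?f (2 * kk2 + 1) ?e)) s s1" "keeps {5} {} s s1"
    and r5: "reg s1 5 = enc K2 (end_penalty z)" by (auto simp: e(2) simp del: tab.simps val.simps)
  have rep1: "rep K2 (reg s1 5) (end_penalty z)" unfolding r5 by (rule rep_end_penalty) simp_all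
  have c1: "input_held rsL rsR rs y s1" by (rule input_held_keeps[OF input_held 1(2)]) auto
  have "holds s1 6 (\<lambda>i. length (rev rs) - 1 - i) (rev rs)" using c1 unfolding input_held_def holds_rev[of s1 6 rs] by (elim conjE) (simp only: length_rev)
  then have "\<exists>s2. runs B Z (pass (ft lift_digit K2) N q 7 6 (ix_down 7)) s1 s2 \<and> rep K2 (reg s2 5) (opt_cost lift_digit K2 (end_penalty z) (rev rs)) \<and>
    (\<forall>j<length (rev rs). rep K2 (arr s2 7 (int j)) (opt_cost lift_digit K2 (end_penalty z) (drop (Suc j) (rev rs)))) \<and> keeps {2, 5} {7} s1 s2"
    using c1 lens Z digrs(1) rep1
    by (intro runs_pass[where pos = "\<lambda>i. length (rev rs) - 1 - i"] is_index_down sizes) (simp_all add: input_held_def)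
  then obtain s2 where 2: "runs B Z (pass (ft lift_digit K2) N q 7 6 (ix_down 7)) s1 s2" "keeps {2, 5} {7} s1 s2"
    and rep2: "rep K2 (reg s2 5) F"
    and codes: "\<forall>j<length (rev rs). rep K2 (arr s2 7 (int j)) (opt_cost lift_digit K2 (end_penalty z) (drop (Suc j) (rev rs)))"
    unfolding F_def by blast
  have c2: "input_held rsL rsR rs y s2" by (rule input_held_keeps[OF c1 2(2)]) auto
  let ?g = "\<lambda>e i. best_top (dec e) (i - M)" and ?e2 = "Bin Add (Reg 4) (Const M)"
  have e2: "safe B ?e2 s2" "val ?e2 s2 = y + M" using c2 fitM by (auto simp: input_held_def)
  have rng: "y + M \<in> {0..<int (2 * mm + 1)}" using digrs(2) int_kk(3) by (simp only: atLeastLessThan_iff) linarith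
  have fits5: "fits B (reg s2 5)" using rep2 sizes(2) by (auto simp: rep_def intro!: fits_small)
  have "reg s2 5 \<in> {0..<int N}" using rep2 by (simp add: rep_def)
  moreover have "\<bar>best_top F' y'\<bar> \<le> int B" for F' y' using best_top_props(1)[of F' y'] KB(2) by (auto simp: top_set_def)
  ultimately have "\<exists>s3. runs B Z (Assign 10 (tab2 ?g N (2 * mm + 1) (Reg 5) ?e2)) s2 s3 \<and>
    reg s3 10 = ?g (val (Reg 5) s2) (val ?e2 s2) \<and> keeps {10} {} s2 s3"
    using Z1 e2 rng fits5 by (intro runs_tab2 sizes(6)) auto
  then obtain s3 where 3: "runs B Z (Assign 10 (tab2 ?g N (2 * mm + 1) (Reg 5) ?e2)) s2 s3" "keeps {10} {} s2 s3"
    and r10: "reg s3 10 = best_top (dec (reg s2 5)) y" by (auto simp: e2(2) simp del: val.simps(4))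
  obtain c where "\<And>t. t \<in> {-K2..K2} \<Longrightarrow> F t = dec (reg s2 5) t + c" using rep2 unfolding rep_def by blast
  from best_top_shift[OF this] have "reg s3 10 = best_top F y" using r10 by simp
  moreover have "\<forall>j<length (rev rs). rep K2 (arr s3 7 (int j)) (opt_cost lift_digit K2 (end_penalty z) (drop (Suc j) (rev rs)))"
    using codes 3(2) by (simp add: keeps_def)
  moreover have "keeps {2, 5, 10} {7} s s3" using keeps_trans[OF keeps_trans[OF 1(2) 2(2)] 3(2)] by (simp add: insert_commute)
  moreover have "runs B Z top_prog s s3" unfolding top_prog_def by (rule runs_Seq[OF 1(1) runs_Seq[OF 2(1) 3(1)]])
  ultimately show ?thesis by blast
qed

text \<open>The output is written cell by cell, so its whole length has to stay below
  \<open>B\<close>. The factors leave room for both sides, the letters \<open>t\<close> of the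
  climb, its top and its digits.\<close>

lemma budget: "8 * (maxw * Z) + 10 * Z \<le> B" "maxw \<le> maxw * Z" "maxw * length rsL \<le> maxw * Z"
  "maxw * length rsR \<le> maxw * Z" "maxw * length rs \<le> maxw * Z"
proof -
  have "(8 * maxw + 10) * Z \<le> B" by (rule ZB) (simp add: min_word_size_def)
  then show "8 * (maxw * Z) + 10 * Z \<le> B" by (simp add: algebra_simps)
  show "maxw \<le> maxw * Z" using Z1 by simp
  show "maxw * length rsL \<le> maxw * Z" "maxw * length rsR \<le> maxw * Z" "maxw * length rs \<le> maxw * Z"
    using Z by (intro mult_le_mono2; simp)+
qed

lemma digit_word: "\<bar>e\<bar> \<le> int Mx \<Longrightarrow> 0 \<le> e + int Mx \<and> e + int Mx < int (2 * Mx + 1) \<and> length (apow e) + 1 \<le> maxw"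
  by (auto simp: maxw_def)

lemma Mx_fits: "int (2 * Mx + 1) + \<bar>int Mx\<bar> \<le> int B"
  using sizes(17) by simp

lemma length_L_top:
  assumes "h \<in> {-K2..K2}"
  shows "length (L (y + P * h)) \<le> maxw"
proof -
  have "\<bar>P * h\<bar> \<le> P * K2" using assms by (auto simp: abs_mult intro!: mult_left_mono)
  then have "\<bar>y + P * h\<bar> \<le> M + P * K2" using digrs(2) by linarith
  then show ?thesis using g_abs[of "y + P * h"] by (simp add: length_L maxw_def off_def)
qed

lemma runs_L:
  assumes input_held: "input_held rsL rsR rs y s" and out: "outputs s v" "length v + maxw < B" and r10: "reg s 10 = h" "h \<in> {-K2..K2}"
  shows "\<exists>s'. runs B Z (emit_tab (\<lambda>i. L (i - int off)) (2 * off + 1)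
      (Bin Add (Bin Add (Reg 4) (Bin Mul (Const P) (Reg 10))) (Const (int off)))) s s' \<and>
    outputs s' (v @ L (y + P * h)) \<and> keeps {1} {1} s s'"
proof -
  let ?e = "Bin Add (Bin Add (Reg 4) (Bin Mul (Const P) (Reg 10))) (Const (int off))" and ?f = "\<lambda>i. L (i - int off)"
  have off: "int off = M + P * K2" by (simp add: off_def M_def)
  have Ph: "\<bar>P * h\<bar> \<le> P * K2" using r10(2) by (auto simp: abs_mult intro!: mult_left_mono)
  have P1: "1 * \<bar>h\<bar> \<le> P * \<bar>h\<bar>" "1 * K2 \<le> P * K2" using p_pos by (intro mult_right_mono; simp)+
  have yh: "\<bar>y + P * h\<bar> \<le> int off" using Ph digrs(2) off by linarith
  have rv: "reg s 4 = y" "reg s 10 = h" using input_held r10(1) by (simp_all add: input_held_def)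
  have oB: "8 * int off + 1 \<le> int B" using sizes(14) by linarith
  have qB: "P \<le> int B" using sizes(3) p_less_q by linarith
  have M0: "0 \<le> M" using digrs(2) by linarith
  have "fits B P" "fits B h" "fits B (P * h)" "fits B (y + P * h)" "fits B (int off)" "fits B (y + P * h + int off)"
    using qB Ph yh oB off P1(2) r10(2) M0 by (intro fits_small; auto)+
  then have safe: "safe B ?e s" using input_held r10(1) fitM(2) by (simp add: input_held_def)
  have "length (L (y + P * h)) \<le> maxw"
    using g_abs[of "y + P * h"] yh by (simp add: length_L maxw_def)
  then have "wp B (emit_tab ?f (2 * off + 1) ?e) (\<lambda>s'. outputs s' (v @ L (y + P * h)) \<and> keeps {1} {1} s s') s"
    using out yh sizes(15) oB by (intro wp_emit_tab[OF out(1) _ _ safe]) (simp_all add: rv del: emit_tab.simps)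
  from runs_hoare[where m = 0 and Z = Z, OF hoare_mono[OF hoare_wp[OF this]]] show ?thesis
    using Z1 by (simp add: loop_cost_emit_tab del: emit_tab.simps)
qed

lemma runs_peak:
  assumes input_held: "input_held rsL rsR rs y s" and out: "outputs s v" "length v \<le> maxw * Z" and r10: "reg s 10 = h" "h \<in> {-K2..K2}"
    and codes: "\<forall>j<length (rev rs). rep K2 (arr s 7 (int j)) (opt_cost lift_digit K2 (end_penalty z) (drop (Suc j) (rev rs)))"
  defines "es \<equiv> new_digits lift_digit h (rev rs) (opt_path lift_digit K2 llnf_rank (end_penalty z) h (rev rs))"
  shows "\<exists>s'. runs B Z peak_prog s s' \<and> outputs s' (v @ peak_word y h es) \<and> keeps {1, 2, 10, 12} {1, 10} s s'"
proof -
  let ?t = "replicate (length rs) Lt"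
  have "\<exists>s1. runs B Z (emit (\<lambda>_. [Lt]) q 0 7 6 ix_up) s s1 \<and> outputs s1 (v @ concat (map (\<lambda>_. [Lt]) rs)) \<and> keeps {1, 2} {1} s s1"
  proof (rule runs_emit[where wl = 1 and pos = "\<lambda>i. i" and xs = rs, OF out(1)])
    show "length v + 1 * length rs < B" using out(2) budget Z by linarith
    show "0 \<le> x + 0 \<and> x + 0 < int q \<and> length [Lt] \<le> 1" if "x \<in> set rs" for x using that digrs(1) by auto
  qed (use input_held lens sizes(3,15) Z is_index_up in \<open>auto simp: input_held_def\<close>)
  then obtain s1 where 1: "runs B Z (emit (\<lambda>_. [Lt]) q 0 7 6 ix_up) s s1" "outputs s1 (v @ ?t)" "keeps {1, 2} {1} s s1"
    unfolding concat_replicate_Lt by blast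
  have c1: "input_held rsL rsR rs y s1" by (rule input_held_keeps[OF input_held 1(3)]) auto
  have l1: "length (v @ ?t) \<le> maxw * Z + Z" using out(2) Z by simp
  have r1: "reg s1 10 = h" using reg_keeps[OF 1(3), of 10] r10(1) by simp
  from l1 have "length (v @ ?t) + maxw < B" using budget Z1 by linarith
  from runs_L[OF c1 1(2) this r1 r10(2)] obtain s2 where
    2: "runs B Z (emit_tab (\<lambda>i. L (i - int off)) (2 * off + 1)
      (Bin Add (Bin Add (Reg 4) (Bin Mul (Const P) (Reg 10))) (Const (int off)))) s1 s2"
    "outputs s2 ((v @ ?t) @ L (y + P * h))" "keeps {1} {1} s1 s2" by blast
  have k2: "keeps {1, 2} {1} s s2" using keeps_trans[OF 1(3) 2(3)] by (simp add: insert_commute)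
  have c2: "input_held rsL rsR rs y s2" by (rule input_held_keeps[OF input_held k2]) auto
  have r2: "reg s2 10 = h" using reg_keeps[OF k2, of 10] r10(1) by simp
  have h2: "holds s2 6 (\<lambda>i. length (rev rs) - 1 - i) (rev rs)"
    using c2 unfolding input_held_def holds_rev[of s2 6 rs] by (elim conjE) (simp only: length_rev)
  have "\<exists>s3. runs B Z (trace (st lift_digit (int kk2) llnf_rank) N q kk2 (- Q) P 7 6 10 (ix_down 7)) s2 s3 \<and>
    reg s3 10 = endst (reg s2 10) (opt_path lift_digit (int kk2) llnf_rank (end_penalty z) (reg s2 10) (rev rs)) \<and>
    holds s3 10 (\<lambda>i. i) (new_digits lift_digit (reg s2 10) (rev rs) (opt_path lift_digit (int kk2) llnf_rank (end_penalty z) (reg s2 10) (rev rs))) \<and> keeps {2, 10, 12} {10} s2 s3"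
  proof (rule runs_trace[OF _ _ _ h2 _ _ _ _ sizes(8,2,10) _ _ lift_digit_affine])
    show "is_index B (ix_down 7) 7 (length (rev rs)) (\<lambda>i. length (rev rs) - 1 - i)"
      by (rule is_index_down) (simp add: lens)
    show "\<forall>j<length (rev rs). rep (int kk2) (arr s2 7 (int j)) (opt_cost lift_digit (int kk2) (end_penalty z) (drop (Suc j) (rev rs)))"
      using codes k2 by (simp add: keeps_def)
  qed (use c2 lens Z digrs(1) r2 r10(2) p_less_q in \<open>auto simp: input_held_def\<close>)
  then obtain s3 where 3: "runs B Z (trace (st lift_digit K2 llnf_rank) N q kk2 (- Q) P 7 6 10 (ix_down 7)) s2 s3"
    "holds s3 10 (\<lambda>i. i) es" "keeps {2, 10, 12} {10} s2 s3"
    unfolding r2 int_kk es_def by blast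
  have les: "length es = length rs" by (simp add: es_def)
  have bes: "\<bar>e\<bar> \<le> int Mx" if "e \<in> set es" for e
    using that unfolding es_def
    by (rule new_digits_lift_digit_bound[rotated 4]) (use digrs(1) r10(2) opt_path_window[OF K2_nonneg] in simp_all)
  have c3: "input_held rsL rsR rs y s3" by (rule input_held_keeps[OF c2 3(3)]) auto
  have o3: "outputs s3 ((v @ ?t) @ L (y + P * h))" by (rule outputs_keeps[OF 2(2) 3(3)]) auto
  have lL: "length (L (y + P * h)) \<le> maxw" by (rule length_L_top[OF r10(2)])
  have "\<exists>s4. runs B Z (emit (\<lambda>e. LT # apow e) (2 * Mx + 1) (int Mx) 7 10 ix_up) s3 s4 \<and>
    outputs s4 (((v @ ?t) @ L (y + P * h)) @ concat (map (\<lambda>e. LT # apow e) es)) \<and> keeps {1, 2} {1} s3 s4"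
  proof (rule runs_emit[where wl = maxw and pos = "\<lambda>i. i" and xs = es, OF o3])
    show "length ((v @ ?t) @ L (y + P * h)) + maxw * length es < B"
      unfolding les length_append[of "v @ ?t"] using l1 lL budget Z1 by linarith
    show "0 \<le> x + int Mx \<and> x + int Mx < int (2 * Mx + 1) \<and> length (LT # apow x) \<le> maxw" if "x \<in> set es" for x
      using digit_word[OF bes[OF that]] by simp
    show "is_index B ix_up 7 (length es) (\<lambda>i. i)" by (rule is_index_up) (simp add: les lens)
    show "int (2 * Mx + 1) + \<bar>int Mx\<bar> \<le> int B" by (rule Mx_fits)
  qed (use c3 lens les sizes(15) Z 3(2) in \<open>auto simp: input_held_def\<close>)
  then obtain s4 where 4: "runs B Z (emit (\<lambda>e. LT # apow e) (2 * Mx + 1) (int Mx) 7 10 ix_up) s3 s4"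
    "outputs s4 (((v @ ?t) @ L (y + P * h)) @ concat (map (\<lambda>e. LT # apow e) es))" "keeps {1, 2} {1} s3 s4" by blast
  have "keeps {1, 2, 10, 12} {1, 10} s s4"
    using keeps_trans[OF keeps_trans[OF k2 3(3)] 4(3)] by (simp add: insert_commute)
  moreover have "outputs s4 (v @ peak_word y h es)" using 4(2) by (simp add: peak_word_def les)
  moreover have "runs B Z peak_prog s s4"
    unfolding peak_prog_def by (rule runs_Seq[OF 1(1) runs_Seq[OF 2(1) runs_Seq[OF 3(1) 4(1)]]])
  ultimately show ?thesis by blast
qed

lemma runs_hill:
  assumes input_held: "input_held rsL rsR rs y s" and out: "outputs s []"
  defines "ss \<equiv> opt_path shift_digit K delta_rank (left_weight (right_cost rsR) G) 0 rsL"
  defines "cs \<equiv> opt_path shift_digit K delta_rank (\<lambda>u. G (endst 0 ss - u)) 0 rsR"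
  defines "z \<equiv> endst 0 ss - endst 0 cs"
  defines "h \<equiv> best_top (opt_cost lift_digit K2 (end_penalty z) (rev rs)) y"
  shows "\<exists>s'. runs B Z hill_prog s s' \<and> outputs s' (left_word apow (new_digits shift_digit 0 rsL ss) @
    peak_word y h (new_digits lift_digit h (rev rs) (opt_path lift_digit K2 llnf_rank (end_penalty z) h (rev rs))) @ right_word apow (new_digits shift_digit 0 rsR cs))"
proof -
  let ?bl = "new_digits shift_digit 0 rsL ss" and ?br = "new_digits shift_digit 0 rsR cs" and ?es = "new_digits lift_digit h (rev rs) (opt_path lift_digit K2 llnf_rank (end_penalty z) h (rev rs))"
  let ?E1 = "emit (\<lambda>b. apow b @ [Lt]) (2 * Mx + 1) (int Mx) 3 8 ix_up"
  let ?E2 = "emit (\<lambda>b. LT # apow (- b)) (2 * Mx + 1) (int Mx) 6 9 (ix_down 6)"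
  have ss: "length ss = length rsL" "window K ss" and cs: "length cs = length rsR" "window K cs"
    unfolding ss_def cs_def by (simp_all add: opt_path_window)
  have a: "endst 0 ss \<in> {-K..K}" "endst 0 cs \<in> {-K..K}"
    using endst_window[OF K_nonneg ss(2)] endst_window[OF K_nonneg cs(2)] by blast+
  then have z: "z \<in> {-K2..K2}" by (auto simp: z_def K2_def)
  have "{-K..K} \<subseteq> {-K2..K2}" using K_le_K2 by auto
  then have win2: "window K2 ss" "window K2 cs" by (rule subset_trans[OF ss(2)], rule subset_trans[OF cs(2)])
  have bl: "\<bar>b\<bar> \<le> int Mx" if "b \<in> set ?bl" for b
    using that by (rule new_digits_shift_digit_bound[rotated 4]) (use ss(1) dig win2 in simp_all)
  have br: "\<bar>b\<bar> \<le> int Mx" if "b \<in> set ?br" for b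
    using that by (rule new_digits_shift_digit_bound[rotated 4]) (use cs(1) dig win2 in simp_all)
  have h: "h \<in> {-K2..K2}" using best_top_props(1) unfolding h_def top_set_def by blast
  obtain s1 where 1: "runs B Z weight_prog s s1" "rep K2 (reg s1 9) G" "keeps {2, 5, 9} {7} s s1"
    using runs_weight[OF input_held] by blast
  have c1: "input_held rsL rsR rs y s1" by (rule input_held_keeps[OF input_held 1(3)]) auto
  obtain s2 where 2: "runs B Z cost_prog s1 s2" "rep K (reg s2 5) (right_cost rsR)" "keeps {2, 5} {7} s1 s2"
    using runs_cost[OF c1] by blast
  have c2: "input_held rsL rsR rs y s2" by (rule input_held_keeps[OF c1 2(3)]) auto
  have r2: "rep K2 (reg s2 9) G" using 1(2) reg_keeps[OF 2(3), of 9] by simp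
  obtain s3 where 3: "runs B Z left_prog s2 s3" "reg s3 11 = endst 0 ss" "holds s3 8 (\<lambda>i. i) ?bl"
    "keeps {2, 5, 10, 11, 12} {7, 8} s2 s3"
    using runs_left[OF c2 r2 2(2)] unfolding ss_def by blast
  have k3: "keeps {2, 5, 9, 10, 11, 12} {7, 8} s s3"
    using keeps_trans[OF keeps_trans[OF 1(3) 2(3)] 3(4)] by (simp add: insert_commute)
  have c3: "input_held rsL rsR rs y s3" by (rule input_held_keeps[OF input_held k3]) auto
  have o3: "outputs s3 []" by (rule outputs_keeps[OF out k3]) auto
  have "\<exists>s4. runs B Z ?E1 s3 s4 \<and> outputs s4 ([] @ left_word apow ?bl) \<and> keeps {1, 2} {1} s3 s4"
    unfolding left_word_def
  proof (rule runs_emit[where wl = maxw and pos = "\<lambda>i. i" and xs = ?bl, OF o3])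
    have lb: "length ?bl = length rsL" using ss(1) by simp
    show "length [] + maxw * length ?bl < B" unfolding lb list.size using budget(1,3) Z1 by linarith
    show "0 \<le> x + int Mx \<and> x + int Mx < int (2 * Mx + 1) \<and> length (apow x @ [Lt]) \<le> maxw" if "x \<in> set ?bl" for x
      using digit_word[OF bl[OF that]] by simp
    show "is_index B ix_up 3 (length ?bl) (\<lambda>i. i)" using lens ss(1) by (intro is_index_up) simp
    show "int (2 * Mx + 1) + \<bar>int Mx\<bar> \<le> int B" by (rule Mx_fits)
  qed (use c3 lens ss(1) sizes(15) Z 3(3) in \<open>auto simp: input_held_def\<close>)
  then obtain s4 where 4: "runs B Z ?E1 s3 s4" "outputs s4 (left_word apow ?bl)" "keeps {1, 2} {1} s3 s4" by auto
  have c4: "input_held rsL rsR rs y s4" by (rule input_held_keeps[OF c3 4(3)]) auto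
  have r4: "rep K2 (reg s4 9) G" "reg s4 11 = endst 0 ss"
    using r2 3(2) reg_keeps[OF 3(4), of 9] reg_keeps[OF 4(3), of 9] reg_keeps[OF 4(3), of 11] by simp_all
  obtain s5 where 5: "runs B Z right_prog s4 s5" "reg s5 13 = z" "holds s5 9 (\<lambda>i. i) ?br" "keeps {2, 5, 10, 12, 13} {7, 9} s4 s5"
    using runs_right[OF c4 r4 a(1)] unfolding cs_def z_def by blast
  have c5: "input_held rsL rsR rs y s5" by (rule input_held_keeps[OF c4 5(4)]) auto
  obtain s6 where 6: "runs B Z top_prog s5 s6" "reg s6 10 = h"
    "\<forall>j<length (rev rs). rep K2 (arr s6 7 (int j)) (opt_cost lift_digit K2 (end_penalty z) (drop (Suc j) (rev rs)))" "keeps {2, 5, 10} {7} s5 s6"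
    using runs_top[OF c5 5(2) z] unfolding h_def by blast
  have k6: "keeps {2, 5, 10, 12, 13} {7, 9} s4 s6" using keeps_trans[OF 5(4) 6(4)] by (simp add: insert_commute)
  have c6: "input_held rsL rsR rs y s6" by (rule input_held_keeps[OF c5 6(4)]) auto
  have o6: "outputs s6 (left_word apow ?bl)" by (rule outputs_keeps[OF 4(2) k6]) auto
  have ll: "length (left_word apow ?bl) \<le> maxw * Z"
  proof -
    have "length (left_word apow ?bl) \<le> maxw * length ?bl"
      unfolding left_word_def by (rule length_concat_le) (use digit_word bl in simp)
    moreover have "length ?bl = length rsL" using ss(1) by simp
    ultimately show ?thesis using le_trans[OF _ budget(3)] by simp
  qed
  obtain s7 where 7: "runs B Z peak_prog s6 s7" "outputs s7 (left_word apow ?bl @ peak_word y h ?es)"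
    "keeps {1, 2, 10, 12} {1, 10} s6 s7"
    using runs_peak[OF c6 o6 ll 6(2) h 6(3)] by blast
  have c7: "input_held rsL rsR rs y s7" by (rule input_held_keeps[OF c6 7(3)]) auto
  have lp: "length (peak_word y h ?es) \<le> Z + maxw + maxw * Z"
  proof -
    have les: "length ?es = length rs" by simp
    have bes: "\<bar>e\<bar> \<le> int Mx" if "e \<in> set ?es" for e
      using that by (rule new_digits_lift_digit_bound[rotated 4]) (use digrs(1) h opt_path_window[OF K2_nonneg] in simp_all)
    have "length (concat (map (\<lambda>e. LT # apow e) ?es)) \<le> maxw * length ?es"
      by (rule length_concat_le) (use digit_word bes in simp)
    moreover have "length (peak_word y h ?es) =
      length ?es + length (L (y + P * h)) + length (concat (map (\<lambda>e. LT # apow e) ?es))"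
      by (simp add: peak_word_def del: length_concat)
    ultimately show ?thesis using length_L_top[OF h] Z budget(5) unfolding les by linarith
  qed
  have lbr: "length (rev ?br) = length rsR" using cs(1) by simp
  have h9: "holds s7 9 (\<lambda>i. i) ?br" by (rule holds_keeps[OF holds_keeps[OF 5(3) 6(4)] 7(3)]) simp_all
  have h9': "holds s7 9 (\<lambda>i. length (rev ?br) - 1 - i) (rev ?br)"
    using h9 unfolding holds_rev[of s7 9 ?br] length_rev .
  have "\<exists>s8. runs B Z ?E2 s7 s8 \<and> outputs s8 ((left_word apow ?bl @ peak_word y h ?es) @ right_word apow ?br) \<and> keeps {1, 2} {1} s7 s8"
    unfolding right_word_def
  proof (rule runs_emit[where wl = maxw and xs = "rev ?br", OF 7(2) _ _ _ h9'])
    show "length (left_word apow ?bl @ peak_word y h ?es) + maxw * length (rev ?br) < B"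
      unfolding length_append lbr using ll lp budget Z1 by linarith
    show "0 \<le> x + int Mx \<and> x + int Mx < int (2 * Mx + 1) \<and> length (LT # apow (- x)) \<le> maxw" if "x \<in> set (rev ?br)" for x
      using digit_word[of x] br[of x] that by simp
    show "is_index B (ix_down 6) 6 (length (rev ?br)) (\<lambda>i. length (rev ?br) - 1 - i)"
      by (rule is_index_down) (simp add: cs(1) lens)
    show "int (2 * Mx + 1) + \<bar>int Mx\<bar> \<le> int B" by (rule Mx_fits)
  qed (use c7 lens cs(1) sizes(15) Z in \<open>auto simp: input_held_def\<close>)
  then obtain s8 where 8: "runs B Z ?E2 s7 s8" "outputs s8 (left_word apow ?bl @ peak_word y h ?es @ right_word apow ?br)"
    by auto
  have "runs B Z hill_prog s s8" unfolding hill_prog_def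
    by (rule runs_Seq[OF 1(1) runs_Seq[OF 2(1) runs_Seq[OF 3(1) runs_Seq[OF 4(1)
      runs_Seq[OF 5(1) runs_Seq[OF 6(1) runs_Seq[OF 7(1) 8(1)]]]]]]])
  with 8(2) show ?thesis by blast
qed

end
end

lemma (in BS) valid_stack_down: "valid_stack (map (\<lambda>d. (d, Down)) ds @ st) \<Longrightarrow> set ds \<subseteq> {0..<P}"
  by (induction ds) auto

context coded
begin

section \<open>The complete program\<close>

definition pnf_prog :: prog where
  "pnf_prog = Seq read_prog (Seq unroll_prog (Seq climb_prog hill_prog))"

text \<open>The integer at the peak is smaller than \<open>(2 q)^(2 n)\<close>, hence has at most
  \<open>4 q n\<close> bits, and with \<open>2 q\<close> steps per bit the climb takes at most
  \<open>8 q^2 n\<close> steps. This is the origin of \<open>Z\<close>.\<close>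

lemma runs_pnf:
  assumes hill: "hill p q w" and Zn: "Z = (8 * q * q + 1) * (length w + 1)" and BZ: "min_word_size * Z \<le> B"
  shows "\<exists>s'. runs B Z pnf_prog (init_state w) s' \<and> outputs s' (pnf p q w)"
proof -
  let ?n = "length w"
  have nZ: "?n + 1 \<le> Z" "8 * q * q * ?n + 1 \<le> Z" unfolding Zn by (simp_all add: algebra_simps)
  have bcZ: "min_word_size \<le> min_word_size * Z" using nZ(1) by (cases Z) simp_all
  have "10 + 8 * q \<le> min_word_size" "q \<le> min_word_size" "4 \<le> min_word_size" "8 * mm \<le> min_word_size" by (simp_all add: min_word_size_def)
  then have qB: "q \<le> B" "4 \<le> B" "mm \<le> B" using bcZ BZ by linarith+
  have "(10 + 8 * q) * Z \<le> min_word_size * Z" using \<open>10 + 8 * q \<le> min_word_size\<close> by (rule mult_le_mono1)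
  then have bigB: "10 * Z + 8 * (q * Z) \<le> B" using BZ by (simp add: algebra_simps)
  then have nB: "Suc ?n < B" "8 * q * q * ?n + 1 < B" using nZ by linarith+
  have "q * ?n + q \<le> q * Z" using mult_le_mono2[OF nZ(1), of q] by simp
  then have wB: "2 * q * Suc (2 * ?n) < B" using bigB nZ by (simp add: algebra_simps)
  \<comment> \<open>Converts powers of \<open>2 q\<close> into powers of 2, at the price of a factor
    \<open>2 q\<close> in the number of bits.\<close>
  have "int (2 * q) < 2 ^ (2 * q)" by (rule of_nat_less_two_power)
  then have Q2: "2 * Q \<le> 2 ^ (2 * q)" by simp
  have pow: "(2 * Q) ^ j \<le> 2 ^ (2 * q * j)" for j
    unfolding power_mult[of 2 "2 * q" j] by (rule power_mono[OF Q2]) simp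
  have fit: "fits B v" if "\<bar>v\<bar> \<le> (2 * Q) ^ Suc (2 * ?n)" for v
  proof -
    have "(2 :: int) ^ (2 * q * Suc (2 * ?n)) < 2 ^ B" by (rule power_strict_increasing[OF wB]) simp
    then show ?thesis unfolding fits_def using that pow[of "Suc (2 * ?n)"] by linarith
  qed
  obtain rsL x rsR where can: "canonical rsL x rsR" and w: "w \<sim> hw rsL x rsR" using hill_canonical[OF hill] .
  have dig: "digits rsL" "digits rsR" using can by (simp_all add: canonical_def)
  have nf: "nf w = nf (hw rsL x rsR)" by (rule equ_nf[OF w])
  obtain ds where ds: "length ds = length rsR" "fst (nf w) = map (\<lambda>d. (d, Down)) ds @ ups rsL"
    using nf_canonical(3)[OF can] nf by auto
  have nfw: "nf w = (map (\<lambda>d. (d, Down)) ds @ ups rsL, snd (nf w))" using ds(2) by (simp add: prod_eq_iff)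
  have un: "unroll (map (\<lambda>d. (d, Down)) ds @ ups rsL, snd (nf w)) = (rsR, (ups rsL, x))"
    using nf_canonical(1)[OF can] nf nfw by simp
  have vs: "valid_stack (map (\<lambda>d. (d, Down)) ds @ ups rsL)" using run_bounds(1)[of w] ds(2) by (simp add: nf_def)
  have dsQ: "set ds \<subseteq> {0..<Q}" using valid_stack_down[OF vs] p_less_q by force
  have xn: "\<bar>snd (nf w)\<bar> + 1 \<le> (2 * Q) ^ ?n" using run_bounds(2)[of w] by (simp add: nf_def)
  have len: "length ds + length rsL \<le> ?n"
    using run_bounds(3)[of w] unfolding nf_def[symmetric] ds(2) by (simp add: ups_def)
  let ?s0 = "init_state w"
  have "\<exists>s1. runs B Z read_prog ?s0 s1 \<and> conf_rep s1 (nf w) \<and> keeps {2, 3, 4} {2, 3} ?s0 s1"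
  proof (rule runs_hoare[OF _ nZ(1)])
    show "hoare B read_prog ((?n + 1) * (4 + pcost read_body)) ?s0 (\<lambda>s'. conf_rep s' (nf w) \<and> keeps {2, 3, 4} {2, 3} ?s0 s')"
    proof (rule hoare_read)
      show "fits B v" if "\<bar>v\<bar> \<le> (2 * Q) ^ Suc ?n" for v
        using that pow2Q_mono[of "Suc ?n" "Suc (2 * ?n)"] by (intro fit) simp
    qed (use nB qB in \<open>simp_all add: init_state_def conf_rep_def\<close>)
  qed (simp add: read_prog_def)
  then obtain s1 where 1: "runs B Z read_prog ?s0 s1" "conf_rep s1 (nf w)" "keeps {2, 3, 4} {2, 3} ?s0 s1" by blast
  have "\<exists>s2. runs B Z unroll_prog s1 s2 \<and> conf_rep s2 (ups rsL, x) \<and> reg s2 6 = int (length rsR) \<and>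
    holds s2 5 (\<lambda>i. i) rsR \<and> length rsR = length ds \<and> \<bar>x\<bar> + 1 \<le> (2 * Q) ^ (2 * ?n) \<and> keeps {3, 4, 6} {5} s1 s2"
  proof (rule runs_hoare[OF hoare_unroll[OF _ _ un dsQ xn len nB(1) qB(1,2)]])
    show "conf_rep s1 (map (\<lambda>d. (d, Down)) ds @ ups rsL, snd (nf w))" using 1(2) nfw by simp
    show "reg s1 6 = 0" using reg_keeps[OF 1(3), of 6] by (simp add: init_state_def)
    show "length ds + 1 \<le> Z" using len nZ(1) by linarith
  qed (simp_all add: fit unroll_prog_def del: power_Suc)
  then obtain s2 where 2: "runs B Z unroll_prog s1 s2" "conf_rep s2 (ups rsL, x)" "reg s2 6 = int (length rsR)"
    "holds s2 5 (\<lambda>i. i) rsR" "\<bar>x\<bar> + 1 \<le> (2 * Q) ^ (2 * ?n)" "keeps {3, 4, 6} {5} s1 s2" by blast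
  have k2: "keeps {2, 3, 4, 6} {2, 3, 5} ?s0 s2" using keeps_trans[OF 1(3) 2(6)] by (simp add: insert_commute)
  have xb: "\<bar>x\<bar> < 2 ^ (2 * q * (2 * ?n))" using 2(5) pow[of "2 * ?n"] by linarith
  obtain rs y where climb: "climb x rs y" and lrs: "length rs \<le> 2 * q * (2 * q * (2 * ?n))" using climb_exists[OF xb] by blast
  have lrs': "length rs \<le> 8 * q * q * ?n" using lrs by (simp add: algebra_simps)
  have "\<exists>s3. runs B Z climb_prog s2 s3 \<and> reg s3 4 = y \<and> reg s3 7 = int (length rs) \<and> holds s3 6 (\<lambda>i. i) rs \<and> keeps {4, 7} {6} s2 s3"
  proof (rule runs_hoare[OF hoare_climb[OF _ _ climb _ qB(3) qB(1)]])
    show "reg s2 4 = x" using 2(2) by (simp add: conf_rep_def)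
    show "reg s2 7 = 0" using reg_keeps[OF k2, of 7] by (simp add: init_state_def)
    show "Suc (length rs) < B" "length rs + 1 \<le> Z" using lrs' nB(2) nZ(2) by linarith+
    show "fits B v" if "\<bar>v\<bar> \<le> \<bar>x\<bar>" for v
      using that 2(5) pow2Q_mono[OF le_SucI[OF le_refl], of "2 * ?n"] by (intro fit) linarith
  qed (simp add: climb_prog_def)
  then obtain s3 where 3: "runs B Z climb_prog s2 s3" "reg s3 4 = y" "reg s3 7 = int (length rs)" "holds s3 6 (\<lambda>i. i) rs"
    "keeps {4, 7} {6} s2 s3" by blast
  have k3: "keeps {2, 3, 4, 6, 7} {2, 3, 5, 6} ?s0 s3" using keeps_trans[OF k2 3(5)] by (simp add: insert_commute)
  have h2: "holds s2 2 Suc rsL" "reg s2 3 = int (length rsL)" using 2(2) by (auto simp: conf_rep_def holds_def ups_def)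
  have input_held: "input_held rsL rsR rs y s3"
    unfolding input_held_def using 3 2(3) h2 holds_keeps[OF 2(4) 3(5)] holds_keeps[OF h2(1) 3(5)]
      reg_keeps[OF 3(5), of 3] reg_keeps[OF 3(5), of 6] by simp
  have out: "outputs s3 []" by (rule outputs_keeps[OF _ k3]) (simp_all add: outputs_def init_state_def)
  have lens: "length rsL + 1 \<le> Z" "length rsR + 1 \<le> Z" "length rs + 1 \<le> Z"
    using len ds(1) nZ lrs' by linarith+
  obtain s4 where 4: "runs B Z hill_prog s3 s4" "outputs s4 (pnf p q w)"
    using runs_hill[OF BZ lens dig climb input_held out] unfolding pnf_computed(2)[OF can w climb] by blast
  have "runs B Z pnf_prog ?s0 s4" unfolding pnf_prog_def
    by (rule runs_Seq[OF 1(1) runs_Seq[OF 2(1) runs_Seq[OF 3(1) 4(1)]]])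
  with 4(2) show ?thesis by blast
qed

lemma linear_time: "linear_time_computable {w. hill p q w} (pnf p q)"
proof -
  define D where "D = 8 * q * q + 1"
  define C where "C = D * (min_word_size + loop_cost pnf_prog)"
  have "\<exists>k s. exec (C * (length w + 1)) pnf_prog (init_state w) k s \<and> k \<le> C * (length w + 1) \<and> outputs s (pnf p q w)"
    if "hill p q w" for w
  proof -
    let ?Z = "D * (length w + 1)"
    have C: "C * (length w + 1) = min_word_size * ?Z + ?Z * loop_cost pnf_prog" by (simp add: C_def algebra_simps)
    have "min_word_size * ?Z \<le> C * (length w + 1)" unfolding C by simp
    from runs_pnf[OF that refl this[unfolded D_def], folded D_def] obtain s where
      "runs (C * (length w + 1)) ?Z pnf_prog (init_state w) s" "outputs s (pnf p q w)" by blast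
    then show ?thesis unfolding runs_def using C by (metis le_add2 le_trans)
  qed
  then show ?thesis unfolding linear_time_computable_def by (intro exI[of _ pnf_prog] exI[of _ C]) simp
qed

end

theorem corollary6p2:
  fixes p q :: nat
  assumes "1 \<le> p" and "p < q"
  shows "linear_time_computable {w. hill p q w} (pnf p q)"
proof -
  interpret BS p q using assms by unfold_locales
  obtain N dec where "0 < N" "\<forall>k F. 0 \<le> k \<longrightarrow> k \<le> K2 \<longrightarrow> (\<forall>t\<in>{-k..k}. \<forall>t'\<in>{-k..k}. F t \<le> F t' + spread) \<longrightarrow>
     (\<exists>e\<in>{0..<int N}. \<exists>c. \<forall>t\<in>{-k..k}. F t = dec e t + (c::int))"
    using profile_codes by blast
  then interpret coded p q N dec by unfold_locales blast+
  show ?thesis by (rule linear_time)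
qed

end
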